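(* Let $n\ge 2$, $p\ge 1$, and let $x:M\to S^{n+p}$ be an $n$-dimensional submanifold of the unit sphere $S^{n+p}$; if $n=3$ or $n=5$, assume that $M$ has no umbilical points. Then $M$ is a Willmore submanifold if and only if for every $\alpha$ with $n+1\le\alpha\le n+p$ $$ \begin{aligned} &-\rho^{n-2}\Big[SH^\alpha+\sum_{\beta,i,j}H^\beta h^\beta_{ij}h^\alpha_{ij}-\sum_{\beta,i,j,k}h^\alpha_{ij}h^\beta_{ik}h^\beta_{kj}-nH^2H^\alpha\Big]+(n-1)H^\alpha\Delta(\rho^{n-2})\\ &\quad+2(n-1)\sum_i(\rho^{n-2})_iH^\alpha_{,i}+(n-1)\rho^{n-2}\Delta^\perp H^\alpha-\sum_{i,j}(\rho^{n-2})_{i,j}\,(nH^\alpha\delta_{ij}-h^\alpha_{ij})=0 . \end{aligned} $$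
   Context: A submanifold is a smooth immersion $x:M\to S^{n+p}$, with $M$ given the induced metric $dx\cdot dx$ with volume element $dv$. Indices: $1\le i,j,k\le n$ and $n+1\le\alpha,\beta\le n+p$. Let $\{e_i\}$ be a local orthonormal tangent frame of $M$ with dual coframe $\{\theta_i\}$ and connection forms $\theta_{ij}$, and $\{e_\alpha\}$ a local orthonormal frame of the normal bundle of $M$ in $S^{n+p}$ with normal connection forms $\theta_{\alpha\beta}$. Let $h^\alpha_{ij}$ be the components of the second fundamental form in these frames, and $$S=\sum_{\alpha,i,j}(h^\alpha_{ij})^2,\quad H^\alpha=\frac1n\sum_k h^\alpha_{kk},\quad \mathbf H=\sum_\alpha H^\alpha e_\alpha,\quad H=|\mathbf H|,\quad \rho^2=S-nH^2\ge 0,\ \rho\ge0.$$ The function $\rho$ vanishes exactly at the umbilical points; for $n=2$, $\rho^{n-2}\equiv 1$. The covariant derivatives of $\mathbf H$ in the normal bundle are defined by $\sum_iH^\alpha_{,i}\theta_i=dH^\alpha+\sum_\beta H^\beta\theta_{\beta\alpha}$ and $\sum_jH^\alpha_{,ij}\theta_j=dH^\alpha_{,i}+\sum_jH^\alpha_{,j}\theta_{ji}+\sum_\beta H^\beta_{,i}\theta_{\beta\alpha}$, and $\Delta^\perp H^\alpha=\sum_iH^\alpha_{,ii}$. For a function $f$ on $M$, $f_i$ and $f_{i,j}$ are the components of its gradient and Hessian with respect to the induced metric, and $\Delta f=\sum_i f_{i,i}$. The Willmore functional is $W(x)=\int_M\rho^n\,dv=\int_M(S-nH^2)^{n/2}dv$.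 $M$ is a Willmore submanifold if $x$ is a critical point of $W$ (with respect to smooth variations of the immersion, compactly supported if $M$ is not compact). *)

theory Defs
  imports "HOL-Analysis.Analysis"
begin

section \<open>Smooth maps and manifolds\<close>

abbreviation dirderiv :: "('a::real_normed_vector \<Rightarrow> 'b::real_normed_vector) \<Rightarrow> 'a \<Rightarrow> 'a \<Rightarrow> 'b"
  where "dirderiv f u v \<equiv> frechet_derivative f (at u) v"

text \<open>Meant for open sets only, since the derivatives are unrestricted ones.\<close>

primrec Ck_on :: "nat \<Rightarrow> 'a::real_normed_vector set \<Rightarrow> ('a \<Rightarrow> 'b::real_normed_vector) \<Rightarrow> bool"
  where
    "Ck_on 0 S f \<longleftrightarrow> continuous_on S f"
  | "Ck_on (Suc k) S f \<longleftrightarrow>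
       (\<forall>u\<in>S. f differentiable (at u)) \<and> (\<forall>v. Ck_on k S (\<lambda>u. dirderiv f u v))"

definition smooth_on :: "'a::real_normed_vector set \<Rightarrow> ('a \<Rightarrow> 'b::real_normed_vector) \<Rightarrow> bool"
  where "smooth_on S f \<longleftrightarrow> (\<forall>k. Ck_on k S f)"

type_synonym ('m, 'n) chart = "'m set \<times> ('m \<Rightarrow> real ^ 'n)"

definition chart_image :: "('m, 'n) chart \<Rightarrow> (real ^ 'n) set"
  where "chart_image c = snd c ` fst c"

text \<open>The coordinate expression of a map on the manifold, meaningful on \<open>chart_image c\<close>.\<close>

definition in_chart :: "('m, 'n) chart \<Rightarrow> ('m \<Rightarrow> 'b) \<Rightarrow> real ^ 'n \<Rightarrow> 'b"
  where "in_chart c f = (\<lambda>u. f (inv_into (fst c) (snd c) u))"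

text \<open>The manifold is the whole type \<open>'m\<close>; it need be neither compact nor connected. The
  atlas is not required to be maximal.\<close>

definition smooth_atlas ::
    "('m::{t2_space,second_countable_topology}, 'n::finite) chart set \<Rightarrow> bool"
  where "smooth_atlas \<A> \<longleftrightarrow>
    (\<Union>c\<in>\<A>. fst c) = UNIV \<and>
    (\<forall>c\<in>\<A>. open (fst c) \<and> open (chart_image c) \<and>
       homeomorphism (fst c) (chart_image c) (snd c) (inv_into (fst c) (snd c))) \<and>
    (\<forall>c\<in>\<A>. \<forall>d\<in>\<A>. smooth_on (snd c ` (fst c \<inter> fst d)) (in_chart c (snd d)))"

definition sphere_immersion ::
    "('m::{t2_space,second_countable_topology}, 'n::finite) chart set
      \<Rightarrow> ('m \<Rightarrow> 'e::euclidean_space) \<Rightarrow> bool"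
  where "sphere_immersion \<A> x \<longleftrightarrow>
    range x \<subseteq> sphere 0 1 \<and>
    (\<forall>c\<in>\<A>. smooth_on (chart_image c) (in_chart c x) \<and>
       (\<forall>u\<in>chart_image c. inj (frechet_derivative (in_chart c x) (at u))))"

section \<open>Extrinsic geometry of an immersed coordinate patch\<close>

text \<open>Below, \<open>y\<close> is the coordinate expression of an immersion into the unit sphere of \<open>'e\<close>.
  Tangent vectors of the manifold are given by their coordinates in \<open>real ^ 'n\<close>. Tangential
  indices range over the type \<open>'n\<close>, with \<open>n = CARD('n)\<close>; normal indices are the natural numbers
  in \<open>{n+1..n+p}\<close>, which is \<open>{CARD('n)+1..<DIM('e)}\<close> because \<open>DIM('e) = n+p+1\<close>.

  A pair \<open>a\<close>, \<open>b\<close> as in the next definition consists of an orthonormal basis of the tangent space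
  (for the induced metric) and an orthonormal basis of the normal space in the sphere.\<close>

definition adapted_basis ::
    "(real ^ 'n::finite \<Rightarrow> 'e::euclidean_space) \<Rightarrow> real ^ 'n
      \<Rightarrow> ('n \<Rightarrow> real ^ 'n) \<Rightarrow> (nat \<Rightarrow> 'e) \<Rightarrow> bool"
  where "adapted_basis y u a b \<longleftrightarrow>
    (\<forall>i j. dirderiv y u (a i) \<bullet> dirderiv y u (a j) = (if i = j then 1 else 0)) \<and>
    (\<forall>\<alpha>\<in>{CARD('n)+1..<DIM('e)}.
       (\<forall>\<beta>\<in>{CARD('n)+1..<DIM('e)}. b \<alpha> \<bullet> b \<beta> = (if \<alpha> = \<beta> then 1 else 0)) \<and>
       b \<alpha> \<bullet> y u = 0 \<and> (\<forall>v. b \<alpha> \<bullet> dirderiv y u v = 0))"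

definition adapted_frame ::
    "(real ^ 'n::finite \<Rightarrow> 'e::euclidean_space) \<Rightarrow> (real ^ 'n) set
      \<Rightarrow> (real ^ 'n \<Rightarrow> 'n \<Rightarrow> real ^ 'n) \<Rightarrow> (real ^ 'n \<Rightarrow> nat \<Rightarrow> 'e) \<Rightarrow> bool"
  where "adapted_frame y V e \<nu> \<longleftrightarrow>
    open V \<and> (\<forall>i. smooth_on V (\<lambda>u. e u i)) \<and>
    (\<forall>\<alpha>\<in>{CARD('n)+1..<DIM('e)}. smooth_on V (\<lambda>u. \<nu> u \<alpha>)) \<and>
    (\<forall>u\<in>V. adapted_basis y u (e u) (\<nu> u))"

text \<open>\<open>h\<^sup>\<alpha>\<^sub>i\<^sub>j\<close> is the \<open>\<alpha>\<close>-component of the second derivative of the position vector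
  (Gauss formula). It depends only on the basis at the point, and for a frame field it equals
  the \<open>\<alpha>\<close>-component of the derivative of \<open>dy(e\<^sub>i)\<close> in direction \<open>e\<^sub>j\<close>, since
  \<open>dy(D e\<^sub>i(e\<^sub>j))\<close> is tangent.\<close>

definition sff ::
    "(real ^ 'n::finite \<Rightarrow> 'e::euclidean_space) \<Rightarrow> real ^ 'n
      \<Rightarrow> ('n \<Rightarrow> real ^ 'n) \<Rightarrow> (nat \<Rightarrow> 'e) \<Rightarrow> nat \<Rightarrow> 'n \<Rightarrow> 'n \<Rightarrow> real"
  where "sff y u a b \<alpha> i j = dirderiv (\<lambda>w. dirderiv y w (a i)) u (a j) \<bullet> b \<alpha>"

definition sff_sq ::
    "(real ^ 'n::finite \<Rightarrow> 'e::euclidean_space) \<Rightarrow> real ^ 'n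
      \<Rightarrow> ('n \<Rightarrow> real ^ 'n) \<Rightarrow> (nat \<Rightarrow> 'e) \<Rightarrow> real"
  where "sff_sq y u a b =
    (\<Sum>\<alpha>\<in>{CARD('n)+1..<DIM('e)}. \<Sum>i\<in>UNIV. \<Sum>j\<in>UNIV. (sff y u a b \<alpha> i j)\<^sup>2)"

definition mean_curv ::
    "(real ^ 'n::finite \<Rightarrow> 'e::euclidean_space) \<Rightarrow> real ^ 'n
      \<Rightarrow> ('n \<Rightarrow> real ^ 'n) \<Rightarrow> (nat \<Rightarrow> 'e) \<Rightarrow> nat \<Rightarrow> real"
  where "mean_curv y u a b \<alpha> = (1 / real CARD('n)) * (\<Sum>k\<in>UNIV. sff y u a b \<alpha> k k)"

definition mean_curv_vec ::
    "(real ^ 'n::finite \<Rightarrow> 'e::euclidean_space) \<Rightarrow> real ^ 'n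
      \<Rightarrow> ('n \<Rightarrow> real ^ 'n) \<Rightarrow> (nat \<Rightarrow> 'e) \<Rightarrow> 'e"
  where "mean_curv_vec y u a b =
    (\<Sum>\<alpha>\<in>{CARD('n)+1..<DIM('e)}. mean_curv y u a b \<alpha> *\<^sub>R b \<alpha>)"

definition rho_basis ::
    "(real ^ 'n::finite \<Rightarrow> 'e::euclidean_space) \<Rightarrow> real ^ 'n
      \<Rightarrow> ('n \<Rightarrow> real ^ 'n) \<Rightarrow> (nat \<Rightarrow> 'e) \<Rightarrow> real"
  where "rho_basis y u a b =
    sqrt (sff_sq y u a b - real CARD('n) * (norm (mean_curv_vec y u a b))\<^sup>2)"

text \<open>Connection forms evaluated on a vector \<open>v\<close>: \<open>\<theta>\<^sub>i\<^sub>j\<close> and \<open>\<theta>\<^sub>\<alpha>\<^sub>\<beta>\<close> are the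
  coefficients of \<open>e\<^sub>j\<close> in \<open>de\<^sub>i\<close> and of \<open>e\<^sub>\<beta>\<close> in \<open>de\<^sub>\<alpha>\<close>, so \<open>\<theta>\<^sub>i\<^sub>j\<close> belongs to the
  Levi-Civita connection of the induced metric.\<close>

definition tconn ::
    "(real ^ 'n::finite \<Rightarrow> 'e::euclidean_space) \<Rightarrow> (real ^ 'n \<Rightarrow> 'n \<Rightarrow> real ^ 'n)
      \<Rightarrow> 'n \<Rightarrow> 'n \<Rightarrow> real ^ 'n \<Rightarrow> real ^ 'n \<Rightarrow> real"
  where "tconn y e i j u v =
    dirderiv (\<lambda>w. dirderiv y w (e w i)) u v \<bullet> dirderiv y u (e u j)"

definition nconn ::
    "(real ^ 'n::finite \<Rightarrow> nat \<Rightarrow> 'e::euclidean_space)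
      \<Rightarrow> nat \<Rightarrow> nat \<Rightarrow> real ^ 'n \<Rightarrow> real ^ 'n \<Rightarrow> real"
  where "nconn \<nu> \<alpha> \<beta> u v = dirderiv (\<lambda>w. \<nu> w \<alpha>) u v \<bullet> \<nu> u \<beta>"

text \<open>The covariant derivatives are given by equations between 1-forms such as
  \<open>\<Sum>\<^sub>i f\<^sub>i \<theta>\<^sub>i = df\<close>; here these are evaluated on the frame vectors, to which the
  \<open>\<theta>\<^sub>i\<close> are dual.\<close>

definition grad :: "(real ^ 'n \<Rightarrow> 'n::finite \<Rightarrow> real ^ 'n) \<Rightarrow> (real ^ 'n \<Rightarrow> real) \<Rightarrow> 'n \<Rightarrow> real ^ 'n \<Rightarrow> real"
  where "grad e f i u = dirderiv f u (e u i)"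

definition hess ::
    "(real ^ 'n::finite \<Rightarrow> 'e::euclidean_space) \<Rightarrow> (real ^ 'n \<Rightarrow> 'n \<Rightarrow> real ^ 'n)
      \<Rightarrow> (real ^ 'n \<Rightarrow> real) \<Rightarrow> 'n \<Rightarrow> 'n \<Rightarrow> real ^ 'n \<Rightarrow> real"
  where "hess y e f i j u =
    dirderiv (grad e f i) u (e u j) + (\<Sum>k\<in>UNIV. grad e f k u * tconn y e k i u (e u j))"

definition laplacian ::
    "(real ^ 'n::finite \<Rightarrow> 'e::euclidean_space) \<Rightarrow> (real ^ 'n \<Rightarrow> 'n \<Rightarrow> real ^ 'n)
      \<Rightarrow> (real ^ 'n \<Rightarrow> real) \<Rightarrow> real ^ 'n \<Rightarrow> real"
  where "laplacian y e f u = (\<Sum>i\<in>UNIV. hess y e f i i u)"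

definition mean_curv_deriv ::
    "(real ^ 'n::finite \<Rightarrow> 'e::euclidean_space) \<Rightarrow> (real ^ 'n \<Rightarrow> 'n \<Rightarrow> real ^ 'n)
      \<Rightarrow> (real ^ 'n \<Rightarrow> nat \<Rightarrow> 'e) \<Rightarrow> nat \<Rightarrow> 'n \<Rightarrow> real ^ 'n \<Rightarrow> real"
  where "mean_curv_deriv y e \<nu> \<alpha> i u =
    dirderiv (\<lambda>w. mean_curv y w (e w) (\<nu> w) \<alpha>) u (e u i) +
    (\<Sum>\<beta>\<in>{CARD('n)+1..<DIM('e)}. mean_curv y u (e u) (\<nu> u) \<beta> * nconn \<nu> \<beta> \<alpha> u (e u i))"

definition mean_curv_deriv2 ::
    "(real ^ 'n::finite \<Rightarrow> 'e::euclidean_space) \<Rightarrow> (real ^ 'n \<Rightarrow> 'n \<Rightarrow> real ^ 'n)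
      \<Rightarrow> (real ^ 'n \<Rightarrow> nat \<Rightarrow> 'e) \<Rightarrow> nat \<Rightarrow> 'n \<Rightarrow> 'n \<Rightarrow> real ^ 'n \<Rightarrow> real"
  where "mean_curv_deriv2 y e \<nu> \<alpha> i j u =
    dirderiv (mean_curv_deriv y e \<nu> \<alpha> i) u (e u j) +
    (\<Sum>k\<in>UNIV. mean_curv_deriv y e \<nu> \<alpha> k u * tconn y e k i u (e u j)) +
    (\<Sum>\<beta>\<in>{CARD('n)+1..<DIM('e)}. mean_curv_deriv y e \<nu> \<beta> i u * nconn \<nu> \<beta> \<alpha> u (e u j))"

definition normal_laplacian ::
    "(real ^ 'n::finite \<Rightarrow> 'e::euclidean_space) \<Rightarrow> (real ^ 'n \<Rightarrow> 'n \<Rightarrow> real ^ 'n)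
      \<Rightarrow> (real ^ 'n \<Rightarrow> nat \<Rightarrow> 'e) \<Rightarrow> nat \<Rightarrow> real ^ 'n \<Rightarrow> real"
  where "normal_laplacian y e \<nu> \<alpha> u = (\<Sum>i\<in>UNIV. mean_curv_deriv2 y e \<nu> \<alpha> i i u)"

section \<open>The Willmore functional\<close>

text \<open>The value does not depend on the chart or on the adapted basis.\<close>

definition rho ::
    "('m::{t2_space,second_countable_topology}, 'n::finite) chart set
      \<Rightarrow> ('m \<Rightarrow> 'e::euclidean_space) \<Rightarrow> 'm \<Rightarrow> real"
  where "rho \<A> x q = (SOME r. \<exists>c\<in>\<A>. q \<in> fst c \<and>
    (\<exists>a b. adapted_basis (in_chart c x) (snd c q) a b \<and>
       r = rho_basis (in_chart c x) (snd c q) a b))"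

definition umbilical ::
    "('m::{t2_space,second_countable_topology}, 'n::finite) chart set
      \<Rightarrow> ('m \<Rightarrow> 'e::euclidean_space) \<Rightarrow> 'm \<Rightarrow> bool"
  where "umbilical \<A> x q \<longleftrightarrow> (\<exists>c\<in>\<A>. q \<in> fst c \<and>
    (\<exists>a b. adapted_basis (in_chart c x) (snd c q) a b \<and>
       (\<forall>\<alpha>\<in>{CARD('n)+1..<DIM('e)}. \<forall>i j.
          sff (in_chart c x) (snd c q) a b \<alpha> i j =
            (if i = j then mean_curv (in_chart c x) (snd c q) a b \<alpha> else 0))))"

definition gram :: "(real ^ 'n::finite \<Rightarrow> 'e::euclidean_space) \<Rightarrow> real ^ 'n \<Rightarrow> real ^ 'n ^ 'n"
  where "gram y u = (\<chi> i j. dirderiv y u (axis i 1) \<bullet> dirderiv y u (axis j 1))"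

text \<open>The Borel measure on the manifold with volume element \<open>dv\<close>: the unique one that in every
  chart has density \<open>sqrt (det g)\<close> with respect to Lebesgue measure.\<close>

definition vol_measure ::
    "('m::{t2_space,second_countable_topology}, 'n::finite) chart set
      \<Rightarrow> ('m \<Rightarrow> 'e::euclidean_space) \<Rightarrow> 'm measure"
  where "vol_measure \<A> x = (THE \<mu>. sets \<mu> = sets borel \<and>
    (\<forall>c\<in>\<A>. \<forall>B\<in>sets borel. B \<subseteq> fst c \<longrightarrow>
       emeasure \<mu> B =
         (\<integral>\<^sup>+u\<in>snd c ` B. ennreal (sqrt (det (gram (in_chart c x) u))) \<partial>lborel)))"

text \<open>The contribution of \<open>K\<close> to the Willmore functional; \<open>K = UNIV\<close> gives the functional itself.\<close>

definition willmore_functional ::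
    "('m::{t2_space,second_countable_topology}, 'n::finite) chart set
      \<Rightarrow> ('m \<Rightarrow> 'e::euclidean_space) \<Rightarrow> 'm set \<Rightarrow> real"
  where "willmore_functional \<A> x K = (LINT q:K|vol_measure \<A> x. rho \<A> x q ^ CARD('n))"

definition smooth_variation ::
    "('m::{t2_space,second_countable_topology}, 'n::finite) chart set
      \<Rightarrow> ('m \<Rightarrow> 'e::euclidean_space) \<Rightarrow> real \<Rightarrow> 'm set \<Rightarrow> (real \<Rightarrow> 'm \<Rightarrow> 'e) \<Rightarrow> bool"
  where "smooth_variation \<A> x \<epsilon> K X \<longleftrightarrow>
    \<epsilon> > 0 \<and> compact K \<and> X 0 = x \<and>
    (\<forall>c\<in>\<A>. smooth_on ({-\<epsilon><..<\<epsilon>} \<times> chart_image c) (\<lambda>(t, u). in_chart c (X t) u)) \<and>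
    (\<forall>t\<in>{-\<epsilon><..<\<epsilon>}. sphere_immersion \<A> (X t) \<and> (\<forall>q. q \<notin> K \<longrightarrow> X t q = x q))"

text \<open>The functional is only integrated over the compact set \<open>K\<close> carrying the variation, as the
  integral over a non-compact manifold may diverge. Outside \<open>K\<close> the integrand does not depend
  on \<open>t\<close>, so for compact manifolds this is criticality of the functional itself.\<close>

definition willmore_submanifold ::
    "('m::{t2_space,second_countable_topology}, 'n::finite) chart set
      \<Rightarrow> ('m \<Rightarrow> 'e::euclidean_space) \<Rightarrow> bool"
  where "willmore_submanifold \<A> x \<longleftrightarrow>
    (\<forall>\<epsilon> K X. smooth_variation \<A> x \<epsilon> K X \<longrightarrow>
       ((\<lambda>t. willmore_functional \<A> (X t) K) has_real_derivative 0) (at 0))"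

end

theory Submission
  imports Defs
begin

text \<open>\<open>\<rho>\<^sup>2\<close> is the squared norm of the trace-free second fundamental form, so in a chart the first
  variation of \<open>\<rho>\<^sup>n dv\<close> along a field \<open>\<zeta>\<close> orthogonal to \<open>x\<close> is a linear expression in the first two
  derivatives of \<open>\<zeta>\<close>. If \<open>\<zeta>\<close> is normal, the Codazzi equation and integration by parts turn it into
  \<open>n \<Sum>\<^sub>\<alpha> E\<^sub>\<alpha> \<zeta>\<^sub>\<alpha> dv\<close> plus a divergence, with \<open>E\<^sub>\<alpha>\<close> the expression of the theorem; a tangential
  \<open>\<zeta>\<close> is an infinitesimal reparametrisation and contributes a divergence only. The two integrations
  by parts need \<open>\<rho>\<^bsup>n-2\<^esup>\<close> to be \<open>C\<^sup>2\<close>: for even \<open>n\<close> it is a power of \<open>\<rho>\<^sup>2\<close>, for odd \<open>n \<ge> 7\<close> the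
  exponent exceeds 4, and for \<open>n = 3, 5\<close> there are no umbilical points.

  A compactly supported field is cut into pieces, each supported in the domain of a frame, by
  multiplying it with finitely many bump functions one after the other, so \<open>E = 0\<close> implies
  criticality. Conversely, the variation \<open>(x + t \<eta>) / |x + t \<eta>|\<close>, with \<open>\<eta>\<close> a bump function times one
  normal frame vector, localises the vanishing of the first variation to a point.\<close>

text \<open>Two points shape the proof. First, frames are not canonical, so the time derivative is
  taken in an adapted frame that moves smoothly with the variation. Its rotation drops out: the
  normal part is antisymmetric and meets a symmetric pairing, and the tangential part matters only
  through its symmetrisation, which is minus the derivative of the metric. The curvature of the
  sphere adds only a multiple of the identity to the derivative of the second fundamental form, and
  the trace-free form annihilates it.

  Second, variations cannot be added or cut off, but velocity fields can. The first variation is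
  therefore expressed by a function \<open>lam\<close> on the manifold that depends on the velocity
  field only. It is defined through one standard variation, the radial projection of
  \<open>x + t \<xi>\<close>, as a quotient of two densities, which makes it independent of the
  chart; the explicit formula \<open>dens_var\<close> makes it additive. The standard variation need
  not be an immersion away from t = 0, so several statements ask for injectivity of the differential
  at a single point only.\<close>

lemma dirderiv_eqI: "(f has_derivative f') (at u) ==> dirderiv f u v = f' v"
  using frechet_derivative_at by metis

lemma has_derivative_dirderiv: "f differentiable (at u) ==> (f has_derivative dirderiv f u) (at u)"
  by (simp add: frechet_derivative_works)

lemma bounded_linear_dirderiv: "f differentiable (at u) ==> bounded_linear (dirderiv f u)"
  using has_derivative_dirderiv has_derivative_bounded_linear by blast

lemma linear_dirderiv: "f differentiable (at u) ==> linear (dirderiv f u)"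
  using bounded_linear_dirderiv bounded_linear.linear by blast

lemma dirderiv_cong_open:
  assumes "open S" "u \<in> S" "\<And>w. w \<in> S ==> f w = g w"
  shows "dirderiv f u v = dirderiv g u v"
proof -
  have "(f has_derivative D) (at u) \<longleftrightarrow> (g has_derivative D) (at u)" for D
    using assms has_derivative_transform_within_open[of f D u UNIV S g]
      has_derivative_transform_within_open[of g D u UNIV S f] by auto
  then show ?thesis by (simp add: frechet_derivative_def)
qed

lemma differentiable_cong_open:
  assumes "open S" "u \<in> S" "\<And>w. w \<in> S ==> f w = g w" "f differentiable (at u)"
  shows "g differentiable (at u)"
  using assms has_derivative_transform_within_open[of f _ u UNIV S g]
  unfolding differentiable_def by blast

section \<open>Calculus of smooth functions\<close>

lemma Ck_on_SucD: "Ck_on (Suc k) S f ==> Ck_on k S f"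
proof (induction k arbitrary: f)
  case 0
  then show ?case
    by (auto intro!: continuous_at_imp_continuous_on differentiable_imp_continuous_within)
next
  case (Suc k)
  then show ?case by auto
qed

lemma Ck_on_le: "Ck_on m S f ==> k \<le> m ==> Ck_on k S f"
proof (induction m)
  case 0 then show ?case by simp
next
  case (Suc m)
  then show ?case by (metis Ck_on_SucD le_Suc_eq)
qed

lemma Ck_on_continuous: "Ck_on k S f ==> continuous_on S f"
  using Ck_on_le[of k S f 0] by simp

lemma Ck_on_cong:
  assumes "open S"
  shows "Ck_on k S f ==> (\<And>w. w \<in> S ==> f w = g w) ==> Ck_on k S g"
proof (induction k arbitrary: f g)
  case 0
  then show ?case by (simp cong: continuous_on_cong)
next
  case (Suc k)
  have "g differentiable (at u)" if "u \<in> S" for u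
    using differentiable_cong_open[OF assms that Suc.prems(2)] Suc.prems(1) that by auto
  moreover have "Ck_on k S (\<lambda>u. dirderiv g u v)" for v
    using Suc.IH[of "\<lambda>u. dirderiv f u v"] Suc.prems dirderiv_cong_open[OF assms _ Suc.prems(2)]
    by auto
  ultimately show ?case by simp
qed

lemma Ck_on_subset: "Ck_on k S f ==> T \<subseteq> S ==> Ck_on k T f"
  by (induction k arbitrary: f) (auto intro: continuous_on_subset)

text \<open>Most regularity statements are proved in frames or charts that exist only near one
  point; this glues them.\<close>

lemma Ck_on_local:
  "(\<And>u. u \<in> S ==> \<exists>T. open T \<and> u \<in> T \<and> Ck_on k T f) ==> Ck_on k S f"
proof (induction k arbitrary: f)
  case 0
  have "isCont f u" if "u \<in> S" for u
    using 0[OF that] continuous_on_eq_continuous_at by auto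
  then show ?case by (simp add: continuous_at_imp_continuous_on)
next
  case (Suc k)
  have "f differentiable (at u)" if "u \<in> S" for u
    using Suc.prems[OF that] by auto
  moreover have "Ck_on k S (\<lambda>u. dirderiv f u v)" for v
  proof (rule Suc.IH)
    fix u assume "u \<in> S"
    from Suc.prems[OF this] show "\<exists>T. open T \<and> u \<in> T \<and> Ck_on k T (\<lambda>u. dirderiv f u v)" by auto
  qed
  ultimately show ?case by simp
qed

lemma Ck_on_const: "Ck_on k S (\<lambda>_. c)"
  by (induction k arbitrary: c) (simp_all add: frechet_derivative_const)

lemma Ck_on_bounded_linear_compose:
  assumes L: "bounded_linear L"
  shows "open S ==> Ck_on k S f ==> Ck_on k S (\<lambda>u. L (f u))"
proof (induction k arbitrary: f)
  case 0
  then show ?case by (simp add: L bounded_linear.continuous_on)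
next
  case (Suc k)
  have hd: "((\<lambda>u. L (f u)) has_derivative (\<lambda>v. L (dirderiv f u v))) (at u)" if "u \<in> S" for u
    using Suc.prems that by (intro bounded_linear.has_derivative[OF L] has_derivative_dirderiv) auto
  have "Ck_on k S (\<lambda>u. dirderiv (\<lambda>u. L (f u)) u v)" for v
    by (rule Ck_on_cong[OF Suc.prems(1) Suc.IH[OF Suc.prems(1), of "\<lambda>u. dirderiv f u v"]])
      (use Suc.prems dirderiv_eqI[OF hd] in auto)
  then show ?case using hd by (auto simp: differentiable_def)
qed

lemma Ck_on_bounded_linear: "bounded_linear L ==> Ck_on k S L"
proof (cases k)
  case (Suc m)
  assume L: "bounded_linear L"
  have "dirderiv L u v = L v" for u v
    by (rule dirderiv_eqI) (rule bounded_linear_imp_has_derivative[OF L])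
  then show ?thesis
    using L Suc by (simp add: Ck_on_const bounded_linear_imp_differentiable)
qed (simp add: linear_continuous_on)

lemma Ck_on_id: "Ck_on k S (\<lambda>u. u)"
  by (rule Ck_on_bounded_linear) (rule bounded_linear_ident)

lemma Ck_on_add:
  "open S ==> Ck_on k S f ==> Ck_on k S g ==> Ck_on k S (\<lambda>u. f u + g u)"
proof (induction k arbitrary: f g)
  case 0
  then show ?case by (simp add: continuous_on_add)
next
  case (Suc k)
  have hd: "((\<lambda>u. f u + g u) has_derivative (\<lambda>v. dirderiv f u v + dirderiv g u v)) (at u)"
    if "u \<in> S" for u
    using Suc.prems that by (intro has_derivative_add has_derivative_dirderiv) auto
  have "Ck_on k S (\<lambda>u. dirderiv (\<lambda>u. f u + g u) u v)" for v
    by (rule Ck_on_cong[OF Suc.prems(1) Suc.IH[OF Suc.prems(1),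
            of "\<lambda>u. dirderiv f u v" "\<lambda>u. dirderiv g u v"]])
      (use Suc.prems dirderiv_eqI[OF hd] in auto)
  then show ?case using hd by (auto simp: differentiable_def)
qed

lemma Ck_on_sum:
  "open S ==> (\<And>i. i \<in> I ==> Ck_on k S (f i)) ==> Ck_on k S (\<lambda>u. \<Sum>i\<in>I. f i u)"
  by (induction I rule: infinite_finite_induct) (auto simp: Ck_on_const Ck_on_add)

lemma Ck_on_bilinear:
  assumes h: "bounded_bilinear h"
  shows "open S ==> Ck_on k S f ==> Ck_on k S g ==> Ck_on k S (\<lambda>u. h (f u) (g u))"
proof (induction k arbitrary: f g)
  case 0
  then show ?case using bounded_bilinear.continuous_on[OF h] by simp
next
  case (Suc k)
  have hd: "((\<lambda>u. h (f u) (g u)) has_derivative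
      (\<lambda>v. h (f u) (dirderiv g u v) + h (dirderiv f u v) (g u))) (at u)" if "u \<in> S" for u
    using Suc.prems that by (intro bounded_bilinear.FDERIV[OF h] has_derivative_dirderiv) auto
  have "Ck_on k S (\<lambda>u. dirderiv (\<lambda>u. h (f u) (g u)) u v)" for v
  proof (rule Ck_on_cong[OF Suc.prems(1)])
    show "Ck_on k S (\<lambda>u. h (f u) (dirderiv g u v) + h (dirderiv f u v) (g u))"
      using Suc.prems by (intro Ck_on_add Suc.IH Ck_on_SucD[of k S f] Ck_on_SucD[of k S g]) auto
  qed (use dirderiv_eqI[OF hd] in auto)
  then show ?case using hd by (auto simp: differentiable_def)
qed

lemmas Ck_on_inner = Ck_on_bilinear[OF bounded_bilinear_inner]
lemmas Ck_on_scaleR = Ck_on_bilinear[OF bounded_bilinear_scaleR]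
lemmas Ck_on_mult = Ck_on_bilinear[OF bounded_bilinear_mult]
lemmas Ck_on_minus = Ck_on_bounded_linear_compose[OF bounded_linear_minus[OF bounded_linear_ident]]

lemma Ck_on_diff:
  "open S ==> Ck_on k S f ==> Ck_on k S g ==> Ck_on k S (\<lambda>u. f u - g u)"
  using Ck_on_add[OF _ _ Ck_on_minus, of S k f g] by simp

lemma Ck_on_power:
  fixes f :: "_ => 'b::real_normed_field"
  shows "open S ==> Ck_on k S f ==> Ck_on k S (\<lambda>u. f u ^ m)"
  by (induction m) (auto simp: Ck_on_const Ck_on_mult)

lemma Ck_on_prod:
  fixes f :: "_ => _ => 'b::real_normed_field"
  shows "open S ==> (\<And>i. i \<in> I ==> Ck_on k S (f i)) ==> Ck_on k S (\<lambda>u. \<Prod>i\<in>I. f i u)"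
  by (induction I rule: infinite_finite_induct) (auto simp: Ck_on_const Ck_on_mult)

text \<open>\<open>Ck_on\<close> controls derivatives in constant directions only. Expanding a
  direction in the basis reduces variable directions to constant ones; this is where finite
  dimension enters the chain rule.\<close>

lemma dirderiv_expand:
  fixes f :: "'a::euclidean_space => 'b::real_normed_vector"
  assumes "f differentiable (at u)"
  shows "dirderiv f u v = (\<Sum>b\<in>Basis. (v \<bullet> b) *\<^sub>R dirderiv f u b)"
  using linear_componentwise_iff linear_sum[OF linear_dirderiv[OF assms], of "\<lambda>b. (v \<bullet> b) *\<^sub>R b" Basis]
  by (simp add: euclidean_representation linear_cmul[OF linear_dirderiv[OF assms]])

lemma Ck_on_compose:
  fixes g :: "'b::euclidean_space => 'c::real_normed_vector"
  shows "open S ==> open T ==> f ` S \<subseteq> T ==> Ck_on k T g ==> Ck_on k S f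
    ==> Ck_on k S (\<lambda>u. g (f u))"
proof (induction k arbitrary: g)
  case 0
  then show ?case using continuous_on_compose2[of T g S f] by simp
next
  case (Suc k)
  have hd: "((\<lambda>u. g (f u)) has_derivative (\<lambda>v. dirderiv g (f u) (dirderiv f u v))) (at u)"
    if "u \<in> S" for u
    by (rule has_derivative_compose[OF has_derivative_dirderiv has_derivative_dirderiv])
      (use Suc.prems that in auto)
  have "Ck_on k S (\<lambda>u. dirderiv (\<lambda>u. g (f u)) u v)" for v
  proof (rule Ck_on_cong[OF Suc.prems(1)])
    show "Ck_on k S (\<lambda>u. \<Sum>b\<in>Basis. (dirderiv f u v \<bullet> b) *\<^sub>R dirderiv g (f u) b)"
      using Suc.prems Ck_on_SucD[OF Suc.prems(5)]
      by (intro Ck_on_sum Ck_on_scaleR Ck_on_inner Ck_on_const Suc.IH) auto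
    show "(\<Sum>b\<in>Basis. (dirderiv f u v \<bullet> b) *\<^sub>R dirderiv g (f u) b)
        = dirderiv (\<lambda>u. g (f u)) u v" if "u \<in> S" for u
    proof -
      have "g differentiable at (f u)" using Suc.prems that by auto
      then show ?thesis
        by (rule trans[OF dirderiv_expand[symmetric] dirderiv_eqI[OF hd[OF that], symmetric]])
    qed
  qed
  then show ?case using hd by (auto simp: differentiable_def)
qed

lemma Ck_on_dirderiv:
  fixes f :: "'a::euclidean_space => 'b::real_normed_vector"
  assumes "open S" "Ck_on (Suc k) S f" "Ck_on k S v"
  shows "Ck_on k S (\<lambda>u. dirderiv f u (v u))"
proof (rule Ck_on_cong[OF assms(1)])
  show "Ck_on k S (\<lambda>u. \<Sum>b\<in>Basis. (v u \<bullet> b) *\<^sub>R dirderiv f u b)"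
    using assms by (intro Ck_on_sum Ck_on_scaleR Ck_on_inner Ck_on_const) auto
qed (use assms dirderiv_expand[of f] in auto)

lemma Ck_on_Pair:
  assumes "open S" "Ck_on k S f" "Ck_on k S g"
  shows "Ck_on k S (\<lambda>u. (f u, g u))"
proof -
  have "Ck_on k S (\<lambda>u. (f u, 0) + (0, g u))"
    using assms
      Ck_on_bounded_linear_compose[OF bounded_linear_Pair[OF bounded_linear_ident bounded_linear_zero]]
      Ck_on_bounded_linear_compose[OF bounded_linear_Pair[OF bounded_linear_zero bounded_linear_ident]]
    by (intro Ck_on_add) auto
  then show ?thesis by simp
qed

lemmas Ck_on_fst = Ck_on_bounded_linear[OF bounded_linear_fst]
lemmas Ck_on_snd = Ck_on_bounded_linear[OF bounded_linear_snd]

lemma Ck_on_inverse: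
  fixes f :: "_ => real"
  shows "open S ==> (\<And>u. u \<in> S ==> f u \<noteq> 0) ==> Ck_on k S f ==> Ck_on k S (\<lambda>u. inverse (f u))"
proof (induction k)
  case 0
  then show ?case by (auto intro: continuous_on_inverse)
next
  case (Suc k)
  have hd: "((\<lambda>u. inverse (f u)) has_derivative
      (\<lambda>v. - (inverse (f u) * dirderiv f u v * inverse (f u)))) (at u)" if "u \<in> S" for u
    using Suc.prems that by (intro Deriv.has_derivative_inverse has_derivative_dirderiv) auto
  have "Ck_on k S (\<lambda>u. dirderiv (\<lambda>u. inverse (f u)) u v)" for v
  proof (rule Ck_on_cong[OF Suc.prems(1)])
    show "Ck_on k S (\<lambda>u. - (inverse (f u) * dirderiv f u v * inverse (f u)))"
      using Suc.prems Ck_on_SucD[OF Suc.prems(3)] by (intro Ck_on_minus Ck_on_mult Suc.IH) auto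
  qed (use dirderiv_eqI[OF hd] in auto)
  then show ?case using hd by (auto simp: differentiable_def)
qed

lemma Ck_on_divide:
  fixes f g :: "_ => real"
  assumes "open S" "\<And>u. u \<in> S ==> g u \<noteq> 0" "Ck_on k S f" "Ck_on k S g"
  shows "Ck_on k S (\<lambda>u. f u / g u)"
  unfolding divide_inverse using assms by (intro Ck_on_mult Ck_on_inverse) auto

lemma has_derivative_sqrt:
  assumes "(f has_derivative f') (at u)" "f u > 0"
  shows "((\<lambda>u. sqrt (f u)) has_derivative (\<lambda>v. f' v * inverse (2 * sqrt (f u)))) (at u)"
proof -
  have "(sqrt has_derivative (*) (inverse (sqrt (f u)) / 2)) (at (f u))"
    using DERIV_real_sqrt[OF assms(2)] by (simp add: has_field_derivative_def)
  from has_derivative_compose[OF assms(1) this]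
  show ?thesis by (simp add: field_simps)
qed

lemma Ck_on_sqrt:
  fixes f :: "_ => real"
  shows "open S ==> (\<And>u. u \<in> S ==> f u > 0) ==> Ck_on k S f ==> Ck_on k S (\<lambda>u. sqrt (f u))"
proof (induction k)
  case 0
  then show ?case by (auto intro: continuous_on_real_sqrt)
next
  case (Suc k)
  have hd: "((\<lambda>u. sqrt (f u)) has_derivative
      (\<lambda>v. dirderiv f u v * inverse (2 * sqrt (f u)))) (at u)" if "u \<in> S" for u
    using Suc.prems that by (intro has_derivative_sqrt has_derivative_dirderiv) auto
  have "Ck_on k S (\<lambda>u. dirderiv (\<lambda>u. sqrt (f u)) u v)" for v
  proof (rule Ck_on_cong[OF Suc.prems(1)])
    show "Ck_on k S (\<lambda>u. dirderiv f u v * inverse (2 * sqrt (f u)))"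
    proof (intro Ck_on_mult Ck_on_inverse Ck_on_const Suc.IH Suc.prems(1,2) Ck_on_SucD[OF Suc.prems(3)])
      show "2 * sqrt (f w) \<noteq> 0" if "w \<in> S" for w
        using Suc.prems(2)[OF that] by simp
    qed (use Suc.prems in auto)
  qed (use dirderiv_eqI[OF hd] in auto)
  then show ?case using hd by (auto simp: differentiable_def)
qed

text \<open>Away from 0 this is the chain rule. At 0 the two-sided derivative makes sense because
  \<open>sqrt\<close> is extended as an odd function, and the difference quotient has absolute value
  \<open>sqrt \<bar>h\<bar> ^ (m - 2)\<close>, which tends to 0 once m is at least 3.\<close>

lemma has_real_derivative_sqrt_power:
  assumes "s \<ge> 0" "m \<ge> 3"
  shows "((\<lambda>s. sqrt s ^ m) has_real_derivative (real m / 2) * sqrt s ^ (m - 2)) (at s)"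
proof -
  obtain j where m: "m = Suc (Suc (Suc j))"
    using assms(2) by (metis Suc_le_D numeral_3_eq_3 Suc_le_mono)
  show ?thesis
  proof (cases "s = 0")
    case False
    then have s: "sqrt s > 0" using assms by simp
    have "((\<lambda>s. sqrt s ^ m) has_real_derivative
        of_nat m * (inverse (sqrt s) / 2 * sqrt s ^ (m - Suc 0))) (at s)"
      using False assms by (intro DERIV_power DERIV_real_sqrt) auto
    moreover have "of_nat m * (inverse (sqrt s) / 2 * sqrt s ^ (m - Suc 0)) = (real m / 2) * sqrt s ^ (m - 2)"
    proof -
      have "of_nat m * (inverse r / 2 * r ^ Suc (Suc j)) = (real m / 2) * r ^ Suc j"
        if "r > 0" for r :: real using that by simp
      from this[OF s] show ?thesis unfolding m by (simp only: diff_Suc_Suc diff_zero numeral_2_eq_2)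
    qed
    ultimately show ?thesis by (simp only:)
  next
    case True
    have "\<bar>sqrt h ^ m / h\<bar> \<le> sqrt \<bar>h\<bar> ^ Suc j" for h
    proof -
      have "\<bar>sqrt h\<bar> = sqrt \<bar>h\<bar>"
        by (simp add: abs_if real_sqrt_minus)
      then have "\<bar>sqrt h ^ m\<bar> = (sqrt \<bar>h\<bar>) ^ m"
        by (simp only: power_abs)
      also have "\<dots> = (sqrt \<bar>h\<bar> * sqrt \<bar>h\<bar>) * sqrt \<bar>h\<bar> ^ Suc j"
        unfolding m by (simp only: power_Suc mult.assoc)
      also have "\<dots> = \<bar>h\<bar> * sqrt \<bar>h\<bar> ^ Suc j"
        by (simp only: real_sqrt_mult_self abs_abs)
      finally show ?thesis
        by (cases "h = 0") (simp_all only: abs_divide, simp_all)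
    qed
    then have ev: "\<forall>\<^sub>F h in at 0. norm (sqrt h ^ m / h) \<le> sqrt \<bar>h\<bar> ^ Suc j"
      by (simp only: real_norm_def eventually_True)
    have "((\<lambda>h::real. sqrt \<bar>h\<bar> ^ Suc j) \<longlongrightarrow> sqrt \<bar>0\<bar> ^ Suc j) (at 0)"
      by (intro tendsto_intros)
    then have "((\<lambda>h::real. sqrt \<bar>h\<bar> ^ Suc j) \<longlongrightarrow> 0) (at 0)"
      by simp
    from Lim_null_comparison[OF ev this]
    have "((\<lambda>h. sqrt h ^ m / h) \<longlongrightarrow> 0) (at 0)" .
    then show ?thesis using True unfolding m by (simp add: DERIV_def)
  qed
qed

text \<open>Each differentiation lowers the exponent by two, and a step is possible while the
  exponent is at least 3. Zeros of f are allowed; this is what makes odd powers of rho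
  differentiable at umbilical points.\<close>

lemma Ck_on_sqrt_power:
  fixes f :: "_ => real"
  shows "open S ==> (\<And>u. u \<in> S ==> f u \<ge> 0) ==> Ck_on k S f ==> m > 2 * k
    ==> Ck_on k S (\<lambda>u. sqrt (f u) ^ m)"
proof (induction k arbitrary: m)
  case 0
  then show ?case by (auto intro!: continuous_on_real_sqrt continuous_on_power)
next
  case (Suc k)
  have hd: "((\<lambda>u. sqrt (f u) ^ m) has_derivative
      (\<lambda>v. (real m / 2) * sqrt (f u) ^ (m - 2) * dirderiv f u v)) (at u)" if "u \<in> S" for u
  proof -
    have "((\<lambda>s. sqrt s ^ m) has_derivative (*) ((real m / 2) * sqrt (f u) ^ (m - 2))) (at (f u))"
      using has_real_derivative_sqrt_power[of "f u" m] Suc.prems that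
      by (auto simp: has_field_derivative_def)
    from has_derivative_compose[OF has_derivative_dirderiv[of f u] this] show ?thesis
      using Suc.prems that by (simp add: mult.assoc)
  qed
  have "Ck_on k S (\<lambda>u. dirderiv (\<lambda>u. sqrt (f u) ^ m) u v)" for v
  proof (rule Ck_on_cong[OF Suc.prems(1)])
    show "Ck_on k S (\<lambda>u. (real m / 2) * sqrt (f u) ^ (m - 2) * dirderiv f u v)"
      using Suc.prems Ck_on_SucD[OF Suc.prems(3)]
      by (intro Ck_on_mult Ck_on_const Suc.IH) auto
  qed (use dirderiv_eqI[OF hd] in auto)
  then show ?case using hd by (auto simp: differentiable_def)
qed

section \<open>Symmetry of second derivatives\<close>

lemma MVT_dirderiv:
  fixes g :: "'a::real_normed_vector => real"
  assumes "0 < h" "\<And>s. 0 \<le> s ==> s \<le> h ==> g differentiable (at (w + s *\<^sub>R a))"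
  shows "\<exists>s. 0 < s \<and> s < h \<and> g (w + h *\<^sub>R a) - g w = h * dirderiv g (w + s *\<^sub>R a) a"
proof -
  have "((\<lambda>s. g (w + s *\<^sub>R a)) has_derivative (\<lambda>t. t * dirderiv g (w + s *\<^sub>R a) a)) (at s)"
    if "0 \<le> s" "s \<le> h" for s
  proof -
    have "((\<lambda>s. w + s *\<^sub>R a) has_derivative (\<lambda>t. t *\<^sub>R a)) (at s)"
      by (auto intro!: derivative_eq_intros)
    from has_derivative_compose[OF this has_derivative_dirderiv[OF assms(2)[OF that]]]
    show ?thesis
      using linear_cmul[OF linear_dirderiv[OF assms(2)[OF that]]] by simp
  qed
  then have "\<exists>z>0. z < h \<and> g (w + h *\<^sub>R a) - g (w + 0 *\<^sub>R a) = (h - 0) * dirderiv g (w + z *\<^sub>R a) a"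
    using assms(1)
    by (intro MVT2) (auto simp: has_field_derivative_def mult.commute[of "dirderiv _ _ _", abs_def])
  then show ?thesis by auto
qed

text \<open>The mean value theorem in direction a, applied to the difference g(w + h b) - g(w), and
  then in direction b turns the second difference quotient into a mixed derivative at a nearby
  point, and the mixed derivative is continuous.\<close>

lemma second_difference_tendsto:
  fixes g :: "'a::real_normed_vector => real"
  assumes "open S" "u \<in> S" "Ck_on 2 S g" "e > 0"
  shows "\<exists>d>0. \<forall>h. 0 < h \<and> h < d \<longrightarrow>
    \<bar>(g (u + h *\<^sub>R a + h *\<^sub>R b) - g (u + h *\<^sub>R a) - g (u + h *\<^sub>R b) + g u) / h\<^sup>2
      - dirderiv (\<lambda>w. dirderiv g w a) u b\<bar> < e"
proof -
  have g1: "\<And>w. w \<in> S ==> g differentiable (at w)"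
    and g2: "\<And>w. w \<in> S ==> (\<lambda>w. dirderiv g w a) differentiable (at w)"
    and g3: "continuous_on S (\<lambda>w. dirderiv (\<lambda>w. dirderiv g w a) w b)"
    using assms(3) by (auto simp: numeral_2_eq_2)
  obtain d1 where d1: "d1 > 0" "ball u d1 \<subseteq> S" using assms open_contains_ball by blast
  have "isCont (\<lambda>w. dirderiv (\<lambda>w. dirderiv g w a) w b) u"
    using g3 assms continuous_on_eq_continuous_at by blast
  then obtain d2 where d2: "d2 > 0" "\<And>w. dist w u < d2 ==>
      \<bar>dirderiv (\<lambda>w. dirderiv g w a) w b - dirderiv (\<lambda>w. dirderiv g w a) u b\<bar> < e"
    using \<open>e > 0\<close> unfolding continuous_at_eps_delta by (auto simp: dist_real_def)
  \<comment> \<open>For s, r at most h < d the point u + s a + r b is at distance at most h (|a| +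
    |b|) from u, hence in both balls. The summand 1 keeps the denominator positive when a = b =
    0.\<close>
  define d where "d = min d1 d2 / (norm a + norm b + 1)"
  have pos: "norm a + norm b + 1 > 0" by (simp add: add_nonneg_pos)
  have "d > 0" using d1 d2 pos by (simp add: d_def)
  moreover have "\<bar>(g (u + h *\<^sub>R a + h *\<^sub>R b) - g (u + h *\<^sub>R a) - g (u + h *\<^sub>R b) + g u) / h\<^sup>2
      - dirderiv (\<lambda>w. dirderiv g w a) u b\<bar> < e" if h: "0 < h" "h < d" for h
  proof -
    have small: "dist (u + s *\<^sub>R a + r *\<^sub>R b) u < min d1 d2"
      if "0 \<le> s" "s \<le> h" "0 \<le> r" "r \<le> h" for s r
    proof -
      have "dist (u + s *\<^sub>R a + r *\<^sub>R b) u \<le> s * norm a + r * norm b"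
        using norm_triangle_ineq[of "s *\<^sub>R a" "r *\<^sub>R b"] that by (simp add: dist_norm)
      also have "\<dots> \<le> h * norm a + h * norm b"
        using that by (intro add_mono mult_right_mono) auto
      also have "\<dots> = h * (norm a + norm b)" by (simp add: distrib_left)
      also have "\<dots> \<le> d * (norm a + norm b)"
        using h by (intro mult_right_mono) auto
      also have "\<dots> < d * (norm a + norm b + 1)"
        using h by simp
      also have "\<dots> = min d1 d2" using pos by (simp add: d_def)
      finally show ?thesis .
    qed
    then have inS: "u + s *\<^sub>R a + r *\<^sub>R b \<in> S" if "0 \<le> s" "s \<le> h" "0 \<le> r" "r \<le> h" for s r
      using that d1 by (auto simp: dist_commute subset_eq)
    let ?G = "\<lambda>w. g (w + h *\<^sub>R b) - g w"
    have hd: "(?G has_derivative (\<lambda>v. dirderiv g (u + s *\<^sub>R a + h *\<^sub>R b) v - dirderiv g (u + s *\<^sub>R a) v))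
        (at (u + s *\<^sub>R a))" if "0 \<le> s" "s \<le> h" for s
    proof (rule has_derivative_diff)
      have "((\<lambda>w. w + h *\<^sub>R b) has_derivative (\<lambda>v. v)) (at (u + s *\<^sub>R a))"
        by (auto intro!: derivative_eq_intros)
      from has_derivative_compose[OF this has_derivative_dirderiv[OF g1[OF inS[OF that]]]]
      show "((\<lambda>w. g (w + h *\<^sub>R b)) has_derivative dirderiv g (u + s *\<^sub>R a + h *\<^sub>R b)) (at (u + s *\<^sub>R a))"
        using h by simp
      show "(g has_derivative dirderiv g (u + s *\<^sub>R a)) (at (u + s *\<^sub>R a))"
        using g1[OF inS[OF that, of 0]] h by (intro has_derivative_dirderiv) simp
    qed
    obtain s where s: "0 < s" "s < h"
      "?G (u + h *\<^sub>R a) - ?G u = h * dirderiv ?G (u + s *\<^sub>R a) a"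
      using MVT_dirderiv[of h ?G u a] h hd unfolding differentiable_def by blast
    have s': "?G (u + h *\<^sub>R a) - ?G u
        = h * (dirderiv g (u + s *\<^sub>R a + h *\<^sub>R b) a - dirderiv g (u + s *\<^sub>R a) a)"
      using s dirderiv_eqI[OF hd, of s] by simp
    obtain r where r: "0 < r" "r < h"
      "dirderiv g (u + s *\<^sub>R a + h *\<^sub>R b) a - dirderiv g (u + s *\<^sub>R a) a
        = h * dirderiv (\<lambda>w. dirderiv g w a) (u + s *\<^sub>R a + r *\<^sub>R b) b"
      using MVT_dirderiv[of h "\<lambda>w. dirderiv g w a" "u + s *\<^sub>R a" b] h g2 inS s by auto
    have "(g (u + h *\<^sub>R a + h *\<^sub>R b) - g (u + h *\<^sub>R a) - g (u + h *\<^sub>R b) + g u) / h\<^sup>2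
        = dirderiv (\<lambda>w. dirderiv g w a) (u + s *\<^sub>R a + r *\<^sub>R b) b"
      using s' r(3) h by (simp add: power2_eq_square field_simps)
    then show ?thesis using d2(2)[of "u + s *\<^sub>R a + r *\<^sub>R b"] small[of s r] s r by simp
  qed
  ultimately show ?thesis by blast
qed

text \<open>The second difference quotient is symmetric in a and b, so its two limits agree.\<close>

lemma dirderiv_commute_real:
  fixes g :: "'a::real_normed_vector => real"
  assumes "open S" "u \<in> S" "Ck_on 2 S g"
  shows "dirderiv (\<lambda>w. dirderiv g w a) u b = dirderiv (\<lambda>w. dirderiv g w b) u a"
proof (rule ccontr)
  let ?A = "dirderiv (\<lambda>w. dirderiv g w a) u b" and ?B = "dirderiv (\<lambda>w. dirderiv g w b) u a"
  let ?Q = "\<lambda>h a b. (g (u + h *\<^sub>R a + h *\<^sub>R b) - g (u + h *\<^sub>R a) - g (u + h *\<^sub>R b) + g u) / h\<^sup>2"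
  assume "?A \<noteq> ?B"
  then have e: "\<bar>?A - ?B\<bar> / 2 > 0" by simp
  obtain d where d: "d > 0" "\<And>h. 0 < h \<and> h < d ==> \<bar>?Q h a b - ?A\<bar> < \<bar>?A - ?B\<bar> / 2"
    using second_difference_tendsto[OF assms e, of a b] by blast
  obtain d' where d': "d' > 0" "\<And>h. 0 < h \<and> h < d' ==> \<bar>?Q h b a - ?B\<bar> < \<bar>?A - ?B\<bar> / 2"
    using second_difference_tendsto[OF assms e, of b a] by blast
  define h where "h = min d d' / 2"
  have "0 < h" "h < d" "h < d'" using d d' by (auto simp: h_def)
  moreover have "?Q h b a = ?Q h a b" by (simp add: add_ac)
  ultimately have "\<bar>?Q h a b - ?A\<bar> < \<bar>?A - ?B\<bar> / 2" "\<bar>?Q h a b - ?B\<bar> < \<bar>?A - ?B\<bar> / 2"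
    using d(2)[of h] d'(2)[of h] by (simp_all only: HOL.simp_thms)
  moreover have "[|\<bar>q - A\<bar> < \<bar>A - B\<bar> / 2; \<bar>q - B\<bar> < \<bar>A - B\<bar> / 2|] ==> False" for q A B :: real
    by (smt (verit) field_sum_of_halves)
  ultimately show False by blast
qed

lemma dirderiv_inner:
  assumes "f differentiable (at u)"
  shows "dirderiv (\<lambda>w. f w \<bullet> c) u v = dirderiv f u v \<bullet> c"
  by (rule dirderiv_eqI) (intro has_derivative_inner_left has_derivative_dirderiv assms)

lemma dirderiv_commute:
  fixes f :: "'a::real_normed_vector => 'b::euclidean_space"
  assumes "open S" "u \<in> S" "Ck_on 2 S f"
  shows "dirderiv (\<lambda>w. dirderiv f w a) u b = dirderiv (\<lambda>w. dirderiv f w b) u a"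
proof (rule euclidean_eqI)
  fix c :: 'b
  have 1: "dirderiv (\<lambda>w. dirderiv f w v) u v' \<bullet> c = dirderiv (\<lambda>w. dirderiv (\<lambda>w. f w \<bullet> c) w v) u v'" for v v'
  proof -
    have "dirderiv (\<lambda>w. dirderiv f w v) u v' \<bullet> c = dirderiv (\<lambda>w. dirderiv f w v \<bullet> c) u v'"
      using assms by (intro dirderiv_inner[symmetric]) (auto simp: numeral_2_eq_2)
    also have "\<dots> = dirderiv (\<lambda>w. dirderiv (\<lambda>w. f w \<bullet> c) w v) u v'"
      using assms by (intro dirderiv_cong_open[OF assms(1,2)] dirderiv_inner[symmetric])
        (auto simp: numeral_2_eq_2)
    finally show ?thesis .
  qed
  show "dirderiv (\<lambda>w. dirderiv f w a) u b \<bullet> c = dirderiv (\<lambda>w. dirderiv f w b) u a \<bullet> c"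
    unfolding 1 by (rule dirderiv_commute_real[OF assms(1,2)])
      (intro Ck_on_inner assms Ck_on_const)
qed

section \<open>Bump functions\<close>

text \<open>The standard flat function is the case k = 0. The inverse powers are included so that
  the derivative is again a linear combination of members of the family.\<close>

definition corner :: "nat => real => real"
  where "corner k x = (if x > 0 then exp (- inverse x) * inverse x ^ k else 0)"

lemma corner_tendsto_0: "(corner k \<longlongrightarrow> 0) (at 0)"
proof (rule filterlim_split_at)
  have "((\<lambda>x. inverse x ^ k / exp (inverse x)) \<longlongrightarrow> (0::real)) (at_right 0)"
    by (rule filterlim_compose[OF tendsto_power_div_exp_0 filterlim_inverse_at_top_right])
  then show "(corner k \<longlongrightarrow> 0) (at_right 0)"
    by (rule Lim_transform_eventually)
      (auto simp: corner_def eventually_at_filter exp_minus divide_inverse mult.commute)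
  show "(corner k \<longlongrightarrow> 0) (at_left 0)"
    by (rule Lim_transform_eventually[OF tendsto_const])
      (auto simp: corner_def eventually_at_filter)
qed

lemma corner_has_real_derivative:
  "(corner k has_real_derivative corner (k + 2) x - real k * corner (k + 1) x) (at x)"
proof -
  consider "x > 0" | "x < 0" | "x = 0" by linarith
  then show ?thesis
  proof cases
    case 1
    have "((\<lambda>x. exp (- inverse x) * inverse x ^ k) has_real_derivative
        corner (k + 2) x - real k * corner (k + 1) x) (at x)"
    proof -
      have e: "((\<lambda>x. exp (- inverse x)) has_real_derivative exp (- inverse x) * (inverse x ^ Suc (Suc 0))) (at x)"
        using 1 by (auto intro!: derivative_eq_intros)
      have "((\<lambda>x. inverse x ^ k) has_real_derivative
          of_nat k * ((- (inverse x ^ Suc (Suc 0))) * inverse x ^ (k - Suc 0))) (at x)"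
        using 1 by (intro DERIV_power DERIV_inverse) auto
      from DERIV_mult[OF e this] show ?thesis
        by (rule DERIV_cong) (use 1 in \<open>cases k; simp add: corner_def algebra_simps\<close>)
    qed
    then show ?thesis
      by (rule has_field_derivative_transform_within_open[where S="{0<..}"])
        (use 1 in \<open>auto simp: corner_def\<close>)
  next
    case 2
    have "((\<lambda>_. 0) has_real_derivative 0) (at x)" by simp
    then have "(corner k has_real_derivative 0) (at x)"
      by (rule has_field_derivative_transform_within_open[where S="{..<0}"])
        (use 2 in \<open>auto simp: corner_def\<close>)
    then show ?thesis using 2 by (simp add: corner_def)
  next
    case 3
    \<comment> \<open>Dividing by h only raises the index: corner k h / h = corner (k + 1) h, which
      tends to 0.\<close>
    have "((\<lambda>h. (corner k (0 + h) - corner k 0) / h) \<longlongrightarrow> 0) (at 0)"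
      by (rule Lim_transform_eventually[OF corner_tendsto_0[of "k + 1"]])
        (auto simp: corner_def eventually_at_filter divide_inverse)
    then show ?thesis using 3 by (simp add: DERIV_def corner_def)
  qed
qed

lemma Ck_on_corner: "Ck_on m UNIV (corner k)"
proof (induction m arbitrary: k)
  case 0
  then show ?case
    by (auto intro!: continuous_at_imp_continuous_on DERIV_isCont corner_has_real_derivative)
next
  case (Suc m)
  have hd: "(corner k has_derivative (\<lambda>v. (corner (k + 2) x - real k * corner (k + 1) x) * v)) (at x)" for x
    using corner_has_real_derivative[of k x] by (simp add: has_field_derivative_def)
  have "Ck_on m UNIV (\<lambda>x. (corner (k + 2) x - real k * corner (k + 1) x) * v)" for v
    by (intro Ck_on_mult Ck_on_diff Ck_on_const Suc.IH) auto
  then show ?case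
    using hd dirderiv_eqI[OF hd] by (auto simp: differentiable_def)
qed

definition smooth_step :: "real => real"
  where "smooth_step x = corner 0 x / (corner 0 x + corner 0 (1 - x))"

lemma Ck_on_smooth_step: "Ck_on m UNIV smooth_step"
proof -
  \<comment> \<open>x and 1 - x are never both nonpositive, so one of the two nonnegative summands
    is positive.\<close>
  have "corner 0 x + corner 0 (1 - x) \<noteq> 0" for x :: real
    by (auto simp: corner_def add_pos_pos less_imp_neq[symmetric])
  moreover have "Ck_on m UNIV (\<lambda>x. corner 0 (1 - x))"
    by (rule Ck_on_compose[where g="corner 0", OF _ _ _ Ck_on_corner])
      (auto intro: Ck_on_diff Ck_on_const Ck_on_id)
  ultimately have "Ck_on m UNIV (\<lambda>x. corner 0 x / (corner 0 x + corner 0 (1 - x)))"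
    by (intro Ck_on_divide Ck_on_add Ck_on_corner) auto
  then show ?thesis by (simp add: smooth_step_def[abs_def])
qed

text \<open>The squared distance is used because it is smooth at the centre. The argument of the
  step is at least 1 up to distance r and at most 0 from distance \<open>sqrt 2 * r\<close> on, in
  particular from 2 r on.\<close>

definition bump :: "'a::euclidean_space => real => 'a => real"
  where "bump a r u = smooth_step (2 - ((u - a) \<bullet> (u - a)) / r\<^sup>2)"

lemma Ck_on_bump: "Ck_on m UNIV (bump a r)"
proof -
  have "Ck_on m UNIV (\<lambda>u. 2 - ((u - a) \<bullet> (u - a)) * inverse (r\<^sup>2))"
    by (intro Ck_on_diff Ck_on_mult Ck_on_inner Ck_on_const Ck_on_id) auto
  from Ck_on_compose[OF open_UNIV open_UNIV subset_UNIV Ck_on_smooth_step this]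
  show ?thesis by (simp add: bump_def[abs_def] divide_inverse)
qed

lemma bump_nonneg: "bump a r u \<ge> 0"
  by (simp add: bump_def smooth_step_def corner_def add_nonneg_nonneg)

lemma bump_eq_1:
  assumes "r > 0" "dist u a \<le> r"
  shows "bump a r u = 1"
proof -
  have "(u - a) \<bullet> (u - a) \<le> r\<^sup>2"
    using assms power_mono[of "dist u a" r 2] by (simp add: dist_norm power2_norm_eq_inner)
  then have "(u - a) \<bullet> (u - a) / r\<^sup>2 \<le> 1" using assms by simp
  then show ?thesis by (simp add: bump_def smooth_step_def corner_def)
qed

lemma bump_eq_0:
  assumes "r > 0" "dist u a \<ge> 2 * r"
  shows "bump a r u = 0"
proof -
  have "(2 * r)\<^sup>2 \<le> (u - a) \<bullet> (u - a)"
    using assms power_mono[of "2 * r" "dist u a" 2] by (simp add: dist_norm power2_norm_eq_inner)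
  moreover have "2 * r\<^sup>2 \<le> (2 * r)\<^sup>2" by (simp add: power_mult_distrib)
  ultimately have "2 * r\<^sup>2 \<le> (u - a) \<bullet> (u - a)" by (rule order_trans[rotated])
  then have "2 \<le> (u - a) \<bullet> (u - a) / r\<^sup>2"
    using assms by (simp add: pos_le_divide_eq)
  then show ?thesis by (simp add: bump_def smooth_step_def corner_def)
qed

section \<open>Orthonormal systems\<close>

text \<open>The system is independent and has as many members as the dimension of S, so it spans S;
  the remainder of the expansion lies in S and is orthogonal to the system, hence to itself.\<close>

lemma orthonormal_expansion:
  fixes f :: "'i => 'e::euclidean_space"
  assumes I: "finite I" and on: "\<And>i j. i \<in> I ==> j \<in> I ==> f i \<bullet> f j = (if i = j then 1 else 0)"
    and S: "subspace S" "f ` I \<subseteq> S" "card I = dim S" and v: "v \<in> S"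
  shows "v = (\<Sum>i\<in>I. (v \<bullet> f i) *\<^sub>R f i)"
proof -
  have inj: "inj_on f I"
    by (rule inj_onI) (metis on zero_neq_one)
  have "independent (f ` I)"
  proof (rule pairwise_orthogonal_independent)
    show "pairwise orthogonal (f ` I)"
      using on by (force simp: pairwise_def orthogonal_def)
    show "0 \<notin> f ` I" using on by force
  qed
  then have span: "S \<subseteq> span (f ` I)"
    using card_ge_dim_independent[OF S(2)] S(3) inj by (simp add: card_image)
  let ?w = "v - (\<Sum>i\<in>I. (v \<bullet> f i) *\<^sub>R f i)"
  have "?w \<in> S"
    using S v by (intro subspace_diff subspace_sum subspace_scale) auto
  moreover have "orthogonal ?w (f j)" if "j \<in> I" for j
  proof -
    have "(\<Sum>i\<in>I. (v \<bullet> f i) *\<^sub>R f i) \<bullet> f j = (\<Sum>i\<in>I. if i = j then v \<bullet> f j else 0)"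
      unfolding inner_sum_left using on that by (intro sum.cong) auto
    then show ?thesis using that I by (simp add: orthogonal_def inner_diff_left)
  qed
  ultimately have "orthogonal ?w ?w"
    using span by (intro orthogonal_to_span[of ?w "f ` I"]) auto
  then show ?thesis by (simp add: orthogonal_self)
qed

text \<open>n vectors that are orthonormal for the pulled-back form are independent and hence a
  basis of the coordinate space; pairing with the basis gives the coefficients, and a vector in the
  kernel of P has all coefficients 0.\<close>

lemma orthonormal_frame_expansion:
  fixes P :: "real ^ 'n::finite => 'e::euclidean_space" and a :: "'n => real ^ 'n"
  assumes P: "linear P" and on: "\<And>i j. P (a i) \<bullet> P (a j) = (if i = j then 1 else 0)"
  shows "v = (\<Sum>i\<in>UNIV. (P v \<bullet> P (a i)) *\<^sub>R a i)" and "inj P"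
proof -
  have "a i \<noteq> a j" if "i \<noteq> j" for i j using on[of i j] on[of i i] that by auto
  then have inja: "inj a" by (auto simp: inj_def)
  have ind: "independent (range a)"
  proof (rule real_vector.independent_if_scalars_zero)
    fix f x assume f: "(\<Sum>x\<in>range a. f x *\<^sub>R x) = 0" and "x \<in> range a"
    then obtain j where x: "x = a j" by auto
    have "0 = P (\<Sum>i\<in>UNIV. f (a i) *\<^sub>R a i) \<bullet> P (a j)"
      using f by (simp add: sum.reindex[OF inja] linear_0[OF P])
    also have "\<dots> = (\<Sum>i\<in>UNIV. f (a i) * (P (a i) \<bullet> P (a j)))"
      by (simp add: linear_sum[OF P] linear_cmul[OF P] inner_sum_left)
    also have "\<dots> = (\<Sum>i\<in>UNIV. if i = j then f (a j) else 0)"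
      by (intro sum.cong) (auto simp: on)
    also have "\<dots> = f (a j)" by simp
    finally show "f x = 0" using x by simp
  qed simp
  have "span (range a) = UNIV"
    using ind card_ge_dim_independent[of "range a" UNIV] inja by (simp add: card_image top.extremum_uniqueI)
  have ex: "\<exists>c. w = (\<Sum>i\<in>UNIV. c i *\<^sub>R a i)" for w
  proof -
    have "w \<in> span (range a)" using \<open>span (range a) = UNIV\<close> by simp
    then obtain c where "w = (\<Sum>x\<in>range a. c x *\<^sub>R x)"
      by (auto simp: span_finite)
    then show ?thesis by (auto simp: sum.reindex[OF inja])
  qed
  have coef: "P w \<bullet> P (a j) = c j" if "w = (\<Sum>i\<in>UNIV. c i *\<^sub>R a i)" for w c j
  proof -
    have "P w \<bullet> P (a j) = (\<Sum>i\<in>UNIV. c i * (P (a i) \<bullet> P (a j)))"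
      using that by (simp add: linear_sum[OF P] linear_cmul[OF P] inner_sum_left)
    also have "\<dots> = (\<Sum>i\<in>UNIV. if i = j then c j else 0)"
      by (intro sum.cong) (auto simp: on)
    finally show ?thesis by simp
  qed
  show exp: "v = (\<Sum>i\<in>UNIV. (P v \<bullet> P (a i)) *\<^sub>R a i)" for v
  proof -
    obtain c where c: "v = (\<Sum>i\<in>UNIV. c i *\<^sub>R a i)" using ex by blast
    then show ?thesis using coef[OF c] by simp
  qed
  show "inj P"
  proof (subst linear_injective_0[OF P], intro allI impI)
    fix v assume "P v = 0"
    then show "v = 0" using exp[of v] by simp
  qed
qed

text \<open>The two bases differ by an orthogonal matrix, and its columns are orthonormal. The
  values of B may lie in any vector space, so the same fact serves for tangential projections, the
  mean curvature vector and, one slot after the other, the norm of the second fundamental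
  form.\<close>

lemma orthonormal_trace_invariant:
  fixes P :: "real ^ 'n::finite => 'e::euclidean_space" and a a' :: "'n => real ^ 'n"
    and B :: "real ^ 'n => real ^ 'n => 'c::real_vector"
  assumes P: "linear P"
    and a: "\<And>i j. P (a i) \<bullet> P (a j) = (if i = j then 1 else 0)"
    and a': "\<And>i j. P (a' i) \<bullet> P (a' j) = (if i = j then 1 else 0)"
    and B: "\<And>w. linear (B w)" "\<And>w. linear (\<lambda>v. B v w)"
  shows "(\<Sum>i\<in>UNIV. B (a' i) (a' i)) = (\<Sum>i\<in>UNIV. B (a i) (a i))"
proof -
  let ?O = "\<lambda>i j. P (a' i) \<bullet> P (a j)"
  have O: "(\<Sum>i\<in>UNIV. ?O i j * ?O i k) = (if j = k then 1 else 0)" for j k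
  proof -
    have "P (a j) = (\<Sum>i\<in>UNIV. (P (a j) \<bullet> P (a' i)) *\<^sub>R P (a' i))"
      using arg_cong[OF orthonormal_frame_expansion(1)[OF P a', of "a j"], of P]
      by (simp add: linear_sum[OF P] linear_cmul[OF P])
    then have "P (a j) \<bullet> P (a k) = (\<Sum>i\<in>UNIV. (P (a j) \<bullet> P (a' i)) * (P (a' i) \<bullet> P (a k)))"
      by (rule trans[OF arg_cong[where f="\<lambda>v. v \<bullet> P (a k)"]]) (simp add: inner_sum_left)
    then show ?thesis by (simp add: a inner_commute)
  qed
  have "B (a' i) (a' i) = (\<Sum>j\<in>UNIV. \<Sum>k\<in>UNIV. (?O i j * ?O i k) *\<^sub>R B (a j) (a k))" for i
  proof -
    have b1: "B (a' i) w = (\<Sum>j\<in>UNIV. ?O i j *\<^sub>R B (a j) w)" for w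
      using arg_cong[OF orthonormal_frame_expansion(1)[OF P a, of "a' i"], of "\<lambda>v. B v w"]
      by (simp add: linear_sum[OF B(2)] linear_cmul[OF B(2)])
    have b2: "B w (a' i) = (\<Sum>j\<in>UNIV. ?O i j *\<^sub>R B w (a j))" for w
      using arg_cong[OF orthonormal_frame_expansion(1)[OF P a, of "a' i"], of "B w"]
      by (simp add: linear_sum[OF B(1)] linear_cmul[OF B(1)])
    show ?thesis by (subst b1) (simp only: b2 scaleR_sum_right scaleR_scaleR)
  qed
  then have "(\<Sum>i\<in>UNIV. B (a' i) (a' i))
      = (\<Sum>i\<in>UNIV. \<Sum>j\<in>UNIV. \<Sum>k\<in>UNIV. (?O i j * ?O i k) *\<^sub>R B (a j) (a k))" by simp
  also have "\<dots> = (\<Sum>j\<in>UNIV. \<Sum>i\<in>UNIV. \<Sum>k\<in>UNIV. (?O i j * ?O i k) *\<^sub>R B (a j) (a k))"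
    by (rule sum.swap)
  also have "\<dots> = (\<Sum>j\<in>UNIV. \<Sum>k\<in>UNIV. \<Sum>i\<in>UNIV. (?O i j * ?O i k) *\<^sub>R B (a j) (a k))"
    by (intro sum.cong refl sum.swap)
  also have "\<dots> = (\<Sum>j\<in>UNIV. \<Sum>k\<in>UNIV. (if j = k then 1 else 0) *\<^sub>R B (a j) (a k))"
    by (simp add: scaleR_sum_left[symmetric] O)
  also have "\<dots> = (\<Sum>j\<in>UNIV. \<Sum>k\<in>UNIV. if j = k then B (a j) (a j) else 0)"
    by (intro sum.cong) auto
  also have "\<dots> = (\<Sum>j\<in>UNIV. B (a j) (a j))" by simp
  finally show ?thesis .
qed

lemma Ck_on_inverse_norm:
  fixes r :: "'z::real_normed_vector => 'e::euclidean_space"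
  assumes "open S" "Ck_on k S r" "\<And>z. z \<in> S ==> r z \<noteq> 0"
  shows "Ck_on k S (\<lambda>z. inverse (norm (r z)))"
proof -
  have "Ck_on k S (\<lambda>z. sqrt (r z \<bullet> r z))"
    by (rule Ck_on_sqrt[OF assms(1) _ Ck_on_inner[OF assms(1,2,2)]]) (use assms(3) in simp)
  from Ck_on_inverse[OF assms(1) _ this] assms(3) show ?thesis
    by (simp add: norm_eq_sqrt_inner)
qed

text \<open>Gram--Schmidt with parameters, started at a parameter where the system is already
  orthonormal, so that it is left unchanged there.\<close>

lemma smooth_gram_schmidt:
  fixes f :: "nat => 'z::real_normed_vector => 'e::euclidean_space"
  assumes "open S" "z0 \<in> S" "\<And>k. k < m ==> smooth_on S (f k)"
    "\<And>j k. j < m ==> k < m ==> f j z0 \<bullet> f k z0 = (if j = k then 1 else 0)"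
  shows "\<exists>S' c. open S' \<and> z0 \<in> S' \<and> S' \<subseteq> S \<and> (\<forall>k l. smooth_on S' (c k l)) \<and>
    (\<forall>k l. k < m \<longrightarrow> c k l z0 = (if k = l then (1::real) else 0)) \<and>
    (\<forall>z\<in>S'. \<forall>j<m. \<forall>k<m. (\<Sum>l<m. c j l z *\<^sub>R f l z) \<bullet> (\<Sum>l<m. c k l z *\<^sub>R f l z)
       = (if j = k then 1 else 0))"
  using assms(3,4)
proof (induction m)
  case 0
  have "smooth_on S (\<lambda>z. 0::real)" by (simp add: smooth_on_def Ck_on_const)
  then show ?case using assms(1,2) by (intro exI[of _ S] exI[of _ "\<lambda>_ _ _. 0"]) auto
next
  case (Suc m)
  from Suc.IH[OF Suc.prems(1)[OF less_SucI] Suc.prems(2)[OF less_SucI less_SucI]]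
  obtain T c where T: "open T" "z0 \<in> T" "T \<subseteq> S" and sm': "\<forall>k l. smooth_on T (c k l)"
    and c0': "\<forall>k l. k < m \<longrightarrow> c k l z0 = (if k = l then (1::real) else 0)"
    and on': "\<forall>z\<in>T. \<forall>j<m. \<forall>k<m.
      (\<Sum>l<m. c j l z *\<^sub>R f l z) \<bullet> (\<Sum>l<m. c k l z *\<^sub>R f l z) = (if j = k then 1 else 0)"
    by blast
  have sm: "Ck_on n T (c k l)" for k l n using sm' by (simp add: smooth_on_def)
  have c0: "c k l z0 = (if k = l then 1 else 0)" if "k < m" for k l using c0' that by blast
  have on: "(\<Sum>l<m. c j l z *\<^sub>R f l z) \<bullet> (\<Sum>l<m. c k l z *\<^sub>R f l z) = (if j = k then 1 else 0)"
    if "z \<in> T" "j < m" "k < m" for z j k using on' that by blast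
  define g where "g k z = (\<Sum>l<m. c k l z *\<^sub>R f l z)" for k z
  define r where "r z = f m z - (\<Sum>j<m. (f m z \<bullet> g j z) *\<^sub>R g j z)" for z
  have fs: "Ck_on n T (f k)" if "k \<le> m" for k n
    using Suc.prems(1)[of k] that T(3) by (auto simp: smooth_on_def intro: Ck_on_subset)
  have gs: "Ck_on n T (g k)" for k n
    unfolding g_def using fs sm T(1) by (intro Ck_on_sum Ck_on_scaleR) auto
  have rs: "Ck_on n T r" for n
    unfolding r_def[abs_def] using fs gs T(1)
    by (intro Ck_on_diff Ck_on_sum Ck_on_scaleR Ck_on_inner) auto
  have g0: "g k z0 = f k z0" if "k < m" for k
  proof -
    have "g k z0 = (\<Sum>l<m. if k = l then f k z0 else 0)"
      unfolding g_def using c0 that by (intro sum.cong) auto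
    then show ?thesis using that by simp
  qed
  have r0: "r z0 = f m z0"
    using Suc.prems(2)[of m] g0 by (simp add: r_def)
  \<comment> \<open>The residual r equals \<open>f m z0\<close> at z0, a unit vector, so it stays
    nonzero on a neighbourhood.\<close>
  define T' where "T' = T \<inter> r -` (- {0})"
  have "open T'"
    unfolding T'_def using Ck_on_continuous[OF rs[of 0]] T(1)
    by (intro continuous_open_preimage) auto
  have norm0: "norm (f m z0) = 1"
    using Suc.prems(2)[of m m] by (simp add: norm_eq_1)
  have "z0 \<in> T'" using T r0 norm0 by (auto simp: T'_def)
  define q where "q z = inverse (norm (r z))" for z
  have qs: "Ck_on n T' q" for n
    unfolding q_def[abs_def] by (intro Ck_on_inverse_norm \<open>open T'\<close> Ck_on_subset[OF rs]) (auto simp: T'_def)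
  \<comment> \<open>The normalised residual, written in terms of the original vectors f.
    Coefficients are recorded instead of the new vectors because the same coefficients are later
    applied to coordinate vectors whose images under the differential are the f.\<close>
  define c' where "c' k l z = (if k < m then (if l < m then c k l z else 0)
      else if l < m then - (\<Sum>j<m. (f m z \<bullet> g j z) * c j l z) * q z
      else if l = m then q z else 0)" for k l z
  have c's: "Ck_on n T' (c' k l)" for k l n
  proof -
    have sub: "Ck_on n T h ==> Ck_on n T' h" for h :: "'z => 'x::real_normed_vector"
      by (rule Ck_on_subset) (auto simp: T'_def)
    have "Ck_on n T' (\<lambda>z. - (\<Sum>j<m. (f m z \<bullet> g j z) * c j l z) * q z)"
      by (intro Ck_on_mult Ck_on_minus Ck_on_sum Ck_on_inner \<open>open T'\<close> qs sub[OF sm] sub[OF gs]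
          sub[OF fs]) auto
    moreover have "Ck_on n T' (c k l)" by (rule sub[OF sm])
    ultimately show ?thesis
      using qs by (cases "k < m"; cases "l < m"; cases "l = m") (simp_all add: c'_def[abs_def] Ck_on_const)
  qed
  have gl: "(\<Sum>l<Suc m. c' k l z *\<^sub>R f l z) = (if k < m then g k z else q z *\<^sub>R r z)" for k z
  proof (cases "k < m")
    case True
    then show ?thesis by (simp add: c'_def g_def)
  next
    case False
    have "(\<Sum>l<m. (- (\<Sum>j<m. (f m z \<bullet> g j z) * c j l z) * q z) *\<^sub>R f l z)
        = - (q z *\<^sub>R (\<Sum>l<m. (\<Sum>j<m. (f m z \<bullet> g j z) * c j l z) *\<^sub>R f l z))"
      by (simp add: scaleR_sum_right sum_negf mult.commute)
    also have "(\<Sum>l<m. (\<Sum>j<m. (f m z \<bullet> g j z) * c j l z) *\<^sub>R f l z)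
        = (\<Sum>j<m. (f m z \<bullet> g j z) *\<^sub>R g j z)"
      unfolding g_def scaleR_sum_left scaleR_sum_right
      by (subst sum.swap) (simp add: g_def)
    finally show ?thesis using False by (simp add: c'_def r_def algebra_simps)
  qed
  have rg: "r z \<bullet> g k z = 0" if "k < m" "z \<in> T'" for k z
  proof -
    have "(\<Sum>j<m. (f m z \<bullet> g j z) *\<^sub>R g j z) \<bullet> g k z = (\<Sum>j<m. if j = k then f m z \<bullet> g k z else 0)"
      unfolding inner_sum_left using on[of z] that
      by (intro sum.cong) (auto simp: g_def T'_def)
    then show ?thesis using that by (simp add: r_def inner_diff_left)
  qed
  have "(\<Sum>l<Suc m. c' j l z *\<^sub>R f l z) \<bullet> (\<Sum>l<Suc m. c' k l z *\<^sub>R f l z) = (if j = k then 1 else 0)"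
    if "z \<in> T'" "j < Suc m" "k < Suc m" for j k z
  proof -
    have "q z *\<^sub>R r z \<bullet> q z *\<^sub>R r z = 1"
      using that by (simp add: q_def T'_def dot_square_norm power2_eq_square)
    then show ?thesis
      unfolding gl using that on[of z j k] rg[of j z] rg[of k z]
      by (auto simp: g_def[symmetric] T'_def inner_commute less_Suc_eq)
  qed
  moreover have "c' k l z0 = (if k = l then 1 else 0)" if "k < Suc m" for k l
    using that c0 Suc.prems(2)[of m] g0 r0 norm0 by (auto simp: c'_def q_def less_Suc_eq)
  ultimately show ?case
    using \<open>open T'\<close> \<open>z0 \<in> T'\<close> T'_def T(3) c's
    by (intro exI[of _ T'] exI[of _ c']) (auto simp: smooth_on_def)
qed

section \<open>Derivatives of maps into the sphere\<close>

abbreviation dd :: "('a::real_normed_vector => 'b::real_normed_vector) => 'a => 'a => 'a => 'b"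
  where "dd f u v w \<equiv> dirderiv (\<lambda>u'. dirderiv f u' v) u w"

text \<open>Product rule for the differential at a moving point applied to a moving direction. The
  direction is expanded in the basis, so that only derivatives in constant directions are
  differentiated, and the sum is reassembled afterwards.\<close>

lemma has_derivative_dirderiv_along:
  fixes z :: "'b::euclidean_space => 'c::real_normed_vector" and g s :: "'a::real_normed_vector => 'b"
  assumes "open T" "Ck_on 2 T z" "open S" "u \<in> S" "g ` S \<subseteq> T"
    "g differentiable (at u)" "s differentiable (at u)"
  shows "((\<lambda>w. dirderiv z (g w) (s w)) has_derivative
    (\<lambda>x. dd z (g u) (s u) (dirderiv g u x) + dirderiv z (g u) (dirderiv s u x))) (at u)"
proof -
  have z: "z differentiable (at w)" "(\<lambda>w. dirderiv z w b) differentiable (at w)" if "w \<in> T" for w b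
    using assms(2) that by (auto simp: numeral_2_eq_2)
  have gu: "g u \<in> T" using assms by auto
  have 1: "((\<lambda>w. (s w \<bullet> b) *\<^sub>R dirderiv z (g w) b) has_derivative
      (\<lambda>x. (s u \<bullet> b) *\<^sub>R dd z (g u) b (dirderiv g u x) + (dirderiv s u x \<bullet> b) *\<^sub>R dirderiv z (g u) b)) (at u)"
    for b
  proof (rule has_derivative_scaleR)
    show "((\<lambda>w. s w \<bullet> b) has_derivative (\<lambda>x. dirderiv s u x \<bullet> b)) (at u)"
      by (intro has_derivative_inner_left has_derivative_dirderiv assms)
    show "((\<lambda>w. dirderiv z (g w) b) has_derivative (\<lambda>x. dd z (g u) b (dirderiv g u x))) (at u)"
      by (rule has_derivative_compose[OF has_derivative_dirderiv[OF assms(6)]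
            has_derivative_dirderiv[OF z(2)[OF gu]]])
  qed
  have 2: "(\<Sum>b\<in>Basis. (s w \<bullet> b) *\<^sub>R dirderiv z (g w) b) = dirderiv z (g w) (s w)" if "w \<in> S" for w
    using dirderiv_expand[OF z(1), of "g w" "s w"] that assms(5) by auto
  have 3: "(\<Sum>b\<in>Basis. (s u \<bullet> b) *\<^sub>R dd z (g u) b y) = dd z (g u) (s u) y" for y
  proof -
    have "((\<lambda>w. \<Sum>b\<in>Basis. (s u \<bullet> b) *\<^sub>R dirderiv z w b) has_derivative
        (\<lambda>y. \<Sum>b\<in>Basis. (s u \<bullet> b) *\<^sub>R dd z (g u) b y)) (at (g u))"
      by (intro has_derivative_sum has_derivative_scaleR_right has_derivative_dirderiv z(2) gu)
    then have "((\<lambda>w. dirderiv z w (s u)) has_derivative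
        (\<lambda>y. \<Sum>b\<in>Basis. (s u \<bullet> b) *\<^sub>R dd z (g u) b y)) (at (g u))"
      by (rule has_derivative_transform_within_open[OF _ assms(1) gu])
        (use dirderiv_expand[OF z(1)] in metis)
    from dirderiv_eqI[OF this] show ?thesis by simp
  qed
  have "((\<lambda>w. \<Sum>b\<in>Basis. (s w \<bullet> b) *\<^sub>R dirderiv z (g w) b) has_derivative
      (\<lambda>x. \<Sum>b\<in>Basis. (s u \<bullet> b) *\<^sub>R dd z (g u) b (dirderiv g u x)
        + (dirderiv s u x \<bullet> b) *\<^sub>R dirderiv z (g u) b)) (at u)"
    by (intro has_derivative_sum 1)
  then have "((\<lambda>w. dirderiv z (g w) (s w)) has_derivative
      (\<lambda>x. \<Sum>b\<in>Basis. (s u \<bullet> b) *\<^sub>R dd z (g u) b (dirderiv g u x)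
        + (dirderiv s u x \<bullet> b) *\<^sub>R dirderiv z (g u) b)) (at u)"
    by (rule has_derivative_transform_within_open[OF _ assms(3,4)]) (rule 2)
  moreover have "(\<Sum>b\<in>Basis. (dirderiv s u x \<bullet> b) *\<^sub>R dirderiv z (g u) b)
      = dirderiv z (g u) (dirderiv s u x)" for x
    by (rule dirderiv_expand[OF z(1)[OF gu], symmetric])
  ultimately show ?thesis
    by (simp add: sum.distrib 3)
qed

lemma linear_dd:
  assumes "open U" "u \<in> U" "Ck_on 2 U (y :: 'a::real_normed_vector => 'b::real_normed_vector)"
  shows "linear (dd y u v)" "linear (\<lambda>v. dd y u v w)"
proof -
  have d: "(\<lambda>w. dirderiv y w v) differentiable (at u)" "\<And>w. w \<in> U ==> y differentiable (at w)" for v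
    using assms by (auto simp: numeral_2_eq_2)
  show "linear (dd y u v)" by (rule linear_dirderiv[OF d(1)])
  show "linear (\<lambda>v. dd y u v w)"
  proof (rule linearI)
    fix v v'
    have "dd y u (v + v') w = dirderiv (\<lambda>x. dirderiv y x v + dirderiv y x v') u w"
      using linear_add[OF linear_dirderiv[OF d(2)]]
      by (intro dirderiv_cong_open[OF assms(1,2)]) auto
    also have "\<dots> = dd y u v w + dd y u v' w"
      by (rule dirderiv_eqI) (intro has_derivative_add has_derivative_dirderiv d)
    finally show "dd y u (v + v') w = dd y u v w + dd y u v' w" .
  next
    fix r v
    have "dd y u (r *\<^sub>R v) w = dirderiv (\<lambda>x. r *\<^sub>R dirderiv y x v) u w"
      using linear_cmul[OF linear_dirderiv[OF d(2)]]
      by (intro dirderiv_cong_open[OF assms(1,2)]) auto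
    also have "\<dots> = r *\<^sub>R dd y u v w"
      by (rule dirderiv_eqI) (intro has_derivative_scaleR_right has_derivative_dirderiv d)
    finally show "dd y u (r *\<^sub>R v) w = r *\<^sub>R dd y u v w" .
  qed
qed

lemma has_derivative_slice:
  assumes "f differentiable (at (t, u))"
  shows "((\<lambda>w. f (t, w)) has_derivative (\<lambda>v. dirderiv f (t, u) (0, v))) (at u)"
    and "((\<lambda>s. f (s, u)) has_derivative (\<lambda>h. dirderiv f (t, u) (h, 0))) (at t)"
proof -
  have "((\<lambda>w. (t, w)) has_derivative (\<lambda>v. (0, v))) (at u)"
    "((\<lambda>s. (s, u)) has_derivative (\<lambda>h. (h, 0))) (at t)"
    by (auto intro!: derivative_eq_intros)
  from this[THEN has_derivative_compose, OF has_derivative_dirderiv[OF assms]]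
  show "((\<lambda>w. f (t, w)) has_derivative (\<lambda>v. dirderiv f (t, u) (0, v))) (at u)"
    "((\<lambda>s. f (s, u)) has_derivative (\<lambda>h. dirderiv f (t, u) (h, 0))) (at t)" by auto
qed

lemma dirderiv_slice:
  "f differentiable (at (t, u)) ==> dirderiv (\<lambda>w. f (t, w)) u v = dirderiv f (t, u) (0, v)"
  by (rule dirderiv_eqI) (rule has_derivative_slice)

lemma dirderiv_inner_both:
  assumes "f differentiable (at u)" "g differentiable (at u)"
  shows "dirderiv (\<lambda>w. f w \<bullet> g w) u v = f u \<bullet> dirderiv g u v + dirderiv f u v \<bullet> g u"
  by (rule dirderiv_eqI) (intro has_derivative_inner has_derivative_dirderiv assms)

text \<open>Differentiating a constant inner product. All antisymmetry relations of the connection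
  forms and the Weingarten equations come from this.\<close>

lemma inner_dirderiv_const:
  assumes "open U" "u \<in> U" "\<And>w. w \<in> U ==> f w \<bullet> g w = c"
    "f differentiable (at u)" "g differentiable (at u)"
  shows "f u \<bullet> dirderiv g u v = - (dirderiv f u v \<bullet> g u)"
proof -
  have "dirderiv (\<lambda>w. f w \<bullet> g w) u v = dirderiv (\<lambda>w. c) u v"
    by (rule dirderiv_cong_open[OF assms(1-3)])
  then show ?thesis by (simp add: dirderiv_inner_both assms frechet_derivative_const)
qed

lemma inner_dirderiv_sphere:
  assumes "open U" "u \<in> U" "\<And>w. w \<in> U ==> y w \<bullet> y w = (1::real)" "y differentiable (at u)"
  shows "y u \<bullet> dirderiv y u v = 0"
  using inner_dirderiv_const[OF assms(1-3,4,4), of v] by (simp add: inner_commute)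

section \<open>Adapted bases\<close>

text \<open>Tangent vectors, normal vectors and the position vector together are n + p + 1
  orthonormal vectors of the ambient space. The number \<open>CARD('n)\<close>, which precedes the
  first normal index, serves as the index of the position vector.\<close>

lemma adapted_expansion:
  fixes Y :: "'n::finite => 'e::euclidean_space"
  assumes dim: "CARD('n) < DIM('e)"
    and Y: "\<And>i j. Y i \<bullet> Y j = (if i = j then 1 else 0)"
    and b: "\<And>\<alpha> \<beta>. \<alpha> \<in> {CARD('n)+1..<DIM('e)} ==> \<beta> \<in> {CARD('n)+1..<DIM('e)} ==>
      b \<alpha> \<bullet> b \<beta> = (if \<alpha> = \<beta> then 1 else 0)"
    and bY: "\<And>\<alpha> i. \<alpha> \<in> {CARD('n)+1..<DIM('e)} ==> b \<alpha> \<bullet> Y i = 0"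
    and bx: "\<And>\<alpha>. \<alpha> \<in> {CARD('n)+1..<DIM('e)} ==> b \<alpha> \<bullet> x = 0"
    and x: "x \<bullet> x = 1" "\<And>i. x \<bullet> Y i = 0"
  shows "v = (\<Sum>i\<in>UNIV. (v \<bullet> Y i) *\<^sub>R Y i) + (\<Sum>\<alpha>\<in>{CARD('n)+1..<DIM('e)}. (v \<bullet> b \<alpha>) *\<^sub>R b \<alpha>)
    + (v \<bullet> x) *\<^sub>R x"
proof -
  define f where "f = case_sum Y (\<lambda>\<alpha>. if \<alpha> = CARD('n) then x else b \<alpha>)"
  let ?I = "Inl ` (UNIV :: 'n set) \<union> Inr ` {CARD('n)..<DIM('e)}"
  have card: "card ?I = dim (UNIV :: 'e set)"
  proof -
    have "card ?I = card (Inl ` (UNIV :: 'n set) :: ('n + nat) set) + card (Inr ` {CARD('n)..<DIM('e)} :: ('n + nat) set)"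
      by (intro card_Un_disjoint) auto
    also have "\<dots> = CARD('n) + (DIM('e) - CARD('n))"
      by (simp add: card_image)
    finally show ?thesis using dim by simp
  qed
  have on: "f i \<bullet> f j = (if i = j then 1 else 0)" if "i \<in> ?I" "j \<in> ?I" for i j
    using that Y b bY bx x by (auto simp: f_def inner_commute split: if_splits)
  have "v = (\<Sum>i\<in>?I. (v \<bullet> f i) *\<^sub>R f i)"
    by (rule orthonormal_expansion[OF _ on _ _ card]) auto
  also have "\<dots> = (\<Sum>i\<in>Inl ` UNIV. (v \<bullet> f i) *\<^sub>R f i) + (\<Sum>i\<in>Inr ` {CARD('n)..<DIM('e)}. (v \<bullet> f i) *\<^sub>R f i)"
    by (rule sum.union_disjoint) auto
  also have "\<dots> = (\<Sum>i\<in>UNIV. (v \<bullet> Y i) *\<^sub>R Y i)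
      + (\<Sum>\<alpha>\<in>{CARD('n)..<DIM('e)}. (v \<bullet> f (Inr \<alpha>)) *\<^sub>R f (Inr \<alpha>))"
    by (simp add: sum.reindex f_def)
  also have "(\<Sum>\<alpha>\<in>{CARD('n)..<DIM('e)}. (v \<bullet> f (Inr \<alpha>)) *\<^sub>R f (Inr \<alpha>))
      = (v \<bullet> x) *\<^sub>R x + (\<Sum>\<alpha>\<in>{CARD('n)+1..<DIM('e)}. (v \<bullet> b \<alpha>) *\<^sub>R b \<alpha>)"
    using dim by (subst sum.atLeast_Suc_lessThan) (auto simp: f_def intro!: sum.cong)
  finally show ?thesis by (simp add: add_ac)
qed

lemma adapted_basisD:
  fixes y :: "real ^ 'n::finite => 'e::euclidean_space"
  assumes "adapted_basis y u a b"
  shows "dirderiv y u (a i) \<bullet> dirderiv y u (a j) = (if i = j then 1 else 0)"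
    and "\<alpha> \<in> {CARD('n)+1..<DIM('e)} ==> \<beta> \<in> {CARD('n)+1..<DIM('e)} ==>
      b \<alpha> \<bullet> b \<beta> = (if \<alpha> = \<beta> then 1 else 0)"
    and "\<alpha> \<in> {CARD('n)+1..<DIM('e)} ==> b \<alpha> \<bullet> y u = 0"
    and "\<alpha> \<in> {CARD('n)+1..<DIM('e)} ==> b \<alpha> \<bullet> dirderiv y u v = 0"
  using assms unfolding adapted_basis_def by blast+

lemma adapted_basis_expansion:
  fixes y :: "real ^ 'n::finite => 'e::euclidean_space"
  assumes "CARD('n) < DIM('e)" "adapted_basis y u a b" "y u \<bullet> y u = 1" "\<And>v. y u \<bullet> dirderiv y u v = 0"
  shows "v = (\<Sum>i\<in>UNIV. (v \<bullet> dirderiv y u (a i)) *\<^sub>R dirderiv y u (a i))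
    + (\<Sum>\<alpha>\<in>{CARD('n)+1..<DIM('e)}. (v \<bullet> b \<alpha>) *\<^sub>R b \<alpha>) + (v \<bullet> y u) *\<^sub>R y u"
  by (rule adapted_expansion[OF assms(1)]) (use adapted_basisD[OF assms(2)] assms(3,4) in auto)

lemma adapted_basis_ex:
  fixes y :: "real ^ 'n::finite => 'e::euclidean_space"
  assumes "linear (dirderiv y u)" "inj (dirderiv y u)"
  shows "\<exists>a b. adapted_basis y u a b"
proof -
  let ?P = "dirderiv y u" and ?N = "{CARD('n)+1..<DIM('e)}"
  have sub: "subspace (range ?P)" using assms(1) by (simp add: linear_subspace_image)
  have dimP: "dim (range ?P) = CARD('n)"
    using dim_image_eq[OF assms(1), of UNIV] assms(2) by simp
  obtain B where B: "B \<subseteq> range ?P" "pairwise orthogonal B" "\<And>x. x \<in> B ==> norm x = 1"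
    "independent B" "card B = dim (range ?P)"
    using orthonormal_basis_subspace[OF sub] by metis
  have "finite B" using B(4) independent_imp_finite by blast
  then obtain h where h: "bij_betw h (UNIV :: 'n set) B"
    using finite_same_card_bij[of "UNIV :: 'n set" B] B(5) dimP by auto
  then have hB: "h i \<in> B" and hinj: "h i = h j \<longleftrightarrow> i = j" for i j
    by (auto simp: bij_betw_def inj_def)
  define a where "a i = (SOME v. ?P v = h i)" for i
  have a: "?P (a i) = h i" for i
  proof -
    obtain v where "h i = ?P v" using subsetD[OF B(1) hB[of i]] by (rule rangeE)
    from this[symmetric] show ?thesis unfolding a_def by (rule someI)
  qed
  have tang: "?P (a i) \<bullet> ?P (a j) = (if i = j then 1 else 0)" for i j
  proof (cases "i = j")
    case True
    then show ?thesis using B(3)[OF hB[of j]] by (simp only: a norm_eq_1 simp_thms if_True)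
  next
    case False
    then show ?thesis
      using B(2) hB hinj unfolding a pairwise_def orthogonal_def by auto
  qed
  let ?T = "span (insert (y u) (range ?P))"
  let ?O = "{v \<in> UNIV. \<forall>x\<in>?T. orthogonal x v}"
  \<comment> \<open>An upper bound suffices: nothing is assumed about \<open>y u\<close>, and the
    orthogonal complement then has dimension at least p, from which p orthonormal vectors are
    picked.\<close>
  have "dim ?T \<le> CARD('n) + 1" using dimP by (simp add: dim_insert)
  moreover have "dim ?O + dim ?T = DIM('e)"
    using dim_subspace_orthogonal_to_vectors[of ?T UNIV] by simp
  ultimately have le: "card ?N \<le> dim ?O" by simp
  have subO: "subspace ?O"
    by (auto simp: subspace_def orthogonal_def inner_add_right)
  obtain C where C: "C \<subseteq> ?O" "pairwise orthogonal C" "\<And>x. x \<in> C ==> norm x = 1"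
    "independent C" "card C = dim ?O"
    by (rule orthonormal_basis_subspace[OF subO]) (rule that; blast)
  have "finite C" using C(4) independent_imp_finite by blast
  then obtain b where b: "b ` ?N \<subseteq> C" "inj_on b ?N"
    using card_le_inj[of ?N C] le C(5) by auto
  have "b \<alpha> \<bullet> b \<beta> = (if \<alpha> = \<beta> then 1 else 0)" if "\<alpha> \<in> ?N" "\<beta> \<in> ?N" for \<alpha> \<beta>
  proof (cases "\<alpha> = \<beta>")
    case True
    have "b \<beta> \<in> C" using b(1) that by blast
    from C(3)[OF this] True show ?thesis by (simp only: norm_eq_1 simp_thms if_True)
  next
    case False
    then have "b \<alpha> \<noteq> b \<beta>" using b(2) that by (auto simp: inj_on_def)
    moreover have "b \<alpha> \<in> C" "b \<beta> \<in> C" using b(1) that by auto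
    ultimately show ?thesis using False C(2) by (auto simp: pairwise_def orthogonal_def)
  qed
  moreover have "b \<alpha> \<bullet> w = 0" if "\<alpha> \<in> ?N" "w \<in> insert (y u) (range ?P)" for \<alpha> w
  proof -
    have "b \<alpha> \<in> ?O" using b(1) C(1) that(1) by blast
    moreover have "w \<in> ?T" using that(2) by (rule span_base)
    ultimately show ?thesis by (auto simp: orthogonal_def inner_commute)
  qed
  ultimately have "adapted_basis y u a b"
    using tang unfolding adapted_basis_def by blast
  then show ?thesis by blast
qed

text \<open>The tangential frame is needed in coordinates, while orthonormality concerns its image
  in the ambient space; Gram-Schmidt is applied to the images and its coefficients to the constant
  vectors a. The time parameter makes the same construction serve for variations and, with a family
  constant in time, for a single immersion.\<close>

lemma adapted_frame_extension:
  fixes Y :: "real \<times> (real ^ 'n::finite) => 'e::euclidean_space"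
  assumes \<Omega>: "open \<Omega>" "(t0, u0) \<in> \<Omega>" and Y: "smooth_on \<Omega> Y" "\<And>z. z \<in> \<Omega> ==> Y z \<bullet> Y z = 1"
    and ab: "adapted_basis (\<lambda>u. Y (t0, u)) u0 a b"
  shows "\<exists>\<Omega>' A B. open \<Omega>' \<and> (t0, u0) \<in> \<Omega>' \<and> \<Omega>' \<subseteq> \<Omega> \<and> (\<forall>i. smooth_on \<Omega>' (\<lambda>z. A z i)) \<and>
    (\<forall>\<alpha>. smooth_on \<Omega>' (\<lambda>z. B z \<alpha>)) \<and> A (t0, u0) = a \<and>
    (\<forall>\<alpha>\<in>{CARD('n)+1..<DIM('e)}. B (t0, u0) \<alpha> = b \<alpha>) \<and>
    (\<forall>t u. (t, u) \<in> \<Omega>' \<longrightarrow> adapted_basis (\<lambda>u. Y (t, u)) u (A (t, u)) (B (t, u)))"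
proof -
  let ?n = "CARD('n)" and ?N = "{CARD('n)+1..<DIM('e)}"
  have Yk: "Ck_on k \<Omega> Y" for k using Y by (simp add: smooth_on_def)
  have dY: "Y differentiable (at z)" if "z \<in> \<Omega>" for z using Yk[of 1] that by simp
  define P where "P z v = dirderiv Y z (0, v)" for z v
  have Peq: "dirderiv (\<lambda>u. Y (t, u)) u v = P (t, u) v" if "(t, u) \<in> \<Omega>" for t u v
    unfolding P_def by (rule dirderiv_slice[OF dY[OF that]])
  have linP: "linear (P z)" if "z \<in> \<Omega>" for z
  proof -
    have "linear (\<lambda>v. dirderiv Y z (0, v))"
      using linear_compose[OF _ linear_dirderiv[OF dY[OF that]], of "\<lambda>v. (0, v)"]
      by (auto simp: o_def linear_iff)
    then show ?thesis by (simp add: P_def[abs_def])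
  qed
  have Ps: "Ck_on k \<Omega> (\<lambda>z. P z v)" for k v
    using Yk[of "Suc k"] by (simp add: P_def)
  have YP: "Y z \<bullet> P z v = 0" if "z \<in> \<Omega>" for z v
    unfolding P_def by (rule inner_dirderiv_sphere[OF \<Omega>(1) that Y(2) dY[OF that]])
  obtain g where g: "bij_betw g {..<?n} (UNIV :: 'n set)"
    using finite_same_card_bij[of "{..<?n}" "UNIV :: 'n set"] by auto
  define g' where "g' = the_inv_into {..<?n} g"
  have g': "g' i < ?n" "g (g' i) = i" for i
    using g bij_betw_the_inv_into[OF g] f_the_inv_into_f_bij_betw[OF g]
    by (auto simp: g'_def bij_betw_def)
  have g'': "k < ?n ==> g' (g k) = k" for k
    using g by (simp add: g'_def the_inv_into_f_f bij_betw_def)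
  have injg: "g j = g k \<longleftrightarrow> j = k" if "j < ?n" "k < ?n" for j k
    using g'' that by metis
  have "\<exists>S' c. open S' \<and> (t0, u0) \<in> S' \<and> S' \<subseteq> \<Omega> \<and> (\<forall>k l. smooth_on S' (c k l)) \<and>
      (\<forall>k l. k < ?n \<longrightarrow> c k l (t0, u0) = (if k = l then (1::real) else 0)) \<and>
      (\<forall>z\<in>S'. \<forall>j<?n. \<forall>k<?n. (\<Sum>l<?n. c j l z *\<^sub>R P z (a (g l))) \<bullet> (\<Sum>l<?n. c k l z *\<^sub>R P z (a (g l)))
       = (if j = k then 1 else 0))"
  proof (rule smooth_gram_schmidt[OF \<Omega>, of ?n "\<lambda>k z. P z (a (g k))"])
    show "P (t0, u0) (a (g j)) \<bullet> P (t0, u0) (a (g k)) = (if j = k then 1 else 0)"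
      if "j < ?n" "k < ?n" for j k
      using adapted_basisD(1)[OF ab, of "g j" "g k"] \<Omega>(2) injg that by (simp add: Peq)
  qed (use Ps in \<open>simp add: smooth_on_def\<close>)
  then obtain S1 c where S1: "open S1" "(t0, u0) \<in> S1" "S1 \<subseteq> \<Omega>"
    and cs: "\<forall>k l. smooth_on S1 (c k l)"
    and c0: "\<forall>k l. k < ?n \<longrightarrow> c k l (t0, u0) = (if k = l then (1::real) else 0)"
    and con: "\<forall>z\<in>S1. \<forall>j<?n. \<forall>k<?n. (\<Sum>l<?n. c j l z *\<^sub>R P z (a (g l))) \<bullet> (\<Sum>l<?n. c k l z *\<^sub>R P z (a (g l)))
       = (if j = k then 1 else 0)" by blast
  define A where "A z i = (\<Sum>l<?n. c (g' i) l z *\<^sub>R a (g l))" for z i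
  have As: "Ck_on k S1 (\<lambda>z. A z i)" for k i
    unfolding A_def using cs S1 by (intro Ck_on_sum Ck_on_scaleR Ck_on_const) (auto simp: smooth_on_def)
  have PA: "P z (A z i) = (\<Sum>l<?n. c (g' i) l z *\<^sub>R P z (a (g l)))" if "z \<in> S1" for z i
    using linP[of z] that S1(3) by (auto simp: A_def linear_sum linear_cmul)
  have Aon: "P z (A z i) \<bullet> P z (A z j) = (if i = j then 1 else 0)" if "z \<in> S1" for z i j
    using con that g'(1)[of i] g'(1)[of j] g'(2) by (auto simp: PA) metis
  have A0: "A (t0, u0) = a"
  proof
    fix i
    have "A (t0, u0) i = (\<Sum>l<?n. if g' i = l then a i else 0)"
      unfolding A_def using c0 g' by (intro sum.cong) auto
    then show "A (t0, u0) i = a i" using g'(1)[of i] by simp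
  qed
  have PAs: "Ck_on k S1 (\<lambda>z. P z (A z i))" for k i
  proof (rule Ck_on_cong[OF S1(1)])
    show "Ck_on k S1 (\<lambda>z. \<Sum>l<?n. c (g' i) l z *\<^sub>R P z (a (g l)))"
      using cs S1 by (intro Ck_on_sum Ck_on_scaleR Ck_on_subset[OF Ps]) (auto simp: smooth_on_def)
  qed (simp add: PA)
  let ?m = "DIM('e) - (?n + 1)"
  \<comment> \<open>k stands for the normal index n + 1 + k. The constant vector b is projected off
    the tangent space and the position vector; at the base point this changes nothing, so the system
    starts out orthonormal.\<close>
  define f where "f k z = b (?n + 1 + k) - (\<Sum>i\<in>UNIV. (b (?n + 1 + k) \<bullet> P z (A z i)) *\<^sub>R P z (A z i))
      - (b (?n + 1 + k) \<bullet> Y z) *\<^sub>R Y z" for k z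
  have fs: "Ck_on n S1 (f k)" for k n
    unfolding f_def using S1
    by (intro Ck_on_diff Ck_on_sum Ck_on_scaleR Ck_on_inner Ck_on_const PAs Ck_on_subset[OF Yk]) auto
  have fY: "f k z \<bullet> Y z = 0" if "z \<in> S1" for k z
  proof -
    have "P z v \<bullet> Y z = 0" "Y z \<bullet> Y z = 1" for v
      using that S1(3) YP[of z v] Y(2)[of z] by (auto simp: inner_commute)
    then show ?thesis by (simp add: f_def inner_diff_left inner_sum_left)
  qed
  have fA: "f k z \<bullet> P z (A z j) = 0" if "z \<in> S1" for k z j
  proof -
    have "(\<Sum>i\<in>UNIV. (b (?n + 1 + k) \<bullet> P z (A z i)) *\<^sub>R P z (A z i)) \<bullet> P z (A z j)
        = (\<Sum>i\<in>UNIV. if i = j then b (?n + 1 + k) \<bullet> P z (A z j) else 0)"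
      unfolding inner_sum_left using Aon[OF that] by (intro sum.cong) auto
    moreover have "Y z \<bullet> P z (A z j) = 0" by (rule YP[OF subsetD[OF S1(3) that]])
    ultimately show ?thesis
      by (simp add: f_def inner_diff_left)
  qed
  have fP: "f k z \<bullet> P z v = 0" if "z \<in> S1" for k z v
  proof -
    have "P z v = (\<Sum>i\<in>UNIV. (P z v \<bullet> P z (A z i)) *\<^sub>R P z (A z i))"
    proof -
      have l: "linear (P z)" by (rule linP[OF subsetD[OF S1(3) that]])
      show ?thesis
        using arg_cong[OF orthonormal_frame_expansion(1)[OF l Aon[OF that], of v], of "P z"]
        by (simp add: linear_sum[OF l] linear_cmul[OF l])
    qed
    also have "f k z \<bullet> \<dots> = 0" using fA[OF that] by (simp add: inner_sum_right)
    finally show ?thesis .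
  qed
  have bidx: "?n + 1 + k \<in> ?N" if "k < ?m" for k using that by auto
  have f0: "f k (t0, u0) = b (?n + 1 + k)" if "k < ?m" for k
    using adapted_basisD(3,4)[OF ab bidx[OF that]] S1(2,3) by (simp add: f_def Peq[symmetric] subset_eq)
  have "\<exists>S' d. open S' \<and> (t0, u0) \<in> S' \<and> S' \<subseteq> S1 \<and> (\<forall>k l. smooth_on S' (d k l)) \<and>
      (\<forall>k l. k < ?m \<longrightarrow> d k l (t0, u0) = (if k = l then (1::real) else 0)) \<and>
      (\<forall>z\<in>S'. \<forall>j<?m. \<forall>k<?m. (\<Sum>l<?m. d j l z *\<^sub>R f l z) \<bullet> (\<Sum>l<?m. d k l z *\<^sub>R f l z)
       = (if j = k then 1 else 0))"
  proof (rule smooth_gram_schmidt[OF S1(1,2), of ?m f])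
    show "f j (t0, u0) \<bullet> f k (t0, u0) = (if j = k then 1 else 0)"
      if "j < ?m" "k < ?m" for j k
      using adapted_basisD(2)[OF ab bidx[OF that(1)] bidx[OF that(2)]] f0 that by simp
  qed (use fs in \<open>simp add: smooth_on_def\<close>)
  then obtain S2 d where S2: "open S2" "(t0, u0) \<in> S2" "S2 \<subseteq> S1"
    and ds: "\<forall>k l. smooth_on S2 (d k l)"
    and d0: "\<forall>k l. k < ?m \<longrightarrow> d k l (t0, u0) = (if k = l then (1::real) else 0)"
    and don: "\<forall>z\<in>S2. \<forall>j<?m. \<forall>k<?m. (\<Sum>l<?m. d j l z *\<^sub>R f l z) \<bullet> (\<Sum>l<?m. d k l z *\<^sub>R f l z)
       = (if j = k then 1 else 0)" by blast
  define B where "B z \<alpha> = (\<Sum>l<?m. d (\<alpha> - (?n + 1)) l z *\<^sub>R f l z)" for z \<alpha>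
  have Bs: "Ck_on k S2 (\<lambda>z. B z \<alpha>)" for k \<alpha>
    unfolding B_def using ds S2
    by (intro Ck_on_sum Ck_on_scaleR Ck_on_subset[OF fs]) (auto simp: smooth_on_def)
  have B0: "B (t0, u0) \<alpha> = b \<alpha>" if "\<alpha> \<in> ?N" for \<alpha>
  proof -
    have k: "\<alpha> - (?n + 1) < ?m" using that by auto
    have "B (t0, u0) \<alpha> = (\<Sum>l<?m. if \<alpha> - (?n + 1) = l then b \<alpha> else 0)"
      unfolding B_def using d0 k f0 that by (intro sum.cong) auto
    then show ?thesis using k by simp
  qed
  have "adapted_basis (\<lambda>u. Y (t, u)) u (A (t, u)) (B (t, u))" if "(t, u) \<in> S2" for t u
  proof -
    have S: "(t, u) \<in> S1" "(t, u) \<in> \<Omega>" using that S2 S1 by auto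
    show ?thesis
      unfolding adapted_basis_def Peq[OF S(2)]
    proof (intro conjI allI ballI)
      show "P (t, u) (A (t, u) i) \<bullet> P (t, u) (A (t, u) j) = (if i = j then 1 else 0)" for i j
        by (rule Aon[OF S(1)])
      fix \<alpha> assume \<alpha>: "\<alpha> \<in> ?N"
      show "B (t, u) \<alpha> \<bullet> Y (t, u) = 0"
        using fY[OF S(1)] by (simp add: B_def inner_sum_left)
      show "B (t, u) \<alpha> \<bullet> P (t, u) v = 0" for v
        using fP[OF S(1)] by (simp add: B_def inner_sum_left)
      fix \<beta> assume \<beta>: "\<beta> \<in> ?N"
      have "\<alpha> - (?n + 1) < ?m" "\<beta> - (?n + 1) < ?m" "\<alpha> - (?n + 1) = \<beta> - (?n + 1) \<longleftrightarrow> \<alpha> = \<beta>"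
        using \<alpha> \<beta> by auto
      moreover from this(1,2) have "B (t, u) \<alpha> \<bullet> B (t, u) \<beta> =
          (if \<alpha> - (?n + 1) = \<beta> - (?n + 1) then 1 else 0)"
        using don that unfolding B_def by blast
      ultimately show "B (t, u) \<alpha> \<bullet> B (t, u) \<beta> = (if \<alpha> = \<beta> then 1 else 0)" by simp
    qed
  qed
  moreover have "Ck_on k S2 (\<lambda>z. A z i)" for k i by (rule Ck_on_subset[OF As S2(3)])
  ultimately show ?thesis
    using S2 S1 Bs A0 B0
    by (intro exI[of _ S2] exI[of _ A] exI[of _ B]) (auto simp: smooth_on_def)
qed

section \<open>The function rho in a chart\<close>

lemma Ck_on_dd:
  fixes f :: "'a::euclidean_space => 'b::real_normed_vector"
  assumes "open S" "Ck_on (Suc (Suc k)) S f" "Ck_on k S v" "Ck_on k S w"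
  shows "Ck_on k S (\<lambda>z. dd f z (v z) (w z))"
proof (rule Ck_on_cong[OF assms(1)])
  show "Ck_on k S (\<lambda>z. \<Sum>b\<in>Basis. (v z \<bullet> b) *\<^sub>R dd f z b (w z))"
    using assms by (intro Ck_on_sum Ck_on_scaleR Ck_on_inner Ck_on_const Ck_on_dirderiv) auto
  fix z assume z: "z \<in> S"
  have "Ck_on 2 S f" using assms(2) by (rule Ck_on_le) simp
  note l = linear_dd(2)[OF assms(1) z this, of "w z"]
  have "dd f z (v z) (w z) = dd f z (\<Sum>b\<in>Basis. (v z \<bullet> b) *\<^sub>R b) (w z)"
    by (simp add: euclidean_representation)
  also have "\<dots> = (\<Sum>b\<in>Basis. (v z \<bullet> b) *\<^sub>R dd f z b (w z))"
    by (simp add: linear_sum[OF l] linear_cmul[OF l])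
  finally show "(\<Sum>b\<in>Basis. (v z \<bullet> b) *\<^sub>R dd f z b (w z)) = dd f z (v z) (w z)" by simp
qed

text \<open>Obtained by differentiating y . dy(v) = 0. This is the only place where the second
  fundamental form of the sphere itself appears.\<close>

lemma inner_dd_sphere:
  assumes "open U" "u \<in> U" "\<And>w. w \<in> U ==> y w \<bullet> y w = (1::real)" "Ck_on 2 U y"
  shows "y u \<bullet> dd y u v w = - (dirderiv y u v \<bullet> dirderiv y u w)"
proof -
  have d: "y differentiable (at x)" "(\<lambda>w. dirderiv y w v) differentiable (at x)" if "x \<in> U" for x
    using assms(4) that by (auto simp: numeral_2_eq_2)
  have "y x \<bullet> dirderiv y x v = 0" if "x \<in> U" for x
    by (rule inner_dirderiv_sphere[OF assms(1) that assms(3) d(1)[OF that]])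
  from inner_dirderiv_const[OF assms(1,2) this d(1)[OF assms(2)] d(2)[OF assms(2)], of w]
  show ?thesis by (simp add: inner_commute)
qed

lemma norm_mean_curv_vec_sq:
  fixes y :: "real ^ 'n::finite => 'e::euclidean_space"
  assumes "adapted_basis y u a b"
  shows "(norm (mean_curv_vec y u a b))\<^sup>2 = (\<Sum>\<alpha>\<in>{CARD('n)+1..<DIM('e)}. (mean_curv y u a b \<alpha>)\<^sup>2)"
proof -
  have "(norm (mean_curv_vec y u a b))\<^sup>2 = (\<Sum>\<alpha>\<in>{CARD('n)+1..<DIM('e)}. \<Sum>\<beta>\<in>{CARD('n)+1..<DIM('e)}.
      mean_curv y u a b \<alpha> * (mean_curv y u a b \<beta> * (b \<beta> \<bullet> b \<alpha>)))"
    by (simp add: power2_norm_eq_inner mean_curv_vec_def inner_sum_left inner_sum_right sum_distrib_left)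
  also have "\<dots> = (\<Sum>\<alpha>\<in>{CARD('n)+1..<DIM('e)}. \<Sum>\<beta>\<in>{CARD('n)+1..<DIM('e)}.
      if \<beta> = \<alpha> then (mean_curv y u a b \<alpha>)\<^sup>2 else 0)"
    using adapted_basisD(2)[OF assms] by (intro sum.cong refl) (auto simp: power2_eq_square)
  finally show ?thesis by simp
qed

definition tsff ::
    "(real ^ 'n::finite => 'e::euclidean_space) => real ^ 'n
      => ('n => real ^ 'n) => (nat => 'e) => nat => 'n => 'n => real"
  where "tsff y u a b \<alpha> i j = sff y u a b \<alpha> i j - (if i = j then mean_curv y u a b \<alpha> else 0)"

definition rho_sq ::
    "(real ^ 'n::finite => 'e::euclidean_space) => real ^ 'n
      => ('n => real ^ 'n) => (nat => 'e) => real"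
  where "rho_sq y u a b = (\<Sum>\<alpha>\<in>{CARD('n)+1..<DIM('e)}. \<Sum>i\<in>UNIV. \<Sum>j\<in>UNIV. (tsff y u a b \<alpha> i j)\<^sup>2)"

lemma sum_if_diag: "(\<Sum>j\<in>(UNIV::'n::finite set). if i = j then f j else 0) = f i"
  by simp

lemma sum_mean_curv: "(\<Sum>k\<in>UNIV. sff y u a b \<alpha> k k) = real CARD('n) * mean_curv y u a b \<alpha>"
  for y :: "real ^ 'n::finite => 'e::euclidean_space"
  by (simp add: mean_curv_def)

lemma tsff_trace: "(\<Sum>k\<in>UNIV. tsff y u a b \<alpha> k k) = 0"
  by (simp add: tsff_def sum_subtractf sum_mean_curv)

text \<open>\<open>sff\<close> and \<open>tsff\<close> differ by a multiple of the identity, whose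
  pairing with a trace-free form is 0.\<close>

lemma rho_sq_inner:
  "(\<Sum>i\<in>UNIV. \<Sum>j\<in>UNIV. tsff y u a b \<alpha> i j * tsff y u a b \<alpha> i j)
    = (\<Sum>i\<in>UNIV. \<Sum>j\<in>UNIV. tsff y u a b \<alpha> i j * sff y u a b \<alpha> i j)"
proof -
  have "(\<Sum>i\<in>UNIV. \<Sum>j\<in>UNIV. tsff y u a b \<alpha> i j * tsff y u a b \<alpha> i j)
      = (\<Sum>i\<in>UNIV. (\<Sum>j\<in>UNIV. tsff y u a b \<alpha> i j * sff y u a b \<alpha> i j)
          - (\<Sum>j\<in>UNIV. if i = j then tsff y u a b \<alpha> i i * mean_curv y u a b \<alpha> else 0))"
    unfolding sum_subtractf[symmetric]
    by (intro sum.cong refl) (auto simp: tsff_def algebra_simps)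
  then show ?thesis
    by (simp add: sum_subtractf tsff_trace sum_distrib_right[symmetric])
qed

lemma rho_sq_eq:
  fixes y :: "real ^ 'n::finite => 'e::euclidean_space"
  assumes "adapted_basis y u a b"
  shows "rho_sq y u a b = sff_sq y u a b - real CARD('n) * (norm (mean_curv_vec y u a b))\<^sup>2"
proof -
  have "(\<Sum>i\<in>UNIV. \<Sum>j\<in>UNIV. (tsff y u a b \<alpha> i j)\<^sup>2)
      = (\<Sum>i\<in>UNIV. \<Sum>j\<in>UNIV. (sff y u a b \<alpha> i j)\<^sup>2) - real CARD('n) * (mean_curv y u a b \<alpha>)\<^sup>2" for \<alpha>
  proof -
    have "(\<Sum>i\<in>UNIV. \<Sum>j\<in>UNIV. (tsff y u a b \<alpha> i j)\<^sup>2)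
        = (\<Sum>i\<in>UNIV. (\<Sum>j\<in>UNIV. (sff y u a b \<alpha> i j)\<^sup>2)
            - (\<Sum>j\<in>UNIV. if i = j then sff y u a b \<alpha> i i * mean_curv y u a b \<alpha> else 0))"
      unfolding sum_subtractf[symmetric] power2_eq_square rho_sq_inner
      by (intro sum.cong refl) (auto simp: tsff_def algebra_simps)
    then show ?thesis
      by (simp add: sum_subtractf sum_distrib_right[symmetric] sum_mean_curv power2_eq_square)
  qed
  then show ?thesis
    unfolding rho_sq_def sff_sq_def norm_mean_curv_vec_sq[OF assms]
    by (simp add: sum_subtractf sum_distrib_left)
qed

lemma rho_sq_nonneg: "rho_sq y u a b \<ge> 0"
  by (simp add: rho_sq_def sum_nonneg)

lemma rho_basis_eq: "adapted_basis y u a b ==> rho_basis y u a b = sqrt (rho_sq y u a b)"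
  by (simp add: rho_basis_def rho_sq_eq)

text \<open>The normal part of a vector is what remains after the tangential and position parts are
  removed, so it does not involve b at all. Hence S and the mean curvature vector are traces, over
  the tangential basis, of expressions in the normal part of the second derivative, and traces do
  not depend on the orthonormal basis.\<close>

lemma rho_basis_unique:
  fixes y :: "real ^ 'n::finite => 'e::euclidean_space"
  assumes dim: "CARD('n) < DIM('e)" and U: "open U" "u \<in> U" and y: "Ck_on 2 U y"
    "\<And>w. w \<in> U ==> y w \<bullet> y w = 1"
    and ab: "adapted_basis y u a b" and ab': "adapted_basis y u a' b'"
  shows "rho_basis y u a b = rho_basis y u a' b'"
proof -
  let ?N = "{CARD('n)+1..<DIM('e)}" and ?P = "dirderiv y u"
  have dy: "y differentiable (at w)" if "w \<in> U" for w using y(1) that by (auto simp: numeral_2_eq_2)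
  have linP: "linear ?P" by (rule linear_dirderiv[OF dy[OF U(2)]])
  have yP: "y u \<bullet> ?P v = 0" for v by (rule inner_dirderiv_sphere[OF U y(2) dy[OF U(2)]])
  define nor where "nor a v = v - (\<Sum>i\<in>UNIV. (v \<bullet> ?P (a i)) *\<^sub>R ?P (a i)) - (v \<bullet> y u) *\<^sub>R y u"
    for a :: "'n => real ^ 'n" and v
  have nor_b: "(\<Sum>\<alpha>\<in>?N. (v \<bullet> b \<alpha>) *\<^sub>R b \<alpha>) = nor a v" if "adapted_basis y u a b" for a b v
    using adapted_basis_expansion[OF dim that y(2)[OF U(2)] yP, of v]
    by (simp add: nor_def algebra_simps)
  have nor_nor: "nor a v \<bullet> nor a v = (\<Sum>\<alpha>\<in>?N. (v \<bullet> b \<alpha>)\<^sup>2)" if "adapted_basis y u a b" for a b v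
  proof -
    have "nor a v \<bullet> nor a v = (\<Sum>\<alpha>\<in>?N. \<Sum>\<beta>\<in>?N. (v \<bullet> b \<alpha>) * ((v \<bullet> b \<beta>) * (b \<beta> \<bullet> b \<alpha>)))"
      unfolding nor_b[OF that, symmetric]
      by (simp add: inner_sum_left inner_sum_right sum_distrib_left)
    also have "\<dots> = (\<Sum>\<alpha>\<in>?N. \<Sum>\<beta>\<in>?N. if \<beta> = \<alpha> then (v \<bullet> b \<alpha>)\<^sup>2 else 0)"
      using adapted_basisD(2)[OF that] by (intro sum.cong refl) (auto simp: power2_eq_square)
    finally show ?thesis by simp
  qed
  have nor_eq: "nor a' = nor a"
  proof
    fix v
    have "(\<Sum>i\<in>UNIV. (v \<bullet> ?P (a' i)) *\<^sub>R ?P (a' i)) = (\<Sum>i\<in>UNIV. (v \<bullet> ?P (a i)) *\<^sub>R ?P (a i))"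
      by (rule orthonormal_trace_invariant[OF linP adapted_basisD(1)[OF ab] adapted_basisD(1)[OF ab']])
        (auto simp: linear_iff linear_add[OF linP] linear_cmul[OF linP] inner_add_right algebra_simps)
    then show "nor a' v = nor a v" by (simp add: nor_def)
  qed
  have lin_nor: "linear (nor a)"
    by (simp add: nor_def[abs_def] linear_iff inner_add_left scaleR_add_left sum.distrib
        scaleR_sum_right algebra_simps)
  have linQ: "linear (\<lambda>w. nor a (dd y u v w))" "linear (\<lambda>v. nor a (dd y u v w))" for v w
    using linear_compose[OF linear_dd(1)[OF U y(1)] lin_nor, unfolded o_def]
      linear_compose[OF linear_dd(2)[OF U y(1)] lin_nor, unfolded o_def] by auto
  have S: "sff_sq y u a b = (\<Sum>i\<in>UNIV. \<Sum>j\<in>UNIV. nor a (dd y u (a i) (a j)) \<bullet> nor a (dd y u (a i) (a j)))"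
    if "adapted_basis y u a b" for a b
    unfolding nor_nor[OF that] sff_sq_def sff_def
    by (subst sum.swap, intro sum.cong refl, rule sum.swap)
  have H: "mean_curv_vec y u a b = (1 / real CARD('n)) *\<^sub>R (\<Sum>k\<in>UNIV. nor a (dd y u (a k) (a k)))"
    if "adapted_basis y u a b" for a b
    unfolding nor_b[OF that, symmetric] mean_curv_vec_def mean_curv_def sff_def
    by (subst sum.swap) (simp add: scaleR_sum_right sum_distrib_left scaleR_sum_left sum_distrib_right)
  note tr = orthonormal_trace_invariant[OF linP adapted_basisD(1)[OF ab] adapted_basisD(1)[OF ab']]
  have "mean_curv_vec y u a' b' = mean_curv_vec y u a b"
    unfolding H[OF ab] H[OF ab'] nor_eq by (subst tr) (auto intro: linQ)
  moreover have "sff_sq y u a' b' = sff_sq y u a b"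
  proof -
    \<comment> \<open>S is a double trace; the basis is exchanged in the second slot first and in
      the first slot afterwards.\<close>
    have "sff_sq y u a' b' = (\<Sum>i\<in>UNIV. \<Sum>j\<in>UNIV. nor a (dd y u (a' i) (a j)) \<bullet> nor a (dd y u (a' i) (a j)))"
      unfolding S[OF ab'] nor_eq
      by (intro sum.cong refl tr)
        (auto simp: linear_iff linear_add[OF linQ(1)] linear_cmul[OF linQ(1)] inner_add_left inner_add_right)
    also have "\<dots> = sff_sq y u a b"
      unfolding S[OF ab]
      by (rule tr)
        (auto simp: linear_iff linear_add[OF linQ(2)] linear_cmul[OF linQ(2)] inner_add_left
          inner_add_right sum.distrib sum_distrib_left)
    finally show ?thesis .
  qed
  ultimately show ?thesis by (simp add: rho_basis_def)
qed

text \<open>The chain rule for second derivatives has an extra term, dz applied to the second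
  derivative of the coordinate change. It is tangent, so the normal vectors do not see it.
  Surjectivity of the differential of \<tau> ensures that b is orthogonal to every tangent vector of
  z.\<close>

lemma adapted_basis_compose:
  fixes y z :: "real ^ 'n::finite => 'e::euclidean_space"
  assumes S: "open S" "u \<in> S" and T: "open T" "\<tau> ` S \<subseteq> T" and z: "Ck_on 2 T z" and \<tau>: "Ck_on 2 S \<tau>"
    and y: "\<And>w. w \<in> S ==> y w = z (\<tau> w)" and surj: "surj (dirderiv \<tau> u)"
    and ab: "adapted_basis y u a b"
  shows "adapted_basis z (\<tau> u) (\<lambda>i. dirderiv \<tau> u (a i)) b"
    and "rho_basis y u a b = rho_basis z (\<tau> u) (\<lambda>i. dirderiv \<tau> u (a i)) b"
proof -
  have d\<tau>: "\<tau> differentiable (at w)" "(\<lambda>w. dirderiv \<tau> w v) differentiable (at w)" if "w \<in> S" for w v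
    using \<tau> that by (auto simp: numeral_2_eq_2)
  have dz: "z differentiable (at w)" if "w \<in> T" for w using z that by (auto simp: numeral_2_eq_2)
  have Dy: "dirderiv y w v = dirderiv z (\<tau> w) (dirderiv \<tau> w v)" if "w \<in> S" for w v
  proof -
    have "\<tau> w \<in> T" using that T(2) by auto
    have "dirderiv y w v = dirderiv (\<lambda>w. z (\<tau> w)) w v"
      by (rule dirderiv_cong_open[OF S(1) that y])
    also have "\<dots> = dirderiv z (\<tau> w) (dirderiv \<tau> w v)"
      by (rule dirderiv_eqI[OF has_derivative_compose[OF has_derivative_dirderiv[OF d\<tau>(1)[OF that]]
              has_derivative_dirderiv[OF dz[OF \<open>\<tau> w \<in> T\<close>]]]])
    finally show ?thesis .
  qed
  have Dy2: "dd y u v w = dd z (\<tau> u) (dirderiv \<tau> u v) (dirderiv \<tau> u w) + dirderiv z (\<tau> u) (dd \<tau> u v w)" for v w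
  proof -
    have "dd y u v w = dirderiv (\<lambda>w. dirderiv z (\<tau> w) (dirderiv \<tau> w v)) u w"
      by (rule dirderiv_cong_open[OF S Dy])
    also have "\<dots> = dd z (\<tau> u) (dirderiv \<tau> u v) (dirderiv \<tau> u w) + dirderiv z (\<tau> u) (dd \<tau> u v w)"
      by (rule dirderiv_eqI[OF has_derivative_dirderiv_along[OF T(1) z S T(2) d\<tau>(1)[OF S(2)] d\<tau>(2)[OF S(2)]]])
    finally show ?thesis .
  qed
  have bz: "b \<alpha> \<bullet> dirderiv z (\<tau> u) v = 0" if "\<alpha> \<in> {CARD('n)+1..<DIM('e)}" for \<alpha> v
  proof -
    obtain v' where "v = dirderiv \<tau> u v'" using surj by (metis surjD)
    then show ?thesis using adapted_basisD(4)[OF ab that, of v'] by (simp add: Dy[OF S(2)])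
  qed
  show "adapted_basis z (\<tau> u) (\<lambda>i. dirderiv \<tau> u (a i)) b"
    unfolding adapted_basis_def
    using adapted_basisD[OF ab] bz y[OF S(2)] by (simp add: Dy[OF S(2)])
  have "sff y u a b \<alpha> i j = sff z (\<tau> u) (\<lambda>i. dirderiv \<tau> u (a i)) b \<alpha> i j"
    if "\<alpha> \<in> {CARD('n)+1..<DIM('e)}" for \<alpha> i j
    using bz[OF that] by (simp add: sff_def Dy2 inner_add_right inner_commute)
  then show "rho_basis y u a b = rho_basis z (\<tau> u) (\<lambda>i. dirderiv \<tau> u (a i)) b"
    by (simp add: rho_basis_def sff_sq_def mean_curv_vec_def mean_curv_def)
qed

text \<open>The choice is immaterial wherever an adapted basis exists; elsewhere the value is
  arbitrary and may even be negative.\<close>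

definition rho_at :: "(real ^ 'n::finite => 'e::euclidean_space) => real ^ 'n => real"
  where "rho_at y u = (SOME r. \<exists>a b. adapted_basis y u a b \<and> r = rho_basis y u a b)"

lemma rho_at_eq:
  fixes y :: "real ^ 'n::finite => 'e::euclidean_space"
  assumes "CARD('n) < DIM('e)" "open U" "u \<in> U" "Ck_on 2 U y"
    "\<And>w. w \<in> U ==> y w \<bullet> y w = 1" "adapted_basis y u a b"
  shows "rho_at y u = rho_basis y u a b"
  unfolding rho_at_def
  by (rule someI2[where a="rho_basis y u a b"]) (use assms(6) rho_basis_unique[OF assms(1-5)] in blast)+

section \<open>The Gram determinant\<close>

text \<open>In the Leibniz formula a permutation other than the identity moves at least two indices,
  so after one factor has been differentiated an off-diagonal entry of the identity matrix, a zero,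
  is left over.\<close>

lemma has_derivative_det_at_id:
  fixes C :: "real => real ^ 'n ^ 'n::finite"
  assumes C: "\<And>i j. ((\<lambda>t. C t $ i $ j) has_real_derivative c i j) (at t0)" and C0: "C t0 = mat 1"
  shows "((\<lambda>t. det (C t)) has_real_derivative (\<Sum>i\<in>UNIV. c i i)) (at t0)"
proof -
  have p: "((\<lambda>t. \<Prod>i\<in>UNIV. C t $ i $ p i) has_derivative
      (\<lambda>y. \<Sum>i\<in>UNIV. (y * c i (p i)) * (\<Prod>j\<in>UNIV - {i}. C t0 $ j $ p j))) (at t0)" for p
    by (rule has_derivative_prod)
      (use C in \<open>simp add: has_field_derivative_def mult.commute[of _ "c _ _"]\<close>)
  have "((\<lambda>t. det (C t)) has_derivative (\<lambda>y. \<Sum>p\<in>{p. p permutes UNIV}. of_int (sign p) *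
      (\<Sum>i\<in>UNIV. (y * c i (p i)) * (\<Prod>j\<in>UNIV - {i}. C t0 $ j $ p j)))) (at t0)"
    unfolding det_def by (intro has_derivative_sum has_derivative_mult_right p)
  moreover have "(\<Sum>p\<in>{p. p permutes (UNIV::'n set)}. of_int (sign p) *
      (\<Sum>i\<in>UNIV. (y * c i (p i)) * (\<Prod>j\<in>UNIV - {i}. C t0 $ j $ p j))) = y * (\<Sum>i\<in>UNIV. c i i)" for y
  proof -
    have z: "(\<Sum>i\<in>UNIV. (y * c i (p i)) * (\<Prod>j\<in>UNIV - {i}. C t0 $ j $ p j))
        = (if p = id then y * (\<Sum>i\<in>UNIV. c i i) else 0)" if pp: "p permutes (UNIV::'n set)" for p
    proof (cases "p = id")
      case True
      then show ?thesis by (simp add: C0 mat_def sum_distrib_left)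
    next
      case False
      have "(\<Prod>j\<in>UNIV - {i}. C t0 $ j $ p j) = 0" for i
      proof -
        obtain j where j: "j \<noteq> i" "p j \<noteq> j"
        proof (rule ccontr)
          assume "\<not> thesis"
          then have *: "\<not> (\<exists>j. j \<noteq> i \<and> p j \<noteq> j)" using that by blast
          then have "p j = j" if "j \<noteq> i" for j using that by blast
          moreover have "inj p" using pp permutes_inj by blast
          ultimately have "p i = i" by (metis injD)
          then show False using * False by (metis eq_id_iff)
        qed
        then show ?thesis by (intro prod_zero bexI[of _ j]) (auto simp: C0 mat_def)
      qed
      then show ?thesis using False by (simp only: mult_zero_right sum.neutral_const if_False)
    qed
    have "(\<Sum>p\<in>{p. p permutes (UNIV::'n set)}. of_int (sign p) *
      (\<Sum>i\<in>UNIV. (y * c i (p i)) * (\<Prod>j\<in>UNIV - {i}. C t0 $ j $ p j)))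
      = (\<Sum>p\<in>{p. p permutes (UNIV::'n set)}. if p = id then y * (\<Sum>i\<in>UNIV. c i i) else 0)"
      by (intro sum.cong refl) (auto simp: z sign_id)
    also have "\<dots> = y * (\<Sum>i\<in>UNIV. c i i)"
      using permutes_id[of "UNIV::'n set"] by (subst sum.delta) (auto simp: finite_permutations)
    finally show ?thesis .
  qed
  ultimately show ?thesis by (intro has_derivative_imp_has_field_derivative) (simp only:, simp)
qed

lemma gram_quadratic:
  fixes y :: "real ^ 'n::finite => 'e::euclidean_space"
  assumes "linear (dirderiv y u)"
  shows "dirderiv y u v \<bullet> dirderiv y u w = (\<Sum>i\<in>UNIV. \<Sum>j\<in>UNIV. v $ i * w $ j * gram y u $ i $ j)"
proof -
  have e: "dirderiv y u v = (\<Sum>i\<in>UNIV. v $ i *\<^sub>R dirderiv y u (axis i 1))" for v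
    using arg_cong[OF basis_expansion[of v, symmetric], of "dirderiv y u"]
    by (simp add: linear_sum[OF assms] linear_cmul[OF assms] scalar_mult_eq_scaleR)
  show ?thesis
    by (subst e[of v], subst e[of w])
      (simp add: inner_sum_left inner_sum_right gram_def sum_distrib_left mult_ac, subst sum.swap, simp add: mult_ac inner_commute)
qed

text \<open>If \<open>a'\<^sub>i = \<Sum>\<^sub>k L\<^sub>i\<^sub>k e\<^sub>k\<close> then the Gram matrix of \<open>a'\<close> is \<open>L g L\<^sup>T\<close>.\<close>

lemma det_gram_frame:
  fixes y :: "real ^ 'n::finite => 'e::euclidean_space"
  assumes "linear (dirderiv y u)" "\<And>i j. dirderiv y u (a i) \<bullet> dirderiv y u (a j) = (if i = j then 1 else 0)"
  shows "det (gram y u) * (det (\<chi> i. a i))\<^sup>2 = 1"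
proof -
  let ?L = "(\<chi> i. a i) :: real ^ 'n ^ 'n"
  have "?L ** gram y u ** transpose ?L = mat 1"
  proof (simp add: vec_eq_iff, intro allI)
    fix i j
    have "(?L ** gram y u ** transpose ?L) $ i $ j = (\<Sum>l\<in>UNIV. \<Sum>k\<in>UNIV. a i $ k * gram y u $ k $ l * a j $ l)"
      by (simp add: matrix_matrix_mult_def transpose_def sum_distrib_right)
    also have "\<dots> = (\<Sum>k\<in>UNIV. \<Sum>l\<in>UNIV. a i $ k * gram y u $ k $ l * a j $ l)" by (rule sum.swap)
    also have "\<dots> = dirderiv y u (a i) \<bullet> dirderiv y u (a j)"
      unfolding gram_quadratic[OF assms(1)] by (intro sum.cong refl) (simp add: mult_ac)
    finally show "(?L ** gram y u ** transpose ?L) $ i $ j = mat 1 $ i $ j"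
      by (simp add: assms(2) mat_def)
  qed
  then have "det (?L ** gram y u ** transpose ?L) = 1" by simp
  then show ?thesis by (simp add: det_mul power2_eq_square mult_ac)
qed

lemma det_gram_pos:
  fixes y :: "real ^ 'n::finite => 'e::euclidean_space"
  assumes "linear (dirderiv y u)" "adapted_basis y u a b"
  shows "det (gram y u) > 0"
proof -
  have "det (gram y u) * (det (\<chi> i. a i))\<^sup>2 = 1"
    by (rule det_gram_frame[OF assms(1) adapted_basisD(1)[OF assms(2)]])
  then show ?thesis by (metis zero_less_mult_pos2 zero_less_one zero_le_power2 order_le_less mult_zero_right zero_neq_one)
qed

text \<open>A kernel vector of the differential is a kernel vector of the Gram matrix.\<close>

lemma det_gram_pos_imp_inj:
  fixes y :: "real ^ 'n::finite => 'e::euclidean_space"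
  assumes "linear (dirderiv y u)" "det (gram y u) \<noteq> 0"
  shows "inj (dirderiv y u)"
proof (subst linear_injective_0[OF assms(1)], intro allI impI)
  fix v assume v: "dirderiv y u v = 0"
  have "(gram y u *v v) $ i = dirderiv y u (axis i 1) \<bullet> dirderiv y u v" for i
  proof -
    have "dirderiv y u v = (\<Sum>j\<in>UNIV. v $ j *\<^sub>R dirderiv y u (axis j 1))"
      using arg_cong[OF basis_expansion[of v, symmetric], of "dirderiv y u"]
      by (simp add: linear_sum[OF assms(1)] linear_cmul[OF assms(1)] scalar_mult_eq_scaleR)
    then show ?thesis
      by (simp add: matrix_vector_mult_def gram_def inner_sum_right mult.commute)
  qed
  then have "gram y u *v v = 0" by (simp add: vec_eq_iff v)
  moreover have "invertible (gram y u)" using assms(2) by (simp add: invertible_det_nz)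
  ultimately show "v = 0"
    by (metis invertible_def matrix_left_invertible_ker)
qed

text \<open>With J the Jacobian matrix of \<tau>, the Gram matrices satisfy g_y = J^T g_z J.\<close>

lemma det_gram_compose:
  fixes y z :: "real ^ 'n::finite => 'e::euclidean_space"
  assumes "linear (dirderiv z (\<tau> u))" "linear (dirderiv \<tau> u)"
    "\<And>v. dirderiv y u v = dirderiv z (\<tau> u) (dirderiv \<tau> u v)"
  shows "det (gram y u) = det (gram z (\<tau> u)) * (det (matrix (dirderiv \<tau> u)))\<^sup>2"
proof -
  let ?J = "matrix (dirderiv \<tau> u)"
  have "gram y u = transpose ?J ** gram z (\<tau> u) ** ?J"
  proof (simp add: vec_eq_iff, intro allI)
    fix i j
    have "(transpose ?J ** gram z (\<tau> u) ** ?J) $ i $ j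
        = (\<Sum>l\<in>UNIV. \<Sum>k\<in>UNIV. dirderiv \<tau> u (axis i 1) $ k * gram z (\<tau> u) $ k $ l * dirderiv \<tau> u (axis j 1) $ l)"
      by (simp add: matrix_matrix_mult_def transpose_def sum_distrib_right matrix_def)
    also have "\<dots> = (\<Sum>k\<in>UNIV. \<Sum>l\<in>UNIV. dirderiv \<tau> u (axis i 1) $ k * gram z (\<tau> u) $ k $ l * dirderiv \<tau> u (axis j 1) $ l)"
      by (rule sum.swap)
    also have "\<dots> = gram y u $ i $ j"
      unfolding gram_def[of y] by (simp add: assms(3) gram_quadratic[OF assms(1)] mult_ac)
    finally show "gram y u $ i $ j = (transpose ?J ** gram z (\<tau> u) ** ?J) $ i $ j" by simp
  qed
  then show ?thesis by (simp add: det_mul power2_eq_square mult_ac)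
qed

section \<open>First variation\<close>

text \<open>The first sum pairs the trace-free form with the normal part of the covariant Hessian of
  \<zeta> for the induced metric: the subtracted sum is the Levi-Civita correction, as the
  tangential part of the second derivative of y carries the Christoffel symbols. The second sum is
  the effect of changing the metric, whose derivative is the symmetric bracket.\<close>

definition rho_sq_var ::
    "(real ^ 'n::finite => 'e::euclidean_space) => (real ^ 'n => 'e) => real ^ 'n
      => ('n => real ^ 'n) => (nat => 'e) => real"
  where "rho_sq_var y \<zeta> u a b =
    2 * ((\<Sum>\<alpha>\<in>{CARD('n)+1..<DIM('e)}. \<Sum>i\<in>UNIV. \<Sum>j\<in>UNIV. tsff y u a b \<alpha> i j *
        ((dd \<zeta> u (a i) (a j)
          - (\<Sum>k\<in>UNIV. (dd y u (a i) (a j) \<bullet> dirderiv y u (a k)) *\<^sub>R dirderiv \<zeta> u (a k))) \<bullet> b \<alpha>))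
      - (\<Sum>i\<in>UNIV. \<Sum>k\<in>UNIV.
          (dirderiv \<zeta> u (a i) \<bullet> dirderiv y u (a k) + dirderiv \<zeta> u (a k) \<bullet> dirderiv y u (a i)) *
          (\<Sum>\<alpha>\<in>{CARD('n)+1..<DIM('e)}. \<Sum>j\<in>UNIV. tsff y u a b \<alpha> i j * sff y u a b \<alpha> k j)))"

text \<open>Half the trace of the derivative of the metric, that is, the tangential divergence of
  \<zeta>.\<close>

definition area_var ::
    "(real ^ 'n::finite => 'e::euclidean_space) => (real ^ 'n => 'e) => real ^ 'n
      => ('n => real ^ 'n) => real"
  where "area_var y \<zeta> u a = (\<Sum>i\<in>UNIV. dirderiv \<zeta> u (a i) \<bullet> dirderiv y u (a i))"

lemma sum_swap3:
  "(\<Sum>i\<in>I. \<Sum>j\<in>J. \<Sum>k\<in>K. f i j k) = (\<Sum>j\<in>J. \<Sum>k\<in>K. \<Sum>i\<in>I. f i j k)"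
proof -
  have "(\<Sum>i\<in>I. \<Sum>j\<in>J. \<Sum>k\<in>K. f i j k) = (\<Sum>j\<in>J. \<Sum>i\<in>I. \<Sum>k\<in>K. f i j k)" by (rule sum.swap)
  also have "\<dots> = (\<Sum>j\<in>J. \<Sum>k\<in>K. \<Sum>i\<in>I. f i j k)" by (intro sum.cong refl sum.swap)
  finally show ?thesis .
qed

lemma sum_if_cond: "(\<Sum>i\<in>I. if P then f i else 0) = (if P then (\<Sum>i\<in>I. f i) else 0)"
  by simp

text \<open>\<open>hp\<close> stands for the time derivative of the second fundamental form in a
  moving frame, c and m for the rotation of the tangential and the normal frame, g for the
  derivative of the metric and e for the contribution of the sphere. The contraction of T with h is
  symmetric, so only the symmetric part of c survives; m is antisymmetric and drops out; e
  multiplies the trace of T.\<close>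

lemma variation_algebra:
  fixes h T Z hp :: "nat => 'n::finite => 'n => real" and H e :: "nat => real"
    and c g :: "'n => 'n => real" and m :: "nat => nat => real"
  assumes h: "\<And>\<alpha> i j. \<alpha> \<in> N ==> h \<alpha> i j = h \<alpha> j i"
    and T: "\<And>\<alpha> i j. T \<alpha> i j = h \<alpha> i j - (if i = j then H \<alpha> else 0)"
    and tr: "\<And>\<alpha>. (\<Sum>k\<in>UNIV. T \<alpha> k k) = 0"
    and m: "\<And>\<alpha> \<beta>. \<alpha> \<in> N ==> \<beta> \<in> N ==> m \<alpha> \<beta> = - m \<beta> \<alpha>"
    and c: "\<And>i j. c i j + c j i = - g i j"
    and hp: "\<And>\<alpha> i j. \<alpha> \<in> N ==> hp \<alpha> i j = (\<Sum>k\<in>UNIV. c i k * h \<alpha> k j) + (\<Sum>l\<in>UNIV. c j l * h \<alpha> i l)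
      + Z \<alpha> i j + (\<Sum>\<beta>\<in>N. h \<beta> i j * m \<beta> \<alpha>) + (if i = j then e \<alpha> else 0)"
  shows "(\<Sum>\<alpha>\<in>N. \<Sum>i\<in>UNIV. \<Sum>j\<in>UNIV. T \<alpha> i j * hp \<alpha> i j)
    = (\<Sum>\<alpha>\<in>N. \<Sum>i\<in>UNIV. \<Sum>j\<in>UNIV. T \<alpha> i j * Z \<alpha> i j)
      - (\<Sum>i\<in>UNIV. \<Sum>k\<in>UNIV. g i k * (\<Sum>\<alpha>\<in>N. \<Sum>j\<in>UNIV. T \<alpha> i j * h \<alpha> k j))"
proof -
  let ?K = "\<lambda>i k. (\<Sum>\<alpha>\<in>N. \<Sum>j\<in>UNIV. T \<alpha> i j * h \<alpha> k j)"
  have Tsym: "T \<alpha> i j = T \<alpha> j i" if "\<alpha> \<in> N" for \<alpha> i j using h[OF that] by (simp add: T)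
  have K: "?K i k = ?K k i" for i k
  proof -
    have "(\<Sum>j\<in>UNIV. T \<alpha> i j * h \<alpha> k j) = (\<Sum>j\<in>UNIV. T \<alpha> k j * h \<alpha> i j)" if "\<alpha> \<in> N" for \<alpha>
    proof -
      have "(\<Sum>j\<in>UNIV. T \<alpha> i j * h \<alpha> k j)
          = (\<Sum>j\<in>UNIV. h \<alpha> i j * h \<alpha> k j) - (\<Sum>j\<in>UNIV. if i = j then H \<alpha> * h \<alpha> k i else 0)" for i k
        unfolding sum_subtractf[symmetric] by (intro sum.cong refl) (auto simp: T algebra_simps)
      then show ?thesis using h[OF that, of i k] by (simp add: mult.commute)
    qed
    then show ?thesis by (rule sum.cong[OF refl])
  qed
  define S1 where "S1 = (\<Sum>\<alpha>\<in>N. \<Sum>i\<in>UNIV. \<Sum>j\<in>UNIV. T \<alpha> i j * (\<Sum>k\<in>UNIV. c i k * h \<alpha> k j))"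
  have S1: "S1 = (\<Sum>i\<in>UNIV. \<Sum>k\<in>UNIV. c i k * ?K i k)"
  proof -
    have "S1 = (\<Sum>\<alpha>\<in>N. \<Sum>i\<in>UNIV. \<Sum>k\<in>UNIV. \<Sum>j\<in>UNIV. c i k * (T \<alpha> i j * h \<alpha> k j))"
    proof -
      have "(\<Sum>j\<in>UNIV. \<Sum>k\<in>UNIV. T \<alpha> i j * (c i k * h \<alpha> k j))
          = (\<Sum>k\<in>UNIV. \<Sum>j\<in>UNIV. c i k * (T \<alpha> i j * h \<alpha> k j))" for \<alpha> i
        by (subst sum.swap) (simp add: mult.left_commute)
      then show ?thesis unfolding S1_def sum_distrib_left by (simp only:)
    qed
    also have "\<dots> = (\<Sum>i\<in>UNIV. \<Sum>k\<in>UNIV. \<Sum>\<alpha>\<in>N. \<Sum>j\<in>UNIV. c i k * (T \<alpha> i j * h \<alpha> k j))"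
      by (rule sum_swap3)
    finally show ?thesis by (simp add: sum_distrib_left)
  qed
  have S2: "(\<Sum>\<alpha>\<in>N. \<Sum>i\<in>UNIV. \<Sum>j\<in>UNIV. T \<alpha> i j * (\<Sum>l\<in>UNIV. c j l * h \<alpha> i l)) = S1"
    unfolding S1_def
  proof (rule sum.cong[OF refl])
    fix \<alpha> assume \<alpha>: "\<alpha> \<in> N"
    have "(\<Sum>i\<in>UNIV. \<Sum>j\<in>UNIV. T \<alpha> i j * (\<Sum>l\<in>UNIV. c j l * h \<alpha> i l))
        = (\<Sum>j\<in>UNIV. \<Sum>i\<in>UNIV. T \<alpha> i j * (\<Sum>l\<in>UNIV. c j l * h \<alpha> i l))" by (rule sum.swap)
    also have "\<dots> = (\<Sum>j\<in>UNIV. \<Sum>i\<in>UNIV. T \<alpha> j i * (\<Sum>l\<in>UNIV. c j l * h \<alpha> l i))"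
    proof (intro sum.cong refl arg_cong2[where f="(*)"])
      show "T \<alpha> i j = T \<alpha> j i" for i j by (rule Tsym[OF \<alpha>])
      show "h \<alpha> i l = h \<alpha> l i" for i l by (rule h[OF \<alpha>])
    qed
    finally show "(\<Sum>i\<in>UNIV. \<Sum>j\<in>UNIV. T \<alpha> i j * (\<Sum>l\<in>UNIV. c j l * h \<alpha> i l))
        = (\<Sum>i\<in>UNIV. \<Sum>j\<in>UNIV. T \<alpha> i j * (\<Sum>k\<in>UNIV. c i k * h \<alpha> k j))" .
  qed
  \<comment> \<open>The two slots of h contribute equally. Transposing one copy, which is possible
    because \<open>?K\<close> is symmetric, produces c + c^T, that is, -g.\<close>
  have S12: "S1 + S1 = - (\<Sum>i\<in>UNIV. \<Sum>k\<in>UNIV. g i k * ?K i k)"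
  proof -
    have "S1 = (\<Sum>i\<in>UNIV. \<Sum>k\<in>UNIV. c k i * ?K i k)"
      unfolding S1 by (subst sum.swap) (intro sum.cong refl, simp add: K)
    then have "S1 + S1 = (\<Sum>i\<in>UNIV. \<Sum>k\<in>UNIV. (c i k + c k i) * ?K i k)"
      using S1 by (simp add: distrib_right sum.distrib)
    then show ?thesis by (simp add: c sum_negf)
  qed
  \<comment> \<open>The pairing of T with h for normal indices \<alpha>, \<beta> is the full pairing
    of the two second fundamental forms minus n H \<alpha> H \<beta>, hence symmetric in \<alpha>
    and \<beta>.\<close>
  have S4: "(\<Sum>\<alpha>\<in>N. \<Sum>i\<in>UNIV. \<Sum>j\<in>UNIV. T \<alpha> i j * (\<Sum>\<beta>\<in>N. h \<beta> i j * m \<beta> \<alpha>)) = 0"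
  proof -
    let ?W = "\<lambda>\<alpha> \<beta>. \<Sum>i\<in>UNIV. \<Sum>j\<in>UNIV. T \<alpha> i j * h \<beta> i j"
    have tr': "(\<Sum>k\<in>UNIV. h \<beta> k k) = real CARD('n) * H \<beta>" for \<beta>
      using tr[of \<beta>] by (simp add: T sum_subtractf)
    have "?W \<alpha> \<beta> = (\<Sum>i\<in>UNIV. \<Sum>j\<in>UNIV. h \<alpha> i j * h \<beta> i j) - real CARD('n) * H \<alpha> * H \<beta>" for \<alpha> \<beta>
    proof -
      have "?W \<alpha> \<beta> = (\<Sum>i\<in>UNIV. (\<Sum>j\<in>UNIV. h \<alpha> i j * h \<beta> i j) - (\<Sum>j\<in>UNIV. if i = j then H \<alpha> * h \<beta> i i else 0))"
        unfolding sum_subtractf[symmetric] by (intro sum.cong refl) (auto simp: T algebra_simps)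
      then show ?thesis by (simp add: sum_subtractf sum_distrib_left[symmetric] tr')
    qed
    then have W: "?W \<alpha> \<beta> = ?W \<beta> \<alpha>" for \<alpha> \<beta> by (simp add: mult_ac)
    have "(\<Sum>\<alpha>\<in>N. \<Sum>i\<in>UNIV. \<Sum>j\<in>UNIV. T \<alpha> i j * (\<Sum>\<beta>\<in>N. h \<beta> i j * m \<beta> \<alpha>))
        = (\<Sum>\<alpha>\<in>N. \<Sum>\<beta>\<in>N. m \<beta> \<alpha> * ?W \<alpha> \<beta>)"
    proof -
      have "(\<Sum>i\<in>UNIV. \<Sum>j\<in>UNIV. \<Sum>\<beta>\<in>N. T \<alpha> i j * (h \<beta> i j * m \<beta> \<alpha>))
          = (\<Sum>\<beta>\<in>N. \<Sum>i\<in>UNIV. \<Sum>j\<in>UNIV. m \<beta> \<alpha> * (T \<alpha> i j * h \<beta> i j))" for \<alpha>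
        by (subst sum_swap3[symmetric]) (simp add: mult_ac)
      then show ?thesis unfolding sum_distrib_left by (simp only:)
    qed
    also have "\<dots> = (\<Sum>\<alpha>\<in>N. \<Sum>\<beta>\<in>N. m \<alpha> \<beta> * ?W \<beta> \<alpha>)" by (rule sum.swap)
    also have "\<dots> = (\<Sum>\<alpha>\<in>N. \<Sum>\<beta>\<in>N. - (m \<beta> \<alpha> * ?W \<alpha> \<beta>))"
    proof (intro sum.cong refl)
      fix \<alpha> \<beta> assume "\<alpha> \<in> N" "\<beta> \<in> N"
      then show "m \<alpha> \<beta> * ?W \<beta> \<alpha> = - (m \<beta> \<alpha> * ?W \<alpha> \<beta>)"
        using m[of \<alpha> \<beta>] by (simp only: W[of \<beta> \<alpha>] mult_minus_left)
    qed
    finally have "(\<Sum>\<alpha>\<in>N. \<Sum>i\<in>UNIV. \<Sum>j\<in>UNIV. T \<alpha> i j * (\<Sum>\<beta>\<in>N. h \<beta> i j * m \<beta> \<alpha>))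
        = - (\<Sum>\<alpha>\<in>N. \<Sum>\<beta>\<in>N. m \<beta> \<alpha> * ?W \<alpha> \<beta>)" by (simp add: sum_negf)
    then show ?thesis
      using \<open>(\<Sum>\<alpha>\<in>N. \<Sum>i\<in>UNIV. \<Sum>j\<in>UNIV. T \<alpha> i j * (\<Sum>\<beta>\<in>N. h \<beta> i j * m \<beta> \<alpha>))
        = (\<Sum>\<alpha>\<in>N. \<Sum>\<beta>\<in>N. m \<beta> \<alpha> * ?W \<alpha> \<beta>)\<close> by linarith
  qed
  have S5: "(\<Sum>\<alpha>\<in>N. \<Sum>i\<in>UNIV. \<Sum>j\<in>UNIV. T \<alpha> i j * (if i = j then e \<alpha> else 0)) = 0"
  proof -
    have "(\<Sum>i\<in>UNIV. \<Sum>j\<in>UNIV. T \<alpha> i j * (if i = j then e \<alpha> else 0)) = (\<Sum>i\<in>UNIV. T \<alpha> i i) * e \<alpha>" for \<alpha>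
      by (simp add: sum_distrib_right if_distrib[of "(*) _"] cong: if_cong)
    then show ?thesis by (simp add: tr)
  qed
  have "(\<Sum>\<alpha>\<in>N. \<Sum>i\<in>UNIV. \<Sum>j\<in>UNIV. T \<alpha> i j * hp \<alpha> i j)
      = S1 + (\<Sum>\<alpha>\<in>N. \<Sum>i\<in>UNIV. \<Sum>j\<in>UNIV. T \<alpha> i j * (\<Sum>l\<in>UNIV. c j l * h \<alpha> i l))
        + (\<Sum>\<alpha>\<in>N. \<Sum>i\<in>UNIV. \<Sum>j\<in>UNIV. T \<alpha> i j * Z \<alpha> i j)
        + (\<Sum>\<alpha>\<in>N. \<Sum>i\<in>UNIV. \<Sum>j\<in>UNIV. T \<alpha> i j * (\<Sum>\<beta>\<in>N. h \<beta> i j * m \<beta> \<alpha>))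
        + (\<Sum>\<alpha>\<in>N. \<Sum>i\<in>UNIV. \<Sum>j\<in>UNIV. T \<alpha> i j * (if i = j then e \<alpha> else 0))"
    unfolding S1_def sum.distrib[symmetric]
    by (intro sum.cong refl) (simp only: hp distrib_left)
  then show ?thesis unfolding S2 S4 S5 using S12 by simp
qed

section \<open>Families of maps into the sphere and their derivatives in time\<close>

lemma has_vector_derivative_inner:
  assumes "(f has_vector_derivative f') (at t)" "(g has_vector_derivative g') (at t)"
  shows "((\<lambda>t. f t \<bullet> g t) has_real_derivative f t \<bullet> g' + f' \<bullet> g t) (at t)"
  unfolding has_real_derivative_iff_has_vector_derivative
  by (rule bounded_bilinear.has_vector_derivative[OF bounded_bilinear_inner assms])

lemma has_vector_derivative_slice:
  fixes f :: "real \<times> 'b::real_normed_vector => 'c::real_normed_vector"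
  assumes "f differentiable (at (t, u))"
  shows "((\<lambda>s. f (s, u)) has_vector_derivative dirderiv f (t, u) (1, 0)) (at t)"
proof -
  have eq: "(\<lambda>h. dirderiv f (t, u) (h, 0)) = (\<lambda>h. h *\<^sub>R dirderiv f (t, u) (1, 0))"
  proof (rule ext)
    fix h
    have h: "(h, 0 :: 'b) = h *\<^sub>R (1, 0)" by simp
    show "dirderiv f (t, u) (h, 0) = h *\<^sub>R dirderiv f (t, u) (1, 0)"
      unfolding h by (rule linear_cmul[OF linear_dirderiv[OF assms]])
  qed
  show ?thesis
    unfolding has_vector_derivative_def eq[symmetric] by (rule has_derivative_slice(2)[OF assms])
qed

text \<open>The domain is an arbitrary open set of pairs (t, u) because a deformation of a patch may
  exist for a time that depends on the point. No slice is assumed to be an immersion.\<close>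

locale sphere_family =
  fixes \<Omega> :: "(real \<times> (real ^ 'n::finite)) set" and Y :: "real \<times> (real ^ 'n) => 'e::euclidean_space"
  assumes open_dom: "open \<Omega>" and smooth: "smooth_on \<Omega> Y"
    and unit: "z \<in> \<Omega> ==> Y z \<bullet> Y z = 1" and dim: "CARD('n) < DIM('e)"
begin

abbreviation sl :: "real => real ^ 'n => 'e" where "sl t \<equiv> \<lambda>u. Y (t, u)"
abbreviation vel :: "real => real ^ 'n => 'e" where "vel t \<equiv> \<lambda>u. dirderiv Y (t, u) (1, 0)"

lemma CkY: "Ck_on k \<Omega> Y" using smooth by (simp add: smooth_on_def)

lemma diffY:
  assumes "z \<in> \<Omega>"
  shows "Y differentiable (at z)" "(\<lambda>z. dirderiv Y z v) differentiable (at z)"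
    "(\<lambda>z. dd Y z v w) differentiable (at z)"
proof -
  have 1: "Ck_on k \<Omega> (\<lambda>z. dirderiv Y z v)" for k v
    using CkY[of "Suc k"] by (simp only: Ck_on.simps(2))
  have 2: "Ck_on k \<Omega> (\<lambda>z. dd Y z v w)" for k v w
    using 1[of "Suc k" v] by (simp only: Ck_on.simps(2))
  show "Y differentiable (at z)" "(\<lambda>z. dirderiv Y z v) differentiable (at z)"
    "(\<lambda>z. dd Y z v w) differentiable (at z)"
    using CkY[of "Suc 0"] 1[of "Suc 0" v] 2[of "Suc 0" v w] assms
    by (simp_all only: Ck_on.simps(2))
qed

lemma slice_open: "open {u. (t, u) \<in> \<Omega>}"
  using open_vimage[OF open_dom, of "\<lambda>u. (t, u)"] by (simp add: vimage_def continuous_on_Pair)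

lemma time_open: "open {t. (t, u) \<in> \<Omega>}"
  using open_vimage[OF open_dom, of "\<lambda>t. (t, u)"] by (simp add: vimage_def continuous_on_Pair)

lemma Ck_on_slice: "Ck_on k {u. (t, u) \<in> \<Omega>} (sl t)"
  by (rule Ck_on_compose[OF slice_open open_dom _ CkY, of "\<lambda>u. (t, u)"])
    (auto intro!: Ck_on_Pair slice_open Ck_on_const Ck_on_id)

lemma sl_dirderiv: "(t, u) \<in> \<Omega> ==> dirderiv (sl t) u v = dirderiv Y (t, u) (0, v)"
  by (rule dirderiv_slice) (rule diffY)

lemma sl_dd:
  assumes "(t, u) \<in> \<Omega>"
  shows "dd (sl t) u v w = dd Y (t, u) (0, v) (0, w)"
proof -
  have "dd (sl t) u v w = dirderiv (\<lambda>u. dirderiv Y (t, u) (0, v)) u w"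
    using assms by (intro dirderiv_cong_open[OF slice_open[of t]]) (auto simp: sl_dirderiv)
  also have "\<dots> = dd Y (t, u) (0, v) (0, w)"
    using dirderiv_slice[OF diffY(2)[OF assms]] by simp
  finally show ?thesis .
qed

lemma vel_dirderiv: "(t, u) \<in> \<Omega> ==> dirderiv (vel t) u v = dd Y (t, u) (1, 0) (0, v)"
  using dirderiv_slice[OF diffY(2)] by simp

lemma vel_dd:
  assumes "(t, u) \<in> \<Omega>"
  shows "dd (vel t) u v w = dirderiv (\<lambda>z. dd Y z (1, 0) (0, v)) (t, u) (0, w)"
proof -
  have "dd (vel t) u v w = dirderiv (\<lambda>u. dd Y (t, u) (1, 0) (0, v)) u w"
    using assms by (intro dirderiv_cong_open[OF slice_open[of t]]) (auto simp: vel_dirderiv)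
  also have "\<dots> = dirderiv (\<lambda>z. dd Y z (1, 0) (0, v)) (t, u) (0, w)"
    using dirderiv_slice[OF diffY(3)[OF assms]] by simp
  finally show ?thesis .
qed

text \<open>Time and space derivatives are directional derivatives of one smooth function of (t, u),
  so they commute; for the second space derivative the time direction is moved past both space
  directions, one after the other.\<close>

lemma time_derivative:
  assumes "(t, u) \<in> \<Omega>"
  shows "((\<lambda>t. sl t u) has_vector_derivative vel t u) (at t)"
    and "((\<lambda>t. dirderiv (sl t) u v) has_vector_derivative dirderiv (vel t) u v) (at t)"
    and "((\<lambda>t. dd (sl t) u v w) has_vector_derivative dd (vel t) u v w) (at t)"
proof -
  show "((\<lambda>t. sl t u) has_vector_derivative vel t u) (at t)"
    by (rule has_vector_derivative_slice[OF diffY(1)[OF assms]])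
  have t: "t \<in> {t. (t, u) \<in> \<Omega>}" using assms by simp
  have "((\<lambda>t. dirderiv Y (t, u) (0, v)) has_vector_derivative dd Y (t, u) (0, v) (1, 0)) (at t)"
    by (rule has_vector_derivative_slice[OF diffY(2)[OF assms]])
  also have "dd Y (t, u) (0, v) (1, 0) = dirderiv (vel t) u v"
    unfolding vel_dirderiv[OF assms] by (rule dirderiv_commute[OF open_dom assms CkY])
  finally show "((\<lambda>t. dirderiv (sl t) u v) has_vector_derivative dirderiv (vel t) u v) (at t)"
    by (rule has_vector_derivative_transform_within_open[OF _ time_open[of u] t]) (simp add: sl_dirderiv)
  have "((\<lambda>t. dd Y (t, u) (0, v) (0, w)) has_vector_derivative
      dirderiv (\<lambda>z. dd Y z (0, v) (0, w)) (t, u) (1, 0)) (at t)"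
    by (rule has_vector_derivative_slice[OF diffY(3)[OF assms]])
  also have "dirderiv (\<lambda>z. dd Y z (0, v) (0, w)) (t, u) (1, 0) = dirderiv (\<lambda>z. dd Y z (0, v) (1, 0)) (t, u) (0, w)"
    by (rule dirderiv_commute[OF open_dom assms]) (use CkY[of 3] in \<open>simp add: numeral_3_eq_3 numeral_2_eq_2\<close>)
  also have "\<dots> = dirderiv (\<lambda>z. dd Y z (1, 0) (0, v)) (t, u) (0, w)"
    by (rule dirderiv_cong_open[OF open_dom assms]) (rule dirderiv_commute[OF open_dom _ CkY])
  also have "\<dots> = dd (vel t) u v w" by (rule vel_dd[OF assms, symmetric])
  finally show "((\<lambda>t. dd (sl t) u v w) has_vector_derivative dd (vel t) u v w) (at t)"
    by (rule has_vector_derivative_transform_within_open[OF _ time_open[of u] t]) (simp add: sl_dd)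
qed

lemma rho_at_sl:
  assumes "(t, u) \<in> \<Omega>" "adapted_basis (sl t) u a b"
  shows "rho_at (sl t) u = sqrt (rho_sq (sl t) u a b)"
proof -
  have "rho_at (sl t) u = rho_basis (sl t) u a b"
    by (rule rho_at_eq[OF dim slice_open[of t]]) (use assms Ck_on_slice unit in auto)
  then show ?thesis using rho_basis_eq[OF assms(2)] by simp
qed

lemma lin_sl: "(t, u) \<in> \<Omega> ==> linear (dirderiv (sl t) u)"
  by (rule linear_dirderiv) (use has_derivative_slice(1)[OF diffY(1)] in \<open>auto simp: differentiable_def\<close>)

context
  fixes t0 u0 a b
  assumes z0: "(t0, u0) \<in> \<Omega>" and ab: "adapted_basis (sl t0) u0 a b"
begin

text \<open>The moving frame is followed at the fixed point u0 only. The tangential frame is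
  recorded by its coefficients C with respect to the initial one, so that its motion is described by
  real functions.\<close>

lemma frame_derivatives:
  obtains T A B C c \<beta>' where "open T" "t0 \<in> T" "\<And>t. t \<in> T ==> (t, u0) \<in> \<Omega>"
    "\<And>t. t \<in> T ==> adapted_basis (sl t) u0 (A t) (B t)"
    "A t0 = a" "\<And>\<alpha>. \<alpha> \<in> {CARD('n)+1..<DIM('e)} ==> B t0 \<alpha> = b \<alpha>"
    "\<And>t i. A t i = (\<Sum>k\<in>UNIV. C i k t *\<^sub>R a k)"
    "\<And>i k. C i k t0 = (if i = k then (1::real) else 0)"
    "\<And>i k. (C i k has_real_derivative c i k) (at t0)"
    "\<And>\<alpha>. ((\<lambda>t. B t \<alpha>) has_vector_derivative \<beta>' \<alpha>) (at t0)"
proof -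
  obtain \<Omega>' A B where \<Omega>': "open \<Omega>'" "(t0, u0) \<in> \<Omega>'" "\<Omega>' \<subseteq> \<Omega>"
    and A: "\<forall>i. smooth_on \<Omega>' (\<lambda>z. A z i)" and B: "\<forall>\<alpha>. smooth_on \<Omega>' (\<lambda>z. B z \<alpha>)"
    and 0: "A (t0, u0) = a" "\<forall>\<alpha>\<in>{CARD('n)+1..<DIM('e)}. B (t0, u0) \<alpha> = b \<alpha>"
    and AB: "\<forall>t u. (t, u) \<in> \<Omega>' \<longrightarrow> adapted_basis (sl t) u (A (t, u)) (B (t, u))"
    using adapted_frame_extension[OF open_dom z0 smooth unit ab] by blast
  let ?T = "(\<lambda>t. (t, u0)) -` \<Omega>'"
  have "open ?T" by (rule open_vimage[OF \<Omega>'(1)]) (intro continuous_intros)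
  have dA: "(\<lambda>z. A z i) differentiable (at (t0, u0))" and dB: "(\<lambda>z. B z \<alpha>) differentiable (at (t0, u0))" for i \<alpha>
  proof -
    have "Ck_on 1 \<Omega>' (\<lambda>z. A z i)" "Ck_on 1 \<Omega>' (\<lambda>z. B z \<alpha>)" using A B by (auto simp: smooth_on_def)
    then show "(\<lambda>z. A z i) differentiable (at (t0, u0))" "(\<lambda>z. B z \<alpha>) differentiable (at (t0, u0))"
      using \<Omega>'(2) by auto
  qed
  let ?P = "dirderiv (sl t0) u0"
  note on = adapted_basisD(1)[OF ab]
  define C where "C i k t = ?P (A (t, u0) i) \<bullet> ?P (a k)" for i k t
  have blP: "bounded_linear ?P" by (rule linear_conv_bounded_linear[THEN iffD1, OF lin_sl[OF z0]])
  show thesis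
  proof (rule that[of ?T "\<lambda>t. A (t, u0)" "\<lambda>t. B (t, u0)" C])
    show "A (t, u0) i = (\<Sum>k\<in>UNIV. C i k t *\<^sub>R a k)" for t i
      unfolding C_def by (rule orthonormal_frame_expansion(1)[OF lin_sl[OF z0] on])
    show "C i k t0 = (if i = k then 1 else 0)" for i k by (simp add: C_def 0 on)
    show "(C i k has_real_derivative ?P (dirderiv (\<lambda>z. A z i) (t0, u0) (1, 0)) \<bullet> ?P (a k)) (at t0)" for i k
    proof -
      have "((\<lambda>t. ?P (A (t, u0) i)) has_vector_derivative ?P (dirderiv (\<lambda>z. A z i) (t0, u0) (1, 0))) (at t0)"
        by (rule bounded_linear.has_vector_derivative[OF blP has_vector_derivative_slice[OF dA]])
      from has_vector_derivative_inner[OF this has_vector_derivative_const[of "?P (a k)"]]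
      show ?thesis unfolding C_def[abs_def] by simp
    qed
    show "((\<lambda>t. B (t, u0) \<alpha>) has_vector_derivative dirderiv (\<lambda>z. B z \<alpha>) (t0, u0) (1, 0)) (at t0)" for \<alpha>
      by (rule has_vector_derivative_slice[OF dB])
    show "open ?T" by fact
  qed (use \<Omega>' 0 AB in auto)
qed

text \<open>Differentiate the orthonormality of the moving frame in the moving metric. This
  determines only the symmetric part of c; the antisymmetric part depends on the chosen
  frame.\<close>

lemma frame_derivative_tangential:
  assumes "open T" "t0 \<in> T" "\<And>t. t \<in> T ==> adapted_basis (sl t) u0 (A t) (B t)"
    and A: "\<And>t. t \<in> T ==> (t, u0) \<in> \<Omega>" "\<And>t i. A t i = (\<Sum>k\<in>UNIV. C i k t *\<^sub>R a k)"
    and C: "\<And>i k. C i k t0 = (if i = k then (1::real) else 0)"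
      "\<And>i k. (C i k has_real_derivative c i k) (at t0)"
  shows "c i j + c j i = - (dirderiv (vel t0) u0 (a i) \<bullet> dirderiv (sl t0) u0 (a j)
    + dirderiv (vel t0) u0 (a j) \<bullet> dirderiv (sl t0) u0 (a i))"
proof -
  let ?p = "\<lambda>k t. dirderiv (sl t) u0 (a k)" and ?z = "\<lambda>k. dirderiv (vel t0) u0 (a k)"
  let ?S = "\<lambda>i t. \<Sum>k\<in>UNIV. C i k t *\<^sub>R ?p k t"
  have S0: "?S i t0 = ?p i t0" for i
    by (simp add: C if_distrib[of "\<lambda>x. x *\<^sub>R _"] cong: if_cong)
  have "((\<lambda>t. C i k t *\<^sub>R ?p k t) has_vector_derivative C i k t0 *\<^sub>R ?z k + c i k *\<^sub>R ?p k t0) (at t0)" for i k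
    by (intro has_vector_derivative_scaleR C time_derivative z0)
  then have "(?S i has_vector_derivative (\<Sum>k\<in>UNIV. C i k t0 *\<^sub>R ?z k + c i k *\<^sub>R ?p k t0)) (at t0)" for i
    by (intro has_vector_derivative_sum)
  moreover have "(\<Sum>k\<in>UNIV. C i k t0 *\<^sub>R ?z k + c i k *\<^sub>R ?p k t0) = ?z i + (\<Sum>k\<in>UNIV. c i k *\<^sub>R ?p k t0)" for i
    by (simp add: sum.distrib C if_distrib[of "\<lambda>x. x *\<^sub>R _"] cong: if_cong)
  ultimately have dS: "(?S i has_vector_derivative (?z i + (\<Sum>k\<in>UNIV. c i k *\<^sub>R ?p k t0))) (at t0)" for i by simp
  have "((\<lambda>t. ?S i t \<bullet> ?S j t) has_real_derivative ?S i t0 \<bullet> (?z j + (\<Sum>k\<in>UNIV. c j k *\<^sub>R ?p k t0))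
      + (?z i + (\<Sum>k\<in>UNIV. c i k *\<^sub>R ?p k t0)) \<bullet> ?S j t0) (at t0)"
    by (rule has_vector_derivative_inner[OF dS dS])
  moreover have "((\<lambda>t. ?S i t \<bullet> ?S j t) has_real_derivative 0) (at t0)"
  proof (rule has_field_derivative_transform_within_open[OF _ assms(1,2)])
    show "((\<lambda>t. if i = j then 1 else 0) has_real_derivative 0) (at t0)" by simp
    fix t assume t: "t \<in> T"
    have "dirderiv (sl t) u0 (A t i) = ?S i t" for i
      unfolding A(2) using lin_sl[OF A(1)[OF t]] by (simp add: linear_sum linear_cmul)
    then show "(if i = j then 1 else 0) = ?S i t \<bullet> ?S j t"
      using adapted_basisD(1)[OF assms(3)[OF t], of i j] by simp
  qed
  ultimately have "0 = ?S i t0 \<bullet> (?z j + (\<Sum>k\<in>UNIV. c j k *\<^sub>R ?p k t0))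
      + (?z i + (\<Sum>k\<in>UNIV. c i k *\<^sub>R ?p k t0)) \<bullet> ?S j t0"
    by (rule DERIV_unique[rotated])
  moreover have "?p i t0 \<bullet> (\<Sum>k\<in>UNIV. c j k *\<^sub>R ?p k t0) = c j i" for i j
    using adapted_basisD(1)[OF ab]
    by (simp add: inner_sum_right if_distrib[of "(*) _"] cong: if_cong)
  ultimately show ?thesis
    unfolding S0 by (simp add: inner_add_left inner_add_right inner_commute[of "\<Sum>k\<in>UNIV. _ k"] inner_commute[of "?z _"])
qed

text \<open>rho squared is the same in every adapted frame, so it may be differentiated along a
  moving one; all terms that depend on the motion of the frame then cancel by
  \<open>variation_algebra\<close>.\<close>

theorem rho_sq_first_variation:
  "((\<lambda>t. (rho_at (sl t) u0)\<^sup>2) has_real_derivative rho_sq_var (sl t0) (vel t0) u0 a b) (at t0)"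
proof -
  obtain T A B C c \<beta>' where T: "open T" "t0 \<in> T" "\<And>t. t \<in> T ==> (t, u0) \<in> \<Omega>"
    and AB: "\<And>t. t \<in> T ==> adapted_basis (sl t) u0 (A t) (B t)"
    and A0: "A t0 = a" and B0: "\<And>\<alpha>. \<alpha> \<in> {CARD('n)+1..<DIM('e)} ==> B t0 \<alpha> = b \<alpha>"
    and AC: "\<And>t i. A t i = (\<Sum>k\<in>UNIV. C i k t *\<^sub>R a k)"
    and C0: "\<And>i k. C i k t0 = (if i = k then (1::real) else 0)"
    and C: "\<And>i k. (C i k has_real_derivative c i k) (at t0)"
    and \<beta>': "\<And>\<alpha>. ((\<lambda>t. B t \<alpha>) has_vector_derivative \<beta>' \<alpha>) (at t0)"
    by (fact frame_derivatives)
  let ?N = "{CARD('n)+1..<DIM('e)}"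
  let ?y = "sl t0" and ?\<zeta> = "vel t0"
  let ?h = "sff ?y u0 a b" and ?T = "tsff ?y u0 a b"
  let ?q = "\<lambda>k l t. dd (sl t) u0 (a k) (a l)"
  let ?q' = "\<lambda>k l. dd ?\<zeta> u0 (a k) (a l)"
  let ?Y = "\<lambda>k. dirderiv ?y u0 (a k)" and ?z = "\<lambda>k. dirderiv ?\<zeta> u0 (a k)"
  have Ck2: "Ck_on 2 {u. (t, u) \<in> \<Omega>} (sl t)" for t by (rule Ck_on_slice)
  have sm: "u0 \<in> {u. (t, u) \<in> \<Omega>}" if "t \<in> T" for t using T(3)[OF that] by simp
  have sffC: "sff (sl t) u0 (A t) (B t) \<alpha> i j = (\<Sum>k\<in>UNIV. \<Sum>l\<in>UNIV. C i k t * (C j l t * (?q k l t \<bullet> B t \<alpha>)))"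
    if "t \<in> T" for t \<alpha> i j
  proof -
    note l1 = linear_dd(1)[OF slice_open[of t] sm[OF that] Ck2]
      and l2 = linear_dd(2)[OF slice_open[of t] sm[OF that] Ck2]
    show ?thesis
      unfolding sff_def AC
      by (simp add: linear_sum[OF l1] linear_sum[OF l2] linear_cmul[OF l1] linear_cmul[OF l2]
          inner_sum_left sum_distrib_left)
  qed
  \<comment> \<open>The derivative of the second fundamental form by the product rule, already
    evaluated with C equal to the identity at t0: two terms from the tangential frame, one from the
    map, one from the normal frame.\<close>
  define hp where "hp \<alpha> i j = (\<Sum>k\<in>UNIV. c i k * ?h \<alpha> k j) + (\<Sum>l\<in>UNIV. c j l * ?h \<alpha> i l)
      + (?q' i j \<bullet> b \<alpha> + ?q i j t0 \<bullet> \<beta>' \<alpha>)" for \<alpha> i j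
  have hder: "((\<lambda>t. sff (sl t) u0 (A t) (B t) \<alpha> i j) has_real_derivative hp \<alpha> i j) (at t0)"
    if "\<alpha> \<in> ?N" for \<alpha> i j
  proof -
    have q: "((\<lambda>t. ?q k l t \<bullet> B t \<alpha>) has_real_derivative ?q k l t0 \<bullet> \<beta>' \<alpha> + ?q' k l \<bullet> B t0 \<alpha>) (at t0)" for k l
      by (rule has_vector_derivative_inner[OF time_derivative(3)[OF z0] \<beta>'])
    have "((\<lambda>t. \<Sum>k\<in>UNIV. \<Sum>l\<in>UNIV. C i k t * (C j l t * (?q k l t \<bullet> B t \<alpha>))) has_real_derivative
        (\<Sum>k\<in>UNIV. \<Sum>l\<in>UNIV. c i k * (C j l t0 * (?q k l t0 \<bullet> B t0 \<alpha>))
          + (c j l * (?q k l t0 \<bullet> B t0 \<alpha>) + (?q k l t0 \<bullet> \<beta>' \<alpha> + ?q' k l \<bullet> B t0 \<alpha>) * C j l t0) * C i k t0)) (at t0)"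
      by (intro DERIV_sum DERIV_mult C q)
    moreover have "(\<Sum>k\<in>UNIV. \<Sum>l\<in>UNIV. c i k * (C j l t0 * (?q k l t0 \<bullet> B t0 \<alpha>))
          + (c j l * (?q k l t0 \<bullet> B t0 \<alpha>) + (?q k l t0 \<bullet> \<beta>' \<alpha> + ?q' k l \<bullet> B t0 \<alpha>) * C j l t0) * C i k t0) = hp \<alpha> i j"
      unfolding hp_def sff_def B0[OF that] C0
      by (simp add: sum.distrib sum_distrib_left[symmetric] sum_distrib_right[symmetric]
          if_distrib[of "\<lambda>x. x * _"] if_distrib[of "(*) _"] sum_if_cond cong: if_cong)
    ultimately have "((\<lambda>t. \<Sum>k\<in>UNIV. \<Sum>l\<in>UNIV. C i k t * (C j l t * (?q k l t \<bullet> B t \<alpha>)))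
        has_real_derivative hp \<alpha> i j) (at t0)" by simp
    then show ?thesis
      by (rule has_field_derivative_transform_within_open[OF _ T(1,2)]) (simp add: sffC)
  qed
  have T0: "tsff (sl t0) u0 (A t0) (B t0) \<alpha> i j = ?T \<alpha> i j" if "\<alpha> \<in> ?N" for \<alpha> i j
    using B0[OF that] by (simp add: tsff_def mean_curv_def sff_def A0)
  have "((\<lambda>t. rho_sq (sl t) u0 (A t) (B t)) has_real_derivative
      (\<Sum>\<alpha>\<in>?N. \<Sum>i\<in>UNIV. \<Sum>j\<in>UNIV. 2 * (?T \<alpha> i j *
        (hp \<alpha> i j - (if i = j then (1 / real CARD('n)) * (\<Sum>k\<in>UNIV. hp \<alpha> k k) else 0))))) (at t0)"
    unfolding rho_sq_def
  proof (intro DERIV_sum)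
    fix \<alpha> and i j :: 'n assume \<alpha>: "\<alpha> \<in> ?N"
    have "((\<lambda>t. tsff (sl t) u0 (A t) (B t) \<alpha> i j) has_real_derivative
        (hp \<alpha> i j - (if i = j then (1 / real CARD('n)) * (\<Sum>k\<in>UNIV. hp \<alpha> k k) else 0))) (at t0)"
      unfolding tsff_def mean_curv_def
      by (cases "i = j") (auto intro!: DERIV_diff DERIV_sum DERIV_cmult DERIV_cdivide hder[OF \<alpha>])
    from DERIV_power[OF this, of 2] T0[OF \<alpha>, of i j]
    show "((\<lambda>t. (tsff (sl t) u0 (A t) (B t) \<alpha> i j)\<^sup>2) has_real_derivative 2 * (?T \<alpha> i j *
        (hp \<alpha> i j - (if i = j then (1 / real CARD('n)) * (\<Sum>k\<in>UNIV. hp \<alpha> k k) else 0)))) (at t0)"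
      by (simp add: mult_ac)
  qed
  \<comment> \<open>The derivative of the mean curvature enters as a multiple of the identity and is
    annihilated by the trace-free form.\<close>
  also have "(\<Sum>\<alpha>\<in>?N. \<Sum>i\<in>UNIV. \<Sum>j\<in>UNIV. 2 * (?T \<alpha> i j *
        (hp \<alpha> i j - (if i = j then (1 / real CARD('n)) * (\<Sum>k\<in>UNIV. hp \<alpha> k k) else 0))))
      = 2 * (\<Sum>\<alpha>\<in>?N. \<Sum>i\<in>UNIV. \<Sum>j\<in>UNIV. ?T \<alpha> i j * hp \<alpha> i j)"
  proof -
    have "(\<Sum>i\<in>UNIV. \<Sum>j\<in>UNIV. ?T \<alpha> i j * (hp \<alpha> i j - (if i = j then H else 0)))
        = (\<Sum>i\<in>UNIV. \<Sum>j\<in>UNIV. ?T \<alpha> i j * hp \<alpha> i j)" for \<alpha> H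
    proof -
      have "(\<Sum>i\<in>UNIV. \<Sum>j\<in>UNIV. ?T \<alpha> i j * (hp \<alpha> i j - (if i = j then H else 0)))
          = (\<Sum>i\<in>UNIV. (\<Sum>j\<in>UNIV. ?T \<alpha> i j * hp \<alpha> i j) - (\<Sum>j\<in>UNIV. if i = j then ?T \<alpha> i i * H else 0))"
        unfolding sum_subtractf[symmetric] by (intro sum.cong refl) (auto simp: algebra_simps)
      then show ?thesis by (simp add: sum_subtractf sum_distrib_right[symmetric] tsff_trace)
    qed
    then show ?thesis by (simp add: sum_distrib_left[symmetric])
  qed
  \<comment> \<open>Here m is the rotation of the normal frame. The term e comes from the position
    component of the second derivative, which is minus the metric, and is therefore
    diagonal.\<close>
  also have "(\<Sum>\<alpha>\<in>?N. \<Sum>i\<in>UNIV. \<Sum>j\<in>UNIV. ?T \<alpha> i j * hp \<alpha> i j)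
      = (\<Sum>\<alpha>\<in>?N. \<Sum>i\<in>UNIV. \<Sum>j\<in>UNIV. ?T \<alpha> i j *
          ((?q' i j - (\<Sum>k\<in>UNIV. (?q i j t0 \<bullet> ?Y k) *\<^sub>R ?z k)) \<bullet> b \<alpha>))
        - (\<Sum>i\<in>UNIV. \<Sum>k\<in>UNIV. (?z i \<bullet> ?Y k + ?z k \<bullet> ?Y i) * (\<Sum>\<alpha>\<in>?N. \<Sum>j\<in>UNIV. ?T \<alpha> i j * ?h \<alpha> k j))"
  proof (rule variation_algebra[where H="mean_curv ?y u0 a b" and c=c and m="\<lambda>\<beta> \<alpha>. b \<beta> \<bullet> \<beta>' \<alpha>"
        and e="\<lambda>\<alpha>. b \<alpha> \<bullet> ?\<zeta> u0"])
    show "?h \<alpha> i j = ?h \<alpha> j i" for \<alpha> i j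
      unfolding sff_def using dirderiv_commute[OF slice_open[of t0] sm[OF T(2)] Ck2] by metis
    show "?T \<alpha> i j = ?h \<alpha> i j - (if i = j then mean_curv ?y u0 a b \<alpha> else 0)" for \<alpha> i j
      by (simp add: tsff_def)
    show "(\<Sum>k\<in>UNIV. ?T \<alpha> k k) = 0" for \<alpha> by (rule tsff_trace)
    show "c i j + c j i = - (?z i \<bullet> ?Y j + ?z j \<bullet> ?Y i)" for i j
      by (rule frame_derivative_tangential[OF T(1,2) AB T(3) AC C0 C])
  next
    fix \<alpha> \<beta> assume \<alpha>: "\<alpha> \<in> ?N" and \<beta>: "\<beta> \<in> ?N"
    have "((\<lambda>t. B t \<alpha> \<bullet> B t \<beta>) has_real_derivative 0) (at t0)"
      by (rule has_field_derivative_transform_within_open[OF DERIV_const T(1,2)])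
        (use adapted_basisD(2)[OF AB \<alpha> \<beta>] in simp)
    from DERIV_unique[OF has_vector_derivative_inner[OF \<beta>' \<beta>'] this]
    show "b \<alpha> \<bullet> \<beta>' \<beta> = - (b \<beta> \<bullet> \<beta>' \<alpha>)"
      by (simp add: B0[OF \<alpha>] B0[OF \<beta>] inner_commute)
  next
    fix \<alpha> and i j :: 'n assume \<alpha>: "\<alpha> \<in> ?N"
    \<comment> \<open>The orthogonality relations of the moving normal frame fix the tangential and
      the position component of its derivative; its normal components stay unknown, apart from being
      antisymmetric.\<close>
    have bY: "\<beta>' \<alpha> \<bullet> ?Y k = - (b \<alpha> \<bullet> ?z k)" for k
    proof -
      have "((\<lambda>t. B t \<alpha> \<bullet> dirderiv (sl t) u0 (a k)) has_real_derivative 0) (at t0)"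
        by (rule has_field_derivative_transform_within_open[OF DERIV_const T(1,2)])
          (use adapted_basisD(4)[OF AB \<alpha>] in simp)
      from DERIV_unique[OF has_vector_derivative_inner[OF \<beta>' time_derivative(2)[OF z0]] this]
      show ?thesis by (simp add: B0[OF \<alpha>])
    qed
    have by0: "\<beta>' \<alpha> \<bullet> ?y u0 = - (b \<alpha> \<bullet> ?\<zeta> u0)"
    proof -
      have "((\<lambda>t. B t \<alpha> \<bullet> sl t u0) has_real_derivative 0) (at t0)"
        by (rule has_field_derivative_transform_within_open[OF DERIV_const T(1,2)])
          (use adapted_basisD(3)[OF AB \<alpha>] in simp)
      from DERIV_unique[OF has_vector_derivative_inner[OF \<beta>' time_derivative(1)[OF z0]] this]
      show ?thesis by (simp add: B0[OF \<alpha>])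
    qed
    have un: "\<And>w. w \<in> {u. (t0, u) \<in> \<Omega>} ==> sl t0 w \<bullet> sl t0 w = 1" using unit by auto
    have y0: "?y u0 \<bullet> dirderiv ?y u0 v = 0" for v
    proof (rule inner_dirderiv_sphere[where y="sl t0", OF slice_open[of t0] sm[OF T(2)] un])
      show "sl t0 differentiable (at u0)" using Ck2[of t0] sm[OF T(2)] by (simp add: numeral_2_eq_2)
    qed
    have qy: "?q i j t0 \<bullet> ?y u0 = - (if i = j then 1 else 0)"
      using inner_dd_sphere[where y="sl t0" and v="a i" and w="a j", OF slice_open[of t0] sm[OF T(2)] un Ck2]
        adapted_basisD(1)[OF ab, of i j]
      by (simp only: inner_commute[of _ "sl t0 u0"])
    \<comment> \<open>Gauss formula: the second derivative is decomposed before it is paired with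
      the derivative of the normal frame, so that every component of the latter can be
      replaced.\<close>
    have q: "?q i j t0 = (\<Sum>k\<in>UNIV. (?q i j t0 \<bullet> ?Y k) *\<^sub>R ?Y k) + (\<Sum>\<beta>\<in>?N. ?h \<beta> i j *\<^sub>R b \<beta>)
        + (?q i j t0 \<bullet> ?y u0) *\<^sub>R ?y u0"
      unfolding sff_def by (rule adapted_basis_expansion[OF dim ab unit[OF z0] y0])
    have "?q i j t0 \<bullet> \<beta>' \<alpha> = (\<Sum>k\<in>UNIV. (?q i j t0 \<bullet> ?Y k) * (\<beta>' \<alpha> \<bullet> ?Y k)) + (\<Sum>\<beta>\<in>?N. ?h \<beta> i j * (b \<beta> \<bullet> \<beta>' \<alpha>))
        + (?q i j t0 \<bullet> ?y u0) * (\<beta>' \<alpha> \<bullet> ?y u0)"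
      by (subst q) (simp add: inner_add_left inner_sum_left inner_commute[of "\<beta>' \<alpha>"])
    also have "\<dots> = - (\<Sum>k\<in>UNIV. (?q i j t0 \<bullet> ?Y k) * (?z k \<bullet> b \<alpha>)) + (\<Sum>\<beta>\<in>?N. ?h \<beta> i j * (b \<beta> \<bullet> \<beta>' \<alpha>))
        + (if i = j then b \<alpha> \<bullet> ?\<zeta> u0 else 0)"
      unfolding bY by0 qy inner_commute[of "b \<alpha>" "?z _"] by (simp add: sum_negf)
    finally show "hp \<alpha> i j = (\<Sum>k\<in>UNIV. c i k * ?h \<alpha> k j) + (\<Sum>l\<in>UNIV. c j l * ?h \<alpha> i l)
        + (?q' i j - (\<Sum>k\<in>UNIV. (?q i j t0 \<bullet> ?Y k) *\<^sub>R ?z k)) \<bullet> b \<alpha>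
        + (\<Sum>\<beta>\<in>?N. ?h \<beta> i j * (b \<beta> \<bullet> \<beta>' \<alpha>)) + (if i = j then b \<alpha> \<bullet> ?\<zeta> u0 else 0)"
      unfolding hp_def by (simp only: inner_diff_left inner_sum_left inner_scaleR_left)
  qed
  finally have "((\<lambda>t. rho_sq (sl t) u0 (A t) (B t)) has_real_derivative rho_sq_var ?y ?\<zeta> u0 a b) (at t0)"
    unfolding rho_sq_var_def .
  then show ?thesis
    by (rule has_field_derivative_transform_within_open[OF _ T(1,2)])
      (simp add: rho_at_sl[OF T(3) AB] rho_sq_nonneg)
qed

text \<open>The area density is the inverse of the absolute determinant of an orthonormal frame. The
  frame at time t is the initial one multiplied by a matrix M that is the identity at t0, so its
  determinant has derivative tr c, and the diagonal of c is given by the derivative of the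
  metric.\<close>

theorem area_first_variation:
  "((\<lambda>t. sqrt (det (gram (sl t) u0))) has_real_derivative
    sqrt (det (gram (sl t0) u0)) * area_var (sl t0) (vel t0) u0 a) (at t0)"
proof -
  obtain T A B C c \<beta>' where T: "open T" "t0 \<in> T" "\<And>t. t \<in> T ==> (t, u0) \<in> \<Omega>"
    and AB: "\<And>t. t \<in> T ==> adapted_basis (sl t) u0 (A t) (B t)"
    and A0: "A t0 = a" and B0: "\<And>\<alpha>. \<alpha> \<in> {CARD('n)+1..<DIM('e)} ==> B t0 \<alpha> = b \<alpha>"
    and AC: "\<And>t i. A t i = (\<Sum>k\<in>UNIV. C i k t *\<^sub>R a k)"
    and C0: "\<And>i k. C i k t0 = (if i = k then (1::real) else 0)"
    and C: "\<And>i k. (C i k has_real_derivative c i k) (at t0)"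
    and \<beta>': "\<And>\<alpha>. ((\<lambda>t. B t \<alpha>) has_vector_derivative \<beta>' \<alpha>) (at t0)"
    by (fact frame_derivatives)
  define M where "M t = (\<chi> i k. C i k t)" for t
  have M0: "M t0 = mat 1" by (simp add: M_def C0 mat_def vec_eq_iff)
  have dM: "((\<lambda>t. det (M t)) has_real_derivative (\<Sum>i\<in>UNIV. c i i)) (at t0)"
    by (rule has_derivative_det_at_id) (simp_all add: M_def C M0[unfolded M_def])
  have LM: "(\<chi> i. A t i) = M t ** (\<chi> i. a i)" for t
    by (simp add: vec_eq_iff matrix_matrix_mult_def M_def AC)
  have sq: "sqrt g = inverse \<bar>d\<bar>" if "g * d\<^sup>2 = 1" for g d :: real
  proof -
    have "d \<noteq> 0" using that by auto
    then have "g = (inverse d)\<^sup>2" using that by (simp add: field_simps power2_eq_square)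
    then show ?thesis by simp
  qed
  have G: "sqrt (det (gram (sl t) u0)) = inverse \<bar>det (M t)\<bar> * inverse \<bar>det (\<chi> i. a i)\<bar>" if "t \<in> T" for t
    using sq[OF det_gram_frame[OF lin_sl[OF T(3)[OF that]] adapted_basisD(1)[OF AB[OF that]]]]
    by (simp add: LM det_mul abs_mult)
  have "isCont (\<lambda>t. det (M t)) t0" using dM DERIV_isCont by blast
  moreover have "det (M t0) > 0" by (simp add: M0)
  ultimately have "\<forall>\<^sub>F t in nhds t0. det (M t) > 0"
    using tendsto_nhds_iff order_tendstoD(1)[of "\<lambda>t. det (M t)"]
    by (metis isCont_def)
  then obtain T' where T': "open T'" "t0 \<in> T'" "\<And>t. t \<in> T' ==> det (M t) > 0"
    by (auto simp: eventually_nhds)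
  have "((\<lambda>t. inverse (det (M t)) * inverse \<bar>det (\<chi> i. a i)\<bar>) has_real_derivative
      - (inverse (det (M t0)) * (\<Sum>i\<in>UNIV. c i i) * inverse (det (M t0))) * inverse \<bar>det (\<chi> i. a i)\<bar>) (at t0)"
    using M0 by (intro DERIV_cmult_right DERIV_inverse' dM) simp
  moreover have "(\<Sum>i\<in>UNIV. c i i) = - area_var (sl t0) (vel t0) u0 a"
  proof -
    have "c i i = - (dirderiv (vel t0) u0 (a i) \<bullet> dirderiv (sl t0) u0 (a i))" for i
      using frame_derivative_tangential[OF T(1,2) AB T(3) AC C0 C, of i i] by simp
    then show ?thesis by (simp add: area_var_def sum_negf)
  qed
  ultimately have "((\<lambda>t. inverse (det (M t)) * inverse \<bar>det (\<chi> i. a i)\<bar>) has_real_derivative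
      sqrt (det (gram (sl t0) u0)) * area_var (sl t0) (vel t0) u0 a) (at t0)"
    unfolding G[OF T(2)] by (simp add: M0 mult.commute)
  then show ?thesis
    by (rule has_field_derivative_transform_within_open[where S="T \<inter> T'"])
      (use T T' in \<open>auto simp: G T'(3)[THEN abs_of_pos]\<close>)
qed

end

end

section \<open>The Willmore density\<close>

definition dens :: "(real ^ 'n::finite => 'e::euclidean_space) => real ^ 'n => real"
  where "dens y u = rho_at y u ^ CARD('n) * sqrt (det (gram y u))"

definition dens_var ::
    "(real ^ 'n::finite => 'e::euclidean_space) => (real ^ 'n => 'e) => real ^ 'n
      => ('n => real ^ 'n) => (nat => 'e) => real"
  where "dens_var y \<zeta> u a b = sqrt (det (gram y u)) *
    ((real CARD('n) / 2) * rho_at y u ^ (CARD('n) - 2) * rho_sq_var y \<zeta> u a b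
      + rho_at y u ^ CARD('n) * area_var y \<zeta> u a)"

lemma Ck_on_det:
  fixes M :: "'a::real_normed_vector => real ^ 'n ^ 'n::finite"
  assumes "open S" "\<And>i j. Ck_on k S (\<lambda>z. M z $ i $ j)"
  shows "Ck_on k S (\<lambda>z. det (M z))"
  unfolding det_def using assms by (intro Ck_on_sum Ck_on_mult Ck_on_const Ck_on_prod) auto

text \<open>Where r vanishes it need not be differentiable, only its square is; hence the detour
  through powers of the square root. The case n = 2 is the hypothesis itself and is separate because
  the square root rule needs an exponent of at least 3.\<close>

lemma power_nonneg_first_variation:
  assumes s: "((\<lambda>t. (r t)\<^sup>2) has_real_derivative s') (at t0)"
    and T: "open T" "t0 \<in> T" "\<And>t. t \<in> T ==> r t \<ge> (0::real)" and n: "n \<ge> 2"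
  shows "((\<lambda>t. r t ^ n) has_real_derivative (real n / 2) * r t0 ^ (n - 2) * s') (at t0)"
proof (cases "n = 2")
  case True
  then show ?thesis using s by simp
next
  case False
  then have "((\<lambda>s. sqrt s ^ n) has_real_derivative (real n / 2) * sqrt ((r t0)\<^sup>2) ^ (n - 2)) (at ((r t0)\<^sup>2))"
    using n by (intro has_real_derivative_sqrt_power) auto
  from DERIV_chain2[OF this s]
  have "((\<lambda>t. sqrt ((r t)\<^sup>2) ^ n) has_real_derivative (real n / 2) * sqrt ((r t0)\<^sup>2) ^ (n - 2) * s') (at t0)" .
  then show ?thesis
    unfolding real_sqrt_abs abs_of_nonneg[OF T(3)[OF T(2)]]
    by (rule has_field_derivative_transform_within_open[OF _ T(1,2)]) (simp add: T(3))
qed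

context sphere_family
begin

text \<open>\<open>rho_at\<close> is known to be nonnegative only where an adapted basis exists; the
  frame extension supplies bases for all times near t0.\<close>

lemma rho_at_nonneg_near:
  assumes "(t0, u0) \<in> \<Omega>" "adapted_basis (sl t0) u0 a b"
  shows "\<exists>T. open T \<and> t0 \<in> T \<and> (\<forall>t\<in>T. rho_at (sl t) u0 \<ge> 0)"
proof -
  obtain \<Omega>' A B where \<Omega>': "open \<Omega>'" "(t0, u0) \<in> \<Omega>'" "\<Omega>' \<subseteq> \<Omega>"
    and AB: "\<forall>t u. (t, u) \<in> \<Omega>' \<longrightarrow> adapted_basis (sl t) u (A (t, u)) (B (t, u))"
    using adapted_frame_extension[OF open_dom assms(1) smooth unit assms(2)] by blast
  have "open ((\<lambda>t. (t, u0)) -` \<Omega>')" by (rule open_vimage[OF \<Omega>'(1)]) (intro continuous_intros)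
  moreover have "rho_at (sl t) u0 \<ge> 0" if "(t, u0) \<in> \<Omega>'" for t
    using rho_at_sl[of t u0 "A (t, u0)" "B (t, u0)"] AB that \<Omega>'(3) by (auto simp: rho_sq_nonneg)
  ultimately show ?thesis using \<Omega>'(2) by (intro exI[of _ "(\<lambda>t. (t, u0)) -` \<Omega>'"]) auto
qed

theorem dens_first_variation:
  assumes "(t0, u0) \<in> \<Omega>" "adapted_basis (sl t0) u0 a b" "CARD('n) \<ge> 2"
  shows "((\<lambda>t. dens (sl t) u0) has_real_derivative dens_var (sl t0) (vel t0) u0 a b) (at t0)"
proof -
  obtain T where T: "open T" "t0 \<in> T" "\<And>t. t \<in> T ==> rho_at (sl t) u0 \<ge> 0"
    using rho_at_nonneg_near[OF assms(1,2)] by blast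
  note p = power_nonneg_first_variation[OF rho_sq_first_variation[OF assms(1,2)] T assms(3)]
  have alg: "c * p * q * s + s * ar * N = s * (c * p * q + N * ar)" for c p q s ar N :: real
    by (simp add: distrib_left mult_ac)
  show ?thesis
    unfolding dens_def dens_var_def
    by (rule DERIV_cong[OF DERIV_mult[OF p area_first_variation[OF assms(1,2)]] alg])
qed

text \<open>\<open>dens_var\<close> depends on bases chosen pointwise. With a frame that is smooth
  in (t, u) it becomes continuous in both variables, which gives the bound for differentiation under
  the integral and the continuity of \<open>lam\<close>.\<close>

lemma dens_var_continuous:
  assumes z0: "(t0, u0) \<in> \<Omega>" and ab: "adapted_basis (sl t0) u0 a b"
  shows "\<exists>\<Omega>' A B. open \<Omega>' \<and> (t0, u0) \<in> \<Omega>' \<and> \<Omega>' \<subseteq> \<Omega> \<and>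
    (\<forall>t u. (t, u) \<in> \<Omega>' \<longrightarrow> adapted_basis (sl t) u (A (t, u)) (B (t, u))) \<and>
    continuous_on \<Omega>' (\<lambda>z. dens_var (sl (fst z)) (vel (fst z)) (snd z) (A z) (B z))"
proof -
  obtain \<Omega>' A B where \<Omega>': "open \<Omega>'" "(t0, u0) \<in> \<Omega>'" "\<Omega>' \<subseteq> \<Omega>"
    and A: "\<forall>i. smooth_on \<Omega>' (\<lambda>z. A z i)" and B: "\<forall>\<alpha>. smooth_on \<Omega>' (\<lambda>z. B z \<alpha>)"
    and AB: "\<forall>t u. (t, u) \<in> \<Omega>' \<longrightarrow> adapted_basis (sl t) u (A (t, u)) (B (t, u))"
    using adapted_frame_extension[OF open_dom z0 smooth unit ab] by blast
  have Y: "Ck_on k \<Omega>' Y" for k by (rule Ck_on_subset[OF CkY \<Omega>'(3)])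
  have As: "Ck_on k \<Omega>' (\<lambda>z. A z i)" and Bs: "Ck_on k \<Omega>' (\<lambda>z. B z \<alpha>)" for k i \<alpha>
    using A B by (auto simp: smooth_on_def)
  have A0: "Ck_on k \<Omega>' (\<lambda>z. (0, A z i))" for k i
    by (intro Ck_on_Pair Ck_on_const As \<Omega>')
  have eq: "dirderiv (sl (fst z)) (snd z) v = dirderiv Y z (0, v)"
    "dd (sl (fst z)) (snd z) v w = dd Y z (0, v) (0, w)"
    "dirderiv (vel (fst z)) (snd z) v = dd Y z (1, 0) (0, v)"
    "dd (vel (fst z)) (snd z) v w = dirderiv (\<lambda>z. dd Y z (1, 0) (0, v)) z (0, w)" if "z \<in> \<Omega>'" for z v w
    using that \<Omega>'(3) sl_dirderiv[of "fst z" "snd z"] sl_dd[of "fst z" "snd z"]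
      vel_dirderiv[of "fst z" "snd z"] vel_dd[of "fst z" "snd z"] by auto
  have eqA: "continuous_on \<Omega>' (\<lambda>z. dirderiv (sl (fst z)) (snd z) (A z i))" for i
    by (rule Ck_on_continuous[of 0], rule Ck_on_cong[OF \<Omega>'(1) Ck_on_dirderiv[OF \<Omega>'(1) Y A0]])
      (simp add: eq)
  have c1: "continuous_on \<Omega>' (\<lambda>z. dd (sl (fst z)) (snd z) (A z i) (A z j))" for i j
    by (rule Ck_on_continuous[of 0], rule Ck_on_cong[OF \<Omega>'(1) Ck_on_dd[OF \<Omega>'(1) Y A0 A0]])
      (simp add: eq)
  have c2: "continuous_on \<Omega>' (\<lambda>z. dirderiv (vel (fst z)) (snd z) (A z i))" for i
  proof (rule Ck_on_continuous[of 0], rule Ck_on_cong[OF \<Omega>'(1) Ck_on_dirderiv[OF \<Omega>'(1) _ A0]])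
    show "Ck_on (Suc 0) \<Omega>' (\<lambda>z. dirderiv Y z (1, 0))" using Y[of "Suc (Suc 0)"] by simp
  qed (simp add: eq)
  have c3: "continuous_on \<Omega>' (\<lambda>z. dd (vel (fst z)) (snd z) (A z i) (A z j))" for i j
  proof (rule Ck_on_continuous[of 0], rule Ck_on_cong[OF \<Omega>'(1) Ck_on_dd[OF \<Omega>'(1) _ A0 A0]])
    show "Ck_on (Suc (Suc 0)) \<Omega>' (\<lambda>z. dirderiv Y z (1, 0))"
      using Y[of "Suc (Suc (Suc 0))"] by (simp only: Ck_on.simps(2)[of "Suc (Suc 0)" \<Omega>' Y])
  qed (simp add: eq)
  have cB: "continuous_on \<Omega>' (\<lambda>z. B z \<alpha>)" for \<alpha> by (rule Ck_on_continuous[OF Bs])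
  have cs: "continuous_on \<Omega>' (\<lambda>z. sff (sl (fst z)) (snd z) (A z) (B z) \<alpha> i j)" for \<alpha> i j
    unfolding sff_def by (intro continuous_intros c1 cB)
  have ct: "continuous_on \<Omega>' (\<lambda>z. tsff (sl (fst z)) (snd z) (A z) (B z) \<alpha> i j)" for \<alpha> i j
    unfolding tsff_def mean_curv_def
    by (cases "i = j") (auto intro!: continuous_intros cs)
  have cr: "continuous_on \<Omega>' (\<lambda>z. rho_at (sl (fst z)) (snd z))"
  proof -
    have "continuous_on \<Omega>' (\<lambda>z. sqrt (rho_sq (sl (fst z)) (snd z) (A z) (B z)))"
      unfolding rho_sq_def by (intro continuous_intros ct)
    then show ?thesis
    proof (rule continuous_on_eq)
      fix z assume "z \<in> \<Omega>'"
      then show "sqrt (rho_sq (sl (fst z)) (snd z) (A z) (B z)) = rho_at (sl (fst z)) (snd z)"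
        using rho_at_sl[of "fst z" "snd z" "A z" "B z"] AB \<Omega>'(3)
        by (metis prod.collapse subsetD)
    qed
  qed
  have cg: "continuous_on \<Omega>' (\<lambda>z. det (gram (sl (fst z)) (snd z)))"
  proof (rule Ck_on_continuous[of 0], rule Ck_on_cong[OF \<Omega>'(1)])
    show "Ck_on 0 \<Omega>' (\<lambda>z. det (\<chi> i j. dirderiv Y z (0, axis i 1) \<bullet> dirderiv Y z (0, axis j 1)))"
      using Y[of "Suc 0"] by (intro Ck_on_det \<Omega>') (simp add: continuous_on_inner)
  qed (simp add: gram_def eq)
  have "continuous_on \<Omega>' (\<lambda>z. dens_var (sl (fst z)) (vel (fst z)) (snd z) (A z) (B z))"
    unfolding dens_var_def rho_sq_var_def area_var_def
    by (intro continuous_intros cg cr ct cs cB eqA c1 c2 c3)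
  then show ?thesis using \<Omega>' AB by blast
qed

end

locale sphere_patch =
  fixes U :: "(real ^ 'n::finite) set" and y :: "real ^ 'n => 'e::euclidean_space"
  assumes open_U: "open U" and smooth_y: "smooth_on U y"
    and unit_y: "u \<in> U ==> y u \<bullet> y u = 1" and inj_y: "u \<in> U ==> inj (dirderiv y u)"
    and dim_y: "CARD('n) < DIM('e)"
begin

lemma Ck_y: "Ck_on k U y" using smooth_y by (simp add: smooth_on_def)

lemma diff_y: "u \<in> U ==> y differentiable (at u)" using Ck_y[of "Suc 0"] by simp

lemma lin_y: "u \<in> U ==> linear (dirderiv y u)" by (rule linear_dirderiv[OF diff_y])

lemma ab_ex: "u \<in> U ==> \<exists>a b. adapted_basis y u a b"
  by (rule adapted_basis_ex[OF lin_y inj_y])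

lemma rho_at_y:
  assumes "u \<in> U" "adapted_basis y u a b"
  shows "rho_at y u = sqrt (rho_sq y u a b)" "rho_at y u = rho_basis y u a b"
  using rho_at_eq[OF dim_y open_U assms(1) Ck_y unit_y assms(2)] rho_basis_eq[OF assms(2)] by auto

lemma rho_at_y_nonneg: "u \<in> U ==> rho_at y u \<ge> 0"
proof -
  assume u: "u \<in> U"
  then obtain a b where "adapted_basis y u a b" using ab_ex by blast
  from rho_at_y(1)[OF u this] show ?thesis by (simp add: rho_sq_nonneg)
qed

lemma det_gram_y: "u \<in> U ==> det (gram y u) > 0"
  using det_gram_pos[OF lin_y] ab_ex by blast

text \<open>The frame extension applied to the family that does not depend on time, restricted to
  the slice t = 0.\<close>

lemma local_frame_ex:
  assumes "u0 \<in> U"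
  shows "\<exists>V e \<nu>. u0 \<in> V \<and> V \<subseteq> U \<and> adapted_frame y V e \<nu>"
proof -
  obtain a b where ab: "adapted_basis y u0 a b" using ab_ex[OF assms] by blast
  have o: "open (UNIV \<times> U :: (real \<times> _) set)" by (intro open_Times open_UNIV open_U)
  have sm: "smooth_on (UNIV \<times> U :: (real \<times> _) set) (\<lambda>z. y (snd z))"
    unfolding smooth_on_def
    by (intro allI Ck_on_compose[OF o open_U _ Ck_y Ck_on_snd]) auto
  have ab': "adapted_basis (\<lambda>u. y (snd (0::real, u))) u0 a b" using ab by simp
  obtain \<Omega>' A B where \<Omega>': "open \<Omega>'" "(0::real, u0) \<in> \<Omega>'" "\<Omega>' \<subseteq> UNIV \<times> U"
    and A: "\<forall>i. smooth_on \<Omega>' (\<lambda>z. A z i)" and B: "\<forall>\<alpha>. smooth_on \<Omega>' (\<lambda>z. B z \<alpha>)"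
    and AB: "\<forall>t u. (t, u) \<in> \<Omega>' \<longrightarrow> adapted_basis (\<lambda>u. y (snd (t, u))) u (A (t, u)) (B (t, u))"
    using adapted_frame_extension[OF o _ sm _ ab'] assms unit_y by auto
  let ?V = "(\<lambda>u. (0::real, u)) -` \<Omega>'"
  have oV: "open ?V" by (rule open_vimage[OF \<Omega>'(1)]) (intro continuous_intros)
  have p: "Ck_on k ?V (\<lambda>u. (0::real, u))" for k by (intro Ck_on_Pair oV Ck_on_const Ck_on_id)
  have "adapted_frame y ?V (\<lambda>u. A (0, u)) (\<lambda>u. B (0, u))"
    unfolding adapted_frame_def smooth_on_def
  proof (intro conjI allI ballI oV)
    show "Ck_on k ?V (\<lambda>u. A (0, u) i)" for k i
      by (rule Ck_on_compose[OF oV \<Omega>'(1) _ _ p]) (use A in \<open>auto simp: smooth_on_def\<close>)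
    show "Ck_on k ?V (\<lambda>u. B (0, u) \<alpha>)" for k \<alpha>
      by (rule Ck_on_compose[OF oV \<Omega>'(1) _ _ p]) (use B in \<open>auto simp: smooth_on_def\<close>)
    show "adapted_basis y u (A (0, u)) (B (0, u))" if "u \<in> ?V" for u using AB that by auto
  qed
  then show ?thesis using \<Omega>' by (intro exI[of _ ?V]) auto
qed

lemma Ck_on_frame:
  assumes fr: "adapted_frame y V e \<nu>" and V: "V \<subseteq> U"
  shows "open V" "Ck_on k V (\<lambda>w. e w i)"
    "\<alpha> \<in> {CARD('n)+1..<DIM('e)} ==> Ck_on k V (\<lambda>w. \<nu> w \<alpha>)"
    "w \<in> V ==> adapted_basis y w (e w) (\<nu> w)"
    "\<alpha> \<in> {CARD('n)+1..<DIM('e)} ==> Ck_on k V (\<lambda>w. sff y w (e w) (\<nu> w) \<alpha> i j)"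
    "\<alpha> \<in> {CARD('n)+1..<DIM('e)} ==> Ck_on k V (\<lambda>w. mean_curv y w (e w) (\<nu> w) \<alpha>)"
    "\<alpha> \<in> {CARD('n)+1..<DIM('e)} ==> Ck_on k V (\<lambda>w. tsff y w (e w) (\<nu> w) \<alpha> i j)"
    "Ck_on k V (\<lambda>w. rho_sq y w (e w) (\<nu> w))"
proof -
  show o: "open V" and e: "\<And>i. Ck_on k V (\<lambda>w. e w i)"
    and n: "\<And>\<alpha>. \<alpha> \<in> {CARD('n)+1..<DIM('e)} ==> Ck_on k V (\<lambda>w. \<nu> w \<alpha>)"
    and "w \<in> V ==> adapted_basis y w (e w) (\<nu> w)"
    using fr by (auto simp: adapted_frame_def smooth_on_def)
  show s: "Ck_on k V (\<lambda>w. sff y w (e w) (\<nu> w) \<alpha> i j)" if "\<alpha> \<in> {CARD('n)+1..<DIM('e)}" for \<alpha> i j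
    unfolding sff_def by (intro Ck_on_inner Ck_on_dd o Ck_on_subset[OF Ck_y V] e n that)
  show m: "Ck_on k V (\<lambda>w. mean_curv y w (e w) (\<nu> w) \<alpha>)" if "\<alpha> \<in> {CARD('n)+1..<DIM('e)}" for \<alpha>
    unfolding mean_curv_def by (intro Ck_on_mult Ck_on_const Ck_on_sum o s that)
  show t: "Ck_on k V (\<lambda>w. tsff y w (e w) (\<nu> w) \<alpha> i j)" if "\<alpha> \<in> {CARD('n)+1..<DIM('e)}" for \<alpha> i j
  proof -
    have "Ck_on k V (\<lambda>w. if i = j then mean_curv y w (e w) (\<nu> w) \<alpha> else 0)"
      using m[OF that] by (cases "i = j") (simp_all add: Ck_on_const)
    then show ?thesis unfolding tsff_def by (intro Ck_on_diff o s that)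
  qed
  show "Ck_on k V (\<lambda>w. rho_sq y w (e w) (\<nu> w))"
    unfolding rho_sq_def by (intro Ck_on_sum Ck_on_power o t)
qed

text \<open>In a local frame rho squared is a polynomial in smooth components, so it is smooth even
  where rho itself has a corner.\<close>

lemma Ck_on_rho_at_sq: "Ck_on k U (\<lambda>w. (rho_at y w)\<^sup>2)"
proof (rule Ck_on_local)
  fix u assume "u \<in> U"
  then obtain V e \<nu> where V: "u \<in> V" "V \<subseteq> U" "adapted_frame y V e \<nu>"
    using local_frame_ex by blast
  note f = Ck_on_frame[OF V(3,2)]
  have "rho_sq y w (e w) (\<nu> w) = (rho_at y w)\<^sup>2" if "w \<in> V" for w
    using rho_at_y(1)[OF subsetD[OF V(2) that] f(4)[OF that]] by (simp add: rho_sq_nonneg)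
  then have "Ck_on k V (\<lambda>w. (rho_at y w)\<^sup>2)"
    by (rule Ck_on_cong[OF f(1) f(8)])
  then show "\<exists>T. open T \<and> u \<in> T \<and> Ck_on k T (\<lambda>w. (rho_at y w)\<^sup>2)" using f(1) V by blast
qed

lemma Ck_on_sqrt_det_gram: "Ck_on k U (\<lambda>w. sqrt (det (gram y w)))"
proof (intro Ck_on_sqrt Ck_on_det open_U)
  show "Ck_on k U (\<lambda>w. gram y w $ i $ j)" for i j
    using Ck_y[of "Suc k"] by (auto simp: gram_def intro: Ck_on_inner open_U)
qed (rule det_gram_y)

lemma surj_of_det:
  fixes f :: "real ^ 'n => real ^ 'n"
  assumes "linear f" "det (matrix f) \<noteq> 0"
  shows "surj f"
proof -
  have "invertible (matrix f)" using assms(2) by (simp add: invertible_det_nz)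
  then obtain B where B: "matrix f ** B = mat 1" by (auto simp: invertible_def)
  have "f (B *v w) = w" for w
    using B matrix_works[OF linear_matrix_vector_mul_eq[THEN iffD2, OF assms(1)], of "B *v w"]
    by (simp add: matrix_vector_mul_assoc)
  then show ?thesis by (metis surjI)
qed

text \<open>Moving along the tangential field \<open>dy(v)\<close> amounts, to first order, to composing with the
  diffeomorphism \<open>u + t v(u)\<close>.\<close>

lemma tangential_variation:
  fixes v :: "real ^ 'n => real ^ 'n"
  assumes W: "open W" "W \<subseteq> U" and v: "smooth_on W v" and u0: "u0 \<in> W" and ab: "adapted_basis y u0 a b"
  shows "rho_sq_var y (\<lambda>w. dirderiv y w (v w)) u0 a b = dirderiv (\<lambda>w. (rho_at y w)\<^sup>2) u0 (v u0)"
    and "sqrt (det (gram y u0)) * area_var y (\<lambda>w. dirderiv y w (v w)) u0 a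
      = dirderiv (\<lambda>w. sqrt (det (gram y w))) u0 (v u0)
        + sqrt (det (gram y u0)) * (\<Sum>i\<in>UNIV. dirderiv v u0 (axis i 1) $ i)"
proof -
  have vk: "Ck_on k W v" for k using v by (simp add: smooth_on_def)
  have dv: "v differentiable (at u)" if "u \<in> W" for u using vk[of "Suc 0"] that by simp
  define \<phi> where "\<phi> t u = u + t *\<^sub>R v u" for t and u :: "real ^ 'n"
  let ?O = "UNIV \<times> W :: (real \<times> (real ^ 'n)) set"
  have oO: "open ?O" by (intro open_Times open_UNIV W)
  have p: "Ck_on k ?O (\<lambda>z. \<phi> (fst z) (snd z))" for k
    unfolding \<phi>_def
    by (intro Ck_on_add Ck_on_scaleR Ck_on_compose[OF oO W(1) _ vk] oO Ck_on_fst Ck_on_snd) auto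
  \<comment> \<open>The moved point may leave U, and how soon it does depends on u; the pairs for
    which it stays in U form an open set containing {0} x W.\<close>
  define \<Omega> where "\<Omega> = ?O \<inter> (\<lambda>z. \<phi> (fst z) (snd z)) -` U"
  have o: "open \<Omega>"
    unfolding \<Omega>_def using Ck_on_continuous[OF p[of 0]] by (rule continuous_open_preimage[OF _ oO open_U])
  define Y where "Y z = y (\<phi> (fst z) (snd z))" for z
  have Ysm: "smooth_on \<Omega> Y"
    unfolding smooth_on_def Y_def[abs_def]
    by (intro allI Ck_on_compose[OF o open_U _ Ck_y Ck_on_subset[OF p]]) (auto simp: \<Omega>_def)
  interpret F: sphere_family \<Omega> Y
    by unfold_locales (use o Ysm unit_y dim_y in \<open>auto simp: \<Omega>_def Y_def\<close>)
  have Om0: "(0, u) \<in> \<Omega>" if "u \<in> W" for u using that W by (auto simp: \<Omega>_def \<phi>_def)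
  have sl0: "F.sl 0 = y" by (simp add: Y_def \<phi>_def)
  have hd\<phi>t: "((\<lambda>t. \<phi> t u) has_vector_derivative v u) (at t)" for t u
    unfolding \<phi>_def by (auto intro!: derivative_eq_intros)
  have vel0: "F.vel 0 u = dirderiv y u (v u)" if "u \<in> W" for u
  proof -
    have "((\<lambda>t. y (\<phi> t u)) has_vector_derivative dirderiv y u (v u)) (at 0)"
    proof -
      have "((\<lambda>t. y (\<phi> t u)) has_derivative (\<lambda>h. dirderiv y u (h *\<^sub>R v u))) (at 0)"
        by (rule has_derivative_compose[OF hd\<phi>t[unfolded has_vector_derivative_def], of y])
          (use has_derivative_dirderiv[OF diff_y] that W in \<open>auto simp: \<phi>_def\<close>)
      then show ?thesis
        using linear_cmul[OF lin_y] that W by (simp add: has_vector_derivative_def subset_eq)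
    qed
    moreover have "((\<lambda>t. Y (t, u)) has_vector_derivative F.vel 0 u) (at 0)"
      by (rule F.time_derivative(1)[OF Om0[OF that]])
    ultimately show ?thesis unfolding Y_def using vector_derivative_unique_at by fastforce
  qed
  have dvel: "dirderiv (F.vel 0) u w = dirderiv (\<lambda>w. dirderiv y w (v w)) u w" if "u \<in> W" for u w
    by (rule dirderiv_cong_open[OF W(1) that vel0])
  have ddvel: "dd (F.vel 0) u0 w w' = dd (\<lambda>w. dirderiv y w (v w)) u0 w w'" for w w'
    by (rule dirderiv_cong_open[OF W(1) u0 dvel])
  have ab0: "adapted_basis (F.sl 0) u0 a b" using ab by (simp add: sl0)
  define Dp where "Dp t = matrix (dirderiv (\<phi> t) u0)" for t
  have hd\<phi>: "(\<phi> t has_derivative (\<lambda>w. w + t *\<^sub>R dirderiv v u0 w)) (at u0)" for t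
    unfolding \<phi>_def
    by (intro has_derivative_add has_derivative_ident has_derivative_scaleR_right has_derivative_dirderiv dv u0)
  have Dpe: "Dp t $ i $ j = (if i = j then 1 else 0) + t * (dirderiv v u0 (axis j 1) $ i)" for t i j
    using dirderiv_eqI[OF hd\<phi>] by (simp add: Dp_def matrix_def axis_def)
  have Dp0: "Dp 0 = mat 1" by (simp add: vec_eq_iff Dpe mat_def)
  have dDp: "((\<lambda>t. det (Dp t)) has_real_derivative (\<Sum>i\<in>UNIV. dirderiv v u0 (axis i 1) $ i)) (at 0)"
    by (rule has_derivative_det_at_id[where C=Dp, OF _ Dp0]) (auto simp: Dpe intro!: derivative_eq_intros)
  have "isCont (\<lambda>t. det (Dp t)) 0" using dDp DERIV_isCont by blast
  then have "((\<lambda>t. det (Dp t)) \<longlongrightarrow> det (Dp 0)) (nhds 0)"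
    using tendsto_at_iff_tendsto_nhds[of "\<lambda>t. det (Dp t)" 0] by (simp add: isCont_def)
  then have "\<forall>\<^sub>F t in nhds 0. det (Dp t) > 0"
    by (rule order_tendstoD(1)) (simp add: Dp0)
  then obtain T1 where T1: "open T1" "0 \<in> T1" "\<And>t. t \<in> T1 ==> det (Dp t) > 0"
    by (auto simp: eventually_nhds)
  \<comment> \<open>Times at which the moved point stays in U and the Jacobian of the moved
    coordinates is positive, so that the slice is y after an invertible change of
    coordinates.\<close>
  define T where "T = T1 \<inter> {t. (t, u0) \<in> \<Omega>}"
  have T: "open T" "0 \<in> T" using T1 F.time_open[of u0] Om0[OF u0] by (auto simp: T_def)
  let ?S = "\<lambda>t. W \<inter> {u. (t, u) \<in> \<Omega>}"
  have S: "open (?S t)" for t using W(1) F.slice_open by blast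
  have \<phi>2: "Ck_on 2 (?S t) (\<phi> t)" for t
  proof -
    have "Ck_on 2 W (\<lambda>u. u + t *\<^sub>R v u)"
      by (intro Ck_on_add Ck_on_scaleR Ck_on_const Ck_on_id vk W)
    then show ?thesis unfolding \<phi>_def[abs_def] by (rule Ck_on_subset) auto
  qed
  \<comment> \<open>rho does not change under reparametrisation and the Gram determinant changes by
    the square of the Jacobian; both functions of t are thus functions of y along the curve t |->
    \<phi> t u0.\<close>
  have rt: "rho_at (F.sl t) u0 = rho_at y (\<phi> t u0)" and gt: "det (gram (F.sl t) u0) = det (gram y (\<phi> t u0)) * (det (Dp t))\<^sup>2"
    if "t \<in> T" for t
  proof -
    have tu: "(t, u0) \<in> \<Omega>" "u0 \<in> ?S t" "det (Dp t) \<noteq> 0" "\<phi> t u0 \<in> U"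
      using that u0 T1(3)[of t] by (auto simp: T_def \<Omega>_def)
    have lin\<phi>: "linear (dirderiv (\<phi> t) u0)"
      using hd\<phi> by (intro linear_dirderiv) (auto simp: differentiable_def)
    have surj: "surj (dirderiv (\<phi> t) u0)"
      by (rule surj_of_det[OF lin\<phi>]) (use tu in \<open>simp add: Dp_def\<close>)
    have chain: "dirderiv (F.sl t) u0 w = dirderiv y (\<phi> t u0) (dirderiv (\<phi> t) u0 w)" for w
    proof -
      have "((\<lambda>u. y (\<phi> t u)) has_derivative (\<lambda>w. dirderiv y (\<phi> t u0) (dirderiv (\<phi> t) u0 w))) (at u0)"
        by (rule has_derivative_compose[OF has_derivative_dirderiv[of "\<phi> t" u0] has_derivative_dirderiv[OF diff_y[OF tu(4)]]])
          (use hd\<phi> in \<open>auto simp: differentiable_def\<close>)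
      from dirderiv_eqI[OF this] show ?thesis by (simp add: Y_def)
    qed
    show "det (gram (F.sl t) u0) = det (gram y (\<phi> t u0)) * (det (Dp t))\<^sup>2"
      unfolding Dp_def by (rule det_gram_compose[OF lin_y[OF tu(4)] lin\<phi> chain])
    have "inj (dirderiv (F.sl t) u0)"
      by (rule det_gram_pos_imp_inj[OF F.lin_sl[OF tu(1)]])
        (use det_gram_y[OF tu(4)] tu(3) in \<open>simp add: \<open>det (gram (F.sl t) u0) = _\<close>\<close>)
    then obtain a' b' where ab': "adapted_basis (F.sl t) u0 a' b'"
      using adapted_basis_ex[OF F.lin_sl[OF tu(1)]] by blast
    note comp = adapted_basis_compose[OF S tu(2) open_U _ Ck_y \<phi>2 _ surj ab']
    have "rho_at (F.sl t) u0 = rho_basis (F.sl t) u0 a' b'"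
      using F.rho_at_sl[OF tu(1) ab'] rho_basis_eq[OF ab'] by simp
    also have "\<dots> = rho_basis y (\<phi> t u0) (\<lambda>i. dirderiv (\<phi> t) u0 (a' i)) b'"
      by (rule comp(2)) (auto simp: Y_def \<Omega>_def)
    also have "\<dots> = rho_at y (\<phi> t u0)"
      by (rule rho_at_y(2)[OF tu(4), symmetric], rule comp(1)) (auto simp: Y_def \<Omega>_def)
    finally show "rho_at (F.sl t) u0 = rho_at y (\<phi> t u0)" .
  qed
  have u0U: "u0 \<in> U" using u0 W by auto
  have along: "((\<lambda>t. f (\<phi> t u0)) has_real_derivative dirderiv f u0 (v u0)) (at 0)"
    if "f differentiable (at u0)" for f :: "real ^ 'n => real"
  proof -
    have "((\<lambda>t. f (\<phi> t u0)) has_derivative (\<lambda>h. dirderiv f u0 (h *\<^sub>R v u0))) (at 0)"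
      by (rule has_derivative_compose[OF hd\<phi>t[unfolded has_vector_derivative_def], of f])
        (use has_derivative_dirderiv[OF that] in \<open>simp add: \<phi>_def\<close>)
    then show ?thesis
      by (rule has_derivative_imp_has_field_derivative) (simp add: linear_cmul[OF linear_dirderiv[OF that]])
  qed
  \<comment> \<open>The same function of t is differentiated twice: by the first variation formula
    and along the moved point. Uniqueness of the derivative gives the claim; the area is treated
    alike.\<close>
  have "((\<lambda>t. (rho_at (F.sl t) u0)\<^sup>2) has_real_derivative rho_sq_var y (F.vel 0) u0 a b) (at 0)"
    using F.rho_sq_first_variation[OF Om0[OF u0] ab0] by (simp only: sl0)
  moreover have "((\<lambda>t. (rho_at (F.sl t) u0)\<^sup>2) has_real_derivative dirderiv (\<lambda>w. (rho_at y w)\<^sup>2) u0 (v u0)) (at 0)"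
    by (rule has_field_derivative_transform_within_open[OF along T])
      (use Ck_on_rho_at_sq[of "Suc 0"] u0U rt in auto)
  ultimately have "rho_sq_var y (F.vel 0) u0 a b = dirderiv (\<lambda>w. (rho_at y w)\<^sup>2) u0 (v u0)"
    by (rule DERIV_unique)
  then show "rho_sq_var y (\<lambda>w. dirderiv y w (v w)) u0 a b = dirderiv (\<lambda>w. (rho_at y w)\<^sup>2) u0 (v u0)"
    by (simp only: rho_sq_var_def dvel[OF u0] ddvel)
  have "((\<lambda>t. sqrt (det (gram (F.sl t) u0))) has_real_derivative
      sqrt (det (gram y u0)) * area_var y (F.vel 0) u0 a) (at 0)"
    using F.area_first_variation[OF Om0[OF u0] ab0] by (simp only: sl0)
  moreover have "((\<lambda>t. sqrt (det (gram (F.sl t) u0))) has_real_derivative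
      dirderiv (\<lambda>w. sqrt (det (gram y w))) u0 (v u0) * det (Dp 0)
        + (\<Sum>i\<in>UNIV. dirderiv v u0 (axis i 1) $ i) * sqrt (det (gram y (\<phi> 0 u0)))) (at 0)"
  proof (rule has_field_derivative_transform_within_open[OF DERIV_mult[OF along dDp] T])
    show "(\<lambda>w. sqrt (det (gram y w))) differentiable at u0"
      using Ck_on_sqrt_det_gram[of "Suc 0"] u0U by simp
    show "sqrt (det (gram y (\<phi> t u0))) * det (Dp t) = sqrt (det (gram (F.sl t) u0))" if "t \<in> T" for t
      using gt[OF that] T1(3)[of t] that by (simp add: real_sqrt_mult T_def)
  qed
  ultimately have "sqrt (det (gram y u0)) * area_var y (F.vel 0) u0 a =
      dirderiv (\<lambda>w. sqrt (det (gram y w))) u0 (v u0) * det (Dp 0)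
        + (\<Sum>i\<in>UNIV. dirderiv v u0 (axis i 1) $ i) * sqrt (det (gram y (\<phi> 0 u0)))"
    by (rule DERIV_unique)
  then show "sqrt (det (gram y u0)) * area_var y (\<lambda>w. dirderiv y w (v w)) u0 a
      = dirderiv (\<lambda>w. sqrt (det (gram y w))) u0 (v u0)
        + sqrt (det (gram y u0)) * (\<Sum>i\<in>UNIV. dirderiv v u0 (axis i 1) $ i)"
    by (simp add: area_var_def dvel[OF u0] Dp0 \<phi>_def)
qed

end

section \<open>Calculus in an adapted frame\<close>

lemma dirderiv_add: "f differentiable (at u) ==> g differentiable (at u) ==>
    dirderiv (\<lambda>w. f w + g w) u v = dirderiv f u v + dirderiv g u v"
  by (rule dirderiv_eqI) (intro has_derivative_add has_derivative_dirderiv)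

lemma dirderiv_diff: "f differentiable (at u) ==> g differentiable (at u) ==>
    dirderiv (\<lambda>w. f w - g w) u v = dirderiv f u v - dirderiv g u v"
  by (rule dirderiv_eqI) (intro has_derivative_diff has_derivative_dirderiv)

lemma dirderiv_sum: "(\<And>i. i \<in> I ==> f i differentiable (at u)) ==>
    dirderiv (\<lambda>w. \<Sum>i\<in>I. f i w) u v = (\<Sum>i\<in>I. dirderiv (f i) u v)"
  by (rule dirderiv_eqI) (intro has_derivative_sum has_derivative_dirderiv)

lemma dirderiv_mult:
  fixes f g :: "_ => real"
  shows "f differentiable (at u) ==> g differentiable (at u) ==>
    dirderiv (\<lambda>w. f w * g w) u v = f u * dirderiv g u v + dirderiv f u v * g u"
  by (rule dirderiv_eqI) (intro has_derivative_mult has_derivative_dirderiv)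

lemma dirderiv_cmult:
  fixes f :: "_ => real"
  shows "f differentiable (at u) ==> dirderiv (\<lambda>w. c * f w) u v = c * dirderiv f u v"
  by (rule dirderiv_eqI) (intro has_derivative_mult_right has_derivative_dirderiv)

text \<open>Product rule for the second derivative with a moving base point and two moving
  directions. The first direction is expanded in the basis, the second is covered by
  \<open>has_derivative_dirderiv_along\<close>.\<close>

lemma dirderiv_dd_along:
  fixes y :: "'a::euclidean_space => 'b::euclidean_space"
  assumes V: "open V" "u \<in> V" and y: "\<And>k. Ck_on k V y"
    and s: "s1 differentiable (at u)" "s2 differentiable (at u)"
  shows "dirderiv (\<lambda>w. dd y w (s1 w) (s2 w)) u x = dirderiv (\<lambda>w. dd y w (s1 u) (s2 u)) u x
    + dd y u (dirderiv s1 u x) (s2 u) + dd y u (s1 u) (dirderiv s2 u x)"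
proof -
  have y1: "Ck_on k V (\<lambda>w. dirderiv y w b)" for k b
    using y[of "Suc k"] by (simp only: Ck_on.simps(2))
  have y2: "Ck_on k V (\<lambda>w. dd y w b c)" for k b c
    using y1[of "Suc k" b] by (simp only: Ck_on.simps(2))
  have d2: "(\<lambda>w. dd y w b c) differentiable (at u)" for b c
    using y2[of "Suc 0" b c] V(2) by (simp only: Ck_on.simps(2))
  have exp: "dd y w v c = (\<Sum>b\<in>Basis. (v \<bullet> b) *\<^sub>R dd y w b c)" if "w \<in> V" for w v c
  proof -
    note l = linear_dd(2)[OF V(1) that y]
    have "dd y w v c = dd y w (\<Sum>b\<in>Basis. (v \<bullet> b) *\<^sub>R b) c" by (simp only: euclidean_representation)
    then show ?thesis by (simp only: linear_sum[OF l] linear_cmul[OF l])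
  qed
  have dz: "((\<lambda>w. dd y w b (s2 w)) has_derivative
      (\<lambda>x. dirderiv (\<lambda>w. dd y w b (s2 u)) u x + dd y u b (dirderiv s2 u x))) (at u)" for b
  proof -
    have "((\<lambda>w. dirderiv (\<lambda>w. dirderiv y w b) (w) (s2 w)) has_derivative
      (\<lambda>x. dd (\<lambda>w. dirderiv y w b) u (s2 u) (dirderiv (\<lambda>w. w) u x)
        + dirderiv (\<lambda>w. dirderiv y w b) u (dirderiv s2 u x))) (at u)"
      by (rule has_derivative_dirderiv_along[OF V(1) y1 V, where g="\<lambda>w. w"]) (use s in auto)
    moreover have "dirderiv (\<lambda>w. w) u x = x" for x by (rule dirderiv_eqI) (rule has_derivative_ident)
    ultimately show ?thesis by simp
  qed
  have "((\<lambda>w. \<Sum>b\<in>Basis. (s1 w \<bullet> b) *\<^sub>R dd y w b (s2 w)) has_derivative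
      (\<lambda>x. \<Sum>b\<in>Basis. (s1 u \<bullet> b) *\<^sub>R (dirderiv (\<lambda>w. dd y w b (s2 u)) u x + dd y u b (dirderiv s2 u x))
        + (dirderiv s1 u x \<bullet> b) *\<^sub>R dd y u b (s2 u))) (at u)"
    by (intro has_derivative_sum has_derivative_scaleR has_derivative_inner_left has_derivative_dirderiv s dz)
  then have "((\<lambda>w. dd y w (s1 w) (s2 w)) has_derivative
      (\<lambda>x. \<Sum>b\<in>Basis. (s1 u \<bullet> b) *\<^sub>R (dirderiv (\<lambda>w. dd y w b (s2 u)) u x + dd y u b (dirderiv s2 u x))
        + (dirderiv s1 u x \<bullet> b) *\<^sub>R dd y u b (s2 u))) (at u)"
    by (rule has_derivative_transform_within_open[OF _ V]) (rule exp[symmetric])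
  then have "dirderiv (\<lambda>w. dd y w (s1 w) (s2 w)) u x
      = (\<Sum>b\<in>Basis. (s1 u \<bullet> b) *\<^sub>R (dirderiv (\<lambda>w. dd y w b (s2 u)) u x + dd y u b (dirderiv s2 u x))
        + (dirderiv s1 u x \<bullet> b) *\<^sub>R dd y u b (s2 u))" by (rule dirderiv_eqI)
  also have "\<dots> = (\<Sum>b\<in>Basis. (s1 u \<bullet> b) *\<^sub>R dirderiv (\<lambda>w. dd y w b (s2 u)) u x)
      + (\<Sum>b\<in>Basis. (s1 u \<bullet> b) *\<^sub>R dd y u b (dirderiv s2 u x))
      + (\<Sum>b\<in>Basis. (dirderiv s1 u x \<bullet> b) *\<^sub>R dd y u b (s2 u))"
    by (simp only: scaleR_add_right sum.distrib)
  also have "(\<Sum>b\<in>Basis. (s1 u \<bullet> b) *\<^sub>R dirderiv (\<lambda>w. dd y w b (s2 u)) u x)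
      = dirderiv (\<lambda>w. dd y w (s1 u) (s2 u)) u x"
  proof -
    have "((\<lambda>w. \<Sum>b\<in>Basis. (s1 u \<bullet> b) *\<^sub>R dd y w b (s2 u)) has_derivative
        (\<lambda>x. \<Sum>b\<in>Basis. (s1 u \<bullet> b) *\<^sub>R dirderiv (\<lambda>w. dd y w b (s2 u)) u x)) (at u)"
      by (intro has_derivative_sum has_derivative_scaleR_right has_derivative_dirderiv d2)
    then have "((\<lambda>w. dd y w (s1 u) (s2 u)) has_derivative
        (\<lambda>x. \<Sum>b\<in>Basis. (s1 u \<bullet> b) *\<^sub>R dirderiv (\<lambda>w. dd y w b (s2 u)) u x)) (at u)"
      by (rule has_derivative_transform_within_open[OF _ V]) (rule exp[symmetric])
    then show ?thesis by (rule dirderiv_eqI[symmetric])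
  qed
  also have "(\<Sum>b\<in>Basis. (s1 u \<bullet> b) *\<^sub>R dd y u b (dirderiv s2 u x)) = dd y u (s1 u) (dirderiv s2 u x)"
    by (rule exp[OF V(2), symmetric])
  also have "(\<Sum>b\<in>Basis. (dirderiv s1 u x \<bullet> b) *\<^sub>R dd y u b (s2 u)) = dd y u (dirderiv s1 u x) (s2 u)"
    by (rule exp[OF V(2), symmetric])
  finally show ?thesis by (simp only: add_ac)
qed

section \<open>Components, connection forms and derivatives in a fixed adapted frame\<close>

locale framed_patch = sphere_patch U y
  for U :: "(real ^ 'n::finite) set" and y :: "real ^ 'n => 'e::euclidean_space" +
  fixes V :: "(real ^ 'n) set" and e :: "real ^ 'n => 'n => real ^ 'n"
    and \<nu> :: "real ^ 'n => nat => 'e"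
    and N :: "nat set"
  assumes V_sub: "V \<subseteq> U" and frame: "adapted_frame y V e \<nu>"
    and N_def: "N = {CARD('n)+1..<DIM('e)}"
begin

definition D :: "'n => (real ^ 'n => 'c::real_normed_vector) => real ^ 'n => 'c"
  where "D i f w = dirderiv f w (e w i)"
definition Yv :: "'n => real ^ 'n => 'e" where "Yv i w = dirderiv y w (e w i)"
definition nu :: "nat => real ^ 'n => 'e" where "nu \<alpha> w = \<nu> w \<alpha>"
text \<open>The middle index is the direction: \<open>G i j k\<close> is the connection form with
  indices i, k evaluated on the frame vector j, and \<open>Nn \<alpha> j \<beta>\<close> is the
  normal connection form with indices \<alpha>, \<beta> evaluated on it.\<close>

definition G :: "'n => 'n => 'n => real ^ 'n => real" where "G i j k w = tconn y e i k w (e w j)"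
definition Nn :: "nat => 'n => nat => real ^ 'n => real" where "Nn \<alpha> j \<beta> w = nconn \<nu> \<alpha> \<beta> w (e w j)"
definition h :: "nat => 'n => 'n => real ^ 'n => real" where "h \<alpha> i j w = sff y w (e w) (\<nu> w) \<alpha> i j"
definition H :: "nat => real ^ 'n => real" where "H \<alpha> w = mean_curv y w (e w) (\<nu> w) \<alpha>"
definition T :: "nat => 'n => 'n => real ^ 'n => real" where "T \<alpha> i j w = tsff y w (e w) (\<nu> w) \<alpha> i j"
definition Hd :: "nat => 'n => real ^ 'n => real" where "Hd \<alpha> i w = mean_curv_deriv y e \<nu> \<alpha> i w"

lemmas frame_facts = Ck_on_frame[OF frame V_sub, folded N_def]

lemma open_V: "open V" by (rule frame_facts(1))

lemma Ck_yV: "Ck_on k V y" by (rule Ck_on_subset[OF Ck_y V_sub])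

lemma Ck_D: "Ck_on (Suc k) V f ==> Ck_on k V (D i f)"
  unfolding D_def[abs_def] by (rule Ck_on_dirderiv[OF open_V _ frame_facts(2)])

lemma Ck_Yv: "Ck_on k V (Yv i)"
  unfolding Yv_def[abs_def] by (rule Ck_on_dirderiv[OF open_V Ck_yV frame_facts(2)])

lemma Ck_nu: "\<alpha> \<in> N ==> Ck_on k V (nu \<alpha>)"
  unfolding nu_def[abs_def] by (rule frame_facts(3))

lemma Ck_h: "\<alpha> \<in> N ==> Ck_on k V (h \<alpha> i j)" unfolding h_def[abs_def] by (rule frame_facts(5))
lemma Ck_H: "\<alpha> \<in> N ==> Ck_on k V (H \<alpha>)" unfolding H_def[abs_def] by (rule frame_facts(6))
lemma Ck_T: "\<alpha> \<in> N ==> Ck_on k V (T \<alpha> i j)" unfolding T_def[abs_def] by (rule frame_facts(7))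

lemma G_eq: "G i j k w = D j (Yv i) w \<bullet> Yv k w"
  by (simp add: G_def D_def tconn_def Yv_def[abs_def])

lemma Nn_eq: "Nn \<alpha> j \<beta> w = D j (nu \<alpha>) w \<bullet> nu \<beta> w"
  by (simp add: Nn_def D_def nconn_def nu_def[abs_def])

lemma Ck_G: "Ck_on k V (G i j l)"
proof -
  have "Ck_on k V (\<lambda>w. D j (Yv i) w \<bullet> Yv l w)" by (intro Ck_on_inner open_V Ck_D Ck_Yv)
  then show ?thesis by (simp add: G_eq[abs_def])
qed

lemma Ck_Nn: "\<alpha> \<in> N ==> \<beta> \<in> N ==> Ck_on k V (Nn \<alpha> j \<beta>)"
proof -
  assume "\<alpha> \<in> N" "\<beta> \<in> N"
  then have "Ck_on k V (\<lambda>w. D j (nu \<alpha>) w \<bullet> nu \<beta> w)" by (intro Ck_on_inner open_V Ck_D Ck_nu)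
  then show ?thesis by (simp add: Nn_eq[abs_def])
qed

lemma Hd_eq: "Hd \<alpha> i w = D i (H \<alpha>) w + (\<Sum>\<beta>\<in>N. H \<beta> w * Nn \<beta> i \<alpha> w)"
  by (simp add: Hd_def mean_curv_deriv_def D_def H_def[abs_def] Nn_def N_def)

lemma Ck_Hd: "\<alpha> \<in> N ==> Ck_on k V (Hd \<alpha> i)"
proof -
  assume "\<alpha> \<in> N"
  then have "Ck_on k V (\<lambda>w. D i (H \<alpha>) w + (\<Sum>\<beta>\<in>N. H \<beta> w * Nn \<beta> i \<alpha> w))"
    by (intro Ck_on_add Ck_on_sum Ck_on_mult open_V Ck_D Ck_H Ck_Nn)
  then show ?thesis by (simp add: Hd_eq[abs_def])
qed

lemma diffV: "Ck_on (Suc k) V f ==> w \<in> V ==> f differentiable (at w)" by simp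

lemmas diff1 = diffV[where k=0]

lemma D_cong: "w \<in> V ==> (\<And>w. w \<in> V ==> f w = g w) ==> D i f w = D i g w"
  unfolding D_def by (rule dirderiv_cong_open[OF open_V])

context
  fixes w assumes w: "w \<in> V"
begin

lemma abw: "adapted_basis y w (e w) (\<nu> w)" by (rule frame_facts(4)[OF w])
lemma wU: "w \<in> U" using w V_sub by auto

lemma orth:
  "Yv i w \<bullet> Yv j w = (if i = j then 1 else 0)"
  "\<alpha> \<in> N ==> \<beta> \<in> N ==> nu \<alpha> w \<bullet> nu \<beta> w = (if \<alpha> = \<beta> then 1 else 0)"
  "\<alpha> \<in> N ==> nu \<alpha> w \<bullet> Yv i w = 0" "\<alpha> \<in> N ==> nu \<alpha> w \<bullet> y w = 0"
  "\<alpha> \<in> N ==> nu \<alpha> w \<bullet> dirderiv y w v = 0"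
  unfolding Yv_def nu_def using adapted_basisD[OF abw, folded N_def] by blast+

lemma y_Yv: "y w \<bullet> dirderiv y w v = 0" "y w \<bullet> Yv i w = 0"
proof -
  show 1: "y w \<bullet> dirderiv y w v = 0" for v
    by (rule inner_dirderiv_sphere[OF open_U wU unit_y diff_y[OF wU]])
  show "y w \<bullet> Yv i w = 0" unfolding Yv_def by (rule 1)
qed

lemma frame_expansion:
  "v = (\<Sum>i\<in>UNIV. (v \<bullet> Yv i w) *\<^sub>R Yv i w) + (\<Sum>\<alpha>\<in>N. (v \<bullet> nu \<alpha> w) *\<^sub>R nu \<alpha> w) + (v \<bullet> y w) *\<^sub>R y w"
  unfolding Yv_def nu_def N_def
  by (rule adapted_basis_expansion[OF dim_y abw unit_y[OF wU] y_Yv(1)])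

lemma coord_expansion: "v = (\<Sum>l\<in>UNIV. (dirderiv y w v \<bullet> Yv l w) *\<^sub>R e w l)"
  unfolding Yv_def
  by (rule orthonormal_frame_expansion(1)[OF lin_y[OF wU] adapted_basisD(1)[OF abw]])

end

lemma D_const_inner:
  assumes "w \<in> V" "\<And>x. x \<in> V ==> f x \<bullet> g x = c" "Ck_on (Suc 0) V f" "Ck_on (Suc 0) V g"
  shows "D j g w \<bullet> f w = - (D j f w \<bullet> g w)"
  unfolding D_def inner_commute[of "dirderiv g w (e w j)"]
  by (rule inner_dirderiv_const[OF open_V assms(1,2) diff1[OF assms(3,1)] diff1[OF assms(4,1)]])

lemma G_anti: "w \<in> V ==> G i j k w = - G k j i w"
  unfolding G_eq by (rule D_const_inner[where f="Yv k" and g="Yv i", OF _ orth(1) Ck_Yv Ck_Yv])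

lemma Nn_anti: "w \<in> V ==> \<alpha> \<in> N ==> \<beta> \<in> N ==> Nn \<alpha> j \<beta> w = - Nn \<beta> j \<alpha> w"
  unfolding Nn_eq by (rule D_const_inner[where f="nu \<beta>" and g="nu \<alpha>", OF _ orth(2) Ck_nu Ck_nu])

lemma D_Yv: "w \<in> V ==> D j (Yv i) w = dd y w (e w i) (e w j) + dirderiv y w (D j (\<lambda>w. e w i) w)"
proof -
  assume w: "w \<in> V"
  have "((\<lambda>w. dirderiv y w (e w i)) has_derivative (\<lambda>x. dd y w (e w i) (dirderiv (\<lambda>w. w) w x)
      + dirderiv y w (dirderiv (\<lambda>w. e w i) w x))) (at w)"
    by (rule has_derivative_dirderiv_along[OF open_V Ck_yV open_V w, where g="\<lambda>w. w"])
      (use diff1[OF frame_facts(2) w] in auto)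
  moreover have "dirderiv (\<lambda>w. w) w x = x" for x by (rule dirderiv_eqI) (rule has_derivative_ident)
  ultimately have "((\<lambda>w. dirderiv y w (e w i)) has_derivative (\<lambda>x. dd y w (e w i) x
      + dirderiv y w (dirderiv (\<lambda>w. e w i) w x))) (at w)" by simp
  then show ?thesis unfolding D_def Yv_def[abs_def] by (rule dirderiv_eqI)
qed

section \<open>Gauss, Weingarten and Codazzi equations\<close>

lemma h_eq:
  assumes w: "w \<in> V" and \<alpha>: "\<alpha> \<in> N"
  shows "D j (Yv i) w \<bullet> nu \<alpha> w = h \<alpha> i j w"
proof -
  have "dirderiv y w (D j (\<lambda>w. e w i) w) \<bullet> nu \<alpha> w = 0"
    using orth(5)[OF assms] by (simp only: inner_commute[of "dirderiv y w _"])
  then have "D j (Yv i) w \<bullet> nu \<alpha> w = dd y w (e w i) (e w j) \<bullet> nu \<alpha> w"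
    by (simp only: D_Yv[OF w] inner_add_left add_0_right)
  then show ?thesis by (simp only: h_def sff_def nu_def)
qed

lemma h_sym: "w \<in> V ==> h \<alpha> i j w = h \<alpha> j i w"
  unfolding h_def sff_def using dirderiv_commute[OF open_V _ Ck_yV] by metis

lemma T_eq: "T \<alpha> i j w = h \<alpha> i j w - (if i = j then H \<alpha> w else 0)"
  by (simp add: T_def tsff_def h_def H_def)

lemma T_sym: "w \<in> V ==> T \<alpha> i j w = T \<alpha> j i w"
  using h_sym[of w \<alpha> i j] by (simp add: T_eq)

lemma h_trace: "(\<Sum>k\<in>UNIV. h \<alpha> k k w) = real CARD('n) * H \<alpha> w"
  by (simp add: h_def H_def sum_mean_curv)

lemma D_nu_Yv:
  assumes w: "w \<in> V" and \<alpha>: "\<alpha> \<in> N"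
  shows "D j (nu \<alpha>) w \<bullet> Yv k w = - h \<alpha> k j w"
proof -
  have "Yv k x \<bullet> nu \<alpha> x = 0" if "x \<in> V" for x
    using orth(3)[OF that \<alpha>] by (simp only: inner_commute[of "Yv k x"])
  then have "D j (nu \<alpha>) w \<bullet> Yv k w = - (D j (Yv k) w \<bullet> nu \<alpha> w)"
    by (rule D_const_inner[OF w _ Ck_Yv Ck_nu[OF \<alpha>]])
  then show ?thesis by (simp only: h_eq[OF assms])
qed

lemma D_nu_y:
  assumes w: "w \<in> V" and \<alpha>: "\<alpha> \<in> N"
  shows "D j (nu \<alpha>) w \<bullet> y w = 0"
proof -
  have "y x \<bullet> nu \<alpha> x = 0" if "x \<in> V" for x
    using orth(4)[OF that \<alpha>] by (simp only: inner_commute[of "y x"])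
  then have "D j (nu \<alpha>) w \<bullet> y w = - (D j y w \<bullet> nu \<alpha> w)"
    by (rule D_const_inner[OF w _ Ck_yV Ck_nu[OF \<alpha>]])
  also have "D j y w \<bullet> nu \<alpha> w = nu \<alpha> w \<bullet> dirderiv y w (e w j)"
    unfolding D_def by (rule inner_commute)
  finally show ?thesis by (simp only: orth(5)[OF assms] minus_zero)
qed

text \<open>Weingarten formula, paired with an arbitrary vector. The derivative of a normal field
  has no position component because the derivative of y is tangent.\<close>

lemma D_nu_inner:
  assumes "w \<in> V" "\<alpha> \<in> N"
  shows "D j (nu \<alpha>) w \<bullet> v = - (\<Sum>k\<in>UNIV. h \<alpha> k j w * (Yv k w \<bullet> v)) + (\<Sum>\<beta>\<in>N. Nn \<alpha> j \<beta> w * (nu \<beta> w \<bullet> v))"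
proof -
  have "D j (nu \<alpha>) w = (\<Sum>k\<in>UNIV. (- h \<alpha> k j w) *\<^sub>R Yv k w) + (\<Sum>\<beta>\<in>N. Nn \<alpha> j \<beta> w *\<^sub>R nu \<beta> w)"
    using frame_expansion[OF assms(1), of "D j (nu \<alpha>) w"]
    by (simp only: D_nu_Yv[OF assms] D_nu_y[OF assms] Nn_eq[symmetric] scaleR_zero_left add_0_right)
  then show ?thesis by (simp only: inner_add_left inner_sum_left inner_scaleR_left mult_minus_left sum_negf)
qed

text \<open>The covariant derivative of h with components i, k in direction j. The signs are
  negative because the connection forms appear with the component's own index first; antisymmetry
  turns the customary plus signs around.\<close>

definition codazzi :: "nat => 'n => 'n => 'n => real ^ 'n => real"
  where "codazzi \<alpha> i k j w = D j (h \<alpha> i k) w - (\<Sum>l\<in>UNIV. G i j l w * h \<alpha> l k w)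
    - (\<Sum>l\<in>UNIV. G k j l w * h \<alpha> i l w) - (\<Sum>\<beta>\<in>N. Nn \<alpha> j \<beta> w * h \<beta> i k w)"

text \<open>The derivatives of the frame cancel against the connection terms, leaving the third
  derivative of y and three sums that are permuted among themselves when i, j, k are. So the full
  symmetry can be read off from the commutation of partial derivatives, and no curvature term
  occurs.\<close>

lemma codazzi_eq:
  assumes w: "w \<in> V" and \<alpha>: "\<alpha> \<in> N"
  shows "codazzi \<alpha> i k j w = dirderiv (\<lambda>x. dd y x (e w i) (e w k)) w (e w j) \<bullet> nu \<alpha> w
    - (\<Sum>l\<in>UNIV. (dd y w (e w i) (e w j) \<bullet> Yv l w) * h \<alpha> l k w)
    - (\<Sum>l\<in>UNIV. (dd y w (e w k) (e w j) \<bullet> Yv l w) * h \<alpha> l i w)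
    - (\<Sum>l\<in>UNIV. (dd y w (e w i) (e w k) \<bullet> Yv l w) * h \<alpha> l j w)"
proof -
  let ?E = "\<lambda>i. D j (\<lambda>w. e w i) w" and ?q = "\<lambda>i k. dd y w (e w i) (e w k)"
  have de: "(\<lambda>w. e w i) differentiable (at w)" for i by (rule diff1[OF frame_facts(2) w])
  have dq: "(\<lambda>w. dd y w (e w i) (e w k)) differentiable (at w)"
    by (rule diff1[OF Ck_on_dd[OF open_V Ck_yV frame_facts(2) frame_facts(2)] w])
  have l1: "linear (dd y w v)" and l2: "linear (\<lambda>v. dd y w v v')" for v v'
    by (rule linear_dd[OF open_V w Ck_yV])+
  have hq: "dd y w (e w i) (e w k) \<bullet> nu \<alpha> w = h \<alpha> i k w" for i k by (simp add: h_def sff_def nu_def)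
  have q1: "dd y w (?E i) (e w k) \<bullet> nu \<alpha> w = (\<Sum>l\<in>UNIV. (dirderiv y w (?E i) \<bullet> Yv l w) * h \<alpha> l k w)" for i k
    by (subst coord_expansion[OF w, of "?E i"])
      (simp only: linear_sum[OF l2] linear_cmul[OF l2] inner_sum_left inner_scaleR_left hq)
  have q2: "dd y w (e w i) (?E k) \<bullet> nu \<alpha> w = (\<Sum>l\<in>UNIV. (dirderiv y w (?E k) \<bullet> Yv l w) * h \<alpha> i l w)" for i k
    by (subst coord_expansion[OF w, of "?E k"])
      (simp only: linear_sum[OF l1] linear_cmul[OF l1] inner_sum_left inner_scaleR_left hq)
  have "D j (h \<alpha> i k) w = D j (\<lambda>w. dd y w (e w i) (e w k) \<bullet> nu \<alpha> w) w"
    by (simp add: h_def[abs_def] sff_def nu_def)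
  also have "\<dots> = ?q i k \<bullet> D j (nu \<alpha>) w + D j (\<lambda>w. dd y w (e w i) (e w k)) w \<bullet> nu \<alpha> w"
    unfolding D_def by (rule dirderiv_inner_both[OF dq diff1[OF Ck_nu[OF \<alpha>] w]])
  also have "D j (\<lambda>w. dd y w (e w i) (e w k)) w = dirderiv (\<lambda>x. dd y x (e w i) (e w k)) w (e w j)
      + dd y w (?E i) (e w k) + dd y w (e w i) (?E k)"
    unfolding D_def by (rule dirderiv_dd_along[OF open_V w Ck_yV de de])
  also have "?q i k \<bullet> D j (nu \<alpha>) w = - (\<Sum>l\<in>UNIV. (?q i k \<bullet> Yv l w) * h \<alpha> l j w) + (\<Sum>\<beta>\<in>N. Nn \<alpha> j \<beta> w * h \<beta> i k w)"
    unfolding inner_commute[of "?q i k" "D j (nu \<alpha>) w"] D_nu_inner[OF w \<alpha>]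
    by (simp add: inner_commute[of _ "?q i k"] h_def sff_def nu_def mult.commute)
  finally have Dh: "D j (h \<alpha> i k) w = - (\<Sum>l\<in>UNIV. (?q i k \<bullet> Yv l w) * h \<alpha> l j w) + (\<Sum>\<beta>\<in>N. Nn \<alpha> j \<beta> w * h \<beta> i k w)
      + (dirderiv (\<lambda>x. dd y x (e w i) (e w k)) w (e w j) \<bullet> nu \<alpha> w
        + (\<Sum>l\<in>UNIV. (dirderiv y w (?E i) \<bullet> Yv l w) * h \<alpha> l k w)
        + (\<Sum>l\<in>UNIV. (dirderiv y w (?E k) \<bullet> Yv l w) * h \<alpha> i l w))"
    by (simp only: inner_add_left q1 q2)
  have Gs: "(\<Sum>l\<in>UNIV. G i j l w * f l) = (\<Sum>l\<in>UNIV. (?q i j \<bullet> Yv l w) * f l)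
      + (\<Sum>l\<in>UNIV. (dirderiv y w (?E i) \<bullet> Yv l w) * f l)" for i f
    by (simp add: G_eq D_Yv[OF w] inner_add_left distrib_right sum.distrib)
  have hs: "(\<Sum>l\<in>UNIV. (?q k j \<bullet> Yv l w) * h \<alpha> i l w) = (\<Sum>l\<in>UNIV. (?q k j \<bullet> Yv l w) * h \<alpha> l i w)"
    by (intro sum.cong refl) (simp add: h_sym[OF w, of \<alpha> i])
  show ?thesis unfolding codazzi_def Dh Gs hs by simp
qed

lemma codazzi_sym:
  assumes w: "w \<in> V" and \<alpha>: "\<alpha> \<in> N"
  shows "codazzi \<alpha> i k j w = codazzi \<alpha> k i j w" "codazzi \<alpha> i k j w = codazzi \<alpha> i j k w"
proof -
  have q: "dd y x v v' = dd y x v' v" if "x \<in> V" for x v v'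
    by (rule dirderiv_commute[OF open_V that Ck_yV])
  have y1: "Ck_on 2 V (\<lambda>w. dirderiv y w b)" for b
    using Ck_yV[of "Suc 2"] by (simp only: Ck_on.simps(2))
  have t1: "dirderiv (\<lambda>x. dd y x v v') w v'' = dirderiv (\<lambda>x. dd y x v' v) w v''" for v v' v''
    by (rule dirderiv_cong_open[OF open_V w q])
  have t2: "dirderiv (\<lambda>x. dd y x v v') w v'' = dirderiv (\<lambda>x. dd y x v v'') w v'" for v v' v''
    by (rule dirderiv_commute[OF open_V w y1])
  show "codazzi \<alpha> i k j w = codazzi \<alpha> k i j w"
    unfolding codazzi_eq[OF assms] t1[of "e w k" "e w i"] q[OF w, of "e w k" "e w i"] by simp
  show "codazzi \<alpha> i k j w = codazzi \<alpha> i j k w"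
    unfolding codazzi_eq[OF assms] t2[of "e w i" "e w j"] q[OF w, of "e w k" "e w j"] by simp
qed

text \<open>Compatibility of the connection with the metric: this makes the trace commute with
  covariant differentiation.\<close>

lemma G_sym_sum:
  assumes w: "w \<in> V" and S: "\<And>l j. S l j = S j l"
  shows "(\<Sum>j\<in>UNIV. \<Sum>l\<in>UNIV. G j i l w * S l j) = 0"
proof -
  let ?s = "\<Sum>j\<in>UNIV. \<Sum>l\<in>UNIV. G j i l w * S l j"
  have "?s = (\<Sum>l\<in>UNIV. \<Sum>j\<in>UNIV. G j i l w * S l j)" by (rule sum.swap)
  also have "\<dots> = (\<Sum>l\<in>UNIV. \<Sum>j\<in>UNIV. - (G l i j w * S j l))"
  proof (intro sum.cong refl)
    fix l j show "G j i l w * S l j = - (G l i j w * S j l)"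
      using G_anti[OF w, of j i l] S[of l j] by simp
  qed
  also have "\<dots> = - ?s" by (simp add: sum_negf)
  finally show ?thesis by simp
qed

lemma Nn_Hd:
  assumes w: "w \<in> V" and \<alpha>: "\<alpha> \<in> N"
  shows "(\<Sum>\<beta>\<in>N. Nn \<alpha> i \<beta> w * H \<beta> w) = D i (H \<alpha>) w - Hd \<alpha> i w"
proof -
  have "(\<Sum>\<beta>\<in>N. Nn \<alpha> i \<beta> w * H \<beta> w) = (\<Sum>\<beta>\<in>N. - (H \<beta> w * Nn \<beta> i \<alpha> w))"
    using Nn_anti[OF w \<alpha>] by (intro sum.cong refl) (simp add: mult.commute)
  then show ?thesis by (simp add: Hd_eq sum_negf)
qed

text \<open>Contracted Codazzi equation: the divergence of h is the covariant derivative of its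
  trace, n H, and removing the trace part H times the identity costs one more derivative of H. This
  is the origin of the factor n - 1 in the theorem.\<close>

lemma divergence_T:
  assumes w: "w \<in> V" and \<alpha>: "\<alpha> \<in> N"
  shows "(\<Sum>j\<in>UNIV. D j (T \<alpha> i j) w - (\<Sum>l\<in>UNIV. G i j l w * T \<alpha> l j w) - (\<Sum>l\<in>UNIV. G j j l w * T \<alpha> i l w)
      - (\<Sum>\<beta>\<in>N. Nn \<alpha> j \<beta> w * T \<beta> i j w)) = (real CARD('n) - 1) * Hd \<alpha> i w"
proof -
  have DT: "D j (T \<alpha> i j) w = D j (h \<alpha> i j) w - (if i = j then D i (H \<alpha>) w else 0)" for j
  proof (cases "i = j")
    case True
    have "D j (T \<alpha> j j) w = D j (\<lambda>w. h \<alpha> j j w - H \<alpha> w) w" by (simp add: T_eq[abs_def])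
    then show ?thesis
      using True dirderiv_diff[OF diff1[OF Ck_h[OF \<alpha>] w] diff1[OF Ck_H[OF \<alpha>] w]] by (simp add: D_def)
  next
    case False
    then have "T \<alpha> i j = h \<alpha> i j" by (simp add: T_eq fun_eq_iff)
    then show ?thesis using False by simp
  qed
  have GT1: "(\<Sum>l\<in>UNIV. G i j l w * T \<alpha> l j w) = (\<Sum>l\<in>UNIV. G i j l w * h \<alpha> l j w) - G i j j w * H \<alpha> w" for j
    by (simp add: T_eq right_diff_distrib sum_subtractf if_distrib[of "(*) _"] cong: if_cong)
  have GT2: "(\<Sum>l\<in>UNIV. G j j l w * T \<alpha> i l w) = (\<Sum>l\<in>UNIV. G j j l w * h \<alpha> i l w) - G j j i w * H \<alpha> w" for j
    by (simp add: T_eq right_diff_distrib sum_subtractf if_distrib[of "(*) _"] cong: if_cong)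
  have NT: "(\<Sum>\<beta>\<in>N. Nn \<alpha> j \<beta> w * T \<beta> i j w) = (\<Sum>\<beta>\<in>N. Nn \<alpha> j \<beta> w * h \<beta> i j w)
      - (if i = j then (\<Sum>\<beta>\<in>N. Nn \<alpha> i \<beta> w * H \<beta> w) else 0)" for j
    by (cases "i = j") (simp_all add: T_eq right_diff_distrib sum_subtractf)
  have "D j (T \<alpha> i j) w - (\<Sum>l\<in>UNIV. G i j l w * T \<alpha> l j w) - (\<Sum>l\<in>UNIV. G j j l w * T \<alpha> i l w)
      - (\<Sum>\<beta>\<in>N. Nn \<alpha> j \<beta> w * T \<beta> i j w) = codazzi \<alpha> j j i w - (if i = j then Hd \<alpha> i w else 0)" for j
  proof -
    \<comment> \<open>Codazzi symmetry moves the free index i into the direction slot, so that the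
      sum over j becomes the trace of h.\<close>
    have "codazzi \<alpha> j j i w = codazzi \<alpha> i j j w"
      using codazzi_sym[OF assms] by metis
    then show ?thesis
      unfolding DT GT1 GT2 NT codazzi_def[of \<alpha> i j j] using G_anti[OF w, of i j j] Nn_Hd[OF assms, of i]
      by auto
  qed
  then have "(\<Sum>j\<in>UNIV. D j (T \<alpha> i j) w - (\<Sum>l\<in>UNIV. G i j l w * T \<alpha> l j w) - (\<Sum>l\<in>UNIV. G j j l w * T \<alpha> i l w)
      - (\<Sum>\<beta>\<in>N. Nn \<alpha> j \<beta> w * T \<beta> i j w)) = (\<Sum>j\<in>UNIV. codazzi \<alpha> j j i w) - Hd \<alpha> i w"
    by (simp add: sum_subtractf)
  also have "(\<Sum>j\<in>UNIV. codazzi \<alpha> j j i w) = real CARD('n) * Hd \<alpha> i w"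
  proof -
    have 1: "(\<Sum>j\<in>UNIV. D i (h \<alpha> j j) w) = real CARD('n) * D i (H \<alpha>) w"
    proof -
      have "(\<Sum>j\<in>UNIV. D i (h \<alpha> j j) w) = D i (\<lambda>w. \<Sum>j\<in>UNIV. h \<alpha> j j w) w"
        unfolding D_def by (rule dirderiv_sum[symmetric]) (rule diff1[OF Ck_h[OF \<alpha>] w])
      also have "\<dots> = real CARD('n) * D i (H \<alpha>) w"
        unfolding h_trace D_def by (rule dirderiv_cmult[OF diff1[OF Ck_H[OF \<alpha>] w]])
      finally show ?thesis .
    qed
    have 2: "(\<Sum>j\<in>UNIV. \<Sum>l\<in>UNIV. G j i l w * h \<alpha> l j w) = 0" "(\<Sum>j\<in>UNIV. \<Sum>l\<in>UNIV. G j i l w * h \<alpha> j l w) = 0"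
      by (rule G_sym_sum[OF w], rule h_sym[OF w])+
    have 3: "(\<Sum>j\<in>UNIV. \<Sum>\<beta>\<in>N. Nn \<alpha> i \<beta> w * h \<beta> j j w) = real CARD('n) * (\<Sum>\<beta>\<in>N. Nn \<alpha> i \<beta> w * H \<beta> w)"
      by (subst sum.swap) (simp only: sum_distrib_left[symmetric] h_trace mult.left_commute)
    show ?thesis
      unfolding codazzi_def sum_subtractf 1 2 3 Nn_Hd[OF assms] by (simp add: algebra_simps)
  qed
  finally show ?thesis by (simp add: algebra_simps)
qed

end

section \<open>The Euler--Lagrange expression\<close>

context framed_patch
begin

text \<open>R times the trace-free form as a normal vector of the ambient space; R will be
  \<open>rho ^ (n - 2)\<close>. Ambient values let the ordinary derivative be used throughout, at
  the price of tangential components in the divergence.\<close>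

definition Uf :: "(real ^ 'n => real) => 'n => 'n => real ^ 'n => 'e"
  where "Uf R i j w = (\<Sum>\<alpha>\<in>N. (R w * T \<alpha> i j w) *\<^sub>R nu \<alpha> w)"

text \<open>Divergence of \<open>Uf\<close> in its second index, with the flat derivative on the
  ambient values and the Levi-Civita connection on both tangential indices.\<close>

definition Mf :: "(real ^ 'n => real) => 'n => real ^ 'n => 'e"
  where "Mf R i w = (\<Sum>j\<in>UNIV. D j (Uf R i j) w - (\<Sum>k\<in>UNIV. G i j k w *\<^sub>R Uf R k j w)
    - (\<Sum>k\<in>UNIV. G j j k w *\<^sub>R Uf R i k w))"

text \<open>Components of the vector field whose divergence is the boundary term of two integrations
  by parts.\<close>

definition Wf :: "(real ^ 'n => real) => (real ^ 'n => 'e) => 'n => real ^ 'n => real"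
  where "Wf R \<zeta> j w = (\<Sum>i\<in>UNIV. Uf R i j w \<bullet> D i \<zeta> w) - Mf R j w \<bullet> \<zeta> w"

lemma Ck_U: "Ck_on k V R ==> Ck_on k V (Uf R i j)"
  unfolding Uf_def[abs_def] by (intro Ck_on_sum Ck_on_scaleR Ck_on_mult open_V Ck_T Ck_nu)

lemma Ck_M:
  assumes "Ck_on (Suc k) V R"
  shows "Ck_on k V (Mf R i)"
  unfolding Mf_def[abs_def]
  by (intro Ck_on_sum Ck_on_diff Ck_on_scaleR open_V Ck_D[OF Ck_U[OF assms]]
      Ck_U[OF Ck_on_SucD[OF assms]] Ck_G)

lemma D_inner: "w \<in> V ==> Ck_on (Suc 0) V f ==> Ck_on (Suc 0) V g ==>
    D i (\<lambda>w. f w \<bullet> g w) w = f w \<bullet> D i g w + D i f w \<bullet> g w"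
  unfolding D_def by (rule dirderiv_inner_both) (auto intro: diff1)

lemma D_mult: "w \<in> V ==> Ck_on (Suc 0) V f ==> Ck_on (Suc 0) V g ==>
    D i (\<lambda>w. f w * g w :: real) w = f w * D i g w + D i f w * g w"
  unfolding D_def by (rule dirderiv_mult) (auto intro: diff1)

lemma D_sum: "w \<in> V ==> (\<And>j. j \<in> I ==> Ck_on (Suc 0) V (f j)) ==>
    D i (\<lambda>w. \<Sum>j\<in>I. f j w) w = (\<Sum>j\<in>I. D i (f j) w)"
  unfolding D_def by (rule dirderiv_sum) (rule diff1)

lemma D_add: "w \<in> V ==> Ck_on (Suc 0) V f ==> Ck_on (Suc 0) V g ==>
    D i (\<lambda>w. f w + g w) w = D i f w + D i g w"
  unfolding D_def by (rule dirderiv_add) (auto intro: diff1)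

lemma D_diff: "w \<in> V ==> Ck_on (Suc 0) V f ==> Ck_on (Suc 0) V g ==>
    D i (\<lambda>w. f w - g w) w = D i f w - D i g w"
  unfolding D_def by (rule dirderiv_diff) (auto intro: diff1)

lemma D_cmult: "w \<in> V ==> Ck_on (Suc 0) V f ==> D i (\<lambda>w. c * f w :: real) w = c * D i f w"
  unfolding D_def by (rule dirderiv_cmult) (auto intro: diff1)

lemma nu_U:
  assumes "w \<in> V" "\<alpha> \<in> N"
  shows "nu \<alpha> w \<bullet> Uf R i j w = R w * T \<alpha> i j w"
proof -
  have "nu \<alpha> w \<bullet> Uf R i j w = (\<Sum>\<beta>\<in>N. if \<alpha> = \<beta> then R w * T \<alpha> i j w else 0)"
    unfolding Uf_def inner_sum_right using orth(2)[OF assms] by (intro sum.cong refl) simp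
  then show ?thesis using assms(2) by (simp add: N_def)
qed

lemma Yv_U: "w \<in> V ==> Yv k w \<bullet> Uf R i j w = 0"
  unfolding Uf_def inner_sum_right using orth(3)[of w] by (intro sum.neutral) (simp add: inner_commute[of "Yv k w"])

text \<open>Leibniz rule: the derivative falls on R or on the trace-free form, and the latter is
  \<open>divergence_T\<close>. The derivative of the normal vectors supplies exactly the normal
  connection term that \<open>divergence_T\<close> contains.\<close>

lemma nu_M:
  assumes w: "w \<in> V" and \<alpha>: "\<alpha> \<in> N" and R: "Ck_on (Suc 0) V R"
  shows "nu \<alpha> w \<bullet> Mf R i w = (\<Sum>j\<in>UNIV. D j R w * T \<alpha> i j w) + (real CARD('n) - 1) * (R w * Hd \<alpha> i w)"
proof -
  have DU: "nu \<alpha> w \<bullet> D j (Uf R i j) w = R w * D j (T \<alpha> i j) w + D j R w * T \<alpha> i j w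
      - R w * (\<Sum>\<beta>\<in>N. Nn \<alpha> j \<beta> w * T \<beta> i j w)" for j
  proof -
    have "nu \<alpha> w \<bullet> D j (Uf R i j) w + D j (nu \<alpha>) w \<bullet> Uf R i j w = D j (\<lambda>w. nu \<alpha> w \<bullet> Uf R i j w) w"
      by (rule D_inner[OF w Ck_nu[OF \<alpha>] Ck_U[OF R], symmetric])
    also have "\<dots> = D j (\<lambda>w. R w * T \<alpha> i j w) w"
      by (rule D_cong[OF w nu_U[OF _ \<alpha>]])
    also have "\<dots> = R w * D j (T \<alpha> i j) w + D j R w * T \<alpha> i j w"
      by (rule D_mult[OF w R Ck_T[OF \<alpha>]])
    finally have 1: "nu \<alpha> w \<bullet> D j (Uf R i j) w = R w * D j (T \<alpha> i j) w + D j R w * T \<alpha> i j w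
        - D j (nu \<alpha>) w \<bullet> Uf R i j w" by linarith
    have "(\<Sum>\<beta>\<in>N. Nn \<alpha> j \<beta> w * (nu \<beta> w \<bullet> Uf R i j w)) = R w * (\<Sum>\<beta>\<in>N. Nn \<alpha> j \<beta> w * T \<beta> i j w)"
      unfolding sum_distrib_left by (intro sum.cong refl) (simp add: nu_U[OF w])
    then have "D j (nu \<alpha>) w \<bullet> Uf R i j w = R w * (\<Sum>\<beta>\<in>N. Nn \<alpha> j \<beta> w * T \<beta> i j w)"
      unfolding D_nu_inner[OF w \<alpha>] by (simp add: Yv_U[OF w])
    then show ?thesis using 1 by simp
  qed
  have "nu \<alpha> w \<bullet> Mf R i w = (\<Sum>j\<in>UNIV. D j R w * T \<alpha> i j w + R w * (D j (T \<alpha> i j) w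
      - (\<Sum>l\<in>UNIV. G i j l w * T \<alpha> l j w) - (\<Sum>l\<in>UNIV. G j j l w * T \<alpha> i l w)
      - (\<Sum>\<beta>\<in>N. Nn \<alpha> j \<beta> w * T \<beta> i j w)))"
    unfolding Mf_def inner_sum_right inner_diff_right inner_scaleR_right DU nu_U[OF w \<alpha>]
    by (intro sum.cong refl) (simp add: right_diff_distrib sum_distrib_left mult.left_commute)
  also have "\<dots> = (\<Sum>j\<in>UNIV. D j R w * T \<alpha> i j w) + R w * ((real CARD('n) - 1) * Hd \<alpha> i w)"
    unfolding sum.distrib sum_distrib_left[symmetric] divergence_T[OF w \<alpha>] ..
  finally show ?thesis by (simp only: mult.left_commute)
qed

text \<open>The ordinary derivative of a normal field has a Weingarten part. These tangential
  components produce the cubic terms of the equation when the divergence is taken once more.\<close>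

lemma Yv_M:
  assumes w: "w \<in> V" and R: "Ck_on (Suc 0) V R"
  shows "Yv k w \<bullet> Mf R i w = - (R w * (\<Sum>\<beta>\<in>N. \<Sum>j\<in>UNIV. T \<beta> i j w * h \<beta> k j w))"
proof -
  have "Yv k w \<bullet> D j (Uf R i j) w = - (\<Sum>\<beta>\<in>N. R w * (T \<beta> i j w * h \<beta> k j w))" for j
  proof -
    have "Yv k w \<bullet> D j (Uf R i j) w = - (D j (Yv k) w \<bullet> Uf R i j w)"
      unfolding D_def by (rule inner_dirderiv_const[OF open_V w Yv_U diff1[OF Ck_Yv w] diff1[OF Ck_U[OF R] w]])
    then show ?thesis
      by (simp add: Uf_def inner_sum_right h_eq[OF w] mult.assoc)
  qed
  then have "Yv k w \<bullet> Mf R i w = (\<Sum>j\<in>UNIV. - (\<Sum>\<beta>\<in>N. R w * (T \<beta> i j w * h \<beta> k j w)))"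
    by (simp add: Mf_def inner_sum_right inner_diff_right Yv_U[OF w])
  also have "\<dots> = - (\<Sum>\<beta>\<in>N. \<Sum>j\<in>UNIV. R w * (T \<beta> i j w * h \<beta> k j w))"
    unfolding sum_negf by (subst sum.swap) (rule refl)
  finally show ?thesis by (simp only: sum_distrib_left)
qed

lemma hess_eq: "hess y e R i j w = D j (D i R) w + (\<Sum>k\<in>UNIV. D k R w * G k j i w)"
  by (simp add: hess_def grad_def[abs_def] D_def[abs_def] G_def)

lemma normal_laplacian_eq:
  assumes w: "w \<in> V" and \<alpha>: "\<alpha> \<in> N"
  shows "normal_laplacian y e \<nu> \<alpha> w = (\<Sum>i\<in>UNIV. D i (Hd \<alpha> i) w - (\<Sum>k\<in>UNIV. G i i k w * Hd \<alpha> k w)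
    - (\<Sum>\<beta>\<in>N. Nn \<alpha> i \<beta> w * Hd \<beta> i w))"
proof -
  have "mean_curv_deriv2 y e \<nu> \<alpha> i i w = D i (Hd \<alpha> i) w + (\<Sum>k\<in>UNIV. Hd \<alpha> k w * G k i i w)
      + (\<Sum>\<beta>\<in>N. Hd \<beta> i w * Nn \<beta> i \<alpha> w)" for i
    by (simp add: mean_curv_deriv2_def D_def Hd_def[abs_def] G_def Nn_def N_def)
  moreover have "(\<Sum>k\<in>UNIV. Hd \<alpha> k w * G k i i w) = - (\<Sum>k\<in>UNIV. G i i k w * Hd \<alpha> k w)" for i
    unfolding sum_negf[symmetric]
  proof (intro sum.cong refl)
    fix k show "Hd \<alpha> k w * G k i i w = - (G i i k w * Hd \<alpha> k w)"
      using G_anti[OF w, of k i i] by simp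
  qed
  moreover have "(\<Sum>\<beta>\<in>N. Hd \<beta> i w * Nn \<beta> i \<alpha> w) = - (\<Sum>\<beta>\<in>N. Nn \<alpha> i \<beta> w * Hd \<beta> i w)" for i
    unfolding sum_negf[symmetric]
  proof (intro sum.cong refl)
    fix \<beta> assume "\<beta> \<in> N"
    then show "Hd \<beta> i w * Nn \<beta> i \<alpha> w = - (Nn \<alpha> i \<beta> w * Hd \<beta> i w)"
      using Nn_anti[OF w, of \<beta> \<alpha> i] \<alpha> by simp
  qed
  ultimately show ?thesis by (simp add: normal_laplacian_def)
qed

text \<open>The frame derivatives of R need not commute, but T is symmetric, so the order may be
  exchanged inside the pairing before the connection term completes the Hessian.\<close>

lemma hess_T_sum:
  assumes w: "w \<in> V" and \<alpha>: "\<alpha> \<in> N"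
  shows "(\<Sum>i\<in>UNIV. \<Sum>j\<in>UNIV. D i (D j R) w * T \<alpha> i j w)
      + (\<Sum>j\<in>UNIV. D j R w * (\<Sum>i\<in>UNIV. \<Sum>l\<in>UNIV. G j i l w * T \<alpha> l i w))
    = (\<Sum>i\<in>UNIV. \<Sum>j\<in>UNIV. hess y e R i j w * T \<alpha> i j w)"
proof -
  have 1: "(\<Sum>i\<in>UNIV. \<Sum>j\<in>UNIV. D i (D j R) w * T \<alpha> i j w) = (\<Sum>i\<in>UNIV. \<Sum>j\<in>UNIV. D j (D i R) w * T \<alpha> i j w)"
    by (subst sum.swap) (intro sum.cong refl, simp add: T_sym[OF w, of \<alpha>])
  have "(\<Sum>j\<in>UNIV. D j R w * (\<Sum>i\<in>UNIV. \<Sum>l\<in>UNIV. G j i l w * T \<alpha> l i w))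
      = (\<Sum>k\<in>UNIV. \<Sum>j\<in>UNIV. \<Sum>i\<in>UNIV. D k R w * G k j i w * T \<alpha> i j w)"
    by (simp only: sum_distrib_left mult.assoc)
  also have "\<dots> = (\<Sum>j\<in>UNIV. \<Sum>i\<in>UNIV. \<Sum>k\<in>UNIV. D k R w * G k j i w * T \<alpha> i j w)" by (rule sum_swap3)
  also have "\<dots> = (\<Sum>i\<in>UNIV. \<Sum>j\<in>UNIV. \<Sum>k\<in>UNIV. D k R w * G k j i w * T \<alpha> i j w)" by (rule sum.swap)
  finally show ?thesis
    unfolding 1 hess_eq distrib_right sum.distrib sum_distrib_right by simp
qed

text \<open>Second divergence of R T. The cross term of dR with the derivative of H appears twice,
  once from differentiating R in the second part of \<open>nu_M\<close> and once from the divergence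
  of T in the first part. The last term is the tangential part of \<open>Mf\<close>, seen through
  the derivative of the normal vector.\<close>

lemma divergence_M:
  assumes w: "w \<in> V" and \<alpha>: "\<alpha> \<in> N" and R: "Ck_on (Suc (Suc 0)) V R"
  shows "nu \<alpha> w \<bullet> (\<Sum>i\<in>UNIV. D i (Mf R i) w - (\<Sum>k\<in>UNIV. G i i k w *\<^sub>R Mf R k w))
    = (\<Sum>i\<in>UNIV. \<Sum>j\<in>UNIV. hess y e R i j w * T \<alpha> i j w)
      + 2 * (real CARD('n) - 1) * (\<Sum>i\<in>UNIV. D i R w * Hd \<alpha> i w)
      + (real CARD('n) - 1) * R w * normal_laplacian y e \<nu> \<alpha> w
      - R w * (\<Sum>i\<in>UNIV. \<Sum>k\<in>UNIV. h \<alpha> k i w * (\<Sum>\<beta>\<in>N. \<Sum>j\<in>UNIV. T \<beta> i j w * h \<beta> k j w))"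
proof -
  let ?n1 = "real CARD('n) - 1"
  have R1: "Ck_on (Suc 0) V R" by (rule Ck_on_SucD[OF R])
  have DR: "Ck_on (Suc 0) V (D j R)" for j by (rule Ck_D[OF R])
  define m where "m \<alpha> i w = (\<Sum>j\<in>UNIV. D j R w * T \<alpha> i j w) + ?n1 * (R w * Hd \<alpha> i w)" for \<alpha> i w
  have nuM: "nu \<alpha> w \<bullet> Mf R i w = m \<alpha> i w" if "w \<in> V" "\<alpha> \<in> N" for \<alpha> i w
    unfolding m_def by (rule nu_M[OF that R1])
  have Dm: "D i (m \<alpha> i) w = (\<Sum>j\<in>UNIV. D j R w * D i (T \<alpha> i j) w + D i (D j R) w * T \<alpha> i j w)
      + ?n1 * (R w * D i (Hd \<alpha> i) w + D i R w * Hd \<alpha> i w)" for i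
  proof -
    have c1: "Ck_on (Suc 0) V (\<lambda>w. D j R w * T \<alpha> i j w)" for j
      by (rule Ck_on_mult[OF open_V DR Ck_T[OF \<alpha>]])
    have c2: "Ck_on (Suc 0) V (\<lambda>w. R w * Hd \<alpha> i w)" by (rule Ck_on_mult[OF open_V R1 Ck_Hd[OF \<alpha>]])
    have c3: "Ck_on (Suc 0) V (\<lambda>w. ?n1 * (R w * Hd \<alpha> i w))" by (rule Ck_on_mult[OF open_V Ck_on_const c2])
    have c4: "Ck_on (Suc 0) V (\<lambda>w. \<Sum>j\<in>UNIV. D j R w * T \<alpha> i j w)" by (intro Ck_on_sum open_V c1)
    show ?thesis
      unfolding m_def[abs_def] D_add[OF w c4 c3] D_sum[OF w c1] D_cmult[OF w c2]
        D_mult[OF w R1 Ck_Hd[OF \<alpha>]] D_mult[OF w DR Ck_T[OF \<alpha>]] ..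
  qed
  have DM: "nu \<alpha> w \<bullet> D i (Mf R i) w = D i (m \<alpha> i) w - (\<Sum>\<beta>\<in>N. Nn \<alpha> i \<beta> w * m \<beta> i w)
      - R w * (\<Sum>k\<in>UNIV. h \<alpha> k i w * (\<Sum>\<beta>\<in>N. \<Sum>j\<in>UNIV. T \<beta> i j w * h \<beta> k j w))" for i
  proof -
    have "nu \<alpha> w \<bullet> D i (Mf R i) w + D i (nu \<alpha>) w \<bullet> Mf R i w = D i (\<lambda>w. nu \<alpha> w \<bullet> Mf R i w) w"
      by (rule D_inner[OF w Ck_nu[OF \<alpha>] Ck_M[OF R], symmetric])
    also have "\<dots> = D i (m \<alpha> i) w"
      by (rule D_cong[OF w nuM[OF _ \<alpha>]])
    finally have "nu \<alpha> w \<bullet> D i (Mf R i) w = D i (m \<alpha> i) w - D i (nu \<alpha>) w \<bullet> Mf R i w" by linarith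
    moreover have "(\<Sum>\<beta>\<in>N. Nn \<alpha> i \<beta> w * (nu \<beta> w \<bullet> Mf R i w)) = (\<Sum>\<beta>\<in>N. Nn \<alpha> i \<beta> w * m \<beta> i w)"
      by (intro sum.cong refl) (simp only: nuM[OF w])
    ultimately show ?thesis
      unfolding D_nu_inner[OF w \<alpha>] Yv_M[OF w R1]
      by (simp add: sum_negf sum_distrib_left mult.left_commute)
  qed
  have "nu \<alpha> w \<bullet> (\<Sum>i\<in>UNIV. D i (Mf R i) w - (\<Sum>k\<in>UNIV. G i i k w *\<^sub>R Mf R k w))
      = (\<Sum>i\<in>UNIV. D i (m \<alpha> i) w - (\<Sum>\<beta>\<in>N. Nn \<alpha> i \<beta> w * m \<beta> i w)
          - R w * (\<Sum>k\<in>UNIV. h \<alpha> k i w * (\<Sum>\<beta>\<in>N. \<Sum>j\<in>UNIV. T \<beta> i j w * h \<beta> k j w))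
          - (\<Sum>k\<in>UNIV. G i i k w * m \<alpha> k w))"
    by (simp add: inner_sum_right inner_diff_right DM nuM[OF w \<alpha>])
  also have "\<dots> = (\<Sum>i\<in>UNIV. D i (m \<alpha> i) w - (\<Sum>\<beta>\<in>N. Nn \<alpha> i \<beta> w * m \<beta> i w) - (\<Sum>k\<in>UNIV. G i i k w * m \<alpha> k w))
      - R w * (\<Sum>i\<in>UNIV. \<Sum>k\<in>UNIV. h \<alpha> k i w * (\<Sum>\<beta>\<in>N. \<Sum>j\<in>UNIV. T \<beta> i j w * h \<beta> k j w))"
    by (simp add: sum_subtractf sum_distrib_left)
  \<comment> \<open>The summand dR paired with T and the summand (n - 1) R times the derivative of H
    are treated separately: the first gives the Hessian term, the second the normal
    Laplacian.\<close>
  also have "(\<Sum>i\<in>UNIV. D i (m \<alpha> i) w - (\<Sum>\<beta>\<in>N. Nn \<alpha> i \<beta> w * m \<beta> i w) - (\<Sum>k\<in>UNIV. G i i k w * m \<alpha> k w))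
      = (\<Sum>i\<in>UNIV. (\<Sum>j\<in>UNIV. D j R w * D i (T \<alpha> i j) w + D i (D j R) w * T \<alpha> i j w)
          - (\<Sum>\<beta>\<in>N. Nn \<alpha> i \<beta> w * (\<Sum>j\<in>UNIV. D j R w * T \<beta> i j w))
          - (\<Sum>k\<in>UNIV. G i i k w * (\<Sum>j\<in>UNIV. D j R w * T \<alpha> k j w)))
        + (\<Sum>i\<in>UNIV. ?n1 * (R w * D i (Hd \<alpha> i) w + D i R w * Hd \<alpha> i w)
          - (\<Sum>\<beta>\<in>N. Nn \<alpha> i \<beta> w * (?n1 * (R w * Hd \<beta> i w)))
          - (\<Sum>k\<in>UNIV. G i i k w * (?n1 * (R w * Hd \<alpha> k w))))"
    unfolding Dm unfolding m_def distrib_left sum.distrib[symmetric]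
    by (intro sum.cong refl) (simp add: sum.distrib distrib_left)
  also have "(\<Sum>i\<in>UNIV. ?n1 * (R w * D i (Hd \<alpha> i) w + D i R w * Hd \<alpha> i w)
          - (\<Sum>\<beta>\<in>N. Nn \<alpha> i \<beta> w * (?n1 * (R w * Hd \<beta> i w)))
          - (\<Sum>k\<in>UNIV. G i i k w * (?n1 * (R w * Hd \<alpha> k w))))
      = ?n1 * R w * normal_laplacian y e \<nu> \<alpha> w + ?n1 * (\<Sum>i\<in>UNIV. D i R w * Hd \<alpha> i w)"
  proof -
    have "?n1 * (R w * D i (Hd \<alpha> i) w + D i R w * Hd \<alpha> i w)
          - (\<Sum>\<beta>\<in>N. Nn \<alpha> i \<beta> w * (?n1 * (R w * Hd \<beta> i w)))
          - (\<Sum>k\<in>UNIV. G i i k w * (?n1 * (R w * Hd \<alpha> k w)))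
        = ?n1 * R w * (D i (Hd \<alpha> i) w - (\<Sum>k\<in>UNIV. G i i k w * Hd \<alpha> k w) - (\<Sum>\<beta>\<in>N. Nn \<alpha> i \<beta> w * Hd \<beta> i w))
          + ?n1 * (D i R w * Hd \<alpha> i w)" for i
    proof -
      have 1: "(\<Sum>\<beta>\<in>N. Nn \<alpha> i \<beta> w * (?n1 * (R w * Hd \<beta> i w))) = ?n1 * R w * (\<Sum>\<beta>\<in>N. Nn \<alpha> i \<beta> w * Hd \<beta> i w)"
        unfolding sum_distrib_left by (intro sum.cong refl) (simp only: mult_ac)
      have 2: "(\<Sum>k\<in>UNIV. G i i k w * (?n1 * (R w * Hd \<alpha> k w))) = ?n1 * R w * (\<Sum>k\<in>UNIV. G i i k w * Hd \<alpha> k w)"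
        unfolding sum_distrib_left by (intro sum.cong refl) (simp only: mult_ac)
      show ?thesis unfolding 1 2 by (simp only: right_diff_distrib distrib_left mult.assoc)
    qed
    then show ?thesis
      by (simp only: sum.distrib sum_distrib_left[symmetric] normal_laplacian_eq[OF w \<alpha>])
  qed
  also have "(\<Sum>i\<in>UNIV. (\<Sum>j\<in>UNIV. D j R w * D i (T \<alpha> i j) w + D i (D j R) w * T \<alpha> i j w)
          - (\<Sum>\<beta>\<in>N. Nn \<alpha> i \<beta> w * (\<Sum>j\<in>UNIV. D j R w * T \<beta> i j w))
          - (\<Sum>k\<in>UNIV. G i i k w * (\<Sum>j\<in>UNIV. D j R w * T \<alpha> k j w)))
      = (\<Sum>i\<in>UNIV. \<Sum>j\<in>UNIV. hess y e R i j w * T \<alpha> i j w) + ?n1 * (\<Sum>i\<in>UNIV. D i R w * Hd \<alpha> i w)"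
  proof -
    have DTs: "D i (T \<alpha> i j) w = D i (T \<alpha> j i) w" for i j by (rule D_cong[OF w T_sym])
    have "(\<Sum>j\<in>UNIV. D j R w * D i (T \<alpha> i j) w + D i (D j R) w * T \<alpha> i j w)
          - (\<Sum>\<beta>\<in>N. Nn \<alpha> i \<beta> w * (\<Sum>j\<in>UNIV. D j R w * T \<beta> i j w))
          - (\<Sum>k\<in>UNIV. G i i k w * (\<Sum>j\<in>UNIV. D j R w * T \<alpha> k j w))
        = (\<Sum>j\<in>UNIV. D i (D j R) w * T \<alpha> i j w) + (\<Sum>j\<in>UNIV. D j R w * (D i (T \<alpha> j i) w
          - (\<Sum>l\<in>UNIV. G i i l w * T \<alpha> j l w) - (\<Sum>\<beta>\<in>N. Nn \<alpha> i \<beta> w * T \<beta> j i w)))" for i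
    proof -
      have 1: "(\<Sum>\<beta>\<in>N. Nn \<alpha> i \<beta> w * (\<Sum>j\<in>UNIV. D j R w * T \<beta> i j w))
          = (\<Sum>j\<in>UNIV. D j R w * (\<Sum>\<beta>\<in>N. Nn \<alpha> i \<beta> w * T \<beta> j i w))"
        unfolding sum_distrib_left
        by (subst sum.swap) (intro sum.cong refl, simp only: T_sym[OF w, of _ i] mult.left_commute)
      have 2: "(\<Sum>k\<in>UNIV. G i i k w * (\<Sum>j\<in>UNIV. D j R w * T \<alpha> k j w))
          = (\<Sum>j\<in>UNIV. D j R w * (\<Sum>l\<in>UNIV. G i i l w * T \<alpha> j l w))"
        unfolding sum_distrib_left
      proof (subst sum.swap, intro sum.cong refl)
        fix j k show "G i i k w * (D j R w * T \<alpha> k j w) = D j R w * (G i i k w * T \<alpha> j k w)"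
          using T_sym[OF w, of \<alpha> k j] by simp
      qed
      show ?thesis unfolding 1 2 DTs by (simp add: sum.distrib right_diff_distrib sum_subtractf)
    qed
    then have "(\<Sum>i\<in>UNIV. (\<Sum>j\<in>UNIV. D j R w * D i (T \<alpha> i j) w + D i (D j R) w * T \<alpha> i j w)
          - (\<Sum>\<beta>\<in>N. Nn \<alpha> i \<beta> w * (\<Sum>j\<in>UNIV. D j R w * T \<beta> i j w))
          - (\<Sum>k\<in>UNIV. G i i k w * (\<Sum>j\<in>UNIV. D j R w * T \<alpha> k j w)))
        = (\<Sum>i\<in>UNIV. \<Sum>j\<in>UNIV. D i (D j R) w * T \<alpha> i j w) + (\<Sum>i\<in>UNIV. \<Sum>j\<in>UNIV. D j R w * (D i (T \<alpha> j i) w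
          - (\<Sum>l\<in>UNIV. G i i l w * T \<alpha> j l w) - (\<Sum>\<beta>\<in>N. Nn \<alpha> i \<beta> w * T \<beta> j i w)))"
      by (simp only: sum.distrib)
    also have "(\<Sum>i\<in>UNIV. \<Sum>j\<in>UNIV. D j R w * (D i (T \<alpha> j i) w
          - (\<Sum>l\<in>UNIV. G i i l w * T \<alpha> j l w) - (\<Sum>\<beta>\<in>N. Nn \<alpha> i \<beta> w * T \<beta> j i w)))
        = (\<Sum>j\<in>UNIV. D j R w * (\<Sum>i\<in>UNIV. D i (T \<alpha> j i) w
          - (\<Sum>l\<in>UNIV. G i i l w * T \<alpha> j l w) - (\<Sum>\<beta>\<in>N. Nn \<alpha> i \<beta> w * T \<beta> j i w)))"
      unfolding sum_distrib_left by (rule sum.swap)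
    \<comment> \<open>\<open>divergence_T\<close> carries one more connection term, for the free
      index j. Moved to the other side, it is what turns the second frame derivatives of R into the
      Hessian.\<close>
    also have "\<dots> = (\<Sum>j\<in>UNIV. D j R w * (?n1 * Hd \<alpha> j w + (\<Sum>i\<in>UNIV. \<Sum>l\<in>UNIV. G j i l w * T \<alpha> l i w)))"
    proof (intro sum.cong refl arg_cong2[where f="(*)"])
      fix j
      show "(\<Sum>i\<in>UNIV. D i (T \<alpha> j i) w
          - (\<Sum>l\<in>UNIV. G i i l w * T \<alpha> j l w) - (\<Sum>\<beta>\<in>N. Nn \<alpha> i \<beta> w * T \<beta> j i w))
        = ?n1 * Hd \<alpha> j w + (\<Sum>i\<in>UNIV. \<Sum>l\<in>UNIV. G j i l w * T \<alpha> l i w)"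
        using divergence_T[OF w \<alpha>, of j] unfolding sum_subtractf by linarith
    qed
    also have "\<dots> = ?n1 * (\<Sum>i\<in>UNIV. D i R w * Hd \<alpha> i w)
        + (\<Sum>j\<in>UNIV. D j R w * (\<Sum>i\<in>UNIV. \<Sum>l\<in>UNIV. G j i l w * T \<alpha> l i w))"
      by (simp only: distrib_left sum.distrib mult.left_commute[of _ ?n1] sum_distrib_left[symmetric])
    finally show ?thesis using hess_T_sum[OF w \<alpha>, of R] by linarith
  qed
  finally show ?thesis by (simp add: algebra_simps)
qed

text \<open>Writing U for \<open>Uf\<close>, M for \<open>Mf\<close> and W for \<open>Wf\<close>,
  the Leibniz rule for W = U . D\<zeta> - M . \<zeta> gives four terms; the two with one derivative
  on \<zeta> cancel because M is the divergence of U.\<close>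

lemma divergence_identity:
  assumes w: "w \<in> V" and R: "Ck_on (Suc (Suc 0)) V R" and \<zeta>: "Ck_on (Suc (Suc 0)) V \<zeta>"
  shows "(\<Sum>i\<in>UNIV. \<Sum>j\<in>UNIV. Uf R i j w \<bullet> (D j (D i \<zeta>) w - (\<Sum>k\<in>UNIV. G i j k w *\<^sub>R D k \<zeta> w)))
    = (\<Sum>j\<in>UNIV. D j (Wf R \<zeta> j) w - (\<Sum>k\<in>UNIV. G j j k w * Wf R \<zeta> k w))
      + (\<Sum>i\<in>UNIV. D i (Mf R i) w - (\<Sum>k\<in>UNIV. G i i k w *\<^sub>R Mf R k w)) \<bullet> \<zeta> w"
proof -
  have R1: "Ck_on (Suc 0) V R" by (rule Ck_on_SucD[OF R])
  have \<zeta>1: "Ck_on (Suc 0) V \<zeta>" by (rule Ck_on_SucD[OF \<zeta>])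
  have DW: "D j (Wf R \<zeta> j) w = (\<Sum>i\<in>UNIV. Uf R i j w \<bullet> D j (D i \<zeta>) w + D j (Uf R i j) w \<bullet> D i \<zeta> w)
      - (Mf R j w \<bullet> D j \<zeta> w + D j (Mf R j) w \<bullet> \<zeta> w)" for j
  proof -
    have c1: "Ck_on (Suc 0) V (\<lambda>w. Uf R i j w \<bullet> D i \<zeta> w)" for i
      by (rule Ck_on_inner[OF open_V Ck_U[OF R1] Ck_D[OF \<zeta>]])
    have c2: "Ck_on (Suc 0) V (\<lambda>w. \<Sum>i\<in>UNIV. Uf R i j w \<bullet> D i \<zeta> w)" by (intro Ck_on_sum open_V c1)
    have c3: "Ck_on (Suc 0) V (\<lambda>w. Mf R j w \<bullet> \<zeta> w)" by (rule Ck_on_inner[OF open_V Ck_M[OF R] \<zeta>1])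
    show ?thesis
      unfolding Wf_def[abs_def] D_diff[OF w c2 c3] D_sum[OF w c1] D_inner[OF w Ck_M[OF R] \<zeta>1]
        D_inner[OF w Ck_U[OF R1] Ck_D[OF \<zeta>]] ..
  qed
  let ?UDD = "\<Sum>i\<in>UNIV. \<Sum>j\<in>UNIV. Uf R i j w \<bullet> D j (D i \<zeta>) w"
  let ?DUD = "\<Sum>i\<in>UNIV. \<Sum>j\<in>UNIV. D j (Uf R i j) w \<bullet> D i \<zeta> w"
  let ?GU = "\<Sum>i\<in>UNIV. \<Sum>j\<in>UNIV. \<Sum>k\<in>UNIV. G i j k w * (Uf R k j w \<bullet> D i \<zeta> w)"
  let ?GG = "\<Sum>i\<in>UNIV. \<Sum>j\<in>UNIV. \<Sum>k\<in>UNIV. G j j k w * (Uf R i k w \<bullet> D i \<zeta> w)"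
  have s1: "(\<Sum>j\<in>UNIV. \<Sum>i\<in>UNIV. Uf R i j w \<bullet> D j (D i \<zeta>) w) = ?UDD"
    "(\<Sum>j\<in>UNIV. \<Sum>i\<in>UNIV. D j (Uf R i j) w \<bullet> D i \<zeta> w) = ?DUD"
    by (rule sum.swap)+
  have s2: "(\<Sum>j\<in>UNIV. Mf R j w \<bullet> D j \<zeta> w) = ?DUD - ?GU - ?GG"
    unfolding Mf_def by (simp add: inner_sum_left inner_diff_left sum_subtractf)
  have s3: "(\<Sum>j\<in>UNIV. \<Sum>k\<in>UNIV. G j j k w * Wf R \<zeta> k w)
      = ?GG - (\<Sum>j\<in>UNIV. \<Sum>k\<in>UNIV. G j j k w * (Mf R k w \<bullet> \<zeta> w))"
  proof -
    have "(\<Sum>j\<in>UNIV. \<Sum>k\<in>UNIV. G j j k w * Wf R \<zeta> k w)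
        = (\<Sum>j\<in>UNIV. \<Sum>k\<in>UNIV. \<Sum>i\<in>UNIV. G j j k w * (Uf R i k w \<bullet> D i \<zeta> w))
          - (\<Sum>j\<in>UNIV. \<Sum>k\<in>UNIV. G j j k w * (Mf R k w \<bullet> \<zeta> w))"
      by (simp add: Wf_def right_diff_distrib sum_subtractf sum_distrib_left)
    moreover have "(\<Sum>j\<in>UNIV. \<Sum>k\<in>UNIV. \<Sum>i\<in>UNIV. G j j k w * (Uf R i k w \<bullet> D i \<zeta> w)) = ?GG"
      by (rule sum_swap3[symmetric])
    ultimately show ?thesis by (simp only:)
  qed
  \<comment> \<open>Antisymmetry of the connection forms moves the correction from the Hessian of
    \<zeta> to \<open>Uf\<close>.\<close>
  have s4: "(\<Sum>i\<in>UNIV. \<Sum>j\<in>UNIV. \<Sum>k\<in>UNIV. G i j k w * (Uf R i j w \<bullet> D k \<zeta> w)) = - ?GU"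
  proof -
    have "(\<Sum>i\<in>UNIV. \<Sum>j\<in>UNIV. \<Sum>k\<in>UNIV. G i j k w * (Uf R i j w \<bullet> D k \<zeta> w))
        = (\<Sum>j\<in>UNIV. \<Sum>k\<in>UNIV. \<Sum>i\<in>UNIV. G i j k w * (Uf R i j w \<bullet> D k \<zeta> w))" by (rule sum_swap3)
    also have "\<dots> = (\<Sum>k\<in>UNIV. \<Sum>j\<in>UNIV. \<Sum>i\<in>UNIV. G i j k w * (Uf R i j w \<bullet> D k \<zeta> w))" by (rule sum.swap)
    also have "\<dots> = (\<Sum>i\<in>UNIV. \<Sum>j\<in>UNIV. \<Sum>k\<in>UNIV. - (G i j k w * (Uf R k j w \<bullet> D i \<zeta> w)))"
    proof (intro sum.cong refl)
      fix k j i show "G i j k w * (Uf R i j w \<bullet> D k \<zeta> w) = - (G k j i w * (Uf R i j w \<bullet> D k \<zeta> w))"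
        using G_anti[OF w, of i j k] by simp
    qed
    finally show ?thesis by (simp add: sum_negf)
  qed
  have "(\<Sum>j\<in>UNIV. D j (Wf R \<zeta> j) w) = ?UDD + ?DUD - ((?DUD - ?GU - ?GG) + (\<Sum>j\<in>UNIV. D j (Mf R j) w \<bullet> \<zeta> w))"
    by (simp only: DW sum_subtractf sum.distrib s1 s2)
  moreover have "(\<Sum>i\<in>UNIV. \<Sum>j\<in>UNIV. Uf R i j w \<bullet> (D j (D i \<zeta>) w - (\<Sum>k\<in>UNIV. G i j k w *\<^sub>R D k \<zeta> w))) = ?UDD + ?GU"
    by (simp add: inner_diff_right inner_sum_right sum_subtractf s4)
  moreover have "(\<Sum>i\<in>UNIV. D i (Mf R i) w - (\<Sum>k\<in>UNIV. G i i k w *\<^sub>R Mf R k w)) \<bullet> \<zeta> w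
      = (\<Sum>j\<in>UNIV. D j (Mf R j) w \<bullet> \<zeta> w) - (\<Sum>j\<in>UNIV. \<Sum>k\<in>UNIV. G j j k w * (Mf R k w \<bullet> \<zeta> w))"
    by (simp add: inner_sum_left inner_diff_left sum_subtractf)
  ultimately show ?thesis by (simp only: sum_subtractf s3)
qed

text \<open>Two expressions for the covariant Hessian of \<zeta>: the one in
  \<open>rho_sq_var\<close>, which needs a basis at one point only, and the one by frame
  derivatives. The derivative of the frame vector occurs on the right in both terms and
  cancels.\<close>

lemma second_covariant_derivative:
  assumes w: "w \<in> V" and \<zeta>: "Ck_on 2 V \<zeta>"
  shows "dd \<zeta> w (e w i) (e w j) - (\<Sum>k\<in>UNIV. (dd y w (e w i) (e w j) \<bullet> Yv k w) *\<^sub>R D k \<zeta> w)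
    = D j (D i \<zeta>) w - (\<Sum>k\<in>UNIV. G i j k w *\<^sub>R D k \<zeta> w)"
proof -
  let ?E = "D j (\<lambda>w. e w i) w"
  have d\<zeta>: "\<zeta> differentiable (at w)" using \<zeta> w by (simp add: numeral_2_eq_2)
  have "((\<lambda>w. dirderiv \<zeta> w (e w i)) has_derivative (\<lambda>x. dd \<zeta> w (e w i) (dirderiv (\<lambda>w. w) w x)
      + dirderiv \<zeta> w (dirderiv (\<lambda>w. e w i) w x))) (at w)"
    by (rule has_derivative_dirderiv_along[OF open_V \<zeta> open_V w, where g="\<lambda>w. w"])
      (use diff1[OF frame_facts(2) w] in auto)
  moreover have "dirderiv (\<lambda>w. w) w x = x" for x by (rule dirderiv_eqI) (rule has_derivative_ident)
  ultimately have "((\<lambda>w. dirderiv \<zeta> w (e w i)) has_derivative (\<lambda>x. dd \<zeta> w (e w i) x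
      + dirderiv \<zeta> w (dirderiv (\<lambda>w. e w i) w x))) (at w)" by simp
  then have 1: "D j (D i \<zeta>) w = dd \<zeta> w (e w i) (e w j) + dirderiv \<zeta> w ?E"
    unfolding D_def by (rule dirderiv_eqI)
  have 2: "dirderiv \<zeta> w ?E = (\<Sum>k\<in>UNIV. (dirderiv y w ?E \<bullet> Yv k w) *\<^sub>R D k \<zeta> w)"
    by (subst coord_expansion[OF w, of ?E])
      (simp only: linear_sum[OF linear_dirderiv[OF d\<zeta>]] linear_cmul[OF linear_dirderiv[OF d\<zeta>]] D_def)
  have 3: "(\<Sum>k\<in>UNIV. G i j k w *\<^sub>R D k \<zeta> w) = (\<Sum>k\<in>UNIV. (dd y w (e w i) (e w j) \<bullet> Yv k w) *\<^sub>R D k \<zeta> w)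
      + (\<Sum>k\<in>UNIV. (dirderiv y w ?E \<bullet> Yv k w) *\<^sub>R D k \<zeta> w)"
    by (simp only: G_eq D_Yv[OF w] inner_add_left scaleR_add_left sum.distrib)
  show ?thesis unfolding 1 2 3 by simp
qed

text \<open>The Euler-Lagrange expression in the form in which the computation produces it, with the
  trace-free form and rho squared not yet expanded.\<close>

definition EL :: "(real ^ 'n => real) => nat => real ^ 'n => real"
  where "EL R \<alpha> w = (\<Sum>i\<in>UNIV. \<Sum>j\<in>UNIV. hess y e R i j w * T \<alpha> i j w)
      + 2 * (real CARD('n) - 1) * (\<Sum>i\<in>UNIV. D i R w * Hd \<alpha> i w)
      + (real CARD('n) - 1) * R w * normal_laplacian y e \<nu> \<alpha> w
      + R w * (\<Sum>i\<in>UNIV. \<Sum>k\<in>UNIV. h \<alpha> k i w * (\<Sum>\<beta>\<in>N. \<Sum>j\<in>UNIV. T \<beta> i j w * h \<beta> k j w))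
      - R w * rho_sq y w (e w) (\<nu> w) * H \<alpha> w"

text \<open>The left side is the variation of the density divided by n dv, where R rho^2 = rho^n.
  For normal \<zeta> the tangential part of its derivative is -h . \<zeta>, so the metric varies by
  -2 h . \<zeta>. This yields the cubic term with coefficient 2, of which
  \<open>divergence_M\<close> takes one away.\<close>

lemma normal_variation:
  assumes w: "w \<in> V" and R: "Ck_on (Suc (Suc 0)) V R" and \<zeta>: "Ck_on (Suc (Suc 0)) V \<zeta>"
    and normal: "\<And>x k. x \<in> V ==> Yv k x \<bullet> \<zeta> x = 0" "y w \<bullet> \<zeta> w = 0"
  shows "R w * rho_sq_var y \<zeta> w (e w) (\<nu> w) / 2
      + R w * rho_sq y w (e w) (\<nu> w) * area_var y \<zeta> w (e w) / real CARD('n)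
    = (\<Sum>\<alpha>\<in>N. EL R \<alpha> w * (nu \<alpha> w \<bullet> \<zeta> w))
      + (\<Sum>j\<in>UNIV. D j (Wf R \<zeta> j) w - (\<Sum>k\<in>UNIV. G j j k w * Wf R \<zeta> k w))"
proof -
  let ?z = "\<lambda>\<alpha>. nu \<alpha> w \<bullet> \<zeta> w"
  have \<zeta>1: "Ck_on (Suc 0) V \<zeta>" by (rule Ck_on_SucD[OF \<zeta>])
  have \<zeta>2: "Ck_on 2 V \<zeta>" using \<zeta> by (simp only: numeral_2_eq_2)
  have exp: "\<zeta> w \<bullet> v = (\<Sum>\<alpha>\<in>N. ?z \<alpha> * (nu \<alpha> w \<bullet> v))" for v
  proof -
    have "\<zeta> w = (\<Sum>\<alpha>\<in>N. ?z \<alpha> *\<^sub>R nu \<alpha> w)"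
      using frame_expansion[OF w, of "\<zeta> w"] normal(1)[OF w] normal(2)
      by (simp add: inner_commute[of "\<zeta> w"])
    then have "\<zeta> w \<bullet> v = (\<Sum>\<alpha>\<in>N. ?z \<alpha> *\<^sub>R nu \<alpha> w) \<bullet> v" by simp
    then show ?thesis by (simp only: inner_sum_left inner_scaleR_left)
  qed
  have D\<zeta>Y: "D i \<zeta> w \<bullet> Yv k w = - (\<Sum>\<alpha>\<in>N. h \<alpha> k i w * ?z \<alpha>)" for i k
  proof -
    have "D i \<zeta> w \<bullet> Yv k w = - (D i (Yv k) w \<bullet> \<zeta> w)"
      by (rule D_const_inner[OF w normal(1) Ck_Yv \<zeta>1])
    also have "D i (Yv k) w \<bullet> \<zeta> w = (\<Sum>\<alpha>\<in>N. ?z \<alpha> * (nu \<alpha> w \<bullet> D i (Yv k) w))"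
      by (subst inner_commute) (rule exp)
    also have "\<dots> = (\<Sum>\<alpha>\<in>N. h \<alpha> k i w * ?z \<alpha>)"
      using h_eq[OF w, of _ i k] by (intro sum.cong refl) (simp add: inner_commute[of _ "D i (Yv k) w"])
    finally show ?thesis .
  qed
  have area: "area_var y \<zeta> w (e w) = - (real CARD('n) * (\<Sum>\<alpha>\<in>N. H \<alpha> w * ?z \<alpha>))"
  proof -
    have "area_var y \<zeta> w (e w) = (\<Sum>i\<in>UNIV. D i \<zeta> w \<bullet> Yv i w)"
      by (simp add: area_var_def D_def Yv_def)
    also have "\<dots> = - (\<Sum>i\<in>UNIV. \<Sum>\<alpha>\<in>N. h \<alpha> i i w * ?z \<alpha>)" by (simp add: D\<zeta>Y sum_negf)
    also have "(\<Sum>i\<in>UNIV. \<Sum>\<alpha>\<in>N. h \<alpha> i i w * ?z \<alpha>) = (\<Sum>\<alpha>\<in>N. (\<Sum>i\<in>UNIV. h \<alpha> i i w) * ?z \<alpha>)"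
      unfolding sum_distrib_right by (rule sum.swap)
    finally show ?thesis by (simp add: h_trace sum_distrib_left mult.assoc)
  qed
  let ?K = "\<lambda>i k. \<Sum>\<beta>\<in>N. \<Sum>j\<in>UNIV. T \<beta> i j w * h \<beta> k j w"
  let ?C = "\<lambda>i j. D j (D i \<zeta>) w - (\<Sum>k\<in>UNIV. G i j k w *\<^sub>R D k \<zeta> w)"
  have rv: "rho_sq_var y \<zeta> w (e w) (\<nu> w) = 2 * ((\<Sum>\<alpha>\<in>N. \<Sum>i\<in>UNIV. \<Sum>j\<in>UNIV. T \<alpha> i j w * (?C i j \<bullet> nu \<alpha> w))
      - (\<Sum>i\<in>UNIV. \<Sum>k\<in>UNIV. (D i \<zeta> w \<bullet> Yv k w + D k \<zeta> w \<bullet> Yv i w) * ?K i k))"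
    unfolding second_covariant_derivative[OF w \<zeta>2, symmetric]
    unfolding rho_sq_var_def T_def h_def D_def Yv_def nu_def N_def ..
  have U: "R w * (\<Sum>\<alpha>\<in>N. \<Sum>i\<in>UNIV. \<Sum>j\<in>UNIV. T \<alpha> i j w * (?C i j \<bullet> nu \<alpha> w))
      = (\<Sum>i\<in>UNIV. \<Sum>j\<in>UNIV. Uf R i j w \<bullet> ?C i j)"
    unfolding sum_swap3[of _ _ _ N] sum_distrib_left Uf_def inner_sum_left inner_scaleR_left
    by (simp only: mult.assoc inner_commute[of "nu _ w"])
  have h2: "(\<Sum>i\<in>UNIV. \<Sum>k\<in>UNIV. (D i \<zeta> w \<bullet> Yv k w + D k \<zeta> w \<bullet> Yv i w) * ?K i k)
      = - 2 * (\<Sum>\<alpha>\<in>N. ?z \<alpha> * (\<Sum>i\<in>UNIV. \<Sum>k\<in>UNIV. h \<alpha> k i w * ?K i k))"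
  proof -
    have "(D i \<zeta> w \<bullet> Yv k w + D k \<zeta> w \<bullet> Yv i w) = (\<Sum>\<alpha>\<in>N. - 2 * (?z \<alpha> * h \<alpha> k i w))" for i k
    proof -
      have "(\<Sum>\<alpha>\<in>N. h \<alpha> i k w * ?z \<alpha>) = (\<Sum>\<alpha>\<in>N. h \<alpha> k i w * ?z \<alpha>)"
        by (intro sum.cong refl) (simp only: h_sym[OF w, of _ i k])
      then show ?thesis unfolding D\<zeta>Y by (simp add: sum_distrib_left[symmetric] sum_negf mult.commute)
    qed
    then have "(\<Sum>i\<in>UNIV. \<Sum>k\<in>UNIV. (D i \<zeta> w \<bullet> Yv k w + D k \<zeta> w \<bullet> Yv i w) * ?K i k)
        = (\<Sum>i\<in>UNIV. \<Sum>k\<in>UNIV. \<Sum>\<alpha>\<in>N. - 2 * (?z \<alpha> * (h \<alpha> k i w * ?K i k)))"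
      by (simp only: sum_distrib_right mult.assoc)
    also have "\<dots> = (\<Sum>\<alpha>\<in>N. \<Sum>i\<in>UNIV. \<Sum>k\<in>UNIV. - 2 * (?z \<alpha> * (h \<alpha> k i w * ?K i k)))"
      by (rule sum_swap3[symmetric])
    finally show ?thesis by (simp only: sum_distrib_left)
  qed
  \<comment> \<open>\<open>EL\<close> has the cubic term with the opposite sign and the extra term
    -R rho^2 H; the two corrections undo this and cancel later against the variation of the metric
    and of the area.\<close>
  have dM: "(\<Sum>i\<in>UNIV. D i (Mf R i) w - (\<Sum>k\<in>UNIV. G i i k w *\<^sub>R Mf R k w)) \<bullet> \<zeta> w
      = (\<Sum>\<alpha>\<in>N. (EL R \<alpha> w - 2 * R w * (\<Sum>i\<in>UNIV. \<Sum>k\<in>UNIV. h \<alpha> k i w * ?K i k)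
          + R w * rho_sq y w (e w) (\<nu> w) * H \<alpha> w) * ?z \<alpha>)"
    (is "?L \<bullet> _ = _")
  proof -
    have alg: "a + b + c - r * s = (a + b + c + r * s - q) - 2 * r * s + q" for a b c r s q :: real
      by simp
    have "?L \<bullet> \<zeta> w = \<zeta> w \<bullet> ?L" by (rule inner_commute)
    also have "\<dots> = (\<Sum>\<alpha>\<in>N. ?z \<alpha> * (nu \<alpha> w \<bullet> ?L))" by (rule exp)
    also have "\<dots> = (\<Sum>\<alpha>\<in>N. (EL R \<alpha> w - 2 * R w * (\<Sum>i\<in>UNIV. \<Sum>k\<in>UNIV. h \<alpha> k i w * ?K i k)
          + R w * rho_sq y w (e w) (\<nu> w) * H \<alpha> w) * ?z \<alpha>)"
    proof (rule sum.cong[OF refl])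
      fix \<alpha> assume \<alpha>: "\<alpha> \<in> N"
      have "nu \<alpha> w \<bullet> ?L = EL R \<alpha> w - 2 * R w * (\<Sum>i\<in>UNIV. \<Sum>k\<in>UNIV. h \<alpha> k i w * ?K i k)
          + R w * rho_sq y w (e w) (\<nu> w) * H \<alpha> w"
        unfolding divergence_M[OF w \<alpha> R] EL_def by (rule alg)
      then show "?z \<alpha> * (nu \<alpha> w \<bullet> ?L) = (EL R \<alpha> w - 2 * R w * (\<Sum>i\<in>UNIV. \<Sum>k\<in>UNIV. h \<alpha> k i w * ?K i k)
          + R w * rho_sq y w (e w) (\<nu> w) * H \<alpha> w) * ?z \<alpha>" by (simp only: mult.commute)
    qed
    finally show ?thesis .
  qed
  have "R w * rho_sq_var y \<zeta> w (e w) (\<nu> w) / 2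
      = R w * (\<Sum>\<alpha>\<in>N. \<Sum>i\<in>UNIV. \<Sum>j\<in>UNIV. T \<alpha> i j w * (?C i j \<bullet> nu \<alpha> w))
        + 2 * R w * (\<Sum>\<alpha>\<in>N. ?z \<alpha> * (\<Sum>i\<in>UNIV. \<Sum>k\<in>UNIV. h \<alpha> k i w * ?K i k))"
  proof -
    have "r * (2 * (a - - 2 * b)) / 2 = r * a + 2 * r * b" for r a b :: real
      by (simp add: distrib_left)
    then show ?thesis unfolding rv h2 .
  qed
  also have "\<dots> = (\<Sum>j\<in>UNIV. D j (Wf R \<zeta> j) w - (\<Sum>k\<in>UNIV. G j j k w * Wf R \<zeta> k w))
      + (\<Sum>\<alpha>\<in>N. EL R \<alpha> w * ?z \<alpha>) + R w * rho_sq y w (e w) (\<nu> w) * (\<Sum>\<alpha>\<in>N. H \<alpha> w * ?z \<alpha>)"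
  proof -
    have "(\<Sum>\<alpha>\<in>N. (E \<alpha> - 2 * r * X \<alpha> + r * s * H \<alpha> w) * ?z \<alpha>)
        = (\<Sum>\<alpha>\<in>N. E \<alpha> * ?z \<alpha>) - 2 * r * (\<Sum>\<alpha>\<in>N. ?z \<alpha> * X \<alpha>) + r * s * (\<Sum>\<alpha>\<in>N. H \<alpha> w * ?z \<alpha>)"
      for E X :: "nat => real" and r s :: real
      unfolding sum_distrib_left sum_subtractf[symmetric] sum.distrib[symmetric]
      by (intro sum.cong refl) (simp add: algebra_simps)
    then show ?thesis unfolding U divergence_identity[OF w R \<zeta>] dM by simp
  qed
  finally have fin: "R w * rho_sq_var y \<zeta> w (e w) (\<nu> w) / 2
    = (\<Sum>j\<in>UNIV. D j (Wf R \<zeta> j) w - (\<Sum>k\<in>UNIV. G j j k w * Wf R \<zeta> k w))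
      + (\<Sum>\<alpha>\<in>N. EL R \<alpha> w * ?z \<alpha>) + R w * rho_sq y w (e w) (\<nu> w) * (\<Sum>\<alpha>\<in>N. H \<alpha> w * ?z \<alpha>)" .
  have alg: "x + c * - (n * s) / n = b + a" if "x = a + b + c * s" "n \<noteq> 0" for x a b c s n :: real
    using that by simp
  show ?thesis unfolding area by (rule alg[OF fin]) simp
qed

text \<open>Expand T as h minus H times the identity and rho^2 as S - n H^2. The Hessian term
  produces -H times the Laplacian of R, which is (n - 1) H times the Laplacian minus n H times the
  Laplacian, as in the theorem.\<close>

lemma EL_eq:
  assumes w: "w \<in> V" and \<alpha>: "\<alpha> \<in> N"
  shows "EL R \<alpha> w =
    - R w * (sff_sq y w (e w) (\<nu> w) * H \<alpha> w
             + (\<Sum>\<beta>\<in>N. \<Sum>i\<in>UNIV. \<Sum>j\<in>UNIV. H \<beta> w * h \<beta> i j w * h \<alpha> i j w)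
             - (\<Sum>\<beta>\<in>N. \<Sum>i\<in>UNIV. \<Sum>j\<in>UNIV. \<Sum>k\<in>UNIV. h \<alpha> i j w * h \<beta> i k w * h \<beta> k j w)
             - real CARD('n) * (norm (mean_curv_vec y w (e w) (\<nu> w)))\<^sup>2 * H \<alpha> w)
    + (real CARD('n) - 1) * H \<alpha> w * laplacian y e R w
    + 2 * (real CARD('n) - 1) * (\<Sum>i\<in>UNIV. grad e R i w * mean_curv_deriv y e \<nu> \<alpha> i w)
    + (real CARD('n) - 1) * R w * normal_laplacian y e \<nu> \<alpha> w
    - (\<Sum>i\<in>UNIV. \<Sum>j\<in>UNIV. hess y e R i j w * (real CARD('n) * H \<alpha> w * (if i = j then 1 else 0) - h \<alpha> i j w))"
proof -
  have hT: "(\<Sum>i\<in>UNIV. \<Sum>j\<in>UNIV. hess y e R i j w * T \<alpha> i j w)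
      = (\<Sum>i\<in>UNIV. \<Sum>j\<in>UNIV. hess y e R i j w * h \<alpha> i j w) - H \<alpha> w * laplacian y e R w"
    by (simp add: T_eq right_diff_distrib sum_subtractf laplacian_def sum_distrib_left mult.commute
        if_distrib[of "(*) _"] cong: if_cong)
  have hH: "(\<Sum>i\<in>UNIV. \<Sum>j\<in>UNIV. hess y e R i j w * (real CARD('n) * H \<alpha> w * (if i = j then 1 else 0) - h \<alpha> i j w))
      = real CARD('n) * H \<alpha> w * laplacian y e R w - (\<Sum>i\<in>UNIV. \<Sum>j\<in>UNIV. hess y e R i j w * h \<alpha> i j w)"
  proof -
    have "hess y e R i j w * (real CARD('n) * H \<alpha> w * (if i = j then 1 else 0) - h \<alpha> i j w)
        = (if i = j then real CARD('n) * H \<alpha> w * hess y e R i i w else 0) - hess y e R i j w * h \<alpha> i j w" for i j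
      by (simp add: right_diff_distrib)
    then show ?thesis
      by (simp only: sum_subtractf sum_if_diag laplacian_def sum_distrib_left)
  qed
  have cub: "(\<Sum>i\<in>UNIV. \<Sum>k\<in>UNIV. h \<alpha> k i w * (\<Sum>\<beta>\<in>N. \<Sum>j\<in>UNIV. T \<beta> i j w * h \<beta> k j w))
      = (\<Sum>\<beta>\<in>N. \<Sum>i\<in>UNIV. \<Sum>j\<in>UNIV. \<Sum>k\<in>UNIV. h \<alpha> i j w * h \<beta> i k w * h \<beta> k j w)
        - (\<Sum>\<beta>\<in>N. \<Sum>i\<in>UNIV. \<Sum>j\<in>UNIV. H \<beta> w * h \<beta> i j w * h \<alpha> i j w)"
  proof -
    have K: "(\<Sum>j\<in>UNIV. T \<beta> i j w * h \<beta> k j w) = (\<Sum>j\<in>UNIV. h \<beta> i j w * h \<beta> j k w) - H \<beta> w * h \<beta> i k w" for \<beta> i k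
    proof -
      have "(\<Sum>j\<in>UNIV. T \<beta> i j w * h \<beta> k j w) = (\<Sum>j\<in>UNIV. h \<beta> i j w * h \<beta> k j w) - H \<beta> w * h \<beta> k i w"
        by (simp add: T_eq left_diff_distrib sum_subtractf if_distrib[of "\<lambda>x. x * _"] cong: if_cong)
      then show ?thesis using h_sym[OF w, of \<beta> k] by simp
    qed
    have "(\<Sum>i\<in>UNIV. \<Sum>k\<in>UNIV. h \<alpha> k i w * (\<Sum>\<beta>\<in>N. \<Sum>j\<in>UNIV. T \<beta> i j w * h \<beta> k j w))
        = (\<Sum>i\<in>UNIV. \<Sum>k\<in>UNIV. \<Sum>\<beta>\<in>N. h \<alpha> i k w * (\<Sum>j\<in>UNIV. h \<beta> i j w * h \<beta> j k w) - H \<beta> w * h \<beta> i k w * h \<alpha> i k w)"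
      unfolding K sum_distrib_left
      by (intro sum.cong refl) (simp add: h_sym[OF w, of \<alpha>] right_diff_distrib sum_distrib_left mult_ac)
    also have "\<dots> = (\<Sum>\<beta>\<in>N. \<Sum>i\<in>UNIV. \<Sum>k\<in>UNIV. h \<alpha> i k w * (\<Sum>j\<in>UNIV. h \<beta> i j w * h \<beta> j k w) - H \<beta> w * h \<beta> i k w * h \<alpha> i k w)"
      by (rule sum_swap3[symmetric])
    finally show ?thesis by (simp add: sum_subtractf sum_distrib_left mult.assoc)
  qed
  have g: "grad e R i w = D i R w" for i by (simp add: grad_def D_def)
  show ?thesis
    unfolding EL_def hT hH cub rho_sq_eq[OF abw[OF w]] g Hd_def[symmetric]
  proof -
    show "(hh - Ha * L) + a + b + r * (c - d) - r * (S - n * q) * Ha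
        = - r * (S * Ha + d - c - n * q * Ha) + (n - 1) * Ha * L + a + b - (n * Ha * L - hh)"
      for hh Ha L a b r c d S n q :: real
      by (simp add: algebra_simps)
  qed
qed

end

section \<open>Integration in a coordinate patch\<close>

lemma set_integrable_continuous_compact:
  fixes f :: "'a::euclidean_space => real"
  assumes "compact C" "continuous_on C f" "B \<in> sets borel" "B \<subseteq> C"
  shows "set_integrable lborel B f"
proof -
  have "set_integrable lborel C f"
    unfolding set_integrable_def by (rule borel_integrable_compact[OF assms(1,2)])
  then show ?thesis by (rule set_integrable_subset) (use assms in auto)
qed

text \<open>Dominated convergence. The difference quotients are values of D by the mean value
  theorem, and D is bounded on a compact product; B has finite measure as a subset of C.\<close>

lemma DERIV_under_integral:
  fixes F D :: "real => 'a::euclidean_space => real"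
  assumes C: "compact C" "B \<in> sets borel" "B \<subseteq> C" and \<epsilon>: "\<epsilon> > 0"
    and F: "\<And>t. t \<in> {-\<epsilon><..<\<epsilon>} ==> continuous_on C (F t)"
    and D: "\<And>t u. t \<in> {-\<epsilon><..<\<epsilon>} ==> u \<in> C ==> ((\<lambda>t. F t u) has_real_derivative D t u) (at t)"
    and cD: "continuous_on ({-\<epsilon><..<\<epsilon>} \<times> C) (\<lambda>(t, u). D t u)"
  shows "((\<lambda>t. LINT u:B|lborel. F t u) has_real_derivative (LINT u:B|lborel. D 0 u)) (at 0)"
proof -
  \<comment> \<open>The open time interval is shrunk to a compact one on which D is bounded.\<close>
  define \<delta> where "\<delta> = \<epsilon> / 2"
  have \<delta>: "\<delta> > 0" "{-\<delta>..\<delta>} \<subseteq> {-\<epsilon><..<\<epsilon>}" using \<epsilon> by (auto simp: \<delta>_def)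
  have "compact ({-\<delta>..\<delta>} \<times> C)" by (intro compact_Times C compact_Icc)
  moreover have "continuous_on ({-\<delta>..\<delta>} \<times> C) (\<lambda>(t, u). D t u)"
    by (rule continuous_on_subset[OF cD]) (use \<delta> in auto)
  ultimately have "bounded ((\<lambda>(t, u). D t u) ` ({-\<delta>..\<delta>} \<times> C))"
    by (intro compact_imp_bounded compact_continuous_image)
  then obtain M where M: "\<And>t u. t \<in> {-\<delta>..\<delta>} ==> u \<in> C ==> \<bar>D t u\<bar> \<le> M"
    unfolding bounded_iff by force
  have F0: "F 0 u = F (0 + 0) u" for u by simp
  have intF: "set_integrable lborel B (F t)" if "t \<in> {-\<epsilon><..<\<epsilon>}" for t
    by (rule set_integrable_continuous_compact[OF C(1) F[OF that] C(2,3)])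
  have D0: "continuous_on C (D 0)"
  proof -
    have "continuous_on C (\<lambda>u. (\<lambda>(t, u). D t u) (0, u))"
      by (rule continuous_on_compose2[OF cD]) (use \<epsilon> in \<open>auto intro!: continuous_intros\<close>)
    then show ?thesis by simp
  qed
  have bnd: "\<bar>(F h u - F 0 u) / h\<bar> \<le> M" if h: "h \<in> {-\<delta><..<\<delta>}" "h \<noteq> 0" and u: "u \<in> C" for h u
  proof -
    have der: "((\<lambda>t. F t u) has_real_derivative D t u) (at t)" if "t \<in> {-\<delta>..\<delta>}" for t
      using D[of t u] that \<delta>(2) u by auto
    have "\<exists>s\<in>{-\<delta>..\<delta>}. F h u - F 0 u = h * D s u"
    proof (cases "h > 0")
      case True
      have "\<exists>z>0. z < h \<and> F h u - F 0 u = (h - 0) * D z u"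
        by (rule MVT2) (use True h der in auto)
      then show ?thesis using h by force
    next
      case False
      have "\<exists>z>h. z < 0 \<and> F 0 u - F h u = (0 - h) * D z u"
        by (rule MVT2) (use False h der in auto)
      then obtain z where "h < z" "z < 0" "F 0 u - F h u = (0 - h) * D z u" by blast
      then show ?thesis using h by (intro bexI[of _ z]) (simp_all add: algebra_simps)
    qed
    then obtain s where "s \<in> {-\<delta>..\<delta>}" "F h u - F 0 u = h * D s u" by blast
    then show ?thesis using M u h by simp
  qed
  have "((\<lambda>h. ((LINT u:B|lborel. F h u) - (LINT u:B|lborel. F 0 u)) / h) \<longlongrightarrow> (LINT u:B|lborel. D 0 u))
      (at 0 within {-\<delta><..<\<delta>})"
    unfolding tendsto_at_iff_sequentially comp_def
  proof (intro allI impI)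
    fix X :: "nat => real" assume X: "\<forall>i. X i \<in> {-\<delta><..<\<delta>} - {0}" and X0: "X \<longlonglongrightarrow> 0"
    have Xe: "X i \<in> {-\<epsilon><..<\<epsilon>}" for i
    proof -
      have "X i \<in> {-\<delta><..<\<delta>}" using X by blast
      then have "X i \<in> {-\<delta>..\<delta>}" by simp
      then show ?thesis by (rule subsetD[OF \<delta>(2)])
    qed
    have q: "((LINT u:B|lborel. F (X i) u) - (LINT u:B|lborel. F 0 u)) / X i
        = (LINT u|lborel. indicator B u *\<^sub>R ((F (X i) u - F 0 u) / X i))" for i
    proof -
      have "(LINT u:B|lborel. F (X i) u) - (LINT u:B|lborel. F 0 u) = (LINT u:B|lborel. F (X i) u - F 0 u)"
        by (rule set_integral_diff(2)[symmetric]) (use intF Xe \<epsilon> in auto)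
      then show ?thesis by (simp add: set_lebesgue_integral_def)
    qed
    have "(\<lambda>i. LINT u|lborel. indicator B u *\<^sub>R ((F (X i) u - F 0 u) / X i)) \<longlonglongrightarrow> (LINT u|lborel. indicator B u *\<^sub>R D 0 u)"
    proof (rule integral_dominated_convergence[where w="\<lambda>u. indicator B u *\<^sub>R \<bar>M\<bar>"])
      show "(\<lambda>u. indicator B u *\<^sub>R D 0 u) \<in> borel_measurable lborel"
        using set_integrable_continuous_compact[OF C(1) D0 C(2,3)]
        by (auto simp: set_integrable_def)
      show "(\<lambda>u. indicator B u *\<^sub>R ((F (X i) u - F 0 u) / X i)) \<in> borel_measurable lborel" for i
      proof -
        have "set_integrable lborel B (\<lambda>u. (F (X i) u - F 0 u) / X i)"
          by (intro set_integrable_divide set_integral_diff(1) intF Xe) (use \<epsilon> in auto)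
        then show ?thesis by (auto simp: set_integrable_def)
      qed
      show "integrable lborel (\<lambda>u. indicator B u *\<^sub>R \<bar>M\<bar>)"
        using set_integrable_continuous_compact[OF C(1) continuous_on_const C(2,3), of "\<bar>M\<bar>"]
        by (simp add: set_integrable_def)
      show "AE u in lborel. (\<lambda>i. indicator B u *\<^sub>R ((F (X i) u - F 0 u) / X i)) \<longlonglongrightarrow> indicator B u *\<^sub>R D 0 u"
      proof (rule AE_I2)
        fix u show "(\<lambda>i. indicator B u *\<^sub>R ((F (X i) u - F 0 u) / X i)) \<longlonglongrightarrow> indicator B u *\<^sub>R D 0 u"
        proof (cases "u \<in> B")
          case True
          then have "((\<lambda>h. (F (0 + h) u - F 0 u) / h) \<longlongrightarrow> D 0 u) (at 0)"
            using D[of 0 u] C(3) \<epsilon> by (auto simp: DERIV_def)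
          then have "(\<lambda>i. (F (0 + X i) u - F 0 u) / X i) \<longlonglongrightarrow> D 0 u"
            unfolding tendsto_at_iff_sequentially comp_def using X X0 by auto
          then show ?thesis by (intro tendsto_scaleR tendsto_const) simp
        qed simp
      qed
      show "AE u in lborel. norm (indicator B u *\<^sub>R ((F (X i) u - F 0 u) / X i)) \<le> indicator B u *\<^sub>R \<bar>M\<bar>" for i
      proof (rule AE_I2)
        fix u
        have "u \<in> B ==> \<bar>(F (X i) u - F 0 u) / X i\<bar> \<le> \<bar>M\<bar>"
          using bnd[of "X i" u] X C(3) by fastforce
        then show "norm (indicator B u *\<^sub>R ((F (X i) u - F 0 u) / X i)) \<le> indicator B u *\<^sub>R \<bar>M\<bar>"
          by (cases "u \<in> B") simp_all
      qed
    qed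
    then show "(\<lambda>i. ((LINT u:B|lborel. F (X i) u) - (LINT u:B|lborel. F 0 u)) / X i)
        \<longlonglongrightarrow> (LINT u:B|lborel. D 0 u)"
      by (simp only: q) (simp add: set_lebesgue_integral_def)
  qed
  moreover have "at 0 within {-\<delta><..<\<delta>} = at (0::real)"
    using \<delta>(1) by (intro at_within_open) auto
  ultimately show ?thesis by (simp add: DERIV_def)
qed

lemma Ck_on_zero_extend:
  assumes "open V" "compact K" "K \<subseteq> V" "Ck_on k V f" "\<And>u. u \<notin> K ==> f u = 0"
  shows "Ck_on k UNIV (f :: 'a::euclidean_space => 'b::real_normed_vector)"
proof (rule Ck_on_local)
  fix u :: 'a
  have o: "open (- K)" using assms(2) by (simp add: compact_imp_closed open_Compl)
  show "\<exists>T. open T \<and> u \<in> T \<and> Ck_on k T f"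
  proof (cases "u \<in> K")
    case True
    then show ?thesis using assms by blast
  next
    case False
    have "Ck_on k (- K) f"
      by (rule Ck_on_cong[OF o Ck_on_const[of _ _ 0]]) (use assms(5) in auto)
    then show ?thesis using o False by blast
  qed
qed

text \<open>By translation invariance of Lebesgue measure the integral of f(u + t a) does not depend
  on t; its derivative at t = 0 is the integral in question.\<close>

lemma integral_dirderiv_eq_0:
  fixes f :: "'a::euclidean_space => real"
  assumes f: "Ck_on 1 UNIV f" and K: "compact K" "\<And>u. u \<notin> K ==> f u = 0"
  shows "(LINT u:K|lborel. dirderiv f u a) = 0"
proof -
  have f': "Ck_on (Suc 0) UNIV f" using f by simp
  have df: "f differentiable (at u)" for u using f' by simp
  have fc: "continuous_on UNIV f" by (rule Ck_on_continuous[OF f])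
  obtain r where r: "r > 0" "K \<subseteq> ball 0 r" using K(1) compact_imp_bounded bounded_subset_ballD by blast
  \<comment> \<open>Large enough to contain the supports of all translates with |t| < 1.\<close>
  define C where "C = cball (0::'a) (r + norm a)"
  have C: "compact C" "C \<in> sets borel" "C \<subseteq> C" by (auto simp: C_def)
  have "((\<lambda>t. LINT u:C|lborel. f (u + t *\<^sub>R a)) has_real_derivative
      (LINT u:C|lborel. dirderiv f (u + 0 *\<^sub>R a) a)) (at 0)"
  proof (rule DERIV_under_integral[OF C zero_less_one])
    show "continuous_on C (\<lambda>u. f (u + t *\<^sub>R a))" for t
      by (rule continuous_on_compose2[OF fc]) (auto intro!: continuous_intros)
    show "((\<lambda>t. f (u + t *\<^sub>R a)) has_real_derivative dirderiv f (u + t *\<^sub>R a) a) (at t)" for t u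
    proof -
      have "((\<lambda>s. u + s *\<^sub>R a) has_derivative (\<lambda>t. t *\<^sub>R a)) (at t)"
        by (auto intro!: derivative_eq_intros)
      from has_derivative_compose[OF this has_derivative_dirderiv[OF df]]
      show ?thesis
        by (rule has_derivative_imp_has_field_derivative) (simp add: linear_cmul[OF linear_dirderiv[OF df]])
    qed
    have "continuous_on UNIV (\<lambda>u. dirderiv f u a)" using f' by simp
    then show "continuous_on ({-1<..<1} \<times> C) (\<lambda>(t, u). dirderiv f (u + t *\<^sub>R a) a)"
      unfolding case_prod_beta by (rule continuous_on_compose2) (auto intro!: continuous_intros)
  qed
  moreover have "((\<lambda>t. LINT u:C|lborel. f (u + t *\<^sub>R a)) has_real_derivative 0) (at 0)"
  proof (rule has_field_derivative_transform_within_open[where S="{-1<..<1}"])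
    show "((\<lambda>t. LINT u|lborel. f u) has_real_derivative 0) (at 0)" by simp
    fix t :: real assume t: "t \<in> {-1<..<1}"
    have "u + t *\<^sub>R a \<notin> K" if "u \<notin> C" for u
    proof
      assume "u + t *\<^sub>R a \<in> K"
      then have "norm (u + t *\<^sub>R a) < r" using r by auto
      moreover have "norm u \<le> norm (u + t *\<^sub>R a) + norm (t *\<^sub>R a)"
        using norm_triangle_ineq4[of "u + t *\<^sub>R a" "t *\<^sub>R a"] by simp
      moreover have "norm (t *\<^sub>R a) \<le> norm a"
      proof -
        have "\<bar>t\<bar> \<le> 1" using t by auto
        from mult_right_mono[OF this norm_ge_zero[of a]] show ?thesis by simp
      qed
      ultimately show False using that by (simp add: C_def)
    qed
    then have "indicator C u *\<^sub>R f (u + t *\<^sub>R a) = f (t *\<^sub>R a + u)" for u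
      using K(2) by (cases "u \<in> C") (auto simp: add.commute)
    then have "(LINT u:C|lborel. f (u + t *\<^sub>R a)) = (LINT u|lborel. f (t *\<^sub>R a + u))"
      by (simp add: set_lebesgue_integral_def)
    also have "\<dots> = (LINT u|distr lborel borel ((+) (t *\<^sub>R a)). f u)"
      by (rule integral_distr[symmetric]) (use fc in \<open>auto intro: borel_measurable_continuous_onI\<close>)
    also have "\<dots> = (LINT u|lborel. f u)" by (simp add: lborel_distr_plus)
    finally show "(LINT u|lborel. f u) = (LINT u:C|lborel. f (u + t *\<^sub>R a))" by simp
  qed auto
  ultimately have "(LINT u:C|lborel. dirderiv f u a) = 0" by (auto dest: DERIV_unique)
  moreover have "(LINT u:C|lborel. dirderiv f u a) = (LINT u:K|lborel. dirderiv f u a)"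
  proof -
    have "dirderiv f u a = 0" if "u \<notin> K" for u
    proof -
      have "dirderiv f u a = dirderiv (\<lambda>_. 0) u a"
        by (rule dirderiv_cong_open[of "- K"]) (use that K in \<open>auto simp: compact_imp_closed open_Compl\<close>)
      then show ?thesis by (simp add: frechet_derivative_const)
    qed
    moreover have "K \<subseteq> C" using r by (auto simp: C_def) (smt (verit) mem_ball_0 norm_ge_zero subsetD)
    ultimately have "indicator C u *\<^sub>R dirderiv f u a = indicator K u *\<^sub>R dirderiv f u a" for u
      by (cases "u \<in> K") auto
    then show ?thesis unfolding set_lebesgue_integral_def by presburger
  qed
  ultimately show ?thesis by simp
qed

section \<open>Divergence in coordinates and additivity of the first variation\<close>

definition Div :: "(real ^ 'n => real ^ 'n::finite) => real ^ 'n => real"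
  where "Div f u = (\<Sum>i\<in>UNIV. dirderiv f u (axis i 1) $ i)"

lemma integral_Div_eq_0:
  assumes f: "Ck_on 1 UNIV f" and K: "compact K" "\<And>u. u \<notin> K ==> f u = 0"
  shows "(LINT u:K|lborel. Div f u) = 0"
proof -
  have f': "Ck_on (Suc 0) UNIV f" using f by simp
  have df: "f differentiable (at u)" for u using f' by simp
  have comp: "dirderiv f u v $ i = dirderiv (\<lambda>u. f u $ i) u v" for u v i
    using dirderiv_inner[OF df, of "axis i 1" u v] by (simp add: inner_axis)
  have fi: "Ck_on 1 UNIV (\<lambda>u. f u $ i)" for i
    using Ck_on_inner[OF open_UNIV f Ck_on_const, of "axis i 1"] by (simp add: inner_axis)
  have "set_integrable lborel K (\<lambda>u. dirderiv (\<lambda>u. f u $ i) u (axis i 1))" for i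
  proof (rule set_integrable_continuous_compact[OF K(1)])
    have "continuous_on UNIV (\<lambda>u. dirderiv (\<lambda>u. f u $ i) u (axis i 1))" using fi[of i] by simp
    then show "continuous_on K (\<lambda>u. dirderiv (\<lambda>u. f u $ i) u (axis i 1))"
      by (rule continuous_on_subset) simp
  qed (use K in \<open>auto simp: compact_imp_closed\<close>)
  then have "(LINT u:K|lborel. Div f u) = (\<Sum>i\<in>UNIV. LINT u:K|lborel. dirderiv (\<lambda>u. f u $ i) u (axis i 1))"
    unfolding Div_def comp set_lebesgue_integral_def set_integrable_def scaleR_sum_right
    by (intro Bochner_Integration.integral_sum) auto
  then show ?thesis using integral_dirderiv_eq_0[OF fi K(1)] K(2) by simp
qed

lemma Div_scaleR:
  fixes c :: "real ^ 'n::finite => real"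
  assumes "c differentiable (at u)" "f differentiable (at u)"
  shows "Div (\<lambda>w. c w *\<^sub>R f w) u = dirderiv c u (f u) + c u * Div f u"
proof -
  have "dirderiv (\<lambda>w. c w *\<^sub>R f w) u v = c u *\<^sub>R dirderiv f u v + dirderiv c u v *\<^sub>R f u" for v
    by (rule dirderiv_eqI) (intro has_derivative_scaleR has_derivative_dirderiv assms)
  then have "Div (\<lambda>w. c w *\<^sub>R f w) u = c u * Div f u + (\<Sum>i\<in>UNIV. f u $ i * dirderiv c u (axis i 1))"
    by (simp add: Div_def sum.distrib sum_distrib_left mult.commute)
  also have "(\<Sum>i\<in>UNIV. f u $ i * dirderiv c u (axis i 1)) = dirderiv c u (f u)"
  proof -
    note l = linear_dirderiv[OF assms(1)]
    have "dirderiv c u (f u) = dirderiv c u (\<Sum>i\<in>UNIV. f u $ i *\<^sub>R axis i 1)"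
      using basis_expansion[of "f u"] by (simp add: scalar_mult_eq_scaleR)
    then show ?thesis by (simp add: linear_sum[OF l] linear_cmul[OF l])
  qed
  finally show ?thesis by simp
qed

lemma Div_add:
  assumes "f differentiable (at u)" "g differentiable (at u)"
  shows "Div (\<lambda>w. f w + g w) u = Div f u + Div g u"
  by (simp add: Div_def dirderiv_add[OF assms] sum.distrib)

lemma Div_sum:
  assumes "\<And>j. j \<in> I ==> f j differentiable (at u)"
  shows "Div (\<lambda>w. \<Sum>j\<in>I. f j w) u = (\<Sum>j\<in>I. Div (f j) u)"
proof -
  have "dirderiv (\<lambda>w. \<Sum>j\<in>I. f j w) u v = (\<Sum>j\<in>I. dirderiv (f j) u v)" for v
    by (rule dirderiv_sum) (rule assms)
  then show ?thesis unfolding Div_def by (simp only: sum_component) (rule sum.swap)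
qed

lemma rho_sq_var_add:
  assumes "open V" "u \<in> V" "Ck_on 2 V \<zeta>1" "Ck_on 2 V \<zeta>2"
  shows "rho_sq_var y (\<lambda>w. \<zeta>1 w + \<zeta>2 w) u a b = rho_sq_var y \<zeta>1 u a b + rho_sq_var y \<zeta>2 u a b"
    and "area_var y (\<lambda>w. \<zeta>1 w + \<zeta>2 w) u a = area_var y \<zeta>1 u a + area_var y \<zeta>2 u a"
proof -
  have d: "\<zeta>1 differentiable (at w)" "\<zeta>2 differentiable (at w)"
    "(\<lambda>w. dirderiv \<zeta>1 w v) differentiable (at w)" "(\<lambda>w. dirderiv \<zeta>2 w v) differentiable (at w)" if "w \<in> V" for w v
    using assms(3,4) that by (auto simp: numeral_2_eq_2)
  have d1: "dirderiv (\<lambda>w. \<zeta>1 w + \<zeta>2 w) w v = dirderiv \<zeta>1 w v + dirderiv \<zeta>2 w v" if "w \<in> V" for w v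
    by (rule dirderiv_add[OF d(1,2)[OF that]])
  have d2: "dd (\<lambda>w. \<zeta>1 w + \<zeta>2 w) u v v' = dd \<zeta>1 u v v' + dd \<zeta>2 u v v'" for v v'
    by (rule trans[OF dirderiv_cong_open[OF assms(1,2) d1] dirderiv_add[OF d(3,4)[OF assms(2)]]])
  have A: "(dd \<zeta>1 u v v' + dd \<zeta>2 u v v' - (\<Sum>k\<in>UNIV. c k *\<^sub>R (dirderiv \<zeta>1 u (a k) + dirderiv \<zeta>2 u (a k)))) \<bullet> z
      = (dd \<zeta>1 u v v' - (\<Sum>k\<in>UNIV. c k *\<^sub>R dirderiv \<zeta>1 u (a k))) \<bullet> z
        + (dd \<zeta>2 u v v' - (\<Sum>k\<in>UNIV. c k *\<^sub>R dirderiv \<zeta>2 u (a k))) \<bullet> z" for v v' z c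
    by (simp add: scaleR_add_right sum.distrib inner_add_left inner_diff_left)
  have B: "((p + q) \<bullet> r + (p' + q') \<bullet> r') * s = (p \<bullet> r + p' \<bullet> r') * s + (q \<bullet> r + q' \<bullet> r') * s"
    for p q r p' q' r' :: 'b and s
    by (simp add: inner_add_left distrib_right)
  show "rho_sq_var y (\<lambda>w. \<zeta>1 w + \<zeta>2 w) u a b = rho_sq_var y \<zeta>1 u a b + rho_sq_var y \<zeta>2 u a b"
    unfolding rho_sq_var_def d2 d1[OF assms(2)] A B distrib_left sum.distrib
    unfolding distrib_left[symmetric] by (simp only: add_diff_add)
  show "area_var y (\<lambda>w. \<zeta>1 w + \<zeta>2 w) u a = area_var y \<zeta>1 u a + area_var y \<zeta>2 u a"
    by (simp add: area_var_def d1[OF assms(2)] inner_add_left sum.distrib)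
qed

lemma dens_var_add:
  assumes "open V" "u \<in> V" "Ck_on 2 V \<zeta>1" "Ck_on 2 V \<zeta>2"
  shows "dens_var y (\<lambda>w. \<zeta>1 w + \<zeta>2 w) u a b = dens_var y \<zeta>1 u a b + dens_var y \<zeta>2 u a b"
  unfolding dens_var_def rho_sq_var_add[OF assms] by (simp add: algebra_simps)

context sphere_patch
begin

lemma Ck_on_rho_power:
  assumes "V \<subseteq> U" "open V" and k: "even m \<or> m > 2 * k \<or> (\<forall>u\<in>V. rho_at y u > 0)"
  shows "Ck_on k V (\<lambda>w. rho_at y w ^ m)"
proof -
  have s: "Ck_on k V (\<lambda>w. (rho_at y w)\<^sup>2)" by (rule Ck_on_subset[OF Ck_on_rho_at_sq assms(1)])
  have r: "sqrt ((rho_at y w)\<^sup>2) = rho_at y w" if "w \<in> V" for w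
    using rho_at_y_nonneg that assms(1) by auto
  consider "even m" | "m > 2 * k" | "\<forall>u\<in>V. rho_at y u > 0" using k by blast
  then show ?thesis
  proof cases
    case 1
    then obtain j where "m = 2 * j" by blast
    then show ?thesis using Ck_on_power[OF assms(2) s, of j] by (simp add: power_mult)
  next
    case 2
    have "Ck_on k V (\<lambda>w. sqrt ((rho_at y w)\<^sup>2) ^ m)"
      by (rule Ck_on_sqrt_power[OF assms(2) _ s 2]) simp
    then show ?thesis by (rule Ck_on_cong[OF assms(2)]) (simp only: r)
  next
    case 3
    have "Ck_on k V (\<lambda>w. sqrt ((rho_at y w)\<^sup>2) ^ m)"
      by (intro Ck_on_power Ck_on_sqrt assms(2) s) (use 3 in force)
    then show ?thesis by (rule Ck_on_cong[OF assms(2)]) (simp only: r)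
  qed
qed

text \<open>The chain rule has to pass through rho squared, since rho need not be differentiable; it
  is applied along a line, where the one-variable rule for powers is available.\<close>

lemma dirderiv_rho_power:
  assumes u: "u \<in> U" and m: "m \<ge> 2"
  shows "dirderiv (\<lambda>w. rho_at y w ^ m) u v = (real m / 2) * rho_at y u ^ (m - 2) * dirderiv (\<lambda>w. (rho_at y w)\<^sup>2) u v"
proof -
  have dm: "(\<lambda>w. rho_at y w ^ m) differentiable (at u)"
  proof -
    have "Ck_on (Suc 0) U (\<lambda>w. rho_at y w ^ m)"
      by (rule Ck_on_rho_power) (use open_U m in \<open>auto simp: le_less\<close>)
    then show ?thesis using u by simp
  qed
  have d2: "(\<lambda>w. (rho_at y w)\<^sup>2) differentiable (at u)" using Ck_on_rho_at_sq[of "Suc 0"] u by simp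
  have along: "((\<lambda>t. f (u + t *\<^sub>R v)) has_real_derivative dirderiv f u v) (at 0)"
    if "f differentiable (at u)" for f :: "real ^ 'n => real"
  proof -
    have "((\<lambda>s. u + s *\<^sub>R v) has_derivative (\<lambda>t. t *\<^sub>R v)) (at 0)"
      by (auto intro!: derivative_eq_intros)
    moreover have "(f has_derivative dirderiv f u) (at (u + 0 *\<^sub>R v))"
      using has_derivative_dirderiv[OF that] by simp
    ultimately have "((\<lambda>t. f (u + t *\<^sub>R v)) has_derivative (\<lambda>t. dirderiv f u (t *\<^sub>R v))) (at 0)"
      by (rule has_derivative_compose)
    then show ?thesis
      by (rule has_derivative_imp_has_field_derivative) (simp add: linear_cmul[OF linear_dirderiv[OF that]])
  qed
  let ?T = "(\<lambda>t. u + t *\<^sub>R v) -` U"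
  have T: "open ?T" by (rule open_vimage[OF open_U]) (intro continuous_intros)
  have "((\<lambda>t. rho_at y (u + t *\<^sub>R v) ^ m) has_real_derivative
      (real m / 2) * rho_at y (u + 0 *\<^sub>R v) ^ (m - 2) * dirderiv (\<lambda>w. (rho_at y w)\<^sup>2) u v) (at 0)"
    by (rule power_nonneg_first_variation[OF along[OF d2] T _ _ m]) (use u rho_at_y_nonneg in auto)
  from DERIV_unique[OF along[OF dm] this] show ?thesis by simp
qed

end

context framed_patch
begin

lemma Ck_EL:
  assumes R: "Ck_on (Suc (Suc 0)) V R" and \<alpha>: "\<alpha> \<in> N"
  shows "continuous_on V (EL R \<alpha>)"
proof -
  have R1: "Ck_on (Suc 0) V R" and R0: "Ck_on 0 V R" using R Ck_on_le by blast+
  have h0: "Ck_on 0 V (hess y e R i j)" for i j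
    unfolding hess_eq[abs_def]
    by (intro Ck_on_add Ck_on_sum Ck_on_mult open_V Ck_D[OF Ck_D[OF R]] Ck_D[OF R1] Ck_G)
  have n0: "Ck_on 0 V (normal_laplacian y e \<nu> \<alpha>)"
  proof (rule Ck_on_cong[OF open_V])
    show "Ck_on 0 V (\<lambda>w. \<Sum>i\<in>UNIV. D i (Hd \<alpha> i) w - (\<Sum>k\<in>UNIV. G i i k w * Hd \<alpha> k w)
        - (\<Sum>\<beta>\<in>N. Nn \<alpha> i \<beta> w * Hd \<beta> i w))"
      by (intro Ck_on_sum Ck_on_diff Ck_on_mult open_V Ck_D[OF Ck_Hd[OF \<alpha>]] Ck_G Ck_Hd Ck_Nn \<alpha>)
  qed (simp add: normal_laplacian_eq[OF _ \<alpha>])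
  have "Ck_on 0 V (EL R \<alpha>)"
    unfolding EL_def[abs_def]
    by (intro Ck_on_add Ck_on_diff Ck_on_sum Ck_on_mult Ck_on_const open_V h0 n0 R0
        Ck_D[OF R1] Ck_T Ck_h Ck_H Ck_Hd frame_facts(8) \<alpha>)
  then show ?thesis by simp
qed

text \<open>The divergence of a frame vector is the trace of its covariant derivative. It is read
  off from the area part of \<open>tangential_variation\<close> for the field dy(e_k), so no
  Christoffel symbols in coordinates are needed.\<close>

lemma Div_frame:
  assumes u: "u \<in> V"
  shows "Div (\<lambda>w. sqrt (det (gram y w)) *\<^sub>R e w k) u = - sqrt (det (gram y u)) * (\<Sum>j\<in>UNIV. G j j k u)"
proof -
  have uU: "u \<in> U" using u V_sub by auto
  have sm: "smooth_on V (\<lambda>w. e w k)" using frame_facts(2) by (simp add: smooth_on_def)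
  have dg: "(\<lambda>w. sqrt (det (gram y w))) differentiable (at u)"
    using Ck_on_sqrt_det_gram[of "Suc 0"] uU by simp
  have "Div (\<lambda>w. sqrt (det (gram y w)) *\<^sub>R e w k) u
      = dirderiv (\<lambda>w. sqrt (det (gram y w))) u (e u k) + sqrt (det (gram y u)) * Div (\<lambda>w. e w k) u"
    by (rule Div_scaleR[OF dg diff1[OF frame_facts(2) u]])
  also have "\<dots> = sqrt (det (gram y u)) * area_var y (\<lambda>w. dirderiv y w (e w k)) u (e u)"
    unfolding Div_def by (rule tangential_variation(2)[OF open_V V_sub sm u abw[OF u], symmetric])
  also have "area_var y (\<lambda>w. dirderiv y w (e w k)) u (e u) = (\<Sum>j\<in>UNIV. G k j j u)"
    by (simp add: area_var_def G_def tconn_def)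
  also have "\<dots> = - (\<Sum>j\<in>UNIV. G j j k u)"
    unfolding sum_negf[symmetric] by (intro sum.cong refl G_anti[OF u])
  finally show ?thesis by simp
qed

text \<open>\<zeta> is split into a tangential part, handled as an infinitesimal reparametrisation,
  and a normal part, handled by \<open>normal_variation\<close>. That Z vanishes on open sets where
  \<zeta> does is recorded so that Z inherits the compact support.\<close>

lemma weak_pointwise:
  assumes n: "CARD('n) \<ge> 2" and R: "Ck_on (Suc (Suc 0)) V (\<lambda>w. rho_at y w ^ (CARD('n) - 2))"
    and \<zeta>: "smooth_on V \<zeta>" and tang: "\<And>u. u \<in> V ==> y u \<bullet> \<zeta> u = 0"
  shows "\<exists>Z. Ck_on 1 V Z \<and> (\<forall>W. open W \<and> W \<subseteq> V \<and> (\<forall>u\<in>W. \<zeta> u = 0) \<longrightarrow> (\<forall>u\<in>W. Z u = 0)) \<and>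
    (\<forall>u\<in>V. dens_var y \<zeta> u (e u) (\<nu> u) = real CARD('n) * sqrt (det (gram y u)) *
      (\<Sum>\<alpha>\<in>N. EL (\<lambda>w. rho_at y w ^ (CARD('n) - 2)) \<alpha> u * (nu \<alpha> u \<bullet> \<zeta> u)) + Div Z u)"
proof -
  let ?n = "CARD('n)" and ?sg = "\<lambda>w. sqrt (det (gram y w))"
  let ?R = "\<lambda>w. rho_at y w ^ (?n - 2)"
  have \<zeta>k: "Ck_on k V \<zeta>" for k using \<zeta> by (simp add: smooth_on_def)
  define v where "v w = (\<Sum>k\<in>UNIV. (Yv k w \<bullet> \<zeta> w) *\<^sub>R e w k)" for w
  have vk: "Ck_on k V v" for k
    unfolding v_def[abs_def] by (intro Ck_on_sum Ck_on_scaleR Ck_on_inner open_V Ck_Yv \<zeta>k frame_facts(2))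
  have vs: "smooth_on V v" using vk by (simp add: smooth_on_def)
  define \<zeta>T where "\<zeta>T w = dirderiv y w (v w)" for w
  define \<zeta>N where "\<zeta>N w = \<zeta> w - \<zeta>T w" for w
  have Tk: "Ck_on k V \<zeta>T" for k
    unfolding \<zeta>T_def[abs_def] by (rule Ck_on_dirderiv[OF open_V Ck_yV vk])
  have Nk: "Ck_on k V \<zeta>N" for k
    unfolding \<zeta>N_def[abs_def] by (intro Ck_on_diff open_V \<zeta>k Tk)
  have T_eq: "\<zeta>T w = (\<Sum>k\<in>UNIV. (Yv k w \<bullet> \<zeta> w) *\<^sub>R Yv k w)" if "w \<in> V" for w
    using lin_y[of w] V_sub that by (simp add: \<zeta>T_def v_def linear_sum linear_cmul Yv_def subset_eq)
  have nY: "Yv k w \<bullet> \<zeta>N w = 0" if "w \<in> V" for k w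
  proof -
    have "Yv k w \<bullet> \<zeta>T w = (\<Sum>l\<in>UNIV. if k = l then Yv k w \<bullet> \<zeta> w else 0)"
      unfolding T_eq[OF that] inner_sum_right using orth(1)[OF that] by (intro sum.cong refl) simp
    then show ?thesis by (simp add: \<zeta>N_def inner_diff_right)
  qed
  have ny: "y w \<bullet> \<zeta>N w = 0" if "w \<in> V" for w
    using tang[OF that] y_Yv(1)[OF that] by (simp add: \<zeta>N_def \<zeta>T_def inner_diff_right)
  have nn: "nu \<alpha> w \<bullet> \<zeta>N w = nu \<alpha> w \<bullet> \<zeta> w" if "w \<in> V" "\<alpha> \<in> N" for w \<alpha>
    using orth(5)[OF that] by (simp add: \<zeta>N_def \<zeta>T_def inner_diff_right)
  \<comment> \<open>The first summand is the flux of the density along the tangential part. The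
    second is n times the boundary field of the normal part; the factor \<open>sqrt (det g)\<close>
    turns coordinate divergence into covariant divergence.\<close>
  define Z where "Z w = dens y w *\<^sub>R v w + (\<Sum>j\<in>UNIV. (real ?n * Wf ?R \<zeta>N j w) *\<^sub>R (?sg w *\<^sub>R e w j))" for w
  have sgk: "Ck_on k V ?sg" for k by (rule Ck_on_subset[OF Ck_on_sqrt_det_gram V_sub])
  have densk: "Ck_on (Suc 0) V (dens y)"
    unfolding dens_def[abs_def]
    by (intro Ck_on_mult open_V sgk Ck_on_rho_power V_sub) (use n in \<open>auto simp: le_less\<close>)
  have R1: "Ck_on (Suc 0) V ?R" by (rule Ck_on_SucD[OF R])
  have Wk: "Ck_on (Suc 0) V (Wf ?R \<zeta>N j)" for j
    unfolding Wf_def[abs_def]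
    by (intro Ck_on_diff Ck_on_sum Ck_on_inner open_V Ck_U[OF R1] Ck_D[OF Nk] Ck_M[OF R] Nk)
  have sek: "Ck_on (Suc 0) V (\<lambda>w. ?sg w *\<^sub>R e w j)" for j
    by (intro Ck_on_scaleR open_V sgk frame_facts(2))
  have nWk: "Ck_on (Suc 0) V (\<lambda>w. real ?n * Wf ?R \<zeta>N j w)" for j
    by (intro Ck_on_mult Ck_on_const open_V Wk)
  have z1: "Ck_on (Suc 0) V (\<lambda>w. dens y w *\<^sub>R v w)" by (intro Ck_on_scaleR open_V densk vk)
  have z2: "Ck_on (Suc 0) V (\<lambda>w. (real ?n * Wf ?R \<zeta>N j w) *\<^sub>R (?sg w *\<^sub>R e w j))" for j
    by (intro Ck_on_scaleR[OF open_V nWk sek])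
  have z3: "Ck_on (Suc 0) V (\<lambda>w. \<Sum>j\<in>UNIV. (real ?n * Wf ?R \<zeta>N j w) *\<^sub>R (?sg w *\<^sub>R e w j))"
    by (intro Ck_on_sum open_V z2)
  have Zk: "Ck_on 1 V Z"
    using Ck_on_add[OF open_V z1 z3] by (simp add: Z_def[abs_def])
  \<comment> \<open>Openness matters because \<open>Wf\<close> involves a derivative of the
    field.\<close>
  have supp: "Z u = 0" if W: "open W" "W \<subseteq> V" "\<forall>u\<in>W. \<zeta> u = 0" and u: "u \<in> W" for W u
  proof -
    have v0: "v w = 0" if "w \<in> W" for w using W(3) that by (simp add: v_def)
    have N0: "\<zeta>N w = 0" if "w \<in> W" for w
      using W(2,3) that v0 lin_y[of w] V_sub by (auto simp: \<zeta>N_def \<zeta>T_def linear_0 subset_eq)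
    have "D i \<zeta>N u = 0" for i
      unfolding D_def using dirderiv_cong_open[OF W(1) u, of \<zeta>N "\<lambda>_. 0"] N0
      by (simp add: frechet_derivative_const)
    then show ?thesis using v0[OF u] N0[OF u] by (simp add: Z_def Wf_def)
  qed
  have main: "dens_var y \<zeta> u (e u) (\<nu> u) = real ?n * ?sg u * (\<Sum>\<alpha>\<in>N. EL ?R \<alpha> u * (nu \<alpha> u \<bullet> \<zeta> u)) + Div Z u"
    if u: "u \<in> V" for u
  proof -
    have uU: "u \<in> U" using u V_sub by auto
    have rs: "rho_at y u ^ ?n = ?R u * rho_sq y u (e u) (\<nu> u)"
    proof -
      have "rho_sq y u (e u) (\<nu> u) = (rho_at y u)\<^sup>2"
        using rho_at_y(1)[OF uU abw[OF u]] by (simp add: rho_sq_nonneg)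
      moreover have "rho_at y u ^ ((?n - 2) + 2) = ?R u * (rho_at y u)\<^sup>2" by (rule power_add)
      moreover have "(?n - 2) + 2 = ?n" using n by simp
      ultimately show ?thesis by (simp only:)
    qed
    have "dens_var y \<zeta> u (e u) (\<nu> u) = dens_var y (\<lambda>w. \<zeta>T w + \<zeta>N w) u (e u) (\<nu> u)"
      by (simp add: \<zeta>N_def)
    also have "\<dots> = dens_var y \<zeta>T u (e u) (\<nu> u) + dens_var y \<zeta>N u (e u) (\<nu> u)"
      by (rule dens_var_add[OF open_V u Tk Nk])
    also have "dens_var y \<zeta>T u (e u) (\<nu> u) = Div (\<lambda>w. dens y w *\<^sub>R v w) u"
    proof -
      note tv = tangential_variation[OF open_V V_sub vs u abw[OF u], folded \<zeta>T_def[abs_def]]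
      have dr: "(\<lambda>w. rho_at y w ^ ?n) differentiable (at u)"
        by (rule diff1[OF Ck_on_rho_power u]) (use V_sub open_V n in \<open>auto simp: le_less\<close>)
      have "dens_var y \<zeta>T u (e u) (\<nu> u) = ?sg u * dirderiv (\<lambda>w. rho_at y w ^ ?n) u (v u)
          + rho_at y u ^ ?n * (?sg u * area_var y \<zeta>T u (e u))"
        unfolding dens_var_def tv(1) dirderiv_rho_power[OF uU n] by (simp add: algebra_simps)
      also have "\<dots> = dirderiv (dens y) u (v u) + dens y u * Div v u"
        unfolding tv(2) dens_def[abs_def] dirderiv_mult[OF dr diff1[OF sgk u]] Div_def
        by (simp add: algebra_simps)
      also have "\<dots> = Div (\<lambda>w. dens y w *\<^sub>R v w) u"
        by (rule Div_scaleR[OF diff1[OF densk u] diff1[OF vk u], symmetric])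
      finally show ?thesis .
    qed
    also have "dens_var y \<zeta>N u (e u) (\<nu> u) = real ?n * ?sg u * (\<Sum>\<alpha>\<in>N. EL ?R \<alpha> u * (nu \<alpha> u \<bullet> \<zeta> u))
        + Div (\<lambda>w. \<Sum>j\<in>UNIV. (real ?n * Wf ?R \<zeta>N j w) *\<^sub>R (?sg w *\<^sub>R e w j)) u"
    proof -
      \<comment> \<open>Product rule: the coefficient is differentiated along the frame vector, and
        the divergence of the weighted frame vector supplies the connection term.\<close>
      have 1: "Div (\<lambda>w. (real ?n * Wf ?R \<zeta>N j w) *\<^sub>R (?sg w *\<^sub>R e w j)) u
          = real ?n * ?sg u * (D j (Wf ?R \<zeta>N j) u - (\<Sum>i\<in>UNIV. G i i j u * Wf ?R \<zeta>N j u))" for j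
      proof -
        have "dirderiv (\<lambda>w. real ?n * Wf ?R \<zeta>N j w) u (?sg u *\<^sub>R e u j) = real ?n * ?sg u * D j (Wf ?R \<zeta>N j) u"
          using linear_cmul[OF linear_dirderiv[OF diff1[OF Wk u]]]
          by (simp add: dirderiv_cmult[OF diff1[OF Wk u]] D_def)
        then show ?thesis
          unfolding Div_scaleR[OF diff1[OF nWk u] diff1[OF sek u]] Div_frame[OF u]
          by (simp add: right_diff_distrib sum_distrib_left sum_distrib_right sum_negf mult_ac)
      qed
      have "Div (\<lambda>w. \<Sum>j\<in>UNIV. (real ?n * Wf ?R \<zeta>N j w) *\<^sub>R (?sg w *\<^sub>R e w j)) u
          = (\<Sum>j\<in>UNIV. Div (\<lambda>w. (real ?n * Wf ?R \<zeta>N j w) *\<^sub>R (?sg w *\<^sub>R e w j)) u)"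
        by (rule Div_sum) (rule diff1[OF z2 u])
      also have "\<dots> = real ?n * ?sg u * (\<Sum>j\<in>UNIV. D j (Wf ?R \<zeta>N j) u - (\<Sum>k\<in>UNIV. G j j k u * Wf ?R \<zeta>N k u))"
      proof -
        have "(\<Sum>j\<in>UNIV. \<Sum>i\<in>UNIV. G i i j u * Wf ?R \<zeta>N j u) = (\<Sum>j\<in>UNIV. \<Sum>k\<in>UNIV. G j j k u * Wf ?R \<zeta>N k u)"
          by (rule sum.swap)
        then show ?thesis unfolding 1 by (simp only: sum_distrib_left[symmetric] sum_subtractf)
      qed
      finally have Dv: "Div (\<lambda>w. \<Sum>j\<in>UNIV. (real ?n * Wf ?R \<zeta>N j w) *\<^sub>R (?sg w *\<^sub>R e w j)) u
          = real ?n * ?sg u * (\<Sum>j\<in>UNIV. D j (Wf ?R \<zeta>N j) u - (\<Sum>k\<in>UNIV. G j j k u * Wf ?R \<zeta>N k u))" .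
      have "dens_var y \<zeta>N u (e u) (\<nu> u) = real ?n * ?sg u * (?R u * rho_sq_var y \<zeta>N u (e u) (\<nu> u) / 2
          + ?R u * rho_sq y u (e u) (\<nu> u) * area_var y \<zeta>N u (e u) / real ?n)"
        unfolding dens_var_def rs by (simp add: field_simps)
      also have "\<dots> = real ?n * ?sg u * ((\<Sum>\<alpha>\<in>N. EL ?R \<alpha> u * (nu \<alpha> u \<bullet> \<zeta>N u))
          + (\<Sum>j\<in>UNIV. D j (Wf ?R \<zeta>N j) u - (\<Sum>k\<in>UNIV. G j j k u * Wf ?R \<zeta>N k u)))"
        by (subst normal_variation[OF u R Nk nY ny[OF u]]) auto
      also have "(\<Sum>\<alpha>\<in>N. EL ?R \<alpha> u * (nu \<alpha> u \<bullet> \<zeta>N u)) = (\<Sum>\<alpha>\<in>N. EL ?R \<alpha> u * (nu \<alpha> u \<bullet> \<zeta> u))"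
        by (intro sum.cong refl) (simp add: nn[OF u])
      finally show ?thesis unfolding Dv by (simp only: distrib_left)
    qed
    finally show ?thesis
      unfolding Z_def[abs_def] Div_add[OF diff1[OF z1 u] diff1[OF z3 u]] by simp
  qed
  show ?thesis using Zk supp main by blast
qed

theorem weak_form:
  assumes n: "CARD('n) \<ge> 2" and R: "Ck_on (Suc (Suc 0)) V (\<lambda>w. rho_at y w ^ (CARD('n) - 2))"
    and \<zeta>: "smooth_on V \<zeta>" and tang: "\<And>u. u \<in> V ==> y u \<bullet> \<zeta> u = 0"
    and K: "compact K" "K \<subseteq> V" "\<And>u. u \<in> V - K ==> \<zeta> u = 0"
  shows "(LINT u:K|lborel. dens_var y \<zeta> u (e u) (\<nu> u)) = (LINT u:K|lborel. real CARD('n) * sqrt (det (gram y u)) *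
      (\<Sum>\<alpha>\<in>N. EL (\<lambda>w. rho_at y w ^ (CARD('n) - 2)) \<alpha> u * (nu \<alpha> u \<bullet> \<zeta> u)))"
proof -
  let ?L = "\<lambda>u. real CARD('n) * sqrt (det (gram y u)) *
      (\<Sum>\<alpha>\<in>N. EL (\<lambda>w. rho_at y w ^ (CARD('n) - 2)) \<alpha> u * (nu \<alpha> u \<bullet> \<zeta> u))"
  obtain Z where Z: "Ck_on 1 V Z"
    and supp: "\<forall>W. open W \<and> W \<subseteq> V \<and> (\<forall>u\<in>W. \<zeta> u = 0) \<longrightarrow> (\<forall>u\<in>W. Z u = 0)"
    and eq: "\<forall>u\<in>V. dens_var y \<zeta> u (e u) (\<nu> u) = ?L u + Div Z u"
    using weak_pointwise[OF n R \<zeta> tang] by blast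
  have Kc: "closed K" and Kb: "K \<in> sets borel" using K(1) by (auto simp: compact_imp_closed)
  \<comment> \<open>Z vanishes on V outside K, so its extension by 0 is C^1 on the whole space, and
    the integral of its divergence vanishes.\<close>
  define Z' where "Z' u = (if u \<in> K then Z u else 0)" for u
  have oVK: "open (V - K)" using open_V Kc by (rule open_Diff)
  have "\<forall>u\<in>V - K. Z u = 0" using supp[rule_format, of "V - K"] oVK K(3) by blast
  then have ZZ': "Z u = Z' u" if "u \<in> V" for u using that by (auto simp: Z'_def)
  have Z'1: "Ck_on 1 V Z'" by (rule Ck_on_cong[OF open_V Z ZZ'])
  have Z'U: "Ck_on 1 UNIV Z'"
    by (rule Ck_on_zero_extend[OF open_V K(1,2) Z'1]) (simp add: Z'_def)
  have DZ: "Div Z u = Div Z' u" if "u \<in> V" for u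
    unfolding Div_def using dirderiv_cong_open[OF open_V that ZZ'] by simp
  have iZ: "(LINT u:K|lborel. Div Z' u) = 0"
    by (rule integral_Div_eq_0[OF Z'U K(1)]) (simp add: Z'_def)
  have cL: "continuous_on K ?L"
  proof -
    have "continuous_on V (nu \<alpha>)" if "\<alpha> \<in> N" for \<alpha> by (rule Ck_on_continuous[OF Ck_nu[OF that, of 0]])
    moreover have "continuous_on V \<zeta>" using \<zeta> Ck_on_continuous by (auto simp: smooth_on_def)
    moreover have "continuous_on V (\<lambda>u. sqrt (det (gram y u)))"
      by (rule Ck_on_continuous[OF Ck_on_subset[OF Ck_on_sqrt_det_gram[of 0] V_sub]])
    ultimately have "continuous_on V ?L"
      using Ck_EL[OF R]
      by (intro continuous_on_mult continuous_on_const continuous_on_sum continuous_on_inner) auto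
    then show ?thesis by (rule continuous_on_subset[OF _ K(2)])
  qed
  have cD: "continuous_on K (Div Z')"
  proof -
    have "Ck_on (Suc 0) UNIV Z'" using Z'U by simp
    then have "continuous_on UNIV (Div Z')" unfolding Div_def[abs_def] by (intro continuous_intros) simp
    then show ?thesis by (rule continuous_on_subset) simp
  qed
  have "(LINT u:K|lborel. dens_var y \<zeta> u (e u) (\<nu> u)) = (LINT u:K|lborel. ?L u + Div Z' u)"
    by (rule set_lebesgue_integral_cong) (use eq DZ K(2) Kb in auto)
  also have "\<dots> = (LINT u:K|lborel. ?L u) + (LINT u:K|lborel. Div Z' u)"
    by (rule set_integral_add(2)) (use set_integrable_continuous_compact[OF K(1) _ Kb subset_refl] cL cD in auto)
  finally show ?thesis using iZ by simp
qed

end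

section \<open>Change of variables\<close>

text \<open>The change of variables formula of the library asks for a wellordered index type; this copy
  of a finite type provides one.\<close>

typedef ('a::finite) wo = "UNIV :: 'a set" by auto

instance wo :: (finite) finite
proof
  have "(UNIV :: 'a wo set) = range Abs_wo"
    by (metis Rep_wo_inverse surj_def)
  then show "finite (UNIV :: 'a wo set)"
    by (metis finite finite_imageI)
qed

instantiation wo :: (finite) wellorder
begin
definition less_eq_wo :: "'a wo => 'a wo => bool"
  where "less_eq_wo x y \<longleftrightarrow> to_nat (Rep_wo x) \<le> to_nat (Rep_wo y)"
definition less_wo :: "'a wo => 'a wo => bool"
  where "less_wo x y \<longleftrightarrow> to_nat (Rep_wo x) < to_nat (Rep_wo y)"
instance
proof
  fix P :: "'a wo => bool" and a :: "'a wo"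
  assume *: "\<And>x. (\<And>y. y < x ==> P y) ==> P x"
  show "P a"
    by (rule measure_induct_rule[of "\<lambda>x. to_nat (Rep_wo x)"]) (auto intro: * simp: less_wo_def)
qed (auto simp: less_eq_wo_def less_wo_def Rep_wo_inject)
end

lemma bij_Rep_wo: "bij Rep_wo"
  by (metis Abs_wo_inverse Rep_wo_inverse UNIV_I bijI')

definition to_wo :: "real ^ 'n::finite => real ^ 'n wo"
  where "to_wo v = (\<chi> i. v $ Rep_wo i)"

definition of_wo :: "real ^ ('n::finite) wo => real ^ 'n"
  where "of_wo v = (\<chi> i. v $ Abs_wo i)"

lemma of_to_wo [simp]: "of_wo (to_wo v) = v"
  by (simp add: of_wo_def to_wo_def vec_eq_iff Abs_wo_inverse)

lemma to_of_wo [simp]: "to_wo (of_wo v) = v"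
  by (simp add: of_wo_def to_wo_def vec_eq_iff Rep_wo_inverse)

lemma bounded_linear_to_wo: "bounded_linear to_wo"
  unfolding linear_conv_bounded_linear[symmetric]
  by (rule linearI) (auto simp: to_wo_def vec_eq_iff)

lemma bounded_linear_of_wo: "bounded_linear of_wo"
  unfolding linear_conv_bounded_linear[symmetric]
  by (rule linearI) (auto simp: of_wo_def vec_eq_iff)

lemma to_wo_axis: "to_wo (axis (Rep_wo j) 1) = axis j 1"
  by (simp add: to_wo_def axis_def vec_eq_iff Rep_wo_inject)

lemma of_wo_axis: "of_wo (axis j 1) = axis (Rep_wo j) 1"
  by (metis of_to_wo to_wo_axis)

lemma of_wo_measurable [measurable]: "of_wo \<in> borel_measurable borel"
  by (intro borel_measurable_continuous_onI linear_continuous_on bounded_linear_of_wo)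

lemma to_wo_measurable [measurable]: "to_wo \<in> borel_measurable borel"
  by (intro borel_measurable_continuous_onI linear_continuous_on bounded_linear_to_wo)

text \<open>Conjugation by f carries transpositions to transpositions, so the claim follows by
  building p from transpositions.\<close>

lemma sign_conjugate:
  fixes f :: "'a::finite => 'b::finite"
  assumes "bij f" "p permutes UNIV"
  shows "sign (f \<circ> p \<circ> inv f) = sign p"
proof -
  have fin: "finite (UNIV :: 'a set)" by simp
  have perm: "permutation (f \<circ> q \<circ> inv f)" if "q permutes UNIV" for q
  proof -
    have "bij (f \<circ> q \<circ> inv f)"
      using that assms(1) by (intro bij_comp) (auto simp: bij_imp_bij_inv permutes_bij)
    then show ?thesis
      by (simp add: permutation)
  qed
  show ?thesis
    using fin assms(2)
  proof (induction p rule: permutes_rev_induct)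
    case id
    have "f \<circ> id \<circ> inv f = id" using assms(1) by (auto simp: fun_eq_iff bij_inv_eq_iff bij_is_surj surj_f_inv_f)
    then show ?case by simp
  next
    case (swap a b p)
    have sw: "Transposition.transpose a b permutes UNIV" by (simp add: permutes_swap_id)
    have eq: "f \<circ> (p \<circ> Transposition.transpose a b) \<circ> inv f = (f \<circ> p \<circ> inv f) \<circ> Transposition.transpose (f a) (f b)"
    proof
      fix z
      obtain w where w: "z = f w" using assms(1) by (metis bij_pointE)
      have "inv f (f v) = v" for v using assms(1) by (simp add: bij_is_inj)
      moreover have "Transposition.transpose (f a) (f b) (f w) = f (Transposition.transpose a b w)"
        using assms(1) by (auto simp: Transposition.transpose_def bij_is_inj inj_eq)
      ultimately show "(f \<circ> (p \<circ> Transposition.transpose a b) \<circ> inv f) z = ((f \<circ> p \<circ> inv f) \<circ> Transposition.transpose (f a) (f b)) z"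
        by (simp add: w)
    qed
    have pp: "permutation p" "permutation (Transposition.transpose a b)" "permutation (Transposition.transpose (f a) (f b))"
      using swap fin unfolding permutation_permutes[of p] by (blast, auto simp: permutation_swap_id)
    have "sign (Transposition.transpose (f a) (f b)) = sign (Transposition.transpose a b)"
      using swap assms(1) by (auto simp: sign_swap_id bij_is_inj inj_eq)
    then show ?case
      unfolding eq sign_compose[OF perm[OF \<open>p permutes UNIV\<close>] pp(3)] sign_compose[OF pp(1,2)]
      by (simp only: swap)
  qed
qed

text \<open>Reindexing the Leibniz sum: permutations of the one index type correspond to those of
  the other by conjugation with f, which preserves the sign.\<close>

lemma det_reindex:
  fixes A :: "real ^ 'n::finite ^ 'n" and f :: "'m::finite => 'n"
  assumes f: "bij f"
  shows "det (\<chi> i j. A $ f i $ f j) = det A"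
proof -
  have inv: "inv f (f v) = v" "f (inv f w) = w" for v w
    using f by (auto simp: bij_is_inj bij_is_surj surj_f_inv_f)
  have bij: "bij_betw (\<lambda>p. f \<circ> p \<circ> inv f) {p. p permutes UNIV} {p. p permutes UNIV}"
  proof (rule bij_betwI[where g = "\<lambda>p. inv f \<circ> p \<circ> f"])
    have *: "g \<circ> p \<circ> h permutes UNIV" if "bij g" "bij h" "p permutes UNIV" for g :: "'x => 'y" and h :: "'y => 'x" and p
      using that by (intro bij_imp_permutes bij_comp) (auto simp: permutes_bij)
    show "(\<lambda>p. f \<circ> p \<circ> inv f) \<in> {p. p permutes UNIV} \<rightarrow> {p. p permutes UNIV}"
      using f by (auto intro!: * bij_imp_bij_inv)
    show "(\<lambda>p. inv f \<circ> p \<circ> f) \<in> {p. p permutes UNIV} \<rightarrow> {p. p permutes UNIV}"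
      using f by (auto intro!: * bij_imp_bij_inv)
  qed (auto simp: fun_eq_iff inv)
  have "det (\<chi> i j. A $ f i $ f j) =
      (\<Sum>p | p permutes UNIV. of_int (sign p) * (\<Prod>i\<in>UNIV. A $ f i $ f (p i)))"
    by (simp add: det_def)
  also have "\<dots> = (\<Sum>p | p permutes UNIV. of_int (sign (f \<circ> p \<circ> inv f)) *
      (\<Prod>i\<in>UNIV. A $ i $ (f \<circ> p \<circ> inv f) i))"
  proof (intro sum.cong refl arg_cong2[where f = "(*)"])
    fix p :: "'m => 'm" assume "p \<in> {p. p permutes UNIV}"
    then show "(of_int (sign p) :: real) = of_int (sign (f \<circ> p \<circ> inv f))"
      using sign_conjugate[OF f] by simp
    show "(\<Prod>i\<in>UNIV. A $ f i $ f (p i)) = (\<Prod>i\<in>UNIV. A $ i $ (f \<circ> p \<circ> inv f) i)"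
      by (subst prod.reindex_bij_betw[OF f, symmetric]) (simp add: inv)
  qed
  also have "\<dots> = (\<Sum>p | p permutes UNIV. of_int (sign p) * (\<Prod>i\<in>UNIV. A $ i $ p i))"
    by (rule sum.reindex_bij_betw[OF bij, of "\<lambda>p. of_int (sign p) * (\<Prod>i\<in>UNIV. A $ i $ p i)"])
  finally show ?thesis by (simp add: det_def)
qed

lemma prod_Basis_real_vec:
  "(\<Prod>b\<in>(Basis :: (real ^ 'n::finite) set). f b) = (\<Prod>i\<in>UNIV. f (axis i 1))"
proof -
  have B: "(Basis :: (real ^ 'n) set) = range (\<lambda>i. axis i 1)"
    by (auto simp: Basis_vec_def)
  have "inj (\<lambda>i::'n. axis i (1::real))"
    by (auto simp: inj_on_def axis_eq_axis)
  then show ?thesis unfolding B by (simp add: prod.reindex)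
qed

text \<open>Lebesgue measure is determined by boxes, and renaming coordinates maps boxes to boxes
  with the same side lengths.\<close>

lemma lborel_distr_to_wo: "distr lborel borel to_wo = (lborel :: (real ^ ('n::finite) wo) measure)"
proof (rule lborel_eqI[symmetric])
  fix l u :: "real ^ 'n wo"
  assume le: "\<And>b. b \<in> Basis ==> l \<bullet> b \<le> u \<bullet> b"
  have le': "l $ i \<le> u $ i" for i
    using le[of "axis i 1"] by (simp add: inner_axis axis_in_Basis_iff)
  have "to_wo -` box l u = box (of_wo l) (of_wo u)"
  proof -
    have "to_wo v \<in> box l u \<longleftrightarrow> v \<in> box (of_wo l) (of_wo u)" for v
    proof -
      have "(\<forall>i. P (Abs_wo i)) \<longleftrightarrow> (\<forall>i. P i)" for P :: "'n wo => bool"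
        by (metis Rep_wo_inverse)
      from this[of "\<lambda>i. l $ i < v $ Rep_wo i \<and> v $ Rep_wo i < u $ i"] show ?thesis
        by (simp add: mem_box_cart to_wo_def of_wo_def Abs_wo_inverse)
    qed
    then show ?thesis by auto
  qed
  then have "emeasure (distr lborel borel to_wo) (box l u) = emeasure lborel (box (of_wo l) (of_wo u))"
    by (simp add: emeasure_distr)
  also have "\<dots> = ennreal (\<Prod>b\<in>Basis. (of_wo u - of_wo l) \<bullet> b)"
    by (rule emeasure_lborel_box) (auto simp: Basis_vec_def inner_axis of_wo_def le')
  also have "(\<Prod>b\<in>Basis. (of_wo u - of_wo l) \<bullet> b) = (\<Prod>i\<in>UNIV. (of_wo u - of_wo l) $ i)"
    by (simp add: prod_Basis_real_vec inner_axis)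
  also have "\<dots> = (\<Prod>i\<in>UNIV. (of_wo u - of_wo l) $ (Rep_wo i))"
    by (rule prod.reindex_bij_betw[OF bij_Rep_wo, symmetric])
  also have "\<dots> = (\<Prod>b\<in>Basis. (u - l) \<bullet> b)"
    by (simp add: prod_Basis_real_vec inner_axis of_wo_def Rep_wo_inverse)
  finally show "emeasure (distr lborel borel to_wo) (box l u) = ennreal (\<Prod>b\<in>Basis. (u - l) \<bullet> b)" .
qed simp

lemma nn_integral_to_wo:
  fixes f :: "real ^ ('n::finite) wo => ennreal"
  assumes "f \<in> borel_measurable borel"
  shows "(\<integral>\<^sup>+u. f (to_wo u) \<partial>lborel) = (\<integral>\<^sup>+u. f u \<partial>lborel)"
  by (subst lborel_distr_to_wo[symmetric]) (simp add: nn_integral_distr assms)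

text \<open>The formula used is an equivalence between finite values of the two sides; read in both
  directions it shows that if one side is infinite so is the other.\<close>

lemma emeasure_differentiable_image_wo:
  fixes g :: "real ^ 'm::{finite,wellorder} => real ^ 'm::_"
  assumes B: "B \<in> sets borel" and gB: "g ` B \<in> sets borel" and inj: "inj_on g B"
    and der: "\<And>u. u \<in> B ==> (g has_derivative g' u) (at u within B)"
    and meas: "(\<lambda>u. indicator B u * \<bar>det (matrix (g' u))\<bar>) \<in> borel_measurable borel"
  shows "emeasure lborel (g ` B) = (\<integral>\<^sup>+u. ennreal (indicator B u * \<bar>det (matrix (g' u))\<bar>) \<partial>lborel)"
proof -
  define F where "F = (\<lambda>u. indicator B u * \<bar>det (matrix (g' u))\<bar>)"
  have F: "F \<in> borel_measurable borel" "\<And>u. 0 \<le> F u"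
    using meas by (auto simp: F_def)
  have FB: "(F has_integral m) UNIV \<longleftrightarrow> ((\<lambda>u. \<bar>det (matrix (g' u))\<bar>) has_integral m) B" for m
  proof -
    have "F = (\<lambda>u. if u \<in> B then \<bar>det (matrix (g' u))\<bar> else 0)"
      by (rule ext) (simp add: F_def)
    then show ?thesis by (simp only: has_integral_restrict_UNIV)
  qed
  have key: "g ` B \<in> lmeasurable \<and> measure lebesgue (g ` B) = m
      \<longleftrightarrow> ((\<lambda>u. \<bar>det (matrix (g' u))\<bar>) has_integral m) B" for m
    using has_measure_differentiable_image[OF _ der inj] B by simp
  show ?thesis
  proof (cases "(\<integral>\<^sup>+u. ennreal (F u) \<partial>lborel) < \<infinity>")
    case True
    then obtain m where m: "(F has_integral m) UNIV"
      using nn_integral_integrable_on[OF F] by (auto simp: integrable_on_def)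
    then have "g ` B \<in> lmeasurable" "measure lebesgue (g ` B) = m"
      using key[of m] FB[of m] by simp_all
    then have "emeasure lebesgue (g ` B) = ennreal m"
      using emeasure_eq_measure2 by blast
    then show ?thesis
      using nn_integral_has_integral_lborel[OF F m] gB by (simp add: F_def)
  next
    case False
    have "\<not> emeasure lborel (g ` B) < \<infinity>"
    proof
      assume "emeasure lborel (g ` B) < \<infinity>"
      then have "g ` B \<in> lmeasurable" using gB by (auto simp: fmeasurable_def)
      then obtain m where "(F has_integral m) UNIV" using key FB by metis
      then show False using False nn_integral_has_integral_lborel[OF F] by simp
    qed
    then have "emeasure lborel (g ` B) = \<infinity>" by (simp only: infinity_ennreal_def less_top[symmetric] not_not)
    moreover have "(\<integral>\<^sup>+u. ennreal (F u) \<partial>lborel) = \<infinity>"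
      using False by (simp only: infinity_ennreal_def less_top[symmetric] not_not)
    ultimately show ?thesis by (simp only: F_def)
  qed
qed

lemma emeasure_differentiable_image:
  fixes g :: "real ^ 'n::finite => real ^ 'n"
  assumes B: "B \<in> sets borel" and gB: "g ` B \<in> sets borel" and inj: "inj_on g B"
    and der: "\<And>u. u \<in> B ==> (g has_derivative g' u) (at u)"
    and meas: "(\<lambda>u. indicator B u * \<bar>det (matrix (g' u))\<bar>) \<in> borel_measurable borel"
  shows "emeasure lborel (g ` B) = (\<integral>\<^sup>+u. ennreal (indicator B u * \<bar>det (matrix (g' u))\<bar>) \<partial>lborel)"
proof -
  define G where "G = to_wo \<circ> g \<circ> of_wo"
  define G' where "G' v = to_wo \<circ> g' (of_wo v) \<circ> of_wo" for v
  define C where "C = of_wo -` B"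
  have pre: "of_wo -` A = to_wo ` A" for A :: "(real ^ 'n) set"
  proof (intro set_eqI iffI)
    show "v \<in> to_wo ` A" if "v \<in> of_wo -` A" for v
      using that by (intro image_eqI[of v to_wo "of_wo v"]) simp_all
  qed auto
  have GC: "G ` C = of_wo -` (g ` B)"
    unfolding G_def C_def pre by (auto simp: image_comp o_def)
  have borel: "of_wo -` A \<in> sets borel" if "A \<in> sets borel" for A :: "(real ^ 'n) set"
    using measurable_sets[OF of_wo_measurable that] by simp
  have det: "det (matrix (G' v)) = det (matrix (g' (of_wo v)))" for v
  proof -
    have "matrix (G' v) = (\<chi> i j. matrix (g' (of_wo v)) $ Rep_wo i $ Rep_wo j)"
      by (simp add: matrix_def G'_def of_wo_axis) (simp add: to_wo_def)
    then show ?thesis by (simp add: det_reindex[OF bij_Rep_wo])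
  qed
  have ind: "indicator C v = (indicator B (of_wo v) :: real)" for v
    by (simp add: C_def indicator_def)
  have "emeasure lborel (G ` C) = (\<integral>\<^sup>+v. ennreal (indicator C v * \<bar>det (matrix (G' v))\<bar>) \<partial>lborel)"
  proof (rule emeasure_differentiable_image_wo)
    show "C \<in> sets borel" using borel[OF B] by (simp only: C_def)
    show "G ` C \<in> sets borel" using borel[OF gB] by (simp only: GC)
    show "inj_on G C"
      using inj unfolding G_def C_def inj_on_def by (metis comp_apply of_to_wo to_of_wo vimageD)
    show "(G has_derivative G' v) (at v within C)" if "v \<in> C" for v
    proof -
      have "(of_wo has_derivative of_wo) (at v)" and "(to_wo has_derivative to_wo) (at w)" for w :: "real ^ 'n"
        by (auto intro: bounded_linear_imp_has_derivative bounded_linear_to_wo bounded_linear_of_wo)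
      moreover have "(g has_derivative g' (of_wo v)) (at (of_wo v))"
        using der that by (simp add: C_def)
      ultimately have "(G has_derivative G' v) (at v)"
        unfolding G_def G'_def by (intro diff_chain_at) auto
      then show ?thesis by (rule has_derivative_at_withinI)
    qed
    show "(\<lambda>v. indicator C v * \<bar>det (matrix (G' v))\<bar>) \<in> borel_measurable borel"
      unfolding det ind using measurable_compose[OF of_wo_measurable meas] .
  qed
  also have "\<dots> = (\<integral>\<^sup>+u. ennreal (indicator B u * \<bar>det (matrix (g' u))\<bar>) \<partial>lborel)"
    unfolding det ind
    using nn_integral_to_wo[of "\<lambda>v. ennreal (indicator B (of_wo v) * \<bar>det (matrix (g' (of_wo v)))\<bar>)"]
      measurable_compose[OF of_wo_measurable meas] by simp
  also have "emeasure lborel (G ` C) = emeasure lborel (g ` B)"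
  proof -
    have "(\<integral>\<^sup>+v. indicator (G ` C) v \<partial>lborel) = (\<integral>\<^sup>+u. indicator (g ` B) u \<partial>lborel)"
      using nn_integral_to_wo[of "indicator (of_wo -` (g ` B))"] borel[OF gB]
      by (simp add: GC indicator_def of_bool_def cong: if_cong)
    then show ?thesis using borel[OF gB] gB by (simp add: GC)
  qed
  finally show ?thesis .
qed

text \<open>The statement for integrals is an equality of two measures, Lebesgue measure on T and
  the image of the Jacobian density; they agree on every Borel set by the formula for the measure of
  an image.\<close>

theorem nn_integral_change_of_variables:
  fixes g :: "real ^ 'n::finite => real ^ 'n"
  assumes S: "open S" and T: "open T" and gS: "g ` S = T" and inj: "inj_on g S"
    and der: "\<And>u. u \<in> S ==> (g has_derivative g' u) (at u)"
    and cont: "continuous_on S (\<lambda>u. det (matrix (g' u)))"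
    and image: "\<And>A. A \<in> sets borel ==> A \<subseteq> S ==> g ` A \<in> sets borel"
    and f: "f \<in> borel_measurable borel"
  shows "(\<integral>\<^sup>+u\<in>T. f u \<partial>lborel) = (\<integral>\<^sup>+u\<in>S. f (g u) * ennreal \<bar>det (matrix (g' u))\<bar> \<partial>lborel)"
proof -
  define F where "F u = indicator S u * \<bar>det (matrix (g' u))\<bar>" for u
  \<comment> \<open>The value off S is harmless because the density F vanishes there; it only makes
    the map Borel measurable on the whole space.\<close>
  define h where "h u = (if u \<in> S then g u else 0)" for u
  have [measurable]: "S \<in> sets borel" "T \<in> sets borel" using S T by auto
  have cg: "continuous_on S g"
    using der by (meson continuous_at_imp_continuous_on has_derivative_continuous)
  have [measurable]: "F \<in> borel_measurable borel"
    unfolding F_def using borel_measurable_continuous_on_indicator[OF _ continuous_on_rabs[OF cont]] S by simp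
  have [measurable]: "h \<in> borel_measurable borel"
    unfolding h_def using borel_measurable_continuous_on_if[OF _ cg, of "\<lambda>_. 0"] S by simp
  note f [measurable]
  have "density lborel (indicator T) = distr (density lborel F) borel h"
  proof (rule measure_eqI)
    fix A assume "A \<in> sets (density lborel (indicator T))"
    then have A [measurable]: "A \<in> sets borel" by simp
    define B where "B = S \<inter> h -` A"
    have B [measurable]: "B \<in> sets borel"
      unfolding B_def using measurable_sets[of h borel borel A] by auto
    have gB: "g ` B = T \<inter> A" using gS by (auto simp: B_def h_def)
    have "emeasure (density lborel (indicator T)) A = emeasure lborel (T \<inter> A)"
      by (simp add: emeasure_density indicator_inter_arith[symmetric])
    also have "\<dots> = emeasure lborel (g ` B)" by (simp add: gB)
    also have "\<dots> = (\<integral>\<^sup>+u. ennreal (indicator B u * \<bar>det (matrix (g' u))\<bar>) \<partial>lborel)"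
    proof (rule emeasure_differentiable_image)
      show "g ` B \<in> sets borel" by (simp add: gB)
      show "inj_on g B" using inj by (auto simp: B_def inj_on_def)
      have "(\<lambda>u. indicator B u * F u) \<in> borel_measurable borel" by measurable
      also have "(\<lambda>u. indicator B u * F u) = (\<lambda>u. indicator B u * \<bar>det (matrix (g' u))\<bar>)"
        by (auto simp: F_def B_def fun_eq_iff indicator_def)
      finally show "(\<lambda>u. indicator B u * \<bar>det (matrix (g' u))\<bar>) \<in> borel_measurable borel" .
    qed (use der B in \<open>auto simp: B_def\<close>)
    also have "\<dots> = (\<integral>\<^sup>+u. ennreal (F u) * indicator A (h u) \<partial>lborel)"
      by (intro nn_integral_cong) (auto simp: F_def B_def indicator_def)
    also have "\<dots> = emeasure (distr (density lborel F) borel h) A"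
    proof -
      have "emeasure (distr (density lborel F) borel h) A =
          (\<integral>\<^sup>+v. indicator A v \<partial>distr (density lborel F) borel h)"
        by (rule nn_integral_indicator[symmetric]) simp
      also have "\<dots> = (\<integral>\<^sup>+u. indicator A (h u) \<partial>density lborel F)"
        by (rule nn_integral_distr) simp_all
      also have "\<dots> = (\<integral>\<^sup>+u. ennreal (F u) * indicator A (h u) \<partial>lborel)"
        by (rule nn_integral_density) simp_all
      finally show ?thesis by simp
    qed
    finally show "emeasure (density lborel (indicator T)) A = emeasure (distr (density lborel F) borel h) A" .
  qed simp
  then have "(\<integral>\<^sup>+u. f u \<partial>density lborel (indicator T)) = (\<integral>\<^sup>+u. f u \<partial>distr (density lborel F) borel h)"
    by simp
  moreover have "(\<integral>\<^sup>+u. f u \<partial>density lborel (indicator T)) = (\<integral>\<^sup>+u. indicator T u * f u \<partial>lborel)"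
    by (rule nn_integral_density) simp_all
  moreover have "(\<integral>\<^sup>+u. f u \<partial>distr (density lborel F) borel h) = (\<integral>\<^sup>+u. f (h u) \<partial>density lborel F)"
    by (rule nn_integral_distr) simp_all
  moreover have "(\<integral>\<^sup>+u. f (h u) \<partial>density lborel F) = (\<integral>\<^sup>+u. ennreal (F u) * f (h u) \<partial>lborel)"
    by (rule nn_integral_density) simp_all
  moreover have "(\<integral>\<^sup>+u. ennreal (F u) * f (h u) \<partial>lborel) =
      (\<integral>\<^sup>+u\<in>S. f (g u) * ennreal \<bar>det (matrix (g' u))\<bar> \<partial>lborel)"
    by (intro nn_integral_cong) (simp add: F_def h_def mult.commute split: split_indicator)
  ultimately show ?thesis by (simp add: mult.commute)
qed

section \<open>Volume measure\<close>

locale atlas_manifold =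
  fixes \<A> :: "('m::{t2_space,second_countable_topology}, 'n::finite) chart set"
  assumes atlas: "smooth_atlas \<A>"
begin

abbreviation chart_inv :: "('m, 'n) chart => real ^ 'n => 'm"
  where "chart_inv c \<equiv> inv_into (fst c) (snd c)"

lemma chart_exists: "\<exists>c\<in>\<A>. q \<in> fst c"
  using atlas by (auto simp: smooth_atlas_def)

context
  fixes c assumes c: "c \<in> \<A>"
begin

lemma open_dom: "open (fst c)" and open_image: "open (chart_image c)"
  and chart_homeo: "homeomorphism (fst c) (chart_image c) (snd c) (chart_inv c)"
  using atlas c by (auto simp: smooth_atlas_def)

lemma chart_inv_left: "q \<in> fst c ==> chart_inv c (snd c q) = q"
  using chart_homeo by (auto simp: homeomorphism_def)

lemma chart_inv_right: "u \<in> chart_image c ==> snd c (chart_inv c u) = u"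
  using chart_homeo by (auto simp: homeomorphism_def)

lemma chart_inv_in: "u \<in> chart_image c ==> chart_inv c u \<in> fst c"
  using chart_homeo by (auto simp: homeomorphism_def)

lemma in_chart_snd: "q \<in> fst c ==> in_chart c f (snd c q) = f q"
  by (simp add: in_chart_def chart_inv_left)

lemma snd_in_image: "q \<in> fst c ==> snd c q \<in> chart_image c"
  by (simp add: chart_image_def)

lemma continuous_snd: "continuous_on (fst c) (snd c)"
  and continuous_chart_inv: "continuous_on (chart_image c) (chart_inv c)"
  using chart_homeo by (auto simp: homeomorphism_def)

lemma image_eq: "B \<subseteq> fst c ==> snd c ` B = chart_image c \<inter> chart_inv c -` B"
  using chart_inv_left chart_inv_right snd_in_image by (auto simp: image_iff subset_iff) metis

lemma inv_image_eq: "B \<subseteq> chart_image c ==> chart_inv c ` B = fst c \<inter> snd c -` B"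
  using chart_inv_left chart_inv_right chart_inv_in by (auto simp: image_iff subset_iff) metis

lemma open_image_subset:
  assumes "open B" "B \<subseteq> fst c" shows "open (snd c ` B)"
  unfolding image_eq[OF assms(2)]
  using continuous_open_preimage[OF continuous_chart_inv open_image assms(1)] .

lemma open_inv_image:
  assumes "open B" "B \<subseteq> chart_image c" shows "open (chart_inv c ` B)"
  unfolding inv_image_eq[OF assms(2)]
  using continuous_open_preimage[OF continuous_snd open_dom assms(1)] .

lemma chart_inv_measurable: "(\<lambda>u. if u \<in> chart_image c then chart_inv c u else undefined) \<in> borel_measurable borel"
  using open_image continuous_chart_inv by (intro borel_measurable_continuous_on_if) auto

lemma snd_measurable: "(\<lambda>q. if q \<in> fst c then snd c q else 0) \<in> borel_measurable borel"
  using open_dom continuous_snd by (intro borel_measurable_continuous_on_if) auto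

lemma borel_image:
  assumes "B \<in> sets borel" "B \<subseteq> fst c" shows "snd c ` B \<in> sets borel"
proof -
  have "snd c ` B = chart_image c \<inter> (\<lambda>u. if u \<in> chart_image c then chart_inv c u else undefined) -` B"
    unfolding image_eq[OF assms(2)] by auto
  then show ?thesis
    using measurable_sets[OF chart_inv_measurable assms(1)] open_image by auto
qed

lemma borel_inv_image:
  assumes "B \<in> sets borel" "B \<subseteq> chart_image c" shows "chart_inv c ` B \<in> sets borel"
proof -
  have "chart_inv c ` B = fst c \<inter> (\<lambda>q. if q \<in> fst c then snd c q else 0) -` B"
    unfolding inv_image_eq[OF assms(2)] by auto
  then show ?thesis
    using measurable_sets[OF snd_measurable assms(1)] open_dom by auto
qed

end

section \<open>Transition maps between charts\<close>

definition overlap :: "('m, 'n) chart => ('m, 'n) chart => (real ^ 'n) set"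
  where "overlap c d = snd c ` (fst c \<inter> fst d)"

definition trans :: "('m, 'n) chart => ('m, 'n) chart => real ^ 'n => real ^ 'n"
  where "trans c d = in_chart c (snd d)"

context
  fixes c d assumes c: "c \<in> \<A>" and d: "d \<in> \<A>"
begin

lemma open_overlap: "open (overlap c d)"
  unfolding overlap_def using open_image_subset[OF c] open_dom[OF c] open_dom[OF d] by auto

lemma overlap_subset: "overlap c d \<subseteq> chart_image c"
  by (auto simp: overlap_def chart_image_def)

lemma Ck_trans: "Ck_on k (overlap c d) (trans c d)"
  using atlas c d by (auto simp: smooth_atlas_def smooth_on_def overlap_def trans_def)

lemma trans_snd: "q \<in> fst c ==> trans c d (snd c q) = snd d q"
  by (simp add: trans_def in_chart_snd c)

lemma trans_in: "u \<in> overlap c d ==> trans c d u \<in> overlap d c"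
  by (auto simp: overlap_def trans_snd)

lemma in_chart_trans: "u \<in> overlap c d ==> in_chart c f u = in_chart d f (trans c d u)"
  by (auto simp: overlap_def trans_snd in_chart_snd c d)

lemma trans_image: "B \<subseteq> fst c \<inter> fst d ==> trans c d ` snd c ` B = snd d ` B"
  using trans_snd by (force simp: image_iff)

end

lemma trans_trans: "c \<in> \<A> ==> d \<in> \<A> ==> u \<in> overlap c d ==> trans d c (trans c d u) = u"
  by (auto simp: overlap_def trans_snd)

lemma differentiable_trans: "c \<in> \<A> ==> d \<in> \<A> ==> u \<in> overlap c d ==> trans c d differentiable (at u)"
  using Ck_trans[of c d "Suc 0"] by simp

lemma
  assumes cd: "c \<in> \<A>" "d \<in> \<A>" and u: "u \<in> overlap c d"
  shows inj_dirderiv_trans: "inj (dirderiv (trans c d) u)"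
    and surj_dirderiv_trans: "surj (dirderiv (trans c d) u)"
proof -
  have lin: "linear (dirderiv (trans c d) u)"
    by (rule linear_dirderiv[OF differentiable_trans[OF cd u]])
  have "((\<lambda>w. trans d c (trans c d w)) has_derivative
      (\<lambda>v. dirderiv (trans d c) (trans c d u) (dirderiv (trans c d) u v))) (at u)"
    by (rule has_derivative_compose[OF has_derivative_dirderiv[OF differentiable_trans[OF cd u]]
          has_derivative_dirderiv[OF differentiable_trans[OF cd(2,1) trans_in[OF cd u]]]])
  then have "((\<lambda>w. w) has_derivative
      (\<lambda>v. dirderiv (trans d c) (trans c d u) (dirderiv (trans c d) u v))) (at u)"
    by (rule has_derivative_transform_within_open[OF _ open_overlap[OF cd] u])
      (simp add: trans_trans cd)
  moreover have "((\<lambda>w. w) has_derivative (\<lambda>v. v)) (at u)" by (rule has_derivative_ident)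
  ultimately have "(\<lambda>v. dirderiv (trans d c) (trans c d u) (dirderiv (trans c d) u v)) = (\<lambda>v. v)"
    by (rule has_derivative_unique)
  then show inj: "inj (dirderiv (trans c d) u)" by (metis injI)
  show "surj (dirderiv (trans c d) u)" by (rule linear_inj_imp_surj[OF lin inj])
qed

lemma dirderiv_in_chart_trans:
  assumes cd: "c \<in> \<A>" "d \<in> \<A>" and u: "u \<in> overlap c d"
    and f: "in_chart d f differentiable (at (trans c d u))"
  shows "dirderiv (in_chart c f) u v = dirderiv (in_chart d f) (trans c d u) (dirderiv (trans c d) u v)"
proof -
  have "((\<lambda>w. in_chart d f (trans c d w)) has_derivative
      (\<lambda>v. dirderiv (in_chart d f) (trans c d u) (dirderiv (trans c d) u v))) (at u)"
    by (rule has_derivative_compose[OF has_derivative_dirderiv[OF differentiable_trans[OF cd u]]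
          has_derivative_dirderiv[OF f]])
  then have "(in_chart c f has_derivative
      (\<lambda>v. dirderiv (in_chart d f) (trans c d u) (dirderiv (trans c d) u v))) (at u)"
    by (rule has_derivative_transform_within_open[OF _ open_overlap[OF cd] u])
      (simp add: in_chart_trans[OF cd])
  then show ?thesis by (rule dirderiv_eqI)
qed

text \<open>The atlas may be uncountable, but a measure can only be assembled from countably many
  charts; second countability provides them.\<close>

lemma countable_charts: obtains C :: "nat => ('m, 'n) chart" where "range C \<subseteq> \<A>" "(\<Union>k. fst (C k)) = UNIV"
proof -
  obtain F where F: "F \<subseteq> fst ` \<A>" "countable F" "\<Union>F = \<Union>(fst ` \<A>)"
    using Lindelof[of "fst ` \<A>"] open_dom by (metis imageE)
  have U: "\<Union>F = UNIV" using F(3) chart_exists by auto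
  then have "F \<noteq> {}" by auto
  then have r: "range (from_nat_into F) = F" using F(2) by (rule range_from_nat_into)
  have "\<exists>c. c \<in> \<A> \<and> fst c = from_nat_into F k" for k
    using F(1) r by (metis imageE rangeI subsetD)
  then obtain C where C: "C k \<in> \<A>" "fst (C k) = from_nat_into F k" for k by metis
  have "(\<Union>k. fst (C k)) = \<Union>F" using r by (simp add: C)
  then show ?thesis using that[of C] C(1) U by auto
qed

end

locale immersed_manifold = atlas_manifold \<A>
  for \<A> :: "('m::{t2_space,second_countable_topology}, 'n::finite) chart set" +
  fixes x :: "'m => 'e::euclidean_space"
  assumes immersion: "sphere_immersion \<A> x" and dim_x: "CARD('n) < DIM('e)"
begin

lemma patch: "c \<in> \<A> ==> sphere_patch (chart_image c) (in_chart c x)"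
proof
  assume c: "c \<in> \<A>"
  show "open (chart_image c)" by (rule open_image[OF c])
  show "smooth_on (chart_image c) (in_chart c x)"
    using immersion c by (auto simp: sphere_immersion_def)
  show "inj (dirderiv (in_chart c x) u)" if "u \<in> chart_image c" for u
    using immersion c that by (auto simp: sphere_immersion_def)
  show "in_chart c x u \<bullet> in_chart c x u = 1" for u
  proof -
    have "x (chart_inv c u) \<in> sphere 0 1" using immersion by (simp add: sphere_immersion_def image_subset_iff)
    then show ?thesis by (simp add: in_chart_def dot_square_norm)
  qed
qed (rule dim_x)

abbreviation weight :: "('m, 'n) chart => real ^ 'n => real"
  where "weight c u \<equiv> sqrt (det (gram (in_chart c x) u))"

lemma weight_trans:
  assumes cd: "c \<in> \<A>" "d \<in> \<A>" and u: "u \<in> overlap c d"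
  shows "weight c u = weight d (trans c d u) * \<bar>det (matrix (dirderiv (trans c d) u))\<bar>"
proof -
  interpret d: sphere_patch "chart_image d" "in_chart d x" by (rule patch[OF cd(2)])
  have t: "trans c d u \<in> chart_image d"
    using trans_in[OF cd u] overlap_subset[OF cd(2,1)] by auto
  have "det (gram (in_chart c x) u) = det (gram (in_chart d x) (trans c d u)) *
      (det (matrix (dirderiv (trans c d) u)))\<^sup>2"
    by (intro det_gram_compose d.lin_y t linear_dirderiv differentiable_trans dirderiv_in_chart_trans d.diff_y cd u)
  then show ?thesis by (simp add: real_sqrt_mult)
qed

lemma adapted_trans:
  assumes cd: "c \<in> \<A>" "d \<in> \<A>" and u: "u \<in> overlap c d" and ab: "adapted_basis (in_chart c x) u a b"
  shows "adapted_basis (in_chart d x) (trans c d u) (\<lambda>i. dirderiv (trans c d) u (a i)) b"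
    and "rho_basis (in_chart c x) u a b = rho_basis (in_chart d x) (trans c d u) (\<lambda>i. dirderiv (trans c d) u (a i)) b"
proof -
  interpret d: sphere_patch "chart_image d" "in_chart d x" by (rule patch[OF cd(2)])
  have "trans c d ` overlap c d \<subseteq> chart_image d"
    using trans_in[OF cd] overlap_subset[OF cd(2,1)] by auto
  note * = adapted_basis_compose[OF open_overlap[OF cd] u d.open_U this d.Ck_y Ck_trans[OF cd]
      in_chart_trans[OF cd] surj_dirderiv_trans[OF cd u] ab]
  show "adapted_basis (in_chart d x) (trans c d u) (\<lambda>i. dirderiv (trans c d) u (a i)) b"
    and "rho_basis (in_chart c x) u a b = rho_basis (in_chart d x) (trans c d u) (\<lambda>i. dirderiv (trans c d) u (a i)) b"
    using * by blast+
qed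

lemma rho_at_trans:
  assumes cd: "c \<in> \<A>" "d \<in> \<A>" and u: "u \<in> overlap c d"
  shows "rho_at (in_chart c x) u = rho_at (in_chart d x) (trans c d u)"
proof -
  interpret c: sphere_patch "chart_image c" "in_chart c x" by (rule patch[OF cd(1)])
  interpret d: sphere_patch "chart_image d" "in_chart d x" by (rule patch[OF cd(2)])
  have u': "u \<in> chart_image c" "trans c d u \<in> chart_image d"
    using u trans_in[OF cd u] overlap_subset[OF cd] overlap_subset[OF cd(2,1)] by auto
  obtain a b where ab: "adapted_basis (in_chart c x) u a b" using c.ab_ex u' by blast
  show ?thesis
    using c.rho_at_y(2)[OF u'(1) ab] d.rho_at_y(2)[OF u'(2) adapted_trans(1)[OF cd u ab]]
      adapted_trans(2)[OF cd u ab] by simp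
qed

text \<open>\<open>rho\<close> chooses a chart and an adapted basis; invariance under transition
  maps and under the choice of basis makes the result the same for every chart.\<close>

lemma rho_eq:
  assumes c: "c \<in> \<A>" and q: "q \<in> fst c"
  shows "rho \<A> x q = rho_at (in_chart c x) (snd c q)"
proof -
  interpret c: sphere_patch "chart_image c" "in_chart c x" by (rule patch[OF c])
  have u: "snd c q \<in> chart_image c" by (rule snd_in_image[OF c q])
  obtain a b where ab: "adapted_basis (in_chart c x) (snd c q) a b" using c.ab_ex u by blast
  show ?thesis
    unfolding rho_def
  proof (rule some_equality)
    show "\<exists>c'\<in>\<A>. q \<in> fst c' \<and> (\<exists>a b. adapted_basis (in_chart c' x) (snd c' q) a b \<and>
        rho_at (in_chart c x) (snd c q) = rho_basis (in_chart c' x) (snd c' q) a b)"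
      using c q ab c.rho_at_y(2)[OF u ab] by blast
  next
    fix r assume "\<exists>c'\<in>\<A>. q \<in> fst c' \<and> (\<exists>a b. adapted_basis (in_chart c' x) (snd c' q) a b \<and>
        r = rho_basis (in_chart c' x) (snd c' q) a b)"
    then obtain d a' b' where d: "d \<in> \<A>" "q \<in> fst d"
      and ab': "adapted_basis (in_chart d x) (snd d q) a' b'"
      and r: "r = rho_basis (in_chart d x) (snd d q) a' b'" by blast
    interpret d: sphere_patch "chart_image d" "in_chart d x" by (rule patch[OF d(1)])
    have "snd c q \<in> overlap c d" using q d by (auto simp: overlap_def)
    from rho_at_trans[OF c d(1) this] show "r = rho_at (in_chart c x) (snd c q)"
      using d.rho_at_y(2)[OF snd_in_image[OF d] ab'] r by (simp add: trans_snd[OF c d(1) q])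
  qed
qed

text \<open>The value \<open>undefined\<close> outside the chart image only makes the map total and
  measurable; the density is 0 there.\<close>

definition chart_measure :: "('m, 'n) chart => 'm measure"
  where "chart_measure c = distr (density lborel (\<lambda>u. indicator (chart_image c) u * weight c u)) borel
    (\<lambda>u. if u \<in> chart_image c then chart_inv c u else undefined)"

lemma sets_chart_measure [simp]: "sets (chart_measure c) = sets borel"
  by (simp add: chart_measure_def)

lemma weight_measurable:
  assumes "c \<in> \<A>"
  shows "(\<lambda>u. indicator (chart_image c) u * weight c u) \<in> borel_measurable borel"
proof -
  interpret c: sphere_patch "chart_image c" "in_chart c x" by (rule patch[OF assms])
  show ?thesis
    using borel_measurable_continuous_on_indicator[OF _ Ck_on_continuous[OF c.Ck_on_sqrt_det_gram[of 0]]]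
      c.open_U by simp
qed

lemma nn_integral_chart_measure:
  assumes c: "c \<in> \<A>" and f: "f \<in> borel_measurable borel"
  shows "(\<integral>\<^sup>+q. f q \<partial>chart_measure c) = (\<integral>\<^sup>+u\<in>chart_image c. ennreal (weight c u) * f (chart_inv c u) \<partial>lborel)"
proof -
  note [measurable] = weight_measurable[OF c] chart_inv_measurable[OF c] f
  define h where "h = (\<lambda>u. if u \<in> chart_image c then chart_inv c u else undefined)"
  have [measurable]: "h \<in> borel_measurable borel" unfolding h_def by simp
  have "(\<integral>\<^sup>+q. f q \<partial>chart_measure c) =
      (\<integral>\<^sup>+u. f (h u) \<partial>density lborel (\<lambda>u. indicator (chart_image c) u * weight c u))"
    unfolding chart_measure_def h_def[symmetric] by (rule nn_integral_distr) simp_all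
  also have "\<dots> = (\<integral>\<^sup>+u. ennreal (indicator (chart_image c) u * weight c u) * f (h u) \<partial>lborel)"
    by (rule nn_integral_density) simp_all
  also have "\<dots> = (\<integral>\<^sup>+u\<in>chart_image c. ennreal (weight c u) * f (chart_inv c u) \<partial>lborel)"
    by (intro nn_integral_cong) (simp add: h_def split: split_indicator)
  finally show ?thesis .
qed

lemma emeasure_chart_measure:
  assumes c: "c \<in> \<A>" and B: "B \<in> sets borel" "B \<subseteq> fst c"
  shows "emeasure (chart_measure c) B = (\<integral>\<^sup>+u\<in>snd c ` B. ennreal (weight c u) \<partial>lborel)"
proof -
  have "emeasure (chart_measure c) B = (\<integral>\<^sup>+q. indicator B q \<partial>chart_measure c)"
    using B by (intro nn_integral_indicator[symmetric]) simp
  also have "\<dots> = (\<integral>\<^sup>+u\<in>chart_image c. ennreal (weight c u) * indicator B (chart_inv c u) \<partial>lborel)"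
    using B by (intro nn_integral_chart_measure c) simp
  also have "\<dots> = (\<integral>\<^sup>+u\<in>snd c ` B. ennreal (weight c u) \<partial>lborel)"
    unfolding image_eq[OF c B(2)] by (intro nn_integral_cong) (auto split: split_indicator)
  finally show ?thesis .
qed

text \<open>The area densities of two charts differ by the absolute Jacobian of the transition map,
  which is exactly the factor in the change of variables.\<close>

lemma chart_measure_agree:
  assumes cd: "c \<in> \<A>" "d \<in> \<A>" and B: "B \<in> sets borel" "B \<subseteq> fst c" "B \<subseteq> fst d"
  shows "emeasure (chart_measure c) B = emeasure (chart_measure d) B"
proof -
  let ?t = "trans c d"
  have dm: "(\<lambda>u. indicator (snd d ` B) u * ennreal (indicator (chart_image d) u * weight d u)) \<in> borel_measurable borel"
    using weight_measurable[OF cd(2)] borel_image[OF cd(2) B(1,3)] by measurable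
  have sub: "snd c ` B \<subseteq> overlap c d" "snd d ` B \<subseteq> overlap d c"
    using B by (auto simp: overlap_def)
  have tB: "?t u \<in> snd d ` B \<longleftrightarrow> u \<in> snd c ` B" if "u \<in> overlap c d" for u
    using that B(2,3) trans_trans[OF cd that] trans_image[OF cd, of B] trans_image[OF cd(2,1), of B]
    by (metis Int_commute imageI le_inf_iff)
  have "emeasure (chart_measure d) B = (\<integral>\<^sup>+u\<in>snd d ` B. ennreal (weight d u) \<partial>lborel)"
    by (rule emeasure_chart_measure[OF cd(2) B(1,3)])
  also have "\<dots> = (\<integral>\<^sup>+u\<in>overlap d c. indicator (snd d ` B) u * ennreal (indicator (chart_image d) u * weight d u) \<partial>lborel)"
    using sub(2) overlap_subset[OF cd(2,1)] by (intro nn_integral_cong) (auto split: split_indicator)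
  also have "\<dots> = (\<integral>\<^sup>+u\<in>overlap c d. (indicator (snd d ` B) (?t u) * ennreal (indicator (chart_image d) (?t u) * weight d (?t u)))
      * ennreal \<bar>det (matrix (dirderiv ?t u))\<bar> \<partial>lborel)"
  proof (rule nn_integral_change_of_variables[OF open_overlap[OF cd] open_overlap[OF cd(2,1)] _ _ _ _ _ dm])
    show "?t ` overlap c d = overlap d c"
      unfolding overlap_def by (subst trans_image[OF cd]) (auto simp: Int_commute)
    show "inj_on ?t (overlap c d)" by (metis inj_onI trans_trans[OF cd])
    show "(?t has_derivative dirderiv ?t u) (at u)" if "u \<in> overlap c d" for u
      by (rule has_derivative_dirderiv[OF differentiable_trans[OF cd that]])
    show "continuous_on (overlap c d) (\<lambda>u. det (matrix (dirderiv ?t u)))"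
    proof (rule Ck_on_continuous, rule Ck_on_det[OF open_overlap[OF cd]])
      show "Ck_on 0 (overlap c d) (\<lambda>w. matrix (dirderiv ?t w) $ i $ j)" for i j
      proof -
        have "continuous_on (overlap c d) (\<lambda>w. dirderiv ?t w (axis j 1))"
          using Ck_trans[OF cd, of "Suc 0"] by simp
        then show ?thesis by (simp add: matrix_def continuous_on_component)
      qed
    qed
    show "?t ` A \<in> sets borel" if "A \<in> sets borel" "A \<subseteq> overlap c d" for A
    proof -
      have A: "A \<subseteq> chart_image c" using that(2) overlap_subset[OF cd] by auto
      have i: "chart_inv c ` A \<in> sets borel" by (rule borel_inv_image[OF cd(1) that(1) A])
      have s: "chart_inv c ` A \<subseteq> fst c \<inter> fst d"
        using that(2) by (auto simp: overlap_def chart_inv_left[OF cd(1)])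
      have "snd c ` chart_inv c ` A = A"
        using A chart_inv_right[OF cd(1)] by (force simp: image_iff)
      then have "?t ` A = snd d ` chart_inv c ` A"
        using trans_image[OF cd s] by simp
      then show ?thesis using borel_image[OF cd(2) i] s by simp
    qed
  qed
  also have "\<dots> = (\<integral>\<^sup>+u\<in>snd c ` B. ennreal (weight c u) \<partial>lborel)"
  proof (intro nn_integral_cong)
    fix u :: "real ^ 'n"
    show "indicator (snd d ` B) (?t u) * ennreal (indicator (chart_image d) (?t u) * weight d (?t u))
        * ennreal \<bar>det (matrix (dirderiv ?t u))\<bar> * indicator (overlap c d) u = ennreal (weight c u) * indicator (snd c ` B) u"
    proof (cases "u \<in> overlap c d")
      case True
      then have t: "?t u \<in> chart_image d" using trans_in[OF cd] overlap_subset[OF cd(2,1)] by auto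
      show ?thesis using True t tB[OF True] weight_trans[OF cd True]
        by (simp add: ennreal_mult'' split: split_indicator)
    next
      case False
      then have "u \<notin> snd c ` B" using sub(1) by auto
      then show ?thesis using False by simp
    qed
  qed
  also have "\<dots> = emeasure (chart_measure c) B"
    by (rule emeasure_chart_measure[OF cd(1) B(1,2), symmetric])
  finally show ?thesis ..
qed

text \<open>The definition asks for the unique measure with prescribed values inside chart domains.
  Countably many charts are made disjoint and the chart measures of the pieces are added; agreement
  on overlaps shows that the sum has the prescribed values in every chart.\<close>

theorem vol_measure:
  shows sets_vol: "sets (vol_measure \<A> x) = sets borel"
    and emeasure_vol: "\<And>c B. c \<in> \<A> ==> B \<in> sets borel ==> B \<subseteq> fst c ==>
      emeasure (vol_measure \<A> x) B = emeasure (chart_measure c) B"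
proof -
  define P where "P \<mu> \<longleftrightarrow> sets \<mu> = sets borel \<and> (\<forall>c\<in>\<A>. \<forall>B\<in>sets borel. B \<subseteq> fst c \<longrightarrow>
      emeasure \<mu> B = (\<integral>\<^sup>+u\<in>snd c ` B. ennreal (weight c u) \<partial>lborel))" for \<mu> :: "'m measure"
  obtain C :: "nat => ('m, 'n) chart" where C: "range C \<subseteq> \<A>" "(\<Union>k. fst (C k)) = UNIV"
    by (rule countable_charts)
  have CA: "C k \<in> \<A>" for k using C(1) by auto
  define D where "D = disjointed (\<lambda>k. fst (C k))"
  have D: "disjoint_family D" "(\<Union>k. D k) = UNIV" "D k \<subseteq> fst (C k)" for k
    unfolding D_def UN_disjointed_eq using C(2) disjointed_subset[of "\<lambda>k. fst (C k)" k]
    by (simp_all add: disjoint_family_disjointed)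
  have Dm [measurable]: "D k \<in> sets borel" for k
  proof -
    have "fst (C k) \<in> sets borel" for k using open_dom[OF CA] by simp
    then have "range (\<lambda>k. fst (C k)) \<subseteq> sets borel" by auto
    then have "range D \<subseteq> sets borel" unfolding D_def by (rule sets.range_disjointed_sets)
    then show ?thesis by auto
  qed
  have split: "emeasure \<mu> B = (\<Sum>k. emeasure \<mu> (B \<inter> D k))"
    if "sets \<mu> = sets borel" "B \<in> sets borel" for \<mu> :: "'m measure" and B
  proof -
    have "(\<Sum>k. emeasure \<mu> (B \<inter> D k)) = emeasure \<mu> (\<Union>k. B \<inter> D k)"
      using D(1) Dm that by (intro suminf_emeasure) (auto simp: disjoint_family_on_def)
    also have "(\<Union>k. B \<inter> D k) = B" using D(2) by auto
    finally show ?thesis ..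
  qed
  define H where "H k = (\<lambda>u. if u \<in> chart_image (C k) then chart_inv (C k) u else undefined)" for k
  define G where "G k u = ennreal (indicator (chart_image (C k)) u * weight (C k) u) * indicator (D k) (H k u)" for k u
  have [measurable]: "H k \<in> borel_measurable borel" for k
    unfolding H_def by (rule chart_inv_measurable[OF CA])
  have [measurable]: "G k \<in> borel_measurable borel" for k
    unfolding G_def using weight_measurable[OF CA[of k]] by measurable
  let ?N = "count_space (UNIV :: nat set) \<Otimes>\<^sub>M (lborel :: (real ^ 'n) measure)"
  have [measurable]: "(\<lambda>z. G (fst z) (snd z)) \<in> borel_measurable ?N" "(\<lambda>z. H (fst z) (snd z)) \<in> borel_measurable ?N"
    by (auto intro!: measurable_pair_measure_countable1)
  \<comment> \<open>The countable sum of measures is encoded as one image measure: the index k is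
    counted, and the k-th copy of the coordinate space carries the area density restricted to the
    part that the k-th chart maps to \<open>D k\<close>.\<close>
  define V where "V = distr (density ?N (\<lambda>z. G (fst z) (snd z))) borel (\<lambda>z. H (fst z) (snd z))"
  have V: "emeasure V B = (\<Sum>k. emeasure (chart_measure (C k)) (B \<inter> D k))" if B [measurable]: "B \<in> sets borel" for B
  proof -
    have "emeasure V B = (\<integral>\<^sup>+q. indicator B q \<partial>V)"
      by (rule nn_integral_indicator[symmetric]) (simp add: V_def)
    also have "\<dots> = (\<integral>\<^sup>+z. indicator B (H (fst z) (snd z)) \<partial>density ?N (\<lambda>z. G (fst z) (snd z)))"
      unfolding V_def by (rule nn_integral_distr) simp_all
    also have "\<dots> = (\<integral>\<^sup>+z. G (fst z) (snd z) * indicator B (H (fst z) (snd z)) \<partial>?N)"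
      by (rule nn_integral_density) simp_all
    also have "\<dots> = (\<integral>\<^sup>+k. \<integral>\<^sup>+u. G k u * indicator B (H k u) \<partial>lborel \<partial>count_space UNIV)"
      by (subst lborel.nn_integral_fst[symmetric]) simp_all
    also have "\<dots> = (\<Sum>k. \<integral>\<^sup>+u. G k u * indicator B (H k u) \<partial>lborel)"
      by (rule nn_integral_count_space_nat)
    also have "\<dots> = (\<Sum>k. emeasure (chart_measure (C k)) (B \<inter> D k))"
    proof (rule suminf_cong)
      fix k
      have "emeasure (chart_measure (C k)) (B \<inter> D k) = (\<integral>\<^sup>+q. indicator (B \<inter> D k) q \<partial>chart_measure (C k))"
        by (rule nn_integral_indicator[symmetric]) simp
      also have "\<dots> = (\<integral>\<^sup>+u\<in>chart_image (C k). ennreal (weight (C k) u) * indicator (B \<inter> D k) (chart_inv (C k) u) \<partial>lborel)"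
        by (rule nn_integral_chart_measure[OF CA]) simp
      also have "\<dots> = (\<integral>\<^sup>+u. G k u * indicator B (H k u) \<partial>lborel)"
        by (intro nn_integral_cong) (auto simp: G_def H_def split: split_indicator)
      finally show "(\<integral>\<^sup>+u. G k u * indicator B (H k u) \<partial>lborel) = emeasure (chart_measure (C k)) (B \<inter> D k)" ..
    qed
    finally show ?thesis .
  qed
  have "P V"
    unfolding P_def
  proof (intro conjI ballI impI)
    show "sets V = sets borel" by (simp add: V_def)
    fix d B assume d: "d \<in> \<A>" and B [measurable]: "B \<in> sets borel" and Bd: "B \<subseteq> fst d"
    have "emeasure V B = (\<Sum>k. emeasure (chart_measure d) (B \<inter> D k))"
      unfolding V[OF B] using D(3) Bd
      by (intro suminf_cong chart_measure_agree[OF CA d]) auto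
    also have "\<dots> = emeasure (chart_measure d) B" using B by (intro split[symmetric]) auto
    also have "\<dots> = (\<integral>\<^sup>+u\<in>snd d ` B. ennreal (weight d u) \<partial>lborel)" by (rule emeasure_chart_measure[OF d B Bd])
    finally show "emeasure V B = (\<integral>\<^sup>+u\<in>snd d ` B. ennreal (weight d u) \<partial>lborel)" .
  qed
  have PD: "sets \<mu> = sets borel" "\<And>c B. c \<in> \<A> ==> B \<in> sets borel ==> B \<subseteq> fst c ==>
      emeasure \<mu> B = (\<integral>\<^sup>+u\<in>snd c ` B. ennreal (weight c u) \<partial>lborel)" if "P \<mu>" for \<mu>
    using that unfolding P_def by blast+
  \<comment> \<open>Every Borel set is a disjoint union of pieces contained in single chart domains,
    where the values are prescribed.\<close>
  have "\<mu> = V" if "P \<mu>" for \<mu>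
  proof (rule measure_eqI)
    show "sets \<mu> = sets V" by (simp only: PD(1)[OF that] PD(1)[OF \<open>P V\<close>])
    fix B assume "B \<in> sets \<mu>"
    then have B: "B \<in> sets borel" by (simp only: PD(1)[OF that])
    have "emeasure \<mu> (B \<inter> D k) = emeasure V (B \<inter> D k)" for k
    proof -
      have *: "B \<inter> D k \<in> sets borel" "B \<inter> D k \<subseteq> fst (C k)" using B D(3)[of k] by auto
      show ?thesis by (simp only: PD(2)[OF that CA *] PD(2)[OF \<open>P V\<close> CA *])
    qed
    then show "emeasure \<mu> B = emeasure V B"
      by (simp only: split[OF PD(1)[OF that] B] split[OF PD(1)[OF \<open>P V\<close>] B])
  qed
  with \<open>P V\<close> have "P (vol_measure \<A> x)"
    unfolding vol_measure_def P_def[symmetric] by (rule theI)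
  note * = PD[OF this]
  show "sets (vol_measure \<A> x) = sets borel" by (rule *(1))
  show "emeasure (vol_measure \<A> x) B = emeasure (chart_measure c) B"
    if "c \<in> \<A>" "B \<in> sets borel" "B \<subseteq> fst c" for c B
    by (simp only: *(2)[OF that] emeasure_chart_measure[OF that])
qed

lemma density_vol:
  assumes c: "c \<in> \<A>"
  shows "density (vol_measure \<A> x) (indicator (fst c)) = chart_measure c"
proof (rule measure_eqI)
  fix B assume "B \<in> sets (density (vol_measure \<A> x) (indicator (fst c)))"
  then have B: "B \<in> sets borel" by (simp add: sets_vol)
  have o: "fst c \<in> sets borel" using open_dom[OF c] by simp
  have "emeasure (density (vol_measure \<A> x) (indicator (fst c))) B =
      (\<integral>\<^sup>+q. indicator (fst c) q * indicator B q \<partial>vol_measure \<A> x)"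
    using B o by (intro emeasure_density) (simp_all add: sets_vol measurable_cong_sets[OF sets_vol refl])
  also have "\<dots> = (\<integral>\<^sup>+q. indicator (B \<inter> fst c) q \<partial>vol_measure \<A> x)"
    by (intro nn_integral_cong) (simp split: split_indicator)
  also have "\<dots> = emeasure (vol_measure \<A> x) (B \<inter> fst c)"
    using B o by (intro nn_integral_indicator) (simp add: sets_vol)
  also have "\<dots> = emeasure (chart_measure c) (B \<inter> fst c)"
    using B o by (intro emeasure_vol c) auto
  also have "\<dots> = emeasure (chart_measure c) B"
  proof -
    have "emeasure (chart_measure c) A = (\<integral>\<^sup>+u\<in>chart_image c. ennreal (weight c u) * indicator A (chart_inv c u) \<partial>lborel)"
      if "A \<in> sets borel" for A
      using nn_integral_chart_measure[OF c, of "indicator A"] that by (simp add: nn_integral_indicator)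
    moreover have "(\<integral>\<^sup>+u\<in>chart_image c. ennreal (weight c u) * indicator (B \<inter> fst c) (chart_inv c u) \<partial>lborel) =
        (\<integral>\<^sup>+u\<in>chart_image c. ennreal (weight c u) * indicator B (chart_inv c u) \<partial>lborel)"
      by (intro nn_integral_cong) (auto simp: chart_inv_in[OF c] split: split_indicator)
    ultimately show ?thesis using B o by simp
  qed
  finally show "emeasure (density (vol_measure \<A> x) (indicator (fst c))) B = emeasure (chart_measure c) B" .
qed (simp add: sets_vol)

text \<open>On a chart domain the volume measure is the chart measure, which is an image of a
  density; the integral is pulled back through these two constructions.\<close>

theorem vol_transfer:
  fixes f :: "'m => real"
  assumes c: "c \<in> \<A>" and B: "B \<in> sets borel" "B \<subseteq> fst c" and f: "continuous_on (fst c) f"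
  shows "(LINT q:B|vol_measure \<A> x. f q) = (LINT u:snd c ` B|lborel. weight c u * in_chart c f u)"
    and "set_integrable (vol_measure \<A> x) B f \<longleftrightarrow>
      set_integrable lborel (snd c ` B) (\<lambda>u. weight c u * in_chart c f u)"
proof -
  interpret c: sphere_patch "chart_image c" "in_chart c x" by (rule patch[OF c])
  define F where "F q = indicator B q *\<^sub>R f q" for q
  define h where "h = (\<lambda>u. if u \<in> chart_image c then chart_inv c u else undefined)"
  have o: "fst c \<in> sets borel" using open_dom[OF c] by simp
  have "F \<in> borel_measurable borel"
  proof -
    have "F = (\<lambda>q. indicator B q *\<^sub>R (indicator (fst c) q *\<^sub>R f q))"
      using B(2) by (auto simp: F_def fun_eq_iff split: split_indicator)
    then show ?thesis
      using borel_measurable_continuous_on_indicator[OF o f] B(1) by simp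
  qed
  note [measurable] = this weight_measurable[OF c]
  have [measurable]: "h \<in> borel_measurable borel" unfolding h_def by (rule chart_inv_measurable[OF c])
  have Fv: "F \<in> borel_measurable (vol_measure \<A> x)" "(indicator (fst c) :: _ => real) \<in> borel_measurable (vol_measure \<A> x)"
    using o by (simp_all add: measurable_cong_sets[OF sets_vol refl])
  have wn: "AE u in lborel. 0 \<le> indicator (chart_image c) u * weight c u"
    using c.det_gram_y by (auto split: split_indicator intro!: AE_I2 less_imp_le)
  have cm: "chart_measure c = density (vol_measure \<A> x) (\<lambda>q. ennreal (indicator (fst c) q))"
    using density_vol[OF c] by (simp add: ennreal_indicator)
  have ind: "indicator (fst c) q * F q = F q" for q
    using B(2) by (auto simp: F_def split: split_indicator)
  have Fe: "F = (\<lambda>q. indicator B q *\<^sub>R f q)" by (rule ext) (rule F_def)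
  have tr: "(indicator (chart_image c) u * weight c u) *\<^sub>R F (h u) =
      indicator (snd c ` B) u *\<^sub>R (weight c u * in_chart c f u)" for u
    unfolding image_eq[OF c B(2)] by (auto simp: F_def h_def in_chart_def split: split_indicator)
  have "integral\<^sup>L (vol_measure \<A> x) F = integral\<^sup>L (chart_measure c) F"
    unfolding cm using Fv by (subst integral_density) (auto simp: ind)
  also have "\<dots> = integral\<^sup>L (density lborel (\<lambda>u. indicator (chart_image c) u * weight c u)) (\<lambda>u. F (h u))"
    unfolding chart_measure_def h_def[symmetric] by (rule integral_distr) simp_all
  also have "\<dots> = integral\<^sup>L lborel (\<lambda>u. (indicator (chart_image c) u * weight c u) *\<^sub>R F (h u))"
    using wn by (intro integral_density) simp_all
  finally show "(LINT q:B|vol_measure \<A> x. f q) = (LINT u:snd c ` B|lborel. weight c u * in_chart c f u)"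
    unfolding tr set_lebesgue_integral_def by (simp only: Fe)
  have "integrable (vol_measure \<A> x) F \<longleftrightarrow> integrable (chart_measure c) F"
    unfolding cm using Fv by (subst integrable_density) (auto simp: ind)
  also have "\<dots> \<longleftrightarrow> integrable (density lborel (\<lambda>u. indicator (chart_image c) u * weight c u)) (\<lambda>u. F (h u))"
    unfolding chart_measure_def h_def[symmetric] by (rule integrable_distr_eq) simp_all
  also have "\<dots> \<longleftrightarrow> integrable lborel (\<lambda>u. (indicator (chart_image c) u * weight c u) *\<^sub>R F (h u))"
    using wn by (intro integrable_density) simp_all
  finally show "set_integrable (vol_measure \<A> x) B f \<longleftrightarrow>
      set_integrable lborel (snd c ` B) (\<lambda>u. weight c u * in_chart c f u)"
    unfolding tr set_integrable_def by (simp only: Fe)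
qed

end

section \<open>First variation of the Willmore functional\<close>

lemma dens_var_cong:
  assumes V: "open V" "u \<in> V" and eq: "\<And>w. w \<in> V ==> \<zeta> w = \<eta> w"
  shows "dens_var y \<zeta> u a b = dens_var y \<eta> u a b"
proof -
  have 1: "dirderiv \<zeta> w v = dirderiv \<eta> w v" if "w \<in> V" for w v
    by (rule dirderiv_cong_open[OF V(1) that eq])
  have 2: "dd \<zeta> u v w = dd \<eta> u v w" for v w
    by (rule dirderiv_cong_open[OF V 1])
  show ?thesis
    by (simp only: dens_var_def rho_sq_var_def area_var_def 1[OF V(2)] 2)
qed

text \<open>Injectivity is asked at the point u only and z is not assumed to be an immersion,
  because the lemma is applied to the maps \<open>push \<xi> t\<close>.\<close>

lemma (in atlas_manifold) dens_trans:
  fixes z :: "'m => 'e::euclidean_space"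
  assumes cd: "c \<in> \<A>" "d \<in> \<A>" and u: "u \<in> overlap c d" and dim: "CARD('n) < DIM('e)"
    and zc: "Ck_on 2 (chart_image c) (in_chart c z)" and zd: "Ck_on 2 (chart_image d) (in_chart d z)"
    and unit: "\<And>q. z q \<bullet> z q = 1" and inj: "inj (dirderiv (in_chart c z) u)"
  shows "dens (in_chart c z) u = dens (in_chart d z) (trans c d u) * \<bar>det (matrix (dirderiv (trans c d) u))\<bar>"
proof -
  have u': "u \<in> chart_image c" "trans c d u \<in> chart_image d"
    using u trans_in[OF cd u] overlap_subset[OF cd] overlap_subset[OF cd(2,1)] by auto
  have dc: "in_chart c z differentiable (at u)" and dd: "in_chart d z differentiable (at (trans c d u))"
    using zc zd u' by (auto simp: numeral_2_eq_2)
  obtain a b where ab: "adapted_basis (in_chart c z) u a b"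
    using adapted_basis_ex[OF linear_dirderiv[OF dc] inj] by blast
  have "trans c d ` overlap c d \<subseteq> chart_image d"
    using trans_in[OF cd] overlap_subset[OF cd(2,1)] by auto
  note * = adapted_basis_compose[OF open_overlap[OF cd] u open_image[OF cd(2)] this zd Ck_trans[OF cd]
      in_chart_trans[OF cd] surj_dirderiv_trans[OF cd u] ab]
  have "rho_at (in_chart c z) u = rho_basis (in_chart c z) u a b"
    by (rule rho_at_eq[OF dim open_image[OF cd(1)] u'(1) zc _ ab]) (simp add: in_chart_def unit)
  also have "\<dots> = rho_basis (in_chart d z) (trans c d u) (\<lambda>i. dirderiv (trans c d) u (a i)) b"
    by (rule *(2))
  also have "\<dots> = rho_at (in_chart d z) (trans c d u)"
    by (rule rho_at_eq[OF dim open_image[OF cd(2)] u'(2) zd _ *(1), symmetric]) (simp add: in_chart_def unit)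
  finally have 1: "rho_at (in_chart c z) u = rho_at (in_chart d z) (trans c d u)" .
  have "det (gram (in_chart c z) u) = det (gram (in_chart d z) (trans c d u)) *
      (det (matrix (dirderiv (trans c d) u)))\<^sup>2"
    by (rule det_gram_compose[OF linear_dirderiv[OF dd] linear_dirderiv[OF differentiable_trans[OF cd u]]
          dirderiv_in_chart_trans[OF cd u dd]])
  then show ?thesis by (simp add: dens_def 1 real_sqrt_mult)
qed

context immersed_manifold
begin

lemma unit_x: "x q \<bullet> x q = 1"
proof -
  have "x q \<in> sphere 0 1" using immersion by (simp add: sphere_immersion_def image_subset_iff)
  then show ?thesis by (simp add: dot_square_norm)
qed

section \<open>Velocity fields and the standard variation they generate\<close>

definition field :: "('m => 'e) => bool"
  where "field \<xi> \<longleftrightarrow> (\<forall>c\<in>\<A>. smooth_on (chart_image c) (in_chart c \<xi>)) \<and> (\<forall>q. x q \<bullet> \<xi> q = 0)"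

text \<open>Since \<xi> is orthogonal to x, the vector x + t \<xi> has norm at least 1, so the
  variation is defined and smooth for all t.\<close>

definition push :: "('m => 'e) => real => 'm => 'e"
  where "push \<xi> t q = inverse (norm (x q + t *\<^sub>R \<xi> q)) *\<^sub>R (x q + t *\<^sub>R \<xi> q)"

definition push_chart :: "('m, 'n) chart => ('m => 'e) => real \<times> (real ^ 'n) => 'e"
  where "push_chart c \<xi> z = in_chart c (push \<xi> (fst z)) (snd z)"

lemma fieldD: "field \<xi> ==> c \<in> \<A> ==> Ck_on k (chart_image c) (in_chart c \<xi>)" "field \<xi> ==> x q \<bullet> \<xi> q = 0"
  by (auto simp: field_def smooth_on_def)

lemma push_nonzero: "field \<xi> ==> x q + t *\<^sub>R \<xi> q \<noteq> 0"
proof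
  assume "field \<xi>" "x q + t *\<^sub>R \<xi> q = 0"
  then have "x q \<bullet> (x q + t *\<^sub>R \<xi> q) = 0" by simp
  then show False using unit_x fieldD(2)[OF \<open>field \<xi>\<close>] by (simp add: inner_add_right)
qed

lemma push_unit: "field \<xi> ==> push \<xi> t q \<bullet> push \<xi> t q = 1"
  using push_nonzero[of \<xi> q t] by (simp add: push_def dot_square_norm power2_eq_square)

lemma push_0: "push \<xi> 0 = x"
  using unit_x by (simp add: push_def fun_eq_iff norm_eq_sqrt_inner)

lemma push_derivative:
  assumes "field \<xi>"
  shows "((\<lambda>t. push \<xi> t q) has_vector_derivative \<xi> q) (at 0)"
proof -
  \<comment> \<open>The norm is even in t, so normalising does not change the velocity at t =
    0.\<close>
  have n: "norm (x q + t *\<^sub>R \<xi> q) = sqrt (1 + t\<^sup>2 * (\<xi> q \<bullet> \<xi> q))" for t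
    using unit_x[of q] fieldD(2)[OF assms, of q]
    by (simp add: norm_eq_sqrt_inner inner_add_left inner_add_right inner_commute power2_eq_square)
  have 1: "((\<lambda>t. inverse (sqrt (1 + t\<^sup>2 * (\<xi> q \<bullet> \<xi> q)))) has_field_derivative 0) (at 0)"
    by (auto intro!: derivative_eq_intros)
  have 2: "((\<lambda>t. x q + t *\<^sub>R \<xi> q) has_vector_derivative \<xi> q) (at 0)"
    by (auto intro!: derivative_eq_intros)
  from has_vector_derivative_scaleR[OF 1 2] show ?thesis by (simp add: push_def n)
qed

lemma push_family:
  assumes \<xi>: "field \<xi>" and c: "c \<in> \<A>"
  shows "sphere_family (UNIV \<times> chart_image c) (push_chart c \<xi>)"
proof
  let ?\<Omega> = "UNIV \<times> chart_image c :: (real \<times> (real ^ 'n)) set"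
  show o: "open ?\<Omega>" using open_image[OF c] by (intro open_Times) auto
  show "smooth_on ?\<Omega> (push_chart c \<xi>)"
    unfolding smooth_on_def
  proof
    fix k
    interpret sphere_patch "chart_image c" "in_chart c x" by (rule patch[OF c])
    have f: "Ck_on k ?\<Omega> fst" "Ck_on k ?\<Omega> snd"
      by (auto intro: Ck_on_bounded_linear bounded_linear_fst bounded_linear_snd)
    have s: "snd ` ?\<Omega> \<subseteq> chart_image c" by auto
    have r: "Ck_on k ?\<Omega> (\<lambda>z. in_chart c x (snd z) + fst z *\<^sub>R in_chart c \<xi> (snd z))"
      by (rule Ck_on_add[OF o Ck_on_compose[OF o open_U s Ck_y f(2)]
            Ck_on_scaleR[OF o f(1) Ck_on_compose[OF o open_U s fieldD(1)[OF \<xi> c] f(2)]]])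
    have "Ck_on k ?\<Omega> (\<lambda>z. inverse (norm (in_chart c x (snd z) + fst z *\<^sub>R in_chart c \<xi> (snd z))) *\<^sub>R
        (in_chart c x (snd z) + fst z *\<^sub>R in_chart c \<xi> (snd z)))"
      by (rule Ck_on_scaleR[OF o Ck_on_inverse_norm[OF o r] r]) (simp add: in_chart_def push_nonzero[OF \<xi>])
    then show "Ck_on k ?\<Omega> (push_chart c \<xi>)"
      by (simp add: push_chart_def[abs_def] push_def in_chart_def)
  qed
  show "push_chart c \<xi> z \<bullet> push_chart c \<xi> z = 1" for z
    by (simp add: push_chart_def in_chart_def push_unit[OF \<xi>])
qed (rule dim_x)

lemma push_chart_slice: "(\<lambda>u. push_chart c \<xi> (t, u)) = in_chart c (push \<xi> t)"
  by (simp add: push_chart_def)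

lemma push_velocity:
  assumes \<xi>: "field \<xi>" and c: "c \<in> \<A>" and u: "u \<in> chart_image c"
  shows "dirderiv (push_chart c \<xi>) (0, u) (1, 0) = in_chart c \<xi> u"
proof -
  interpret sphere_family "UNIV \<times> chart_image c" "push_chart c \<xi>" by (rule push_family[OF \<xi> c])
  have "((\<lambda>t. push_chart c \<xi> (t, u)) has_vector_derivative in_chart c \<xi> u) (at 0)"
    using push_derivative[OF \<xi>] by (simp add: push_chart_def in_chart_def)
  moreover have "((\<lambda>t. push_chart c \<xi> (t, u)) has_vector_derivative vel 0 u) (at 0)"
    by (rule time_derivative(1)) (use u in simp)
  ultimately show ?thesis using vector_derivative_unique_at by blast
qed

lemma dens_push_derivative:
  assumes n: "CARD('n) \<ge> 2" and \<xi>: "field \<xi>" and c: "c \<in> \<A>" and u: "u \<in> chart_image c"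
    and ab: "adapted_basis (in_chart c x) u a b"
  shows "((\<lambda>t. dens (in_chart c (push \<xi> t)) u) has_real_derivative
    dens_var (in_chart c x) (in_chart c \<xi>) u a b) (at 0)"
proof -
  interpret sphere_family "UNIV \<times> chart_image c" "push_chart c \<xi>" by (rule push_family[OF \<xi> c])
  have "((\<lambda>t. dens (sl t) u) has_real_derivative dens_var (sl 0) (vel 0) u a b) (at 0)"
    by (rule dens_first_variation) (use u ab n in \<open>simp_all add: push_chart_slice push_0\<close>)
  moreover have "dens_var (sl 0) (vel 0) u a b = dens_var (sl 0) (in_chart c \<xi>) u a b"
    by (rule dens_var_cong[OF open_image[OF c] u push_velocity[OF \<xi> c]])
  ultimately show ?thesis by (simp add: push_chart_slice push_0)
qed

text \<open>The Gram determinant is positive at t = 0 and continuous in t at this point. The time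
  span depends on u, which is enough for a derivative at t = 0.\<close>

lemma eventually_inj_push:
  assumes \<xi>: "field \<xi>" and c: "c \<in> \<A>" and u: "u \<in> chart_image c"
  shows "eventually (\<lambda>t. inj (dirderiv (in_chart c (push \<xi> t)) u)) (nhds 0)"
proof -
  interpret sphere_family "UNIV \<times> chart_image c" "push_chart c \<xi>" by (rule push_family[OF \<xi> c])
  interpret x: sphere_patch "chart_image c" "in_chart c x" by (rule patch[OF c])
  obtain a b where ab: "adapted_basis (in_chart c x) u a b" using x.ab_ex[OF u] by blast
  have z: "(t, u) \<in> UNIV \<times> chart_image c" for t :: real using u by simp
  have "isCont (\<lambda>t. sqrt (det (gram (sl t) u))) 0"
    by (rule DERIV_isCont[OF area_first_variation[OF z]]) (use ab in \<open>simp add: push_chart_slice push_0\<close>)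
  then have "((\<lambda>t. sqrt (det (gram (sl t) u))) \<longlongrightarrow> sqrt (det (gram (sl 0) u))) (nhds 0)"
    unfolding isCont_def by (rule tendsto_at_iff_tendsto_nhds[THEN iffD1])
  moreover have "sqrt (det (gram (sl 0) u)) > 0"
    using x.det_gram_y[OF u] by (simp add: push_chart_slice push_0)
  ultimately have "eventually (\<lambda>t. sqrt (det (gram (sl t) u)) > 0) (nhds 0)"
    by (rule order_tendstoD(1))
  then show ?thesis
  proof eventually_elim
    case (elim t)
    then have "inj (dirderiv (sl t) u)" by (intro det_gram_pos_imp_inj lin_sl z) auto
    then show ?case by (simp add: push_chart_slice)
  qed
qed

lemma Ck_push: "field \<xi> ==> c \<in> \<A> ==> Ck_on k (chart_image c) (in_chart c (push \<xi> t))"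
  using sphere_family.Ck_on_slice[OF push_family, of \<xi> c k t] by (simp add: push_chart_slice)

lemma field_add: "field \<xi> ==> field \<eta> ==> field (\<lambda>q. \<xi> q + \<eta> q)"
proof -
  assume f: "field \<xi>" "field \<eta>"
  have "Ck_on k (chart_image c) (in_chart c (\<lambda>q. \<xi> q + \<eta> q))" if "c \<in> \<A>" for c k
    using Ck_on_add[OF open_image[OF that] fieldD(1)[OF f(1) that] fieldD(1)[OF f(2) that]]
    by (simp add: in_chart_def)
  then show ?thesis
    using fieldD(2)[OF f(1)] fieldD(2)[OF f(2)] by (simp add: field_def smooth_on_def inner_add_right)
qed

lemma continuous_of_chart:
  assumes c: "c \<in> \<A>" and f: "continuous_on (chart_image c) (in_chart c f)"
  shows "continuous_on (fst c) f"
proof -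
  have "continuous_on (fst c) (\<lambda>q. in_chart c f (snd c q))"
    by (rule continuous_on_compose2[OF f continuous_snd[OF c]]) (auto simp: chart_image_def)
  then show ?thesis by (simp add: in_chart_snd[OF c] cong: continuous_on_cong)
qed

text \<open>The density of the first variation with respect to the volume of \<open>x\<close>.\<close>

definition lam :: "('m => 'e) => 'm => real"
  where "lam \<xi> q = (let c = SOME c. c \<in> \<A> \<and> q \<in> fst c in
    deriv (\<lambda>t. dens (in_chart c (push \<xi> t)) (snd c q)) 0 / weight c (snd c q))"

context
  assumes n2: "CARD('n) \<ge> 2"
begin

text \<open>Both the density and the weight change by the same Jacobian under a transition map, and
  this Jacobian does not depend on t. Hence the quotient chosen in the definition has the same value
  in every chart.\<close>

lemma lam_eq:
  assumes \<xi>: "field \<xi>" and c: "c \<in> \<A>" and q: "q \<in> fst c"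
    and ab: "adapted_basis (in_chart c x) (snd c q) a b"
  shows "weight c (snd c q) * lam \<xi> q = dens_var (in_chart c x) (in_chart c \<xi>) (snd c q) a b"
proof -
  define d where "d = (SOME c. c \<in> \<A> \<and> q \<in> fst c)"
  have d: "d \<in> \<A>" "q \<in> fst d"
    using someI_ex[OF chart_exists[of q, unfolded Bex_def]] unfolding d_def by blast+
  define J where "J = \<bar>det (matrix (dirderiv (trans c d) (snd c q)))\<bar>"
  have u: "snd c q \<in> overlap c d" using q d by (auto simp: overlap_def)
  have t: "trans c d (snd c q) = snd d q" by (rule trans_snd[OF c d(1) q])
  interpret c: sphere_patch "chart_image c" "in_chart c x" by (rule patch[OF c])
  interpret d: sphere_patch "chart_image d" "in_chart d x" by (rule patch[OF d(1)])
  have w: "weight c (snd c q) = weight d (snd d q) * J"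
    using weight_trans[OF c d(1) u] by (simp add: t J_def)
  have pos: "weight c (snd c q) > 0" "weight d (snd d q) > 0"
    using c.det_gram_y d.det_gram_y snd_in_image c d q by auto
  obtain a' b' where ab': "adapted_basis (in_chart d x) (snd d q) a' b'"
    using d.ab_ex snd_in_image[OF d] by blast
  have D: "((\<lambda>t. dens (in_chart d (push \<xi> t)) (snd d q)) has_real_derivative
      dens_var (in_chart d x) (in_chart d \<xi>) (snd d q) a' b') (at 0)"
    by (rule dens_push_derivative[OF n2 \<xi> d(1) snd_in_image[OF d] ab'])
  have C: "((\<lambda>t. dens (in_chart c (push \<xi> t)) (snd c q)) has_real_derivative
      dens_var (in_chart c x) (in_chart c \<xi>) (snd c q) a b) (at 0)"
    by (rule dens_push_derivative[OF n2 \<xi> c snd_in_image[OF c q] ab])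
  \<comment> \<open>The transformation law holds for t near 0, while the moved map is still an
    immersion at q; it is then differentiated at t = 0.\<close>
  have "eventually (\<lambda>t. dens (in_chart c (push \<xi> t)) (snd c q) = dens (in_chart d (push \<xi> t)) (snd d q) * J) (nhds 0)"
    using eventually_inj_push[OF \<xi> c snd_in_image[OF c q]]
  proof eventually_elim
    case (elim t)
    show ?case
      using dens_trans[OF c d(1) u dim_x Ck_push[OF \<xi> c] Ck_push[OF \<xi> d(1)] push_unit[OF \<xi>] elim]
      by (simp add: t J_def)
  qed
  from DERIV_cong_ev[OF refl this refl] C
  have "((\<lambda>t. dens (in_chart d (push \<xi> t)) (snd d q) * J) has_real_derivative
      dens_var (in_chart c x) (in_chart c \<xi>) (snd c q) a b) (at 0)" by blast
  from DERIV_unique[OF this DERIV_cmult_right[OF D]]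
  have "dens_var (in_chart c x) (in_chart c \<xi>) (snd c q) a b
      = dens_var (in_chart d x) (in_chart d \<xi>) (snd d q) a' b' * J" .
  moreover have "lam \<xi> q = dens_var (in_chart d x) (in_chart d \<xi>) (snd d q) a' b' / weight d (snd d q)"
    using DERIV_imp_deriv[OF D] by (simp add: lam_def d_def[symmetric])
  ultimately show ?thesis using pos by (simp add: w)
qed

lemma lam_chart:
  assumes \<xi>: "field \<xi>" and c: "c \<in> \<A>" and u: "u \<in> chart_image c"
    and ab: "adapted_basis (in_chart c x) u a b"
  shows "weight c u * in_chart c (lam \<xi>) u = dens_var (in_chart c x) (in_chart c \<xi>) u a b"
  using lam_eq[OF \<xi> c chart_inv_in[OF c u]] ab by (simp add: chart_inv_right[OF c u]) (simp add: in_chart_def)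

lemma lam_local_eq:
  assumes "field \<xi>" "field \<eta>" "open G" "q \<in> G" "\<And>q'. q' \<in> G ==> \<xi> q' = \<eta> q'"
  shows "lam \<xi> q = lam \<eta> q"
proof -
  obtain c where c: "c \<in> \<A>" "q \<in> fst c" using chart_exists by blast
  interpret c: sphere_patch "chart_image c" "in_chart c x" by (rule patch[OF c(1)])
  obtain a b where ab: "adapted_basis (in_chart c x) (snd c q) a b"
    using c.ab_ex snd_in_image[OF c] by blast
  have "dens_var (in_chart c x) (in_chart c \<xi>) (snd c q) a b = dens_var (in_chart c x) (in_chart c \<eta>) (snd c q) a b"
  proof (rule dens_var_cong[OF open_image_subset[OF c(1), of "G \<inter> fst c"]])
    show "open (G \<inter> fst c)" using assms(3) open_dom[OF c(1)] by auto
  qed (use assms(4,5) c in \<open>auto simp: in_chart_snd\<close>)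
  with lam_eq[OF assms(1) c ab] lam_eq[OF assms(2) c ab]
  have "weight c (snd c q) * lam \<xi> q = weight c (snd c q) * lam \<eta> q" by (simp only:)
  then show ?thesis using c.det_gram_y[OF snd_in_image[OF c]] by simp
qed

lemma lam_add:
  assumes "field \<xi>" "field \<eta>"
  shows "lam (\<lambda>q. \<xi> q + \<eta> q) q = lam \<xi> q + lam \<eta> q"
proof -
  obtain c where c: "c \<in> \<A>" "q \<in> fst c" using chart_exists by blast
  interpret c: sphere_patch "chart_image c" "in_chart c x" by (rule patch[OF c(1)])
  obtain a b where ab: "adapted_basis (in_chart c x) (snd c q) a b"
    using c.ab_ex snd_in_image[OF c] by blast
  have "in_chart c (\<lambda>q. \<xi> q + \<eta> q) = (\<lambda>u. in_chart c \<xi> u + in_chart c \<eta> u)"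
    by (simp add: in_chart_def)
  with dens_var_add[OF c.open_U snd_in_image[OF c] fieldD(1)[OF assms(1) c(1)] fieldD(1)[OF assms(2) c(1)]]
  have "weight c (snd c q) * lam (\<lambda>q. \<xi> q + \<eta> q) q = weight c (snd c q) * (lam \<xi> q + lam \<eta> q)"
    using lam_eq[OF assms(1) c ab] lam_eq[OF assms(2) c ab] lam_eq[OF field_add[OF assms] c ab]
    by (simp add: distrib_left)
  then show ?thesis using c.det_gram_y[OF snd_in_image[OF c]] by simp
qed

text \<open>Near q the field equals its double, so additivity gives lam = 2 lam at q.\<close>

lemma lam_eq_0:
  assumes "field \<xi>" "open G" "q \<in> G" "\<And>q'. q' \<in> G ==> \<xi> q' = 0"
  shows "lam \<xi> q = 0"
proof -
  have "lam \<xi> q = lam (\<lambda>q. \<xi> q + \<xi> q) q"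
    by (rule lam_local_eq[OF assms(1) field_add[OF assms(1,1)] assms(2,3)]) (simp add: assms(4))
  then show ?thesis using lam_add[OF assms(1,1)] by simp
qed

text \<open>Near each point the adapted bases are taken from a smooth frame, in which
  \<open>dens_var\<close> is continuous; dividing by the positive area density gives
  \<open>lam\<close>.\<close>

lemma continuous_lam_chart:
  assumes \<xi>: "field \<xi>" and c: "c \<in> \<A>"
  shows "continuous_on (chart_image c) (in_chart c (lam \<xi>))"
proof -
  interpret c: sphere_patch "chart_image c" "in_chart c x" by (rule patch[OF c])
  interpret sphere_family "UNIV \<times> chart_image c" "push_chart c \<xi>" by (rule push_family[OF \<xi> c])
  have "Ck_on 0 (chart_image c) (in_chart c (lam \<xi>))"
  proof (rule Ck_on_local)
    fix u0 assume u0: "u0 \<in> chart_image c"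
    obtain a b where ab: "adapted_basis (in_chart c x) u0 a b" using c.ab_ex[OF u0] by blast
    obtain \<Omega> A B where \<Omega>: "open \<Omega>" "(0, u0) \<in> \<Omega>" "\<Omega> \<subseteq> UNIV \<times> chart_image c"
      and AB: "\<And>t u. (t, u) \<in> \<Omega> ==> adapted_basis (sl t) u (A (t, u)) (B (t, u))"
      and cont: "continuous_on \<Omega> (\<lambda>z. dens_var (sl (fst z)) (vel (fst z)) (snd z) (A z) (B z))"
      using dens_var_continuous[of 0 u0 a b] u0 ab by (auto simp: push_chart_slice push_0)
    define T where "T = {u. (0, u) \<in> \<Omega>}"
    have T: "open T" "u0 \<in> T" "T \<subseteq> chart_image c"
      using open_vimage[OF \<Omega>(1), of "\<lambda>u. (0, u)"] \<Omega> by (auto simp: T_def vimage_def continuous_on_Pair)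
    have "continuous_on T (\<lambda>u. dens_var (sl 0) (vel 0) u (A (0, u)) (B (0, u)))"
      using continuous_on_compose2[OF cont, of T "\<lambda>u. (0, u)"] by (auto simp: T_def continuous_on_Pair)
    then have "continuous_on T (\<lambda>u. dens_var (sl 0) (vel 0) u (A (0, u)) (B (0, u)) / weight c u)"
      using Ck_on_continuous[OF Ck_on_subset[OF c.Ck_on_sqrt_det_gram[of 0] T(3)]] c.det_gram_y T(3)
      by (intro continuous_on_divide) (auto simp: subset_iff less_le)
    moreover have "dens_var (sl 0) (vel 0) u (A (0, u)) (B (0, u)) / weight c u = in_chart c (lam \<xi>) u"
      if "u \<in> T" for u
    proof -
      have u: "u \<in> chart_image c" using that T(3) by auto
      have "adapted_basis (in_chart c x) u (A (0, u)) (B (0, u))"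
        using AB[of 0 u] that by (simp add: T_def push_chart_slice push_0)
      from lam_chart[OF \<xi> c u this]
      have "dens_var (sl 0) (in_chart c \<xi>) u (A (0, u)) (B (0, u)) = weight c u * in_chart c (lam \<xi>) u"
        by (simp add: push_chart_slice push_0)
      moreover have "dens_var (sl 0) (vel 0) u (A (0, u)) (B (0, u)) = dens_var (sl 0) (in_chart c \<xi>) u (A (0, u)) (B (0, u))"
        by (rule dens_var_cong[OF open_image[OF c] u push_velocity[OF \<xi> c]])
      ultimately show ?thesis using c.det_gram_y[OF u] by simp
    qed
    ultimately have "continuous_on T (in_chart c (lam \<xi>))"
      by (simp cong: continuous_on_cong)
    then show "\<exists>T. open T \<and> u0 \<in> T \<and> Ck_on 0 T (in_chart c (lam \<xi>))" using T by auto
  qed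
  then show ?thesis by simp
qed

lemma continuous_lam: "field \<xi> ==> c \<in> \<A> ==> continuous_on (fst c) (lam \<xi>)"
  using continuous_of_chart continuous_lam_chart by blast

end

end

text \<open>For properties that are additive over disjoint Borel sets, cutting K into finitely many
  Borel pieces replaces a partition of unity.\<close>

lemma compact_borel_induct:
  fixes K :: "'m::t2_space set"
  assumes K: "compact K"
    and loc: "\<And>q. \<exists>G. open G \<and> q \<in> G \<and> (\<forall>B\<in>sets borel. B \<subseteq> G \<longrightarrow> P B)"
    and union: "\<And>B C. B \<in> sets borel ==> C \<in> sets borel ==> B \<inter> C = {} ==> P B ==> P C ==> P (B \<union> C)"
  shows "P K"
proof -
  obtain G where G: "\<And>q. open (G q)" "\<And>q. q \<in> G q" "\<And>q B. B \<in> sets borel ==> B \<subseteq> G q ==> P B"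
    using loc by metis
  have "K \<subseteq> (\<Union>q\<in>K. G q)" using G(2) by blast
  then obtain F where F: "finite F" "K \<subseteq> (\<Union>q\<in>F. G q)"
    using compactE_image[OF K, of K G] G(1) by metis
  have "\<forall>B\<in>sets borel. B \<subseteq> (\<Union>q\<in>F. G q) \<longrightarrow> P B"
    using F(1)
  proof (induction F)
    case empty
    show ?case using G(3)[of "{}"] by auto
  next
    case (insert q F)
    show ?case
    proof (intro ballI impI)
      fix B assume B: "B \<in> sets borel" "B \<subseteq> (\<Union>q\<in>insert q F. G q)"
      have m: "B \<inter> G q \<in> sets borel" "B - G q \<in> sets borel" using B(1) G(1)[of q] by auto
      have "B - G q \<subseteq> (\<Union>q\<in>F. G q)" using B(2) by auto
      then have "P (B - G q)" using insert.IH m(2) by blast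
      moreover have "P (B \<inter> G q)" by (rule G(3)[OF m(1)]) auto
      ultimately have "P ((B \<inter> G q) \<union> (B - G q))" by (intro union m) auto
      then show "P B" by (simp add: Un_Diff_Int Int_Diff_Un)
    qed
  qed
  moreover have "K \<in> sets borel" using K by (simp add: compact_imp_closed borel_closed)
  ultimately show ?thesis using F(2) by blast
qed

context immersed_manifold
begin

lemma continuous_in_chart:
  assumes c: "c \<in> \<A>" and f: "continuous_on (fst c) f"
  shows "continuous_on (chart_image c) (in_chart c f)"
  unfolding in_chart_def
  by (rule continuous_on_compose2[OF f continuous_chart_inv[OF c]]) (use chart_inv_in[OF c] in auto)

lemma chart_nbhd:
  assumes c: "c \<in> \<A>" and q: "q \<in> fst c" and r: "r > 0" and sub: "cball (snd c q) r \<subseteq> chart_image c"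
  shows "open (chart_inv c ` ball (snd c q) r)" "q \<in> chart_inv c ` ball (snd c q) r"
    "B \<subseteq> chart_inv c ` ball (snd c q) r ==> B \<subseteq> fst c"
    "B \<subseteq> chart_inv c ` ball (snd c q) r ==> snd c ` B \<subseteq> cball (snd c q) r"
proof -
  have b: "ball (snd c q) r \<subseteq> chart_image c" using sub ball_subset_cball by blast
  show "open (chart_inv c ` ball (snd c q) r)" by (rule open_inv_image[OF c open_ball b])
  show "q \<in> chart_inv c ` ball (snd c q) r"
    using r chart_inv_left[OF c q] by (intro image_eqI[of _ _ "snd c q"]) auto
  show "B \<subseteq> fst c" "snd c ` B \<subseteq> cball (snd c q) r" if "B \<subseteq> chart_inv c ` ball (snd c q) r"
    using that inv_image_eq[OF c b] ball_subset_cball[of "snd c q" r] by auto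
qed

text \<open>Inside a chart a continuous function is integrable over subsets of a closed ball;
  finitely many such pieces cover K.\<close>

lemma set_integrable_continuous:
  fixes f :: "'m => real"
  assumes f: "\<And>c. c \<in> \<A> ==> continuous_on (fst c) f" and K: "compact K"
  shows "set_integrable (vol_measure \<A> x) K f"
proof (rule compact_borel_induct[OF K])
  fix q
  obtain c where c: "c \<in> \<A>" "q \<in> fst c" using chart_exists by blast
  interpret c: sphere_patch "chart_image c" "in_chart c x" by (rule patch[OF c(1)])
  obtain r where r: "r > 0" "cball (snd c q) r \<subseteq> chart_image c"
    using open_contains_cball_eq[OF c.open_U] snd_in_image[OF c] by blast
  note G = chart_nbhd[OF c r]
  show "\<exists>G. open G \<and> q \<in> G \<and> (\<forall>B\<in>sets borel. B \<subseteq> G \<longrightarrow> set_integrable (vol_measure \<A> x) B f)"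
  proof (intro exI[of _ "chart_inv c ` ball (snd c q) r"] conjI ballI impI G(1,2))
    fix B assume B: "B \<in> sets borel" "B \<subseteq> chart_inv c ` ball (snd c q) r"
    have "set_integrable lborel (snd c ` B) (\<lambda>u. weight c u * in_chart c f u)"
    proof (rule set_integrable_continuous_compact[OF compact_cball _ borel_image[OF c(1) B(1) G(3)[OF B(2)]] G(4)[OF B(2)]])
      show "continuous_on (cball (snd c q) r) (\<lambda>u. weight c u * in_chart c f u)"
        by (rule continuous_on_subset[OF continuous_on_mult[OF Ck_on_continuous[OF c.Ck_on_sqrt_det_gram[of 0]]
              continuous_in_chart[OF c(1) f[OF c(1)]]] r(2)])
    qed
    then show "set_integrable (vol_measure \<A> x) B f"
      using vol_transfer(2)[OF c(1) B(1) G(3)[OF B(2)] f[OF c(1)]] by simp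
  qed
next
  fix B C :: "'m set"
  assume "B \<in> sets borel" "C \<in> sets borel" "set_integrable (vol_measure \<A> x) B f" "set_integrable (vol_measure \<A> x) C f"
  then show "set_integrable (vol_measure \<A> x) (B \<union> C) f" by (intro set_integrable_Un) (simp_all add: sets_vol)
qed

context
  assumes n2: "CARD('n) \<ge> 2"
begin

lemma continuous_dens:
  assumes c: "c \<in> \<A>" shows "continuous_on (chart_image c) (dens (in_chart c x))"
proof -
  interpret c: sphere_patch "chart_image c" "in_chart c x" by (rule patch[OF c])
  have "Ck_on 0 (chart_image c) (\<lambda>w. rho_at (in_chart c x) w ^ CARD('n))"
    by (rule c.Ck_on_rho_power[OF subset_refl c.open_U]) (use n2 in auto)
  then show ?thesis
    unfolding dens_def by (intro continuous_on_mult Ck_on_continuous[OF c.Ck_on_sqrt_det_gram[of 0]]) simp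
qed

lemma willmore_transfer:
  assumes c: "c \<in> \<A>" and B: "B \<in> sets borel" "B \<subseteq> fst c"
  shows "willmore_functional \<A> x B = (LINT u:snd c ` B|lborel. dens (in_chart c x) u)"
    and "set_integrable (vol_measure \<A> x) B (\<lambda>q. rho \<A> x q ^ CARD('n)) \<longleftrightarrow>
      set_integrable lborel (snd c ` B) (dens (in_chart c x))"
proof -
  interpret c: sphere_patch "chart_image c" "in_chart c x" by (rule patch[OF c])
  have eq: "in_chart c (\<lambda>q. rho \<A> x q ^ CARD('n)) u = rho_at (in_chart c x) u ^ CARD('n)" if "u \<in> chart_image c" for u
    using rho_eq[OF c chart_inv_in[OF c that]] chart_inv_right[OF c that] by (simp add: in_chart_def)
  have "Ck_on 0 (chart_image c) (\<lambda>w. rho_at (in_chart c x) w ^ CARD('n))"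
    by (rule c.Ck_on_rho_power[OF subset_refl c.open_U]) (use n2 in auto)
  then have "continuous_on (chart_image c) (in_chart c (\<lambda>q. rho \<A> x q ^ CARD('n)))"
    using eq by (simp cong: continuous_on_cong)
  note tr = vol_transfer[OF c B continuous_of_chart[OF c this]]
  have d: "weight c u * in_chart c (\<lambda>q. rho \<A> x q ^ CARD('n)) u = dens (in_chart c x) u" if "u \<in> snd c ` B" for u
    using eq[of u] that B(2) snd_in_image[OF c] by (auto simp: dens_def mult.commute)
  have s: "snd c ` B \<in> sets lborel" using borel_image[OF c B] by simp
  show "willmore_functional \<A> x B = (LINT u:snd c ` B|lborel. dens (in_chart c x) u)"
    unfolding willmore_functional_def tr(1) by (rule set_lebesgue_integral_cong[OF s]) (use d in blast)
  show "set_integrable (vol_measure \<A> x) B (\<lambda>q. rho \<A> x q ^ CARD('n)) \<longleftrightarrow>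
      set_integrable lborel (snd c ` B) (dens (in_chart c x))"
    unfolding tr(2) by (rule set_integrable_cong[OF refl refl d])
qed

end

end

section \<open>First variation along an arbitrary smooth variation\<close>

locale smooth_deformation = immersed_manifold \<A> x
  for \<A> :: "('m::{t2_space,second_countable_topology}, 'n::finite) chart set"
    and x :: "'m => 'e::euclidean_space" +
  fixes \<epsilon> :: real and K :: "'m set" and X :: "real => 'm => 'e"
  assumes variation: "smooth_variation \<A> x \<epsilon> K X"
begin

definition \<xi> :: "'m => 'e" where "\<xi> q = vector_derivative (\<lambda>t. X t q) (at 0)"

lemma eps: "\<epsilon> > 0" and compact_K: "compact K" and X0: "X 0 = x"
  using variation by (auto simp: smooth_variation_def)

lemma immersed_X: "t \<in> {-\<epsilon><..<\<epsilon>} ==> immersed_manifold \<A> (X t)"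
  using variation atlas_manifold_axioms dim_x
  by (auto simp: smooth_variation_def immersed_manifold_def immersed_manifold_axioms_def)

lemma family_X:
  assumes "c \<in> \<A>"
  shows "sphere_family ({-\<epsilon><..<\<epsilon>} \<times> chart_image c) (\<lambda>(t, u). in_chart c (X t) u)"
proof
  show "open ({-\<epsilon><..<\<epsilon>} \<times> chart_image c)" using open_image[OF assms] by (intro open_Times) auto
  show "smooth_on ({-\<epsilon><..<\<epsilon>} \<times> chart_image c) (\<lambda>(t, u). in_chart c (X t) u)"
    using variation assms by (simp add: smooth_variation_def)
  show "(case z of (t, u) => in_chart c (X t) u) \<bullet> (case z of (t, u) => in_chart c (X t) u) = 1"
    if "z \<in> {-\<epsilon><..<\<epsilon>} \<times> chart_image c" for z
    using that immersed_manifold.unit_x[OF immersed_X] by (auto simp: in_chart_def)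
qed (rule dim_x)

lemma velocity_X:
  assumes c: "c \<in> \<A>" and u: "u \<in> chart_image c"
  shows "dirderiv (\<lambda>(t, u). in_chart c (X t) u) (0, u) (1, 0) = in_chart c \<xi> u"
    and "((\<lambda>t. X t (chart_inv c u)) has_vector_derivative in_chart c \<xi> u) (at 0)"
proof -
  interpret sphere_family "{-\<epsilon><..<\<epsilon>} \<times> chart_image c" "\<lambda>(t, u). in_chart c (X t) u"
    by (rule family_X[OF c])
  have *: "((\<lambda>t. X t (chart_inv c u)) has_vector_derivative vel 0 u) (at 0)"
    using time_derivative(1)[of 0 u] u eps by (simp add: in_chart_def)
  from vector_derivative_at[OF *]
  show 1: "vel 0 u = in_chart c \<xi> u" by (simp add: in_chart_def \<xi>_def)
  show "((\<lambda>t. X t (chart_inv c u)) has_vector_derivative in_chart c \<xi> u) (at 0)"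
    using * unfolding 1 .
qed

lemma derivative_X: "((\<lambda>t. X t q) has_vector_derivative \<xi> q) (at 0)"
proof -
  obtain c where c: "c \<in> \<A>" "q \<in> fst c" using chart_exists by blast
  from velocity_X(2)[OF c(1) snd_in_image[OF c]] show ?thesis
    by (simp add: in_chart_def chart_inv_left[OF c])
qed

lemma field_\<xi>: "field \<xi>"
  unfolding field_def smooth_on_def
proof (intro conjI ballI allI)
  fix c k assume c: "c \<in> \<A>"
  interpret sphere_family "{-\<epsilon><..<\<epsilon>} \<times> chart_image c" "\<lambda>(t, u). in_chart c (X t) u"
    by (rule family_X[OF c])
  let ?\<Omega> = "{-\<epsilon><..<\<epsilon>} \<times> chart_image c"
  have v: "Ck_on k ?\<Omega> (\<lambda>z. dirderiv (\<lambda>(t, u). in_chart c (X t) u) z (1, 0))"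
    using CkY[of "Suc k"] by (simp only: Ck_on.simps(2))
  have p: "Ck_on k (chart_image c) (\<lambda>u. (0::real, u))"
    by (intro Ck_on_Pair open_image[OF c] Ck_on_const Ck_on_id)
  have s: "(\<lambda>u. (0, u)) ` chart_image c \<subseteq> ?\<Omega>" using eps by auto
  show "Ck_on k (chart_image c) (in_chart c \<xi>)"
    by (rule Ck_on_cong[OF open_image[OF c] Ck_on_compose[OF open_image[OF c] open_dom s v p] velocity_X(1)[OF c]])
next
  fix q
  have "((\<lambda>t. X t q \<bullet> X t q) has_vector_derivative (X 0 q \<bullet> \<xi> q + \<xi> q \<bullet> X 0 q)) (at 0)"
    by (rule bounded_bilinear.has_vector_derivative[OF bounded_bilinear_inner derivative_X derivative_X])
  moreover have "((\<lambda>t. X t q \<bullet> X t q) has_vector_derivative 0) (at 0)"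
    by (rule has_vector_derivative_transform_within_open[of "\<lambda>_. 1" 0 0 "{-\<epsilon><..<\<epsilon>}"])
      (use eps immersed_manifold.unit_x[OF immersed_X] in auto)
  ultimately have "X 0 q \<bullet> \<xi> q + \<xi> q \<bullet> X 0 q = 0"
    by (rule vector_derivative_unique_at)
  then show "x q \<bullet> \<xi> q = 0" by (simp add: X0 inner_commute)
qed

lemma \<xi>_outside:
  assumes "q \<notin> K" shows "\<xi> q = 0"
proof -
  have "((\<lambda>t. X t q) has_vector_derivative 0) (at 0)"
    by (rule has_vector_derivative_transform_within_open[of "\<lambda>_. x q" 0 0 "{-\<epsilon><..<\<epsilon>}"])
      (use eps assms variation in \<open>auto simp: smooth_variation_def\<close>)
  from vector_derivative_unique_at[OF derivative_X this] show ?thesis .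
qed

text \<open>On a small Borel set inside one chart the functional is an integral over a fixed
  coordinate set and can be differentiated under the integral; finitely many such sets make up
  K.\<close>

theorem willmore_first_variation:
  assumes n2: "CARD('n) \<ge> 2"
  shows "((\<lambda>t. willmore_functional \<A> (X t) K) has_real_derivative (LINT q:K|vol_measure \<A> x. lam \<xi> q)) (at 0)"
proof -
  let ?I = "{-\<epsilon><..<\<epsilon>}"
  \<comment> \<open>Integrability is part of the induction property because without it neither the
    functional nor the integral of \<open>lam\<close> would be known to be additive over disjoint
    sets.\<close>
  define P where "P B \<longleftrightarrow> (\<forall>t\<in>?I. set_integrable (vol_measure \<A> (X t)) B (\<lambda>q. rho \<A> (X t) q ^ CARD('n))) \<and>
    set_integrable (vol_measure \<A> x) B (lam \<xi>) \<and>
    ((\<lambda>t. willmore_functional \<A> (X t) B) has_real_derivative (LINT q:B|vol_measure \<A> x. lam \<xi> q)) (at 0)" for B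
  have "P K"
  proof (rule compact_borel_induct[OF compact_K])
    fix q
    obtain c where c: "c \<in> \<A>" "q \<in> fst c" using chart_exists by blast
    interpret c: sphere_patch "chart_image c" "in_chart c x" by (rule patch[OF c(1)])
    interpret sphere_family "?I \<times> chart_image c" "\<lambda>(t, u). in_chart c (X t) u" by (rule family_X[OF c(1)])
    have sl: "sl t = in_chart c (X t)" for t by simp
    have u0: "snd c q \<in> chart_image c" by (rule snd_in_image[OF c])
    obtain a b where ab: "adapted_basis (in_chart c x) (snd c q) a b" using c.ab_ex[OF u0] by blast
    have "(0, snd c q) \<in> ?I \<times> chart_image c" "adapted_basis (sl 0) (snd c q) a b"
      using u0 eps ab by (simp_all add: X0)
    from dens_var_continuous[OF this]
    obtain \<Omega> A B where *: "open \<Omega> \<and> (0, snd c q) \<in> \<Omega> \<and> \<Omega> \<subseteq> ?I \<times> chart_image c \<and>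
        (\<forall>t u. (t, u) \<in> \<Omega> \<longrightarrow> adapted_basis (sl t) u (A (t, u)) (B (t, u))) \<and>
        continuous_on \<Omega> (\<lambda>z. dens_var (sl (fst z)) (vel (fst z)) (snd z) (A z) (B z))"
      by (elim exE) (rule that)
    note \<Omega> = *[THEN conjunct1] *[THEN conjunct2, THEN conjunct1] *[THEN conjunct2, THEN conjunct2, THEN conjunct1]
    have AB: "adapted_basis (sl t) u (A (t, u)) (B (t, u))" if "(t, u) \<in> \<Omega>" for t u
      using *[THEN conjunct2, THEN conjunct2, THEN conjunct2, THEN conjunct1, THEN spec, THEN spec, THEN mp] that .
    note cont = *[THEN conjunct2, THEN conjunct2, THEN conjunct2, THEN conjunct2]
    define D where "D t u = dens_var (sl t) (vel t) u (A (t, u)) (B (t, u))" for t u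
    obtain S T where ST': "open S" "open T" "(0, snd c q) \<in> S \<times> T" "S \<times> T \<subseteq> \<Omega>"
      by (rule open_prod_elim[OF \<Omega>(1,2)])
    note ST = ST'(1,2) ST'(3)[THEN SigmaD1] ST'(3)[THEN SigmaD2] ST'(4)
    obtain \<delta> where \<delta>: "\<delta> > 0" "ball 0 \<delta> \<subseteq> S" using openE[OF ST(1,3)] by blast
    obtain r where r: "r > 0" "cball (snd c q) r \<subseteq> T" using open_contains_cball_eq[OF ST(2)] ST(4) by blast
    have box: "{-\<delta><..<\<delta>} \<times> cball (snd c q) r \<subseteq> \<Omega>"
    proof -
      have "{-\<delta><..<\<delta>} \<subseteq> S" using \<delta>(2) by (auto simp: subset_iff dist_real_def)
      with r(2) ST(5) show ?thesis by (meson Sigma_mono order_trans)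
    qed
    have box2: "t \<in> ?I \<and> u \<in> chart_image c" if "t \<in> {-\<delta><..<\<delta>}" "u \<in> cball (snd c q) r" for t u
      using subsetD[OF order_trans[OF box \<Omega>(3)] SigmaI[OF that]] by (simp only: mem_Sigma_iff)
    have rc: "cball (snd c q) r \<subseteq> chart_image c" using box2[of 0] \<delta>(1) by auto
    have \<delta>I: "t \<in> ?I" if "t \<in> {-\<delta><..<\<delta>}" for t
      using box2[OF that, of "snd c q"] r(1) by (simp only: mem_cball dist_self less_imp_le)
    note G = chart_nbhd[OF c r(1) rc]
    show "\<exists>G. open G \<and> q \<in> G \<and> (\<forall>B\<in>sets borel. B \<subseteq> G \<longrightarrow> P B)"
    proof (intro exI[of _ "chart_inv c ` ball (snd c q) r"] conjI ballI impI G(1,2))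
      fix C :: "'m set" assume C: "C \<in> sets borel" "C \<subseteq> chart_inv c ` ball (snd c q) r"
      have Cb: "snd c ` C \<in> sets borel" by (rule borel_image[OF c(1) C(1) G(3)[OF C(2)]])
      have wt: "willmore_functional \<A> (X t) C = (LINT u:snd c ` C|lborel. dens (sl t) u)"
        and wi: "set_integrable (vol_measure \<A> (X t)) C (\<lambda>q. rho \<A> (X t) q ^ CARD('n))"
        and wc: "continuous_on (cball (snd c q) r) (dens (sl t))" if t: "t \<in> ?I" for t
      proof -
        interpret Xt: immersed_manifold \<A> "X t" by (rule immersed_X[OF t])
        show wc: "continuous_on (cball (snd c q) r) (dens (sl t))"
          using continuous_on_subset[OF Xt.continuous_dens[OF n2 c(1)] rc] by simp
        show "willmore_functional \<A> (X t) C = (LINT u:snd c ` C|lborel. dens (sl t) u)"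
          using Xt.willmore_transfer(1)[OF n2 c(1) C(1) G(3)[OF C(2)]] by simp
        show "set_integrable (vol_measure \<A> (X t)) C (\<lambda>q. rho \<A> (X t) q ^ CARD('n))"
          using Xt.willmore_transfer(2)[OF n2 c(1) C(1) G(3)[OF C(2)]]
            set_integrable_continuous_compact[OF compact_cball wc Cb G(4)[OF C(2)]] by simp
      qed
      have cD: "continuous_on ({-\<delta><..<\<delta>} \<times> cball (snd c q) r) (\<lambda>(t, u). D t u)"
        using continuous_on_subset[OF cont box] by (simp add: D_def case_prod_beta)
      have "((\<lambda>t. LINT u:snd c ` C|lborel. dens (sl t) u) has_real_derivative (LINT u:snd c ` C|lborel. D 0 u)) (at 0)"
      proof (rule DERIV_under_integral[OF compact_cball Cb G(4)[OF C(2)] \<delta>(1) wc[OF \<delta>I] _ cD])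
        fix t u assume tu: "t \<in> {-\<delta><..<\<delta>}" "u \<in> cball (snd c q) r"
        then have z: "(t, u) \<in> \<Omega>" using box by auto
        show "((\<lambda>t. dens (sl t) u) has_real_derivative D t u) (at t)"
          unfolding D_def by (rule dens_first_variation[OF _ AB[OF z] n2]) (use z \<Omega>(3) in auto)
      qed
      then have "((\<lambda>t. willmore_functional \<A> (X t) C) has_real_derivative (LINT u:snd c ` C|lborel. D 0 u)) (at 0)"
        by (rule has_field_derivative_transform_within_open[where S = ?I]) (use eps wt in auto)
      \<comment> \<open>At t = 0 the variation formula involves only the map x and the velocity
        field, so the given variation and the standard one with the same velocity have the same
        density derivative.\<close>
      moreover have lamD: "weight c u * in_chart c (lam \<xi>) u = D 0 u" if "u \<in> cball (snd c q) r" for u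
      proof -
        have z: "(0, u) \<in> \<Omega>" using that box \<delta>(1) by auto
        have u: "u \<in> chart_image c" using that rc by auto
        have "adapted_basis (in_chart c x) u (A (0, u)) (B (0, u))" using AB[OF z] by (simp add: X0)
        from lam_chart[OF n2 field_\<xi> c(1) u this]
        have "weight c u * in_chart c (lam \<xi>) u = dens_var (in_chart c x) (in_chart c \<xi>) u (A (0, u)) (B (0, u))" .
        also have "\<dots> = D 0 u"
          using dens_var_cong[OF open_image[OF c(1)] u velocity_X(1)[OF c(1)], where y = "in_chart c x" and a = "A (0, u)" and b = "B (0, u)"]
          by (simp add: D_def X0)
        finally show ?thesis .
      qed
      moreover note tr = vol_transfer[OF c(1) C(1) G(3)[OF C(2)] continuous_lam[OF n2 field_\<xi> c(1)]]
      have "(LINT u:snd c ` C|lborel. D 0 u) = (LINT q:C|vol_measure \<A> x. lam \<xi> q)"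
        unfolding tr(1) using Cb lamD G(4)[OF C(2)] by (intro set_lebesgue_integral_cong) auto
      moreover have "set_integrable (vol_measure \<A> x) C (lam \<xi>)"
        unfolding tr(2)
      proof (rule set_integrable_continuous_compact[OF compact_cball _ Cb G(4)[OF C(2)]])
        show "continuous_on (cball (snd c q) r) (\<lambda>u. weight c u * in_chart c (lam \<xi>) u)"
          by (rule continuous_on_subset[OF continuous_on_mult[OF Ck_on_continuous[OF c.Ck_on_sqrt_det_gram[of 0]]
              continuous_lam_chart[OF n2 field_\<xi> c(1)]] rc])
      qed
      ultimately show "P C" using wi by (simp add: P_def)
    qed
  next
    fix B C :: "'m set"
    assume BC: "B \<in> sets borel" "C \<in> sets borel" "B \<inter> C = {}" and PB: "P B" and PC: "P C"
    have m: "B \<in> sets (vol_measure \<A> (X t))" "C \<in> sets (vol_measure \<A> (X t))" if "t \<in> ?I" for t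
      using BC immersed_manifold.sets_vol[OF immersed_X[OF that]] by auto
    have m0: "B \<in> sets (vol_measure \<A> x)" "C \<in> sets (vol_measure \<A> x)" using BC by (auto simp: sets_vol)
    have "willmore_functional \<A> (X t) B + willmore_functional \<A> (X t) C = willmore_functional \<A> (X t) (B \<union> C)"
      if "t \<in> ?I" for t
      unfolding willmore_functional_def
      by (rule set_integral_Un[OF BC(3), symmetric]) (use PB PC that in \<open>auto simp: P_def\<close>)
    moreover have "((\<lambda>t. willmore_functional \<A> (X t) B + willmore_functional \<A> (X t) C) has_real_derivative
        (LINT q:B|vol_measure \<A> x. lam \<xi> q) + (LINT q:C|vol_measure \<A> x. lam \<xi> q)) (at 0)"
      using PB PC unfolding P_def by (intro DERIV_add) auto
    ultimately have "((\<lambda>t. willmore_functional \<A> (X t) (B \<union> C)) has_real_derivative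
        (LINT q:B|vol_measure \<A> x. lam \<xi> q) + (LINT q:C|vol_measure \<A> x. lam \<xi> q)) (at 0)"
      by (rule has_field_derivative_transform_within_open[rotated -1, where S = ?I]) (use eps in auto)
    then show "P (B \<union> C)"
      using PB PC m m0 set_integral_Un[OF BC(3), of "vol_measure \<A> x" "lam \<xi>"]
      unfolding P_def by (auto intro: set_integrable_Un)
  qed
  then show ?thesis by (simp add: P_def)
qed

end

section \<open>The Euler-Lagrange equation\<close>

text \<open>The set F of points with coordinates in S is compact, hence closed as the manifold is
  Hausdorff. The open set G of points with coordinates in V and the complement of F cover the
  manifold; on the first the function is g after a transition map, on the second it is 0.\<close>

lemma (in atlas_manifold) Ck_chart_extend:
  fixes g :: "real ^ 'n => 'b::real_normed_vector"
  assumes c: "c \<in> \<A>" and V: "open V" "V \<subseteq> chart_image c" and S: "compact S" "S \<subseteq> V"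
    and g: "Ck_on k V g" "\<And>u. u \<in> V ==> u \<notin> S ==> g u = 0" and d: "d \<in> \<A>"
  shows "Ck_on k (chart_image d) (in_chart d (\<lambda>q. if q \<in> fst c \<and> snd c q \<in> S then g (snd c q) else 0))"
proof (rule Ck_on_local)
  let ?f = "\<lambda>q. if q \<in> fst c \<and> snd c q \<in> S then g (snd c q) else 0"
  fix u assume u: "u \<in> chart_image d"
  define q where "q = chart_inv d u"
  have q: "q \<in> fst d" "snd d q = u" using chart_inv_in[OF d u] chart_inv_right[OF d u] by (auto simp: q_def)
  define G where "G = chart_inv c ` V"
  define F where "F = chart_inv c ` S"
  have G: "open G" "G = fst c \<inter> snd c -` V"
    unfolding G_def by (rule open_inv_image[OF c V]) (rule inv_image_eq[OF c V(2)])
  have SF: "F = fst c \<inter> snd c -` S" unfolding F_def using S(2) V(2) by (intro inv_image_eq[OF c]) auto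
  have "compact F"
    unfolding F_def using S V(2) by (intro compact_continuous_image continuous_on_subset[OF continuous_chart_inv[OF c]]) auto
  then have F: "closed F" by (rule compact_imp_closed)
  show "\<exists>T. open T \<and> u \<in> T \<and> Ck_on k T (in_chart d ?f)"
  proof (cases "q \<in> G")
    case True
    let ?T = "snd d ` (fst d \<inter> G)"
    have T: "open ?T" using open_dom[OF d] G(1) by (intro open_image_subset[OF d]) auto
    have sub: "?T \<subseteq> overlap d c" using G(2) by (auto simp: overlap_def)
    have tV: "trans d c ` ?T \<subseteq> V" using G(2) by (auto simp: trans_snd[OF d c])
    have "Ck_on k ?T (in_chart d ?f)"
    proof (rule Ck_on_cong[OF T Ck_on_compose[OF T V(1) tV g(1) Ck_on_subset[OF Ck_trans[OF d c] sub]]])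
      fix w assume "w \<in> ?T"
      then obtain q' where q': "q' \<in> fst d" "q' \<in> fst c" "snd c q' \<in> V" "w = snd d q'" using G(2) by auto
      show "g (trans d c w) = in_chart d ?f w"
        using q' g(2)[of "snd c q'"] by (simp add: trans_snd[OF d c] in_chart_snd[OF d])
    qed
    then show ?thesis using T True q by blast
  next
    case False
    let ?T = "snd d ` (fst d - F)"
    have T: "open ?T" using open_dom[OF d] F by (intro open_image_subset[OF d]) auto
    have "Ck_on k ?T (in_chart d ?f)"
    proof (rule Ck_on_cong[OF T Ck_on_const[of k ?T 0]])
      fix w assume "w \<in> ?T"
      then obtain q' where q': "q' \<in> fst d" "q' \<notin> F" "w = snd d q'" by blast
      then have "\<not> (q' \<in> fst c \<and> snd c q' \<in> S)" by (simp add: SF)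
      then show "0 = in_chart d ?f w" by (simp only: q'(3) in_chart_snd[OF d q'(1)] if_False)
    qed
    moreover have "q \<notin> F" using False S(2) by (auto simp: F_def G_def)
    ultimately show ?thesis using T q by blast
  qed
qed

lemma (in framed_patch) EL_cong:
  assumes eq: "\<And>w. w \<in> V ==> R w = R' w" and u: "u \<in> V"
  shows "EL R \<alpha> u = EL R' \<alpha> u"
proof -
  have d: "dirderiv R w v = dirderiv R' w v" if "w \<in> V" for w v
    by (rule dirderiv_cong_open[OF open_V that eq])
  have g: "grad e R i w = grad e R' i w" if "w \<in> V" for i w
    by (simp only: grad_def d[OF that])
  have h: "hess y e R i j u = hess y e R' i j u" for i j
    unfolding hess_def g[OF u] by (simp only: dirderiv_cong_open[OF open_V u g])
  show ?thesis unfolding EL_def h by (simp only: D_def d[OF u] eq[OF u])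
qed

context immersed_manifold
begin

lemma field_scale:
  fixes \<phi> :: "'m => real"
  assumes "\<And>d k. d \<in> \<A> ==> Ck_on k (chart_image d) (in_chart d \<phi>)" and \<xi>: "field \<xi>"
  shows "field (\<lambda>q. \<phi> q *\<^sub>R \<xi> q)"
proof -
  have "Ck_on k (chart_image d) (in_chart d (\<lambda>q. \<phi> q *\<^sub>R \<xi> q))" if "d \<in> \<A>" for d k
    using Ck_on_scaleR[OF open_image[OF that] assms(1)[OF that] fieldD(1)[OF \<xi> that]] by (simp add: in_chart_def)
  then show ?thesis using fieldD(2)[OF \<xi>] by (simp add: field_def smooth_on_def)
qed

abbreviation rho_power :: "('m, 'n) chart => real ^ 'n => real"
  where "rho_power c w \<equiv> rho_at (in_chart c x) w ^ (CARD('n) - 2)"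

abbreviation EL_at :: "('m, 'n) chart => (real ^ 'n => 'n => real ^ 'n) => (real ^ 'n => nat => 'e) => nat => real ^ 'n => real"
  where "EL_at c e \<nu> \<equiv> framed_patch.EL (in_chart c x) e \<nu> {CARD('n)+1..<DIM('e)} (rho_power c)"

lemma framed:
  assumes "c \<in> \<A>" "V \<subseteq> chart_image c" "adapted_frame (in_chart c x) V e \<nu>"
  shows "framed_patch (chart_image c) (in_chart c x) V e \<nu> {CARD('n)+1..<DIM('e)}"
  using assms by (intro framed_patch.intro patch framed_patch_axioms.intro) auto

context
  assumes n2: "CARD('n) \<ge> 2"
    and regular: "\<And>c. c \<in> \<A> ==> Ck_on (Suc (Suc 0)) (chart_image c) (rho_power c)"
begin

text \<open>Both K and the part of the manifold over S contain every point where
  \<open>lam \<zeta>\<close> is nonzero, so the domain of integration can be exchanged for one that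
  lies in the domain of a frame.\<close>

lemma local_weak_form:
  assumes c: "c \<in> \<A>" and V: "V \<subseteq> chart_image c" and frame: "adapted_frame (in_chart c x) V e \<nu>"
    and S: "compact S" "S \<subseteq> V" and \<zeta>: "field \<zeta>" "\<And>q. q \<notin> chart_inv c ` S ==> \<zeta> q = 0"
    and K: "\<And>q. q \<notin> K ==> lam \<zeta> q = 0"
  shows "(LINT q:K|vol_measure \<A> x. lam \<zeta> q) = (LINT u:S|lborel. real CARD('n) * weight c u *
    (\<Sum>\<alpha>\<in>{CARD('n)+1..<DIM('e)}. EL_at c e \<nu> \<alpha> u * (\<nu> u \<alpha> \<bullet> in_chart c \<zeta> u)))"
proof -
  interpret f: framed_patch "chart_image c" "in_chart c x" V e \<nu> "{CARD('n)+1..<DIM('e)}"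
    by (rule framed[OF c V frame])
  define F where "F = chart_inv c ` S"
  have SU: "S \<subseteq> chart_image c" using S(2) V by blast
  have "compact F"
    unfolding F_def by (intro compact_continuous_image continuous_on_subset[OF continuous_chart_inv[OF c] SU] S)
  then have F: "closed F" by (rule compact_imp_closed)
  then have Fb: "F \<in> sets borel" by simp
  have Fc: "F \<subseteq> fst c" using SU chart_inv_in[OF c] by (auto simp: F_def)
  have sF: "snd c ` F = S" using SU chart_inv_right[OF c] by (force simp: F_def image_iff)
  have lF: "lam \<zeta> q = 0" if "q \<notin> F" for q
    by (rule lam_eq_0[OF n2 \<zeta>(1), of "- F"]) (use F that \<zeta>(2) in \<open>auto simp: F_def\<close>)
  have "(LINT q:K|vol_measure \<A> x. lam \<zeta> q) = (LINT q:F|vol_measure \<A> x. lam \<zeta> q)"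
    unfolding set_lebesgue_integral_def
    by (rule Bochner_Integration.integral_cong[OF refl]) (auto simp: indicator_def K lF)
  also have "\<dots> = (LINT u:S|lborel. weight c u * in_chart c (lam \<zeta>) u)"
    using vol_transfer(1)[OF c Fb Fc continuous_lam[OF n2 \<zeta>(1) c]] by (simp only: sF)
  also have "\<dots> = (LINT u:S|lborel. dens_var (in_chart c x) (in_chart c \<zeta>) u (e u) (\<nu> u))"
  proof (rule set_lebesgue_integral_cong)
    show "S \<in> sets lborel" using S(1) by (simp add: compact_imp_closed)
    show "\<forall>u. u \<in> S \<longrightarrow> weight c u * in_chart c (lam \<zeta>) u = dens_var (in_chart c x) (in_chart c \<zeta>) u (e u) (\<nu> u)"
    proof (intro allI impI)
      fix u assume "u \<in> S"
      then have "u \<in> V" "u \<in> chart_image c" using S(2) V by auto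
      then show "weight c u * in_chart c (lam \<zeta>) u = dens_var (in_chart c x) (in_chart c \<zeta>) u (e u) (\<nu> u)"
        using frame by (intro lam_chart n2 \<zeta>(1) c) (auto simp: adapted_frame_def)
    qed
  qed
  also have "\<dots> = (LINT u:S|lborel. real CARD('n) * weight c u *
      (\<Sum>\<alpha>\<in>{CARD('n)+1..<DIM('e)}. EL_at c e \<nu> \<alpha> u * (f.nu \<alpha> u \<bullet> in_chart c \<zeta> u)))"
  proof (rule f.weak_form[OF n2 Ck_on_subset[OF regular[OF c] V] _ _ S])
    show "smooth_on V (in_chart c \<zeta>)"
      using Ck_on_subset[OF fieldD(1)[OF \<zeta>(1) c] V] by (simp add: smooth_on_def)
    show "in_chart c x u \<bullet> in_chart c \<zeta> u = 0" for u
      by (simp add: in_chart_def fieldD(2)[OF \<zeta>(1)])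
    show "in_chart c \<zeta> u = 0" if "u \<in> V - S" for u
    proof -
      have "chart_inv c u \<notin> chart_inv c ` S"
      proof
        assume "chart_inv c u \<in> chart_inv c ` S"
        then have "snd c (chart_inv c u) \<in> snd c ` F" by (simp add: F_def)
        then show False using that V chart_inv_right[OF c, of u] by (auto simp: sF)
      qed
      then show ?thesis by (simp add: in_chart_def \<zeta>(2))
    qed
  qed
  finally show ?thesis by (simp only: f.nu_def)
qed

lemma integral_lam_eq_0:
  assumes EL: "\<And>c V e \<nu> \<alpha> u. c \<in> \<A> ==> V \<subseteq> chart_image c ==> adapted_frame (in_chart c x) V e \<nu> ==>
      \<alpha> \<in> {CARD('n)+1..<DIM('e)} ==> u \<in> V ==> EL_at c e \<nu> \<alpha> u = 0"
    and \<xi>: "field \<xi>" "\<And>q. q \<notin> K ==> \<xi> q = 0" and K: "compact K"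
  shows "(LINT q:K|vol_measure \<A> x. lam \<xi> q) = 0"
proof -
  have oK: "open (- K)" using K by (simp add: compact_imp_closed open_Compl)
  \<comment> \<open>\<phi> is a cutoff that is 1 near q and whose support lies in the domain of one
    frame, so that any field supported in K has vanishing integral after multiplication with \<phi>.
    Quantifying over all such fields lets the same cutoffs act on the remainders in the
    induction.\<close>
  define Q where "Q q G \<phi> \<longleftrightarrow> open G \<and> q \<in> G \<and>
      (\<forall>d\<in>\<A>. \<forall>k. Ck_on k (chart_image d) (in_chart d \<phi>)) \<and> (\<forall>q'\<in>G. \<phi> q' = (1::real)) \<and>
      (\<forall>\<eta>. field \<eta> \<longrightarrow> (\<forall>q. q \<notin> K \<longrightarrow> \<eta> q = 0) \<longrightarrow>
        (LINT q:K|vol_measure \<A> x. lam (\<lambda>q. \<phi> q *\<^sub>R \<eta> q) q) = 0)" for q G \<phi>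
  have "\<exists>G \<phi>. Q q G \<phi>" for q
  proof -
    obtain c where c: "c \<in> \<A>" "q \<in> fst c" using chart_exists by blast
    interpret c: sphere_patch "chart_image c" "in_chart c x" by (rule patch[OF c(1)])
    obtain V e \<nu> where V: "snd c q \<in> V" "V \<subseteq> chart_image c" and frame: "adapted_frame (in_chart c x) V e \<nu>"
      using c.local_frame_ex[OF snd_in_image[OF c]] by blast
    have oV: "open V" using frame by (simp add: adapted_frame_def)
    obtain r' where r': "r' > 0" "cball (snd c q) r' \<subseteq> V" using open_contains_cball_eq[OF oV] V(1) by blast
    define r where "r = r' / 2"
    define S where "S = cball (snd c q) (2 * r)"
    have r: "r > 0" and SV: "S \<subseteq> V" and S: "compact S" using r' by (auto simp: r_def S_def)
    define \<phi> where "\<phi> q' = (if q' \<in> fst c \<and> snd c q' \<in> S then bump (snd c q) r (snd c q') else 0)" for q'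
    have sm: "Ck_on k (chart_image d) (in_chart d \<phi>)" if "d \<in> \<A>" for d k
      unfolding \<phi>_def[abs_def]
    proof (rule Ck_chart_extend[OF c(1) oV V(2) S SV _ _ that])
      show "Ck_on k V (bump (snd c q) r)" by (rule Ck_on_subset[OF Ck_on_bump]) simp
      show "bump (snd c q) r u = 0" if "u \<notin> S" for u
        using that by (intro bump_eq_0 r) (simp add: S_def dist_commute)
    qed
    have rc: "cball (snd c q) r \<subseteq> chart_image c" using SV V(2) r by (auto simp: S_def subset_iff)
    note G = chart_nbhd[OF c r rc]
    have one: "\<phi> q' = 1" if "q' \<in> chart_inv c ` ball (snd c q) r" for q'
    proof -
      have "q' \<in> fst c" "snd c q' \<in> cball (snd c q) r" using G(3,4)[of "{q'}"] that by auto
      then show ?thesis using r by (simp add: \<phi>_def S_def bump_eq_1 dist_commute)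
    qed
    have zero: "(LINT q:K|vol_measure \<A> x. lam (\<lambda>q. \<phi> q *\<^sub>R \<eta> q) q) = 0"
      if \<eta>: "field \<eta>" "\<And>q. q \<notin> K ==> \<eta> q = 0" for \<eta>
    proof -
      have fz: "field (\<lambda>q. \<phi> q *\<^sub>R \<eta> q)" by (rule field_scale[OF sm \<eta>(1)])
      have lz: "lam (\<lambda>q. \<phi> q *\<^sub>R \<eta> q) q = 0" if "q \<notin> K" for q
        by (rule lam_eq_0[OF n2 fz oK]) (use that \<eta>(2) in auto)
      have "\<phi> q' *\<^sub>R \<eta> q' = 0" if "q' \<notin> chart_inv c ` S" for q'
        using that chart_inv_left[OF c(1), of q'] by (force simp: \<phi>_def image_iff)
      from local_weak_form[OF c(1) V(2) frame S SV fz this lz]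
      have "(LINT q:K|vol_measure \<A> x. lam (\<lambda>q. \<phi> q *\<^sub>R \<eta> q) q) = (LINT u:S|lborel. real CARD('n) * weight c u *
        (\<Sum>\<alpha>\<in>{CARD('n)+1..<DIM('e)}. EL_at c e \<nu> \<alpha> u * (\<nu> u \<alpha> \<bullet> in_chart c (\<lambda>q. \<phi> q *\<^sub>R \<eta> q) u)))" by blast
      also have "\<dots> = (LINT u:S|lborel. 0)"
        using S SV EL[OF c(1) V(2) frame] by (intro set_lebesgue_integral_cong) (auto simp: compact_imp_closed)
      finally show ?thesis by simp
    qed
    have "Q q (chart_inv c ` ball (snd c q) r) \<phi>"
      unfolding Q_def
    proof (intro conjI ballI allI impI)
      show "(LINT q:K|vol_measure \<A> x. lam (\<lambda>q. \<phi> q *\<^sub>R \<eta> q) q) = 0"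
        if "field \<eta>" "\<forall>q. q \<notin> K \<longrightarrow> \<eta> q = 0" for \<eta>
        using that(2) by (intro zero[OF that(1)]) (rule that(2)[rule_format])
    qed (fact G(1) G(2) sm one)+
    then show ?thesis by blast
  qed
  then obtain G \<phi> where Q: "\<And>p. Q p (G p) (\<phi> p)" by metis
  have G: "open (G p)" "p \<in> G p" for p
    by (rule Q[of p, unfolded Q_def, THEN conjunct1])
      (rule Q[of p, unfolded Q_def, THEN conjunct2, THEN conjunct1])
  have sm: "Ck_on k (chart_image d) (in_chart d (\<phi> p))" if "d \<in> \<A>" for p d k
    using Q[of p] that unfolding Q_def by (elim conjE) (drule (1) bspec, erule spec)
  have one: "\<phi> p q = (1::real)" if "q \<in> G p" for p q
    using Q[of p] that unfolding Q_def by (elim conjE) (erule (1) bspec)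
  have zero: "(LINT q:K|vol_measure \<A> x. lam (\<lambda>q. \<phi> p q *\<^sub>R \<eta> q) q) = 0"
    if "field \<eta>" "\<And>q. q \<notin> K ==> \<eta> q = 0" for p \<eta>
    using Q[of p, unfolded Q_def, THEN conjunct2, THEN conjunct2, THEN conjunct2, THEN conjunct2, rule_format] that
    by metis
  have "K \<subseteq> (\<Union>p\<in>K. G p)" using G(2) by blast
  then obtain P where P: "finite P" "K \<subseteq> (\<Union>p\<in>P. G p)"
    using compactE_image[OF K, of K G] G(1) by metis
  have "(LINT q:K|vol_measure \<A> x. lam \<eta> q) = 0"
    if "field \<eta>" "\<And>q. q \<notin> K ==> \<eta> q = 0" "\<And>q. q \<notin> (\<Union>p\<in>P. G p) ==> \<eta> q = 0" for \<eta>
    using P(1) that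
  proof (induction P arbitrary: \<eta>)
    case empty
    have "lam \<eta> q = 0" for q by (rule lam_eq_0[OF n2 empty(1) open_UNIV]) (use empty(3) in auto)
    then show ?case by simp
  next
    case (insert p P)
    \<comment> \<open>The remainder vanishes on \<open>G p\<close>, where the cutoff is 1, so it is
      covered by the remaining sets; both pieces still vanish outside K.\<close>
    let ?\<eta>1 = "\<lambda>q. \<phi> p q *\<^sub>R \<eta> q" and ?\<eta>2 = "\<lambda>q. (1 - \<phi> p q) *\<^sub>R \<eta> q"
    have f1: "field ?\<eta>1" by (rule field_scale[OF sm insert.prems(1)])
    have "Ck_on k (chart_image d) (in_chart d (\<lambda>q. 1 - \<phi> p q))" if "d \<in> \<A>" for d k
      using Ck_on_diff[OF open_image[OF that] Ck_on_const[of k _ 1] sm[OF that]] by (simp add: in_chart_def)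
    from field_scale[OF this insert.prems(1)] have f2: "field ?\<eta>2" .
    have "\<eta> = (\<lambda>q. ?\<eta>1 q + ?\<eta>2 q)" by (simp add: scaleR_add_left[symmetric])
    then have "lam \<eta> q = lam ?\<eta>1 q + lam ?\<eta>2 q" for q
      using lam_add[OF n2 f1 f2, of q] by metis
    then have "(LINT q:K|vol_measure \<A> x. lam \<eta> q) =
        (LINT q:K|vol_measure \<A> x. lam ?\<eta>1 q + lam ?\<eta>2 q)" by (simp only:)
    also have "\<dots> = (LINT q:K|vol_measure \<A> x. lam ?\<eta>1 q) + (LINT q:K|vol_measure \<A> x. lam ?\<eta>2 q)"
      by (intro set_integral_add(2) set_integrable_continuous K continuous_lam n2 f1 f2)
    also have "(LINT q:K|vol_measure \<A> x. lam ?\<eta>1 q) = 0" by (rule zero[OF insert.prems(1,2)])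
    also have "(LINT q:K|vol_measure \<A> x. lam ?\<eta>2 q) = 0"
    proof (rule insert.IH[OF f2])
      show "?\<eta>2 q = 0" if "q \<notin> K" for q using insert.prems(2)[OF that] by simp
      show "?\<eta>2 q = 0" if "q \<notin> (\<Union>p\<in>P. G p)" for q
        using insert.prems(3)[of q] one[of q p] that by (cases "q \<in> G p") auto
    qed
    finally show ?case by simp
  qed
  from this[OF \<xi>] show ?thesis using P(2) \<xi>(2) by blast
qed

end

end

lemma (in sphere_patch) rho_at_pos:
  assumes u: "u \<in> U" and ab: "adapted_basis y u a b"
    and non_umbilic: "\<not> (\<forall>\<alpha>\<in>{CARD('n)+1..<DIM('e)}. \<forall>i j.
      sff y u a b \<alpha> i j = (if i = j then mean_curv y u a b \<alpha> else 0))"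
  shows "rho_at y u > 0"
proof -
  obtain \<alpha> i j where *: "\<alpha> \<in> {CARD('n)+1..<DIM('e)}" "tsff y u a b \<alpha> i j \<noteq> 0"
    using non_umbilic by (force simp: tsff_def)
  have "rho_sq y u a b \<noteq> 0"
  proof
    assume "rho_sq y u a b = 0"
    then have "(\<Sum>i\<in>UNIV. \<Sum>j\<in>UNIV. (tsff y u a b \<alpha> i j)\<^sup>2) = 0"
      using *(1) by (simp add: rho_sq_def sum_nonneg_eq_0_iff sum_nonneg)
    then show False using *(2) by (simp add: sum_nonneg_eq_0_iff sum_nonneg)
  qed
  then show ?thesis
    unfolding rho_at_y(1)[OF u ab] using rho_sq_nonneg[of y u a b] by simp
qed

lemma (in sphere_family) continuous_det_gram: "continuous_on \<Omega> (\<lambda>z. det (gram (sl (fst z)) (snd z)))"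
proof (rule Ck_on_continuous[of 0], rule Ck_on_det[OF open_dom])
  fix i j
  have c: "continuous_on \<Omega> (\<lambda>z. dirderiv Y z (0, v))" for v
    using CkY[of "Suc 0"] by simp
  have eq: "gram (sl (fst z)) (snd z) $ i $ j = dirderiv Y z (0, axis i 1) \<bullet> dirderiv Y z (0, axis j 1)"
    if "z \<in> \<Omega>" for z
    using sl_dirderiv[of "fst z" "snd z"] that by (simp add: gram_def)
  have "continuous_on \<Omega> (\<lambda>z. dirderiv Y z (0, axis i 1) \<bullet> dirderiv Y z (0, axis j 1))"
    by (intro continuous_on_inner c)
  then show "Ck_on 0 \<Omega> (\<lambda>z. gram (sl (fst z)) (snd z) $ i $ j)"
    using eq by (simp cong: continuous_on_cong)
qed

text \<open>A nonnegative function with zero integral vanishes almost everywhere, but balls have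
  positive measure.\<close>

lemma integral_pos_ball:
  fixes h :: "'a::euclidean_space => real"
  assumes S: "compact S" and h: "continuous_on S h" "\<And>u. u \<in> S ==> h u \<ge> 0"
    and r: "r > 0" "ball a r \<subseteq> S" "\<And>u. u \<in> ball a r ==> h u > 0"
  shows "(LINT u:S|lborel. h u) \<noteq> 0"
proof
  assume 0: "(LINT u:S|lborel. h u) = 0"
  have "S \<in> sets borel" using S by (simp add: compact_imp_closed)
  from set_integrable_continuous_compact[OF S h(1) this subset_refl]
  have "integrable lborel (\<lambda>u. indicator S u *\<^sub>R h u)" by (simp add: set_integrable_def)
  moreover have "AE u in lborel. 0 \<le> indicator S u *\<^sub>R h u"
    using h(2) by (intro AE_I2) (auto simp: indicator_def)
  ultimately have "AE u in lborel. indicator S u *\<^sub>R h u = 0"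
    using 0 integral_nonneg_eq_0_iff_AE unfolding set_lebesgue_integral_def by blast
  then have "AE u in lborel. u \<notin> ball a r"
  proof eventually_elim
    case (elim u)
    show ?case
    proof
      assume "u \<in> ball a r"
      then have "u \<in> S" "h u > 0" using r by auto
      then show False using elim by simp
    qed
  qed
  then have "ball a r \<in> null_sets lborel" by (simp add: AE_iff_null_sets)
  then have "measure lborel (ball a r) = 0" by (rule measure_eq_0_null_sets)
  then show False using content_ball_pos[OF r(1), of a] by simp
qed

section \<open>From criticality to the pointwise equation\<close>

context immersed_manifold
begin

text \<open>Injectivity of the differential is an open condition on the Gram determinant; it is
  needed only over the compact set S, where it holds at t = 0, so a common time span exists. Outside
  the moving set the maps agree with x.\<close>

lemma push_immersion:
  assumes \<eta>: "field \<eta>" and c: "c \<in> \<A>" and S: "compact S" "S \<noteq> {}" "S \<subseteq> chart_image c"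
    and out: "\<And>q. q \<notin> chart_inv c ` S ==> \<eta> q = 0"
  shows "\<exists>\<epsilon>. smooth_variation \<A> x \<epsilon> (chart_inv c ` S) (push \<eta>)"
proof -
  interpret x: sphere_patch "chart_image c" "in_chart c x" by (rule patch[OF c])
  interpret sphere_family "UNIV \<times> chart_image c" "push_chart c \<eta>" by (rule push_family[OF \<eta> c])
  define F where "F = chart_inv c ` S"
  have cF: "compact F"
    unfolding F_def by (intro compact_continuous_image continuous_on_subset[OF continuous_chart_inv[OF c] S(3)] S)
  then have F: "closed F" by (rule compact_imp_closed)
  have pF: "push \<eta> t q = x q" if "q \<notin> F" for t q
    using out[of q] that unit_x[of q] by (simp add: F_def push_def norm_eq_sqrt_inner)
  define W where "W = (UNIV \<times> chart_image c) \<inter> (\<lambda>z. det (gram (sl (fst z)) (snd z))) -` {0<..}"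
  have W: "open W"
    unfolding W_def by (rule continuous_open_preimage[OF continuous_det_gram open_dom open_greaterThan])
  have "{0} \<times> S \<subseteq> W"
    using S(3) x.det_gram_y by (auto simp: W_def push_chart_slice push_0)
  moreover have "{0::real} \<times> S \<noteq> {}" "compact ({0::real} \<times> S)" using S by (auto intro: compact_Times)
  \<comment> \<open>Compactness of {0} x S gives one \<epsilon> for all its points; (t, v) with v in
    S has distance at most |t| from this set.\<close>
  ultimately obtain \<epsilon> where \<epsilon>: "\<epsilon> > 0" "{z. infdist z ({0} \<times> S) \<le> \<epsilon>} \<subseteq> W"
    using compact_in_open_separated[OF _ _ W] by metis
  have inj_c: "inj (dirderiv (in_chart c (push \<eta> t)) v)" if "t \<in> {-\<epsilon><..<\<epsilon>}" "v \<in> S" for t v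
  proof -
    have "infdist (t, v) ({0} \<times> S) \<le> dist (t, v) (0, v)" by (rule infdist_le) (use that in auto)
    also have "\<dots> \<le> \<epsilon>" using that by (auto simp: dist_Pair_Pair)
    finally have "(t, v) \<in> W" using \<epsilon>(2) by auto
    then have "(t, v) \<in> UNIV \<times> chart_image c" "det (gram (sl t) v) \<noteq> 0" by (auto simp: W_def)
    then have "inj (dirderiv (sl t) v)" by (intro det_gram_pos_imp_inj lin_sl)
    then show ?thesis by (simp add: push_chart_slice)
  qed
  \<comment> \<open>In any other chart a point of F inherits injectivity through the transition map,
    and a point off the closed set F has a neighbourhood on which nothing moves.\<close>
  have inj_d: "inj (dirderiv (in_chart d (push \<eta> t)) u)"
    if t: "t \<in> {-\<epsilon><..<\<epsilon>}" and d: "d \<in> \<A>" and u: "u \<in> chart_image d" for t d u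
  proof (cases "chart_inv d u \<in> F")
    case True
    then obtain v where v: "v \<in> S" "chart_inv d u = chart_inv c v" by (auto simp: F_def)
    have q: "chart_inv d u \<in> fst d" "chart_inv d u \<in> fst c" "snd d (chart_inv d u) = u" "snd c (chart_inv d u) = v"
      using chart_inv_in[OF d u] chart_inv_right[OF d u] chart_inv_in[OF c, of v] chart_inv_right[OF c, of v] v S(3)
      by auto
    have o: "u \<in> overlap d c" unfolding overlap_def using q by (intro image_eqI[of u _ "chart_inv d u"]) auto
    have tv: "trans d c u = v" using trans_snd[OF d c q(1)] q by simp
    have diff: "in_chart c (push \<eta> t) differentiable (at (trans d c u))"
      using Ck_push[OF \<eta> c, of "Suc 0" t] v S(3) by (auto simp: tv)
    have "dirderiv (in_chart d (push \<eta> t)) u = dirderiv (in_chart c (push \<eta> t)) v \<circ> dirderiv (trans d c) u"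
      using dirderiv_in_chart_trans[OF d c o diff] by (simp add: tv fun_eq_iff)
    then show ?thesis using inj_compose[OF inj_c[OF t v(1)] inj_dirderiv_trans[OF d c o]] by (simp only:)
  next
    case False
    interpret d: sphere_patch "chart_image d" "in_chart d x" by (rule patch[OF d])
    have T: "open (snd d ` (fst d - F))" using atlas_manifold.open_dom[OF atlas_manifold_axioms d] F by (intro open_image_subset[OF d]) auto
    have um: "u \<in> snd d ` (fst d - F)"
      using False chart_inv_in[OF d u] chart_inv_right[OF d u] by (intro image_eqI[of u _ "chart_inv d u"]) auto
    have "dirderiv (in_chart d (push \<eta> t)) u v = dirderiv (in_chart d x) u v" for v
      by (rule dirderiv_cong_open[OF T um]) (auto simp: in_chart_snd[OF d] pF)
    then have "dirderiv (in_chart d (push \<eta> t)) u = dirderiv (in_chart d x) u" by (rule ext)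
    then show ?thesis using d.inj_y[OF u] by simp
  qed
  have "sphere_immersion \<A> (push \<eta> t)" if t: "t \<in> {-\<epsilon><..<\<epsilon>}" for t
    unfolding sphere_immersion_def smooth_on_def
    using Ck_push[OF \<eta>] inj_d[OF t] push_unit[OF \<eta>] by (auto simp: norm_eq_sqrt_inner)
  moreover have "smooth_on ({-\<epsilon><..<\<epsilon>} \<times> chart_image d) (\<lambda>(t, u). in_chart d (push \<eta> t) u)" if "d \<in> \<A>" for d
  proof -
    interpret d: sphere_family "UNIV \<times> chart_image d" "push_chart d \<eta>" by (rule push_family[OF \<eta> that])
    have eq: "(\<lambda>(t, u). in_chart d (push \<eta> t) u) = push_chart d \<eta>" by (simp add: push_chart_def fun_eq_iff)
    show ?thesis
      unfolding eq smooth_on_def by (intro allI Ck_on_subset[OF d.CkY]) auto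
  qed
  ultimately show ?thesis
    using \<epsilon>(1) cF pF by (intro exI[of _ \<epsilon>]) (simp add: smooth_variation_def push_0 F_def)
qed

lemma EL_eq_0_of_critical:
  assumes n2: "CARD('n) \<ge> 2"
    and regular: "\<And>c. c \<in> \<A> ==> Ck_on (Suc (Suc 0)) (chart_image c) (rho_power c)"
    and critical: "willmore_submanifold \<A> x"
    and c: "c \<in> \<A>" and V: "V \<subseteq> chart_image c" and frame: "adapted_frame (in_chart c x) V e \<nu>"
    and \<alpha>: "\<alpha> \<in> {CARD('n)+1..<DIM('e)}" and u0: "u0 \<in> V"
  shows "EL_at c e \<nu> \<alpha> u0 = 0"
proof (rule ccontr)
  assume nz: "EL_at c e \<nu> \<alpha> u0 \<noteq> 0"
  interpret f: framed_patch "chart_image c" "in_chart c x" V e \<nu> "{CARD('n)+1..<DIM('e)}"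
    by (rule framed[OF c V frame])
  \<comment> \<open>Multiplying by the sign makes the expression positive at u0, and hence on a
    neighbourhood by continuity; S is chosen inside it, so that the integrand below is nonnegative
    on S and positive on the smaller ball.\<close>
  define s where "s = sgn (EL_at c e \<nu> \<alpha> u0)"
  define g where "g u = s * EL_at c e \<nu> \<alpha> u" for u
  have oV: "open V" by (rule f.open_V)
  have cg: "continuous_on V g"
    unfolding g_def by (intro continuous_on_mult continuous_on_const
        f.Ck_EL[OF Ck_on_subset[OF regular[OF c] V] \<alpha>])
  have g0: "g u0 > 0" using nz by (simp add: g_def s_def sgn_mult_abs[symmetric] abs_sgn[symmetric] mult.commute)
  define T where "T = V \<inter> g -` {0<..}"
  have T: "open T" "u0 \<in> T" "T \<subseteq> V"
    using continuous_open_preimage[OF cg oV open_greaterThan] u0 g0 by (auto simp: T_def)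
  obtain r' where r': "r' > 0" "cball u0 r' \<subseteq> T" using open_contains_cball_eq[OF T(1)] T(2) by blast
  define r where "r = r' / 2"
  define S where "S = cball u0 (2 * r)"
  have r: "r > 0" and ST: "S \<subseteq> T" and S: "compact S" "u0 \<in> S" using r' by (auto simp: r_def S_def)
  have SV: "S \<subseteq> V" "S \<subseteq> chart_image c" using ST T(3) V by auto
  define \<eta> where "\<eta> q = (if q \<in> fst c \<and> snd c q \<in> S then bump u0 r (snd c q) *\<^sub>R \<nu> (snd c q) \<alpha> else 0)" for q
  have "Ck_on k (chart_image d) (in_chart d \<eta>)" if "d \<in> \<A>" for d k
    unfolding \<eta>_def[abs_def]
  proof (rule Ck_chart_extend[OF c oV V S(1) SV(1) _ _ that])
    show "Ck_on k V (\<lambda>u. bump u0 r u *\<^sub>R \<nu> u \<alpha>)"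
      using frame \<alpha> by (intro Ck_on_scaleR oV Ck_on_subset[OF Ck_on_bump]) (auto simp: adapted_frame_def smooth_on_def)
    show "bump u0 r u *\<^sub>R \<nu> u \<alpha> = 0" if "u \<notin> S" for u
      using that r by (simp add: S_def bump_eq_0 dist_commute)
  qed
  moreover have "x q \<bullet> \<eta> q = 0" for q
  proof (cases "q \<in> fst c \<and> snd c q \<in> S")
    case True
    then have "adapted_basis (in_chart c x) (snd c q) (e (snd c q)) (\<nu> (snd c q))"
      using frame SV(1) by (auto simp: adapted_frame_def)
    then have "\<nu> (snd c q) \<alpha> \<bullet> in_chart c x (snd c q) = 0" using \<alpha> by (auto simp: adapted_basis_def)
    then show ?thesis using True by (simp add: \<eta>_def in_chart_snd[OF c] inner_commute)
  qed (auto simp: \<eta>_def)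
  ultimately have \<eta>: "field \<eta>" by (simp add: field_def smooth_on_def)
  define F where "F = chart_inv c ` S"
  have out: "\<eta> q = 0" if "q \<notin> F" for q
    using that chart_inv_left[OF c, of q] by (force simp: \<eta>_def F_def image_iff)
  obtain \<epsilon> where var: "smooth_variation \<A> x \<epsilon> F (push \<eta>)"
    using push_immersion[OF \<eta> c S(1) _ SV(2)] out S(2) unfolding F_def by blast
  interpret X: smooth_deformation \<A> x \<epsilon> F "push \<eta>" by unfold_locales (rule var)
  have "X.\<xi> = \<eta>" by (rule ext) (simp add: X.\<xi>_def vector_derivative_at[OF push_derivative[OF \<eta>]])
  then have "((\<lambda>t. willmore_functional \<A> (push \<eta> t) F) has_real_derivative (LINT q:F|vol_measure \<A> x. lam \<eta> q)) (at 0)"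
    using X.willmore_first_variation[OF n2] by simp
  moreover have "((\<lambda>t. willmore_functional \<A> (push \<eta> t) F) has_real_derivative 0) (at 0)"
    using critical var by (simp add: willmore_submanifold_def)
  ultimately have "(LINT q:F|vol_measure \<A> x. lam \<eta> q) = 0" by (rule DERIV_unique)
  moreover have "lam \<eta> q = 0" if "q \<notin> F" for q
    by (rule lam_eq_0[OF n2 \<eta>, of "- F"]) (use that out X.compact_K in \<open>auto simp: compact_imp_closed open_Compl\<close>)
  moreover note local_weak_form[OF n2 regular c V frame S(1) SV(1) \<eta> out[unfolded F_def] this]
  ultimately have "(LINT u:S|lborel. real CARD('n) * weight c u *
    (\<Sum>\<beta>\<in>{CARD('n)+1..<DIM('e)}. EL_at c e \<nu> \<beta> u * (\<nu> u \<beta> \<bullet> in_chart c \<eta> u))) = 0" by simp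
  also have "(LINT u:S|lborel. real CARD('n) * weight c u *
    (\<Sum>\<beta>\<in>{CARD('n)+1..<DIM('e)}. EL_at c e \<nu> \<beta> u * (\<nu> u \<beta> \<bullet> in_chart c \<eta> u))) =
    (LINT u:S|lborel. real CARD('n) * weight c u * (EL_at c e \<nu> \<alpha> u * bump u0 r u))"
  proof (rule set_lebesgue_integral_cong)
    show "S \<in> sets lborel" using S(1) by (simp add: compact_imp_closed)
    show "\<forall>u. u \<in> S \<longrightarrow> real CARD('n) * weight c u *
        (\<Sum>\<beta>\<in>{CARD('n)+1..<DIM('e)}. EL_at c e \<nu> \<beta> u * (\<nu> u \<beta> \<bullet> in_chart c \<eta> u)) =
        real CARD('n) * weight c u * (EL_at c e \<nu> \<alpha> u * bump u0 r u)"
    proof (intro allI impI)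
      fix u assume u: "u \<in> S"
      then have uc: "u \<in> chart_image c" and ab: "adapted_basis (in_chart c x) u (e u) (\<nu> u)"
        using frame SV by (auto simp: adapted_frame_def)
      have \<eta>u: "in_chart c \<eta> u = bump u0 r u *\<^sub>R \<nu> u \<alpha>"
        using u chart_inv_in[OF c uc] chart_inv_right[OF c uc] by (simp add: in_chart_def \<eta>_def)
      have orth: "\<nu> u \<beta> \<bullet> \<nu> u \<alpha> = (if \<beta> = \<alpha> then 1 else 0)" if "\<beta> \<in> {CARD('n)+1..<DIM('e)}" for \<beta>
        using ab that \<alpha> unfolding adapted_basis_def by blast
      have "(\<Sum>\<beta>\<in>{CARD('n)+1..<DIM('e)}. EL_at c e \<nu> \<beta> u * (\<nu> u \<beta> \<bullet> in_chart c \<eta> u))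
          = (\<Sum>\<beta>\<in>{CARD('n)+1..<DIM('e)}. if \<beta> = \<alpha> then EL_at c e \<nu> \<alpha> u * bump u0 r u else 0)"
        by (rule sum.cong[OF refl]) (simp only: \<eta>u inner_scaleR_right orth, simp)
      also have "\<dots> = EL_at c e \<nu> \<alpha> u * bump u0 r u" using \<alpha> by simp
      finally show "real CARD('n) * weight c u *
        (\<Sum>\<beta>\<in>{CARD('n)+1..<DIM('e)}. EL_at c e \<nu> \<beta> u * (\<nu> u \<beta> \<bullet> in_chart c \<eta> u)) =
        real CARD('n) * weight c u * (EL_at c e \<nu> \<alpha> u * bump u0 r u)" by simp
    qed
  qed
  finally have "(LINT u:S|lborel. s * (real CARD('n) * weight c u * (EL_at c e \<nu> \<alpha> u * bump u0 r u))) = 0"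
    by simp
  then have "(LINT u:S|lborel. real CARD('n) * weight c u * (g u * bump u0 r u)) = 0"
    by (simp add: g_def mult_ac)
  moreover have "(LINT u:S|lborel. real CARD('n) * weight c u * (g u * bump u0 r u)) \<noteq> 0"
  proof (rule integral_pos_ball[OF S(1) _ _ r])
    have cb: "continuous_on S (bump u0 r)"
      using Ck_on_continuous[OF Ck_on_bump[of 0 u0 r]] by (rule continuous_on_subset) simp
    show "continuous_on S (\<lambda>u. real CARD('n) * weight c u * (g u * bump u0 r u))"
      by (intro continuous_on_mult continuous_on_const cb continuous_on_subset[OF cg SV(1)]
          continuous_on_subset[OF Ck_on_continuous[OF f.Ck_on_sqrt_det_gram[of 0]] SV(2)])
    have pos: "g u > 0" "weight c u > 0" if "u \<in> S" for u
      using that ST SV(2) f.det_gram_y by (auto simp: T_def)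
    show "0 \<le> real CARD('n) * weight c u * (g u * bump u0 r u)" if "u \<in> S" for u
      using pos[OF that] bump_nonneg[of u0 r u] by simp
    show b: "ball u0 r \<subseteq> S" using r by (auto simp: S_def)
    show "0 < real CARD('n) * weight c u * (g u * bump u0 r u)" if "u \<in> ball u0 r" for u
      using pos[of u] b that r by (auto simp: bump_eq_1 dist_commute less_imp_le)
  qed
  ultimately show False by blast
qed

lemma rho_power_regular:
  assumes c: "c \<in> \<A>" and umb: "CARD('n) = 3 \<or> CARD('n) = 5 ==> \<forall>q. \<not> umbilical \<A> x q"
  shows "Ck_on (Suc (Suc 0)) (chart_image c) (rho_power c)"
proof -
  interpret c: sphere_patch "chart_image c" "in_chart c x" by (rule patch[OF c])
  have pos: "\<forall>u\<in>chart_image c. rho_at (in_chart c x) u > 0" if "\<forall>q. \<not> umbilical \<A> x q"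
  proof
    fix u assume u: "u \<in> chart_image c"
    obtain a b where ab: "adapted_basis (in_chart c x) u a b" using c.ab_ex[OF u] by blast
    show "rho_at (in_chart c x) u > 0"
    proof (rule c.rho_at_pos[OF u ab], rule notI)
      assume umb: "\<forall>\<alpha>\<in>{CARD('n)+1..<DIM('e)}. \<forall>i j. sff (in_chart c x) u a b \<alpha> i j =
        (if i = j then mean_curv (in_chart c x) u a b \<alpha> else 0)"
      have "umbilical \<A> x (chart_inv c u)"
        unfolding umbilical_def
      proof (intro bexI[OF _ c] conjI exI[of _ a] exI[of _ b])
        show "chart_inv c u \<in> fst c" by (rule chart_inv_in[OF c u])
      qed (use ab umb chart_inv_right[OF c u] in \<open>simp_all only:\<close>)
      then show False using that by blast
    qed
  qed
  \<comment> \<open>An odd exponent m - 2 of at most 4 is 1 or 3. For m below 2 truncated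
    subtraction gives 0, which is even.\<close>
  have "even (m - 2) \<or> m - 2 > 2 * Suc (Suc 0) \<or> m = 3 \<or> m = 5" for m :: nat by presburger
  from this[of "CARD('n)"]
  have "even (CARD('n) - 2) \<or> CARD('n) - 2 > 2 * Suc (Suc 0) \<or> (\<forall>u\<in>chart_image c. rho_at (in_chart c x) u > 0)"
    using pos umb by blast
  then show ?thesis by (rule c.Ck_on_rho_power[OF subset_refl c.open_U])
qed

end

section \<open>The equivalence of criticality and the Euler-Lagrange equation\<close>

theorem theorem1p1:
  fixes \<A> :: "('m::{t2_space,second_countable_topology}, 'n::finite) chart set"
    and x :: "'m \<Rightarrow> 'e::euclidean_space"
    and n p :: nat
  assumes "n = CARD('n)" and "n \<ge> 2" and "p \<ge> 1" and "DIM('e) = n + p + 1"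
    and "smooth_atlas \<A>" and "sphere_immersion \<A> x"
    and "n = 3 \<or> n = 5 \<Longrightarrow> \<forall>q. \<not> umbilical \<A> x q"
  shows "willmore_submanifold \<A> x \<longleftrightarrow>
    (\<forall>c\<in>\<A>. \<forall>V e \<nu>. V \<subseteq> chart_image c \<and> adapted_frame (in_chart c x) V e \<nu> \<longrightarrow>
      (\<forall>\<alpha>\<in>{n+1..n+p}. \<forall>u\<in>V.
        let y = in_chart c x;
            N = {n+1..n+p};
            h = sff y u (e u) (\<nu> u);
            S = sff_sq y u (e u) (\<nu> u);
            H = mean_curv y u (e u) (\<nu> u);
            Hnorm = norm (mean_curv_vec y u (e u) (\<nu> u));
            R = (\<lambda>w. rho_basis y w (e w) (\<nu> w) ^ (n - 2))
        in
          - R u * (S * H \<alpha>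
                   + (\<Sum>\<beta>\<in>N. \<Sum>i\<in>UNIV. \<Sum>j\<in>UNIV. H \<beta> * h \<beta> i j * h \<alpha> i j)
                   - (\<Sum>\<beta>\<in>N. \<Sum>i\<in>UNIV. \<Sum>j\<in>UNIV. \<Sum>k\<in>UNIV. h \<alpha> i j * h \<beta> i k * h \<beta> k j)
                   - real n * Hnorm\<^sup>2 * H \<alpha>)
          + (real n - 1) * H \<alpha> * laplacian y e R u
          + 2 * (real n - 1) * (\<Sum>i\<in>UNIV. grad e R i u * mean_curv_deriv y e \<nu> \<alpha> i u)
          + (real n - 1) * R u * normal_laplacian y e \<nu> \<alpha> u
          - (\<Sum>i\<in>UNIV. \<Sum>j\<in>UNIV. hess y e R i j u *
               (real n * H \<alpha> * (if i = j then 1 else 0) - h \<alpha> i j)) = 0))"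
proof -
  have dim: "CARD('n) < DIM('e)" and N: "{n+1..n+p} = {CARD('n)+1..<DIM('e)}" and n2: "CARD('n) \<ge> 2"
    using assms(1-4) by auto
  interpret immersed_manifold \<A> x
    by unfold_locales (fact assms(5) assms(6) dim)+
  have regular: "Ck_on (Suc (Suc 0)) (chart_image c) (rho_power c)" if "c \<in> \<A>" for c
    using rho_power_regular[OF that] assms(1,7) by simp
  let ?E = "\<lambda>c V e \<nu> \<alpha> u. (let y = in_chart c x;
            N = {n+1..n+p};
            h = sff y u (e u) (\<nu> u);
            S = sff_sq y u (e u) (\<nu> u);
            H = mean_curv y u (e u) (\<nu> u);
            Hnorm = norm (mean_curv_vec y u (e u) (\<nu> u));
            R = (\<lambda>w. rho_basis y w (e w) (\<nu> w) ^ (n - 2))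
        in
          - R u * (S * H \<alpha>
                   + (\<Sum>\<beta>\<in>N. \<Sum>i\<in>UNIV. \<Sum>j\<in>UNIV. H \<beta> * h \<beta> i j * h \<alpha> i j)
                   - (\<Sum>\<beta>\<in>N. \<Sum>i\<in>UNIV. \<Sum>j\<in>UNIV. \<Sum>k\<in>UNIV. h \<alpha> i j * h \<beta> i k * h \<beta> k j)
                   - real n * Hnorm\<^sup>2 * H \<alpha>)
          + (real n - 1) * H \<alpha> * laplacian y e R u
          + 2 * (real n - 1) * (\<Sum>i\<in>UNIV. grad e R i u * mean_curv_deriv y e \<nu> \<alpha> i u)
          + (real n - 1) * R u * normal_laplacian y e \<nu> \<alpha> u
          - (\<Sum>i\<in>UNIV. \<Sum>j\<in>UNIV. hess y e R i j u *
               (real n * H \<alpha> * (if i = j then 1 else 0) - h \<alpha> i j)) = 0)"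
  have E: "?E c V e \<nu> \<alpha> u \<longleftrightarrow> EL_at c e \<nu> \<alpha> u = 0"
    if c: "c \<in> \<A>" and V: "V \<subseteq> chart_image c" and frame: "adapted_frame (in_chart c x) V e \<nu>"
      and \<alpha>: "\<alpha> \<in> {CARD('n)+1..<DIM('e)}" and u: "u \<in> V" for c V e \<nu> \<alpha> u
  proof -
    interpret f: framed_patch "chart_image c" "in_chart c x" V e \<nu> "{CARD('n)+1..<DIM('e)}"
      by (rule framed[OF c V frame])
    \<comment> \<open>The two versions of rho agree on the open set V only; this suffices because
      the derivatives of R in \<open>EL\<close> are local.\<close>
    have "rho_power c w = rho_basis (in_chart c x) w (e w) (\<nu> w) ^ (CARD('n) - 2)" if "w \<in> V" for w
      using f.rho_at_y(2)[of w "e w" "\<nu> w"] that V frame by (auto simp: adapted_frame_def)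
    note R = f.EL_cong[OF this u]
    have "?E c V e \<nu> \<alpha> u \<longleftrightarrow> f.EL (\<lambda>w. rho_basis (in_chart c x) w (e w) (\<nu> w) ^ (CARD('n) - 2)) \<alpha> u = 0"
      unfolding Let_def N f.EL_eq[OF u \<alpha>] unfolding assms(1) f.h_def f.H_def by (rule refl)
    then show ?thesis by (simp only: R)
  qed
  show ?thesis
  proof
    assume W: "willmore_submanifold \<A> x"
    show "\<forall>c\<in>\<A>. \<forall>V e \<nu>. V \<subseteq> chart_image c \<and> adapted_frame (in_chart c x) V e \<nu> \<longrightarrow>
      (\<forall>\<alpha>\<in>{n+1..n+p}. \<forall>u\<in>V. ?E c V e \<nu> \<alpha> u)"
    proof (intro ballI allI impI)
      fix c V e \<nu> \<alpha> u
      assume c: "c \<in> \<A>" and *: "V \<subseteq> chart_image c \<and> adapted_frame (in_chart c x) V e \<nu>"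
        and \<alpha>: "\<alpha> \<in> {n+1..n+p}" and u: "u \<in> V"
      note V = conjunct1[OF *] and frame = conjunct2[OF *]
      show "?E c V e \<nu> \<alpha> u"
        unfolding E[OF c V frame \<alpha>[unfolded N] u]
        by (rule EL_eq_0_of_critical[OF n2 regular W c V frame \<alpha>[unfolded N] u])
    qed
  next
    assume E0: "\<forall>c\<in>\<A>. \<forall>V e \<nu>. V \<subseteq> chart_image c \<and> adapted_frame (in_chart c x) V e \<nu> \<longrightarrow>
      (\<forall>\<alpha>\<in>{n+1..n+p}. \<forall>u\<in>V. ?E c V e \<nu> \<alpha> u)"
    have EL: "EL_at c e \<nu> \<alpha> u = 0"
      if c: "c \<in> \<A>" and V: "V \<subseteq> chart_image c" and frame: "adapted_frame (in_chart c x) V e \<nu>"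
        and \<alpha>: "\<alpha> \<in> {CARD('n)+1..<DIM('e)}" and u: "u \<in> V" for c V e \<nu> \<alpha> u
      using E0[THEN bspec, OF c, THEN spec, THEN spec, THEN spec, THEN mp, OF conjI[OF V frame],
          THEN bspec, OF \<alpha>[folded N], THEN bspec, OF u]
      unfolding E[OF c V frame \<alpha> u] .
    show "willmore_submanifold \<A> x"
      unfolding willmore_submanifold_def
    proof (intro allI impI)
      fix \<epsilon> K X assume var: "smooth_variation \<A> x \<epsilon> K X"
      interpret X: smooth_deformation \<A> x \<epsilon> K X by unfold_locales (rule var)
      have "(LINT q:K|vol_measure \<A> x. lam X.\<xi> q) = 0"
        by (rule integral_lam_eq_0[OF n2 regular EL X.field_\<xi> X.\<xi>_outside X.compact_K])
      then show "((\<lambda>t. willmore_functional \<A> (X t) K) has_real_derivative 0) (at 0)"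
        using X.willmore_first_variation[OF n2] by simp
    qed
  qed
qed

end
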